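(* Let $K$ be a compact convex subset of $\mathcal P$, and let $\mathcal N_{K,1}=E_{K,1}\times F_{K,1}$, $\mathcal N_{K,2}=E_{K,2}\times F_{K,2}$ and $\Phi_{K,2}$ be as defined in the context. Denote by $\mathrm{Pol}_{\mathrm{CR}}(\mathcal N_{K,1};\mathcal O_K(\mathcal N_{K,2}))$ the space of CR polynomial mappings from $\mathcal N_{K,1}$ into $\mathcal O_K(\mathcal N_{K,2})$. Then the mapping $\iota\colon\mathrm{Pol}_{\mathrm{CR}}(\mathcal N_{K,1};\mathcal O_K(\mathcal N_{K,2}))\to\mathcal O_K(\mathcal N)$ defined by $$\iota(P)(\zeta_1+\zeta_2,x_1+x_2):=P_{\Phi(\zeta_1+\zeta_2)-\Phi(\zeta_1)-\Phi_{K,2}(\zeta_2)}(\zeta_1,x_1)(\zeta_2,x_2)$$ for every $P\in\mathrm{Pol}_{\mathrm{CR}}(\mathcal N_{K,1};\mathcal O_K(\mathcal N_{K,2}))$ and every $(\zeta_j,x_j)\in\mathcal N_{K,j}$, $j=1,2$, is an isomorphism (of vector spaces).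
   Context: Setting. $E$ is a complex Hilbert space of finite dimension $n$, $F$ a real Hilbert space of finite dimension $m$, $F'$ its dual, $F_{\mathbb C}$ its complexification, and $\Phi\colon E\times E\to F_{\mathbb C}$ is a hermitian map ($\mathbb C$-linear in the first variable, antilinear in the second, $\Phi(\zeta',\zeta)=\overline{\Phi(\zeta,\zeta')}$). Write $\Phi(\zeta):=\Phi(\zeta,\zeta)\in F$, and $\mathcal P:=\{\lambda\in F':\langle\lambda,\Phi(\zeta)\rangle\ge0\ \forall\zeta\in E\}$. $\mathcal N:=E\times F$ is the $2$-step nilpotent Lie group with product $(\zeta,x)(\zeta',x')=(\zeta+\zeta',x+x'+2\operatorname{Im}\Phi(\zeta,\zeta'))$. For $v\in E$, $Z_v$ is the left-invariant vector field on $\mathcal N$ which at $(0,0)$ equals $\frac12(\partial_v-i\partial_{iv})$; a distribution (or function) $u$ on $\mathcal N$ is CR if $\overline{Z_v}u=0$ for every $v\in E$. Any such triple $(E,F,\Phi)$ gives a "quadratic CR manifold" $E\times F$ in this way. $\mathcal F_F$ is the Euclidean Fourier transform on $F$, $\mathcal F_F(g)(\lambda)=\int_F g(x)e^{-i\langle\lambda,x\rangle}dx$, extended to tempered distributions; $I\otimes\mathcal F_F\colon\mathcal S'(E\times F)\to\mathcal S'(E\times F')$ is the partial Fourier transform in the $F$ variable. For a compact $K\subseteq F'$, $\mathcal O_K(\mathcal N)$ is the space of CR functions $g\in C^\infty(\mathcal N)$ such that there is $k\in\mathbb N$ for which $(1+|\cdot|)^{-k}Xg$ is bounded for every left-invariant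 differential operator $X$ on $\mathcal N$, and such that $(I\otimes\mathcal F_F)g$ is supported in $E\times K$. Given $K\subseteq\mathcal P$: $F_{K,1}:=\{x\in F:\langle\lambda,x\rangle=0\ \forall\lambda\in K\}$ (the polar of the vector space generated by $K$); $E_{K,1}:=\{\zeta\in E:\Phi(\zeta,\zeta')\in(F_{K,1})_{\mathbb C}\ \forall\zeta'\in E\}$; $\mathcal N_{K,1}:=E_{K,1}\times F_{K,1}$, with the quadratic CR structure given by the restriction of $\Phi$; $E_{K,2}:=E_{K,1}^\perp$, $F_{K,2}:=F_{K,1}^\perp$ (orthogonal complements); $\Phi_{K,2}\colon E_{K,2}\times E_{K,2}\to(F_{K,2})_{\mathbb C}$ is the hermitian map such that $\Phi_{K,2}(\zeta,\zeta')-\Phi(\zeta,\zeta')\in(F_{K,1})_{\mathbb C}$ for all $\zeta,\zeta'\in E_{K,2}$, with $\Phi_{K,2}(\zeta):=\Phi_{K,2}(\zeta,\zeta)$; $\mathcal N_{K,2}:=E_{K,2}\times F_{K,2}$ is the quadratic CR manifold associated with $\Phi_{K,2}$. The annihilator $F_{K,1}^\circ\subseteq F'$ of $F_{K,1}$ is identified with the dual of $F_{K,2}$, so that $K$ is regarded as a subset of $(F_{K,2})'$ and $\mathcal O_K(\mathcal N_{K,2})$ makes sense. A CR polynomial mapping $P\colon\mathcal N_{K,1}\to\mathcal O_K(\mathcal N_{K,2})$ is a polynomial mapping with values in the vector space $\mathcal O_K(\mathcal N_{K,2})$ which is annihilated by the $\overline{Z_v}$ of $\mathcal N_{K,1}$,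 $v\in E_{K,1}$. For such $P$ there is a unique holomorphic polynomial mapping $Q\colon E_{K,1}\times(F_{K,1})_{\mathbb C}\to\mathcal O_K(\mathcal N_{K,2})$ with $Q(\zeta_1,x_1+i\Phi(\zeta_1))=P(\zeta_1,x_1)$, and for $h\in F_{K,1}$ one sets $P_h(\zeta_1,x_1):=Q(\zeta_1,x_1+i\Phi(\zeta_1)+ih)$. One has $\Phi(\zeta_1+\zeta_2)-\Phi(\zeta_1)-\Phi_{K,2}(\zeta_2)\in F_{K,1}$ for $\zeta_j\in E_{K,j}$. *)

theory Defs
  imports "HOL-Analysis.Analysis" "HOL-Library.Function_Algebras"
begin

text \<open>
  Conventions.

  \<^item> A finite-dimensional complex (real) Hilbert space is a complex (real) linear subspace of
    some \<open>complex ^ 'n\<close> (\<open>real ^ 'm\<close>) with the induced scalar product; up to isometry this covers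
    every finite dimension, including 0, and it makes the subspaces occurring below objects of
    the same kind.

  \<^item> A function on such a space is a function on the ambient type which is 0 off the space;
    operators, norms and integrals only look at the space itself.

  \<^item> The dual of a real Hilbert space \<open>F\<close> is identified with \<open>F\<close> through the scalar product, so
    that the pairing is \<open>\<lambda> \<bullet> x\<close>.  If \<open>F\<^sub>1\<close> is a subspace of \<open>F\<close>, then the annihilator of \<open>F\<^sub>1\<close>
    and the dual of the orthogonal complement \<open>F\<^sub>2\<close> both become \<open>F\<^sub>2\<close>, and the canonical map
    between them (restriction to \<open>F\<^sub>2\<close>) becomes the identity.
\<close>

section \<open>Complexification and hermitian maps\<close>

definition Re_vec :: "complex ^ 'm \<Rightarrow> real ^ 'm" where
  "Re_vec z = (\<chi> j. Re (z $ j))"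

definition Im_vec :: "complex ^ 'm \<Rightarrow> real ^ 'm" where
  "Im_vec z = (\<chi> j. Im (z $ j))"

definition cnj_vec :: "complex ^ 'm \<Rightarrow> complex ^ 'm" where
  "cnj_vec z = (\<chi> j. cnj (z $ j))"

definition of_real_vec :: "real ^ 'm \<Rightarrow> complex ^ 'm" where
  "of_real_vec x = (\<chi> j. complex_of_real (x $ j))"

definition complexification :: "(real ^ 'm) set \<Rightarrow> (complex ^ 'm) set" where
  "complexification F = {z. Re_vec z \<in> F \<and> Im_vec z \<in> F}"

type_synonym ('n, 'm) herm = "complex ^ 'n \<Rightarrow> complex ^ 'n \<Rightarrow> complex ^ 'm"

type_synonym ('n, 'm) point = "(complex ^ 'n) \<times> (real ^ 'm)"

definition hermitian_map ::
  "(complex ^ 'n) set \<Rightarrow> (real ^ 'm) set \<Rightarrow> ('n::finite, 'm::finite) herm \<Rightarrow> bool" where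
  "hermitian_map E F \<Phi> \<longleftrightarrow>
     (\<forall>\<zeta>\<in>E. \<forall>\<zeta>'\<in>E. \<Phi> \<zeta> \<zeta>' \<in> complexification F) \<and>
     (\<forall>\<zeta>\<in>E. \<forall>\<eta>\<in>E. \<forall>\<zeta>'\<in>E. \<Phi> (\<zeta> + \<eta>) \<zeta>' = \<Phi> \<zeta> \<zeta>' + \<Phi> \<eta> \<zeta>') \<and>
     (\<forall>c. \<forall>\<zeta>\<in>E. \<forall>\<zeta>'\<in>E. \<Phi> (c *s \<zeta>) \<zeta>' = c *s \<Phi> \<zeta> \<zeta>') \<and>
     (\<forall>\<zeta>\<in>E. \<forall>\<zeta>'\<in>E. \<Phi> \<zeta>' \<zeta> = cnj_vec (\<Phi> \<zeta> \<zeta>'))"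

definition quadratic_CR ::
  "(complex ^ 'n) set \<Rightarrow> (real ^ 'm) set \<Rightarrow> ('n::finite, 'm::finite) herm \<Rightarrow> bool" where
  "quadratic_CR E F \<Phi> \<longleftrightarrow> vec.subspace E \<and> subspace F \<and> hermitian_map E F \<Phi>"

text \<open>\<open>\<Phi> \<zeta> \<zeta>\<close> is real by hermitian symmetry; \<open>quad \<Phi> \<zeta>\<close> is the same vector, seen in \<open>F\<close>.\<close>

definition quad :: "('n::finite, 'm::finite) herm \<Rightarrow> complex ^ 'n \<Rightarrow> real ^ 'm" where
  "quad \<Phi> \<zeta> = Re_vec (\<Phi> \<zeta> \<zeta>)"

definition pos_cone ::
  "(complex ^ 'n) set \<Rightarrow> (real ^ 'm) set \<Rightarrow> ('n::finite, 'm::finite) herm \<Rightarrow> (real ^ 'm) set" where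
  "pos_cone E F \<Phi> = {l \<in> F. \<forall>\<zeta>\<in>E. l \<bullet> quad \<Phi> \<zeta> \<ge> 0}"


section \<open>Smooth functions and integration on a subspace\<close>

definition dir_deriv :: "'a::real_normed_vector \<Rightarrow> ('a \<Rightarrow> complex) \<Rightarrow> 'a \<Rightarrow> complex" where
  "dir_deriv v f x = vector_derivative (\<lambda>t. f (x + t *\<^sub>R v)) (at 0)"

definition smooth_on_subspace :: "'a::euclidean_space set \<Rightarrow> ('a \<Rightarrow> complex) \<Rightarrow> bool" where
  "smooth_on_subspace V f \<longleftrightarrow>
     (\<forall>vs. set vs \<subseteq> V \<longrightarrow>
        continuous_on V (foldr dir_deriv vs f) \<and>
        (\<forall>v\<in>V. \<forall>x\<in>V. (\<lambda>t::real. foldr dir_deriv vs f (x + t *\<^sub>R v)) differentiable at 0))"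

definition test_function :: "'a::euclidean_space set \<Rightarrow> ('a \<Rightarrow> complex) \<Rightarrow> bool" where
  "test_function V \<phi> \<longleftrightarrow> smooth_on_subspace V \<phi> \<and> compact (closure {x \<in> V. \<phi> x \<noteq> 0})"

definition orthonormal_basis :: "'a::euclidean_space set \<Rightarrow> 'a set" where
  "orthonormal_basis V =
     (SOME B. B \<subseteq> V \<and> span B = V \<and> pairwise orthogonal B \<and> (\<forall>b\<in>B. norm b = 1))"

text \<open>Lebesgue measure of the Euclidean space \<open>V\<close> (independent of the chosen basis), as a Borel
  measure on the ambient space; compare the definition of \<open>lborel\<close>.\<close>

definition subspace_lborel :: "'a::euclidean_space set \<Rightarrow> 'a measure" where
  "subspace_lborel V =
     (let B = orthonormal_basis V
      in distr (\<Pi>\<^sub>M b\<in>B. (lborel :: real measure)) borel (\<lambda>c. \<Sum>b\<in>B. c b *\<^sub>R b))"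


section \<open>Distributions and the partial Fourier transform\<close>

text \<open>A distribution is represented by its action on functions.\<close>

definition distribution_of ::
  "'a::euclidean_space set \<Rightarrow> ('a \<Rightarrow> complex) \<Rightarrow> ('a \<Rightarrow> complex) \<Rightarrow> complex" where
  "distribution_of V g \<phi> = (LINT p:V|subspace_lborel V. g p * \<phi> p)"

text \<open>\<open>I \<otimes> \<F>\<close> on functions, and its extension to tempered distributions by transposition
  (the kernel \<open>exp (-\<i> \<langle>\<lambda>, x\<rangle>)\<close> is symmetric, so that with the dual of \<open>F\<close> identified with \<open>F\<close>
  the transposed operator is given by the same formula).\<close>

definition partial_fourier ::
  "(real ^ 'm) set \<Rightarrow> (('n::finite, 'm::finite) point \<Rightarrow> complex) \<Rightarrow> ('n, 'm) point \<Rightarrow> complex" where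
  "partial_fourier F \<phi> = (\<lambda>(\<zeta>, x).
     LINT l:F|subspace_lborel F. \<phi> (\<zeta>, l) * exp (- (\<i> * complex_of_real (l \<bullet> x))))"

definition dist_partial_fourier ::
  "(real ^ 'm) set \<Rightarrow> ((('n::finite, 'm::finite) point \<Rightarrow> complex) \<Rightarrow> complex) \<Rightarrow>
   (('n, 'm) point \<Rightarrow> complex) \<Rightarrow> complex" where
  "dist_partial_fourier F T \<phi> = T (partial_fourier F \<phi>)"

text \<open>The support of \<open>T\<close> is contained in the (closed) set \<open>C\<close>, that is, \<open>T\<close> vanishes on the
  open subset \<open>V - C\<close> of \<open>V\<close>.\<close>

definition dist_supported_in ::
  "'a::euclidean_space set \<Rightarrow> (('a \<Rightarrow> complex) \<Rightarrow> complex) \<Rightarrow> 'a set \<Rightarrow> bool" where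
  "dist_supported_in V T C \<longleftrightarrow>
     (\<forall>\<phi>. test_function V \<phi> \<and> closure {x \<in> V. \<phi> x \<noteq> 0} \<inter> C = {} \<longrightarrow> T \<phi> = 0)"


section \<open>The group \<open>E \<times> F\<close> and its CR functions\<close>

definition group_mult ::
  "('n::finite, 'm::finite) herm \<Rightarrow> ('n, 'm) point \<Rightarrow> ('n, 'm) point \<Rightarrow> ('n, 'm) point" where
  "group_mult \<Phi> = (\<lambda>(\<zeta>, x) (\<zeta>', x'). (\<zeta> + \<zeta>', x + x' + 2 *\<^sub>R Im_vec (\<Phi> \<zeta> \<zeta>')))"

text \<open>The left-invariant vector field whose value at the identity is \<open>\<partial>\<^sub>u\<close>.\<close>

definition left_field ::
  "('n::finite, 'm::finite) herm \<Rightarrow> ('n, 'm) point \<Rightarrow>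
   (('n, 'm) point \<Rightarrow> complex) \<Rightarrow> ('n, 'm) point \<Rightarrow> complex" where
  "left_field \<Phi> u f p = vector_derivative (\<lambda>t. f (group_mult \<Phi> p (t *\<^sub>R u))) (at 0)"

definition Zbar ::
  "('n::finite, 'm::finite) herm \<Rightarrow> complex ^ 'n \<Rightarrow>
   (('n, 'm) point \<Rightarrow> complex) \<Rightarrow> ('n, 'm) point \<Rightarrow> complex" where
  "Zbar \<Phi> v f p = (left_field \<Phi> (v, 0) f p + \<i> * left_field \<Phi> (\<i> *s v, 0) f p) / 2"

definition CR_on ::
  "(complex ^ 'n) set \<Rightarrow> (real ^ 'm) set \<Rightarrow> ('n::finite, 'm::finite) herm \<Rightarrow>
   (('n, 'm) point \<Rightarrow> complex) \<Rightarrow> bool" where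
  "CR_on E F \<Phi> u \<longleftrightarrow> (\<forall>v\<in>E. \<forall>p\<in>E \<times> F. Zbar \<Phi> v u p = 0)"

text \<open>The left-invariant differential operators form the complex algebra generated by the
  left-invariant vector fields.\<close>

inductive_set left_invariant_ops ::
  "(complex ^ 'n) set \<Rightarrow> (real ^ 'm) set \<Rightarrow> ('n::finite, 'm::finite) herm \<Rightarrow>
   ((('n, 'm) point \<Rightarrow> complex) \<Rightarrow> ('n, 'm) point \<Rightarrow> complex) set"
  for E :: "(complex ^ 'n::finite) set" and F :: "(real ^ 'm::finite) set" and \<Phi> :: "('n, 'm) herm"
where
  ident: "(\<lambda>f. f) \<in> left_invariant_ops E F \<Phi>"
| field: "X \<in> left_invariant_ops E F \<Phi> \<Longrightarrow> u \<in> E \<times> F \<Longrightarrow>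
    (\<lambda>f. left_field \<Phi> u (X f)) \<in> left_invariant_ops E F \<Phi>"
| add: "X \<in> left_invariant_ops E F \<Phi> \<Longrightarrow> Y \<in> left_invariant_ops E F \<Phi> \<Longrightarrow>
    (\<lambda>f p. X f p + Y f p) \<in> left_invariant_ops E F \<Phi>"
| scale: "X \<in> left_invariant_ops E F \<Phi> \<Longrightarrow>
    (\<lambda>f p. c * X f p) \<in> left_invariant_ops E F \<Phi>"

text \<open>The space \<open>\<O>\<^sub>K(E \<times> F)\<close>.  By the growth condition (with \<open>X\<close> the identity) its elements are
  tempered distributions.\<close>

definition CR_space ::
  "(complex ^ 'n) set \<Rightarrow> (real ^ 'm) set \<Rightarrow> ('n::finite, 'm::finite) herm \<Rightarrow> (real ^ 'm) set \<Rightarrow>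
   (('n, 'm) point \<Rightarrow> complex) set" where
  "CR_space E F \<Phi> K = {g.
     (\<forall>p. p \<notin> E \<times> F \<longrightarrow> g p = 0) \<and>
     smooth_on_subspace (E \<times> F) g \<and>
     CR_on E F \<Phi> g \<and>
     (\<exists>k::nat. \<forall>X\<in>left_invariant_ops E F \<Phi>.
        bounded ((\<lambda>p. X g p /\<^sub>R (1 + norm p) ^ k) ` (E \<times> F))) \<and>
     dist_supported_in (E \<times> F)
       (dist_partial_fourier F (distribution_of (E \<times> F) g)) (E \<times> K)}"


section \<open>CR polynomial mappings\<close>

text \<open>Polynomial mappings from \<open>C\<close> into the vector space \<open>W\<close> of functions: finite sums of
  vectors of \<open>W\<close> multiplied by scalar polynomials; \<open>R\<close> is the class of scalar polynomials.\<close>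

definition poly_map ::
  "(('a \<Rightarrow> complex) \<Rightarrow> bool) \<Rightarrow> 'a set \<Rightarrow> ('b \<Rightarrow> complex) set \<Rightarrow> ('a \<Rightarrow> 'b \<Rightarrow> complex) \<Rightarrow> bool" where
  "poly_map R C W P \<longleftrightarrow>
     (\<forall>z. z \<notin> C \<longrightarrow> P z = (\<lambda>q. 0)) \<and>
     (\<exists>(N::nat) p w. (\<forall>j<N. R (p j) \<and> w j \<in> W) \<and>
        (\<forall>z\<in>C. P z = (\<lambda>q. \<Sum>j<N. p j z * w j q)))"

inductive holomorphic_polynomial ::
  "((complex ^ 'n::finite) \<times> (complex ^ 'm::finite) \<Rightarrow> complex) \<Rightarrow> bool" where
  const: "holomorphic_polynomial (\<lambda>z. c)"
| coord1: "holomorphic_polynomial (\<lambda>z. fst z $ i)"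
| coord2: "holomorphic_polynomial (\<lambda>z. snd z $ j)"
| add: "holomorphic_polynomial p \<Longrightarrow> holomorphic_polynomial q \<Longrightarrow>
    holomorphic_polynomial (\<lambda>z. p z + q z)"
| mult: "holomorphic_polynomial p \<Longrightarrow> holomorphic_polynomial q \<Longrightarrow>
    holomorphic_polynomial (\<lambda>z. p z * q z)"

text \<open>Since \<open>P\<close> takes its values in a finite-dimensional space of functions, its derivatives may
  be computed at each point \<open>q\<close> separately.\<close>

definition Pol_CR ::
  "(complex ^ 'n) set \<Rightarrow> (real ^ 'm) set \<Rightarrow> ('n::finite, 'm::finite) herm \<Rightarrow> ('b \<Rightarrow> complex) set \<Rightarrow>
   (('n, 'm) point \<Rightarrow> 'b \<Rightarrow> complex) set" where
  "Pol_CR E F \<Phi> W = {P. poly_map polynomial_function (E \<times> F) W P \<and>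
     (\<forall>q. CR_on E F \<Phi> (\<lambda>z. P z q))}"

definition holomorphic_extension ::
  "(complex ^ 'n) set \<Rightarrow> (real ^ 'm) set \<Rightarrow> ('n::finite, 'm::finite) herm \<Rightarrow> ('b \<Rightarrow> complex) set \<Rightarrow>
   (('n, 'm) point \<Rightarrow> 'b \<Rightarrow> complex) \<Rightarrow> (complex ^ 'n) \<times> (complex ^ 'm) \<Rightarrow> 'b \<Rightarrow> complex" where
  "holomorphic_extension E F \<Phi> W P =
     (THE Q. poly_map holomorphic_polynomial (E \<times> complexification F) W Q \<and>
        (\<forall>\<zeta>\<in>E. \<forall>x\<in>F. Q (\<zeta>, of_real_vec x + \<i> *s of_real_vec (quad \<Phi> \<zeta>)) = P (\<zeta>, x)))"

text \<open>\<open>poly_shift E F \<Phi> W P h\<close> is \<open>P\<^sub>h\<close>.\<close>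

definition poly_shift ::
  "(complex ^ 'n) set \<Rightarrow> (real ^ 'm) set \<Rightarrow> ('n::finite, 'm::finite) herm \<Rightarrow> ('b \<Rightarrow> complex) set \<Rightarrow>
   (('n, 'm) point \<Rightarrow> 'b \<Rightarrow> complex) \<Rightarrow> real ^ 'm \<Rightarrow> ('n, 'm) point \<Rightarrow> 'b \<Rightarrow> complex" where
  "poly_shift E F \<Phi> W P h = (\<lambda>(\<zeta>, x). holomorphic_extension E F \<Phi> W P
     (\<zeta>, of_real_vec x + \<i> *s of_real_vec (quad \<Phi> \<zeta>) + \<i> *s of_real_vec h))"


section \<open>The two quadratic CR manifolds determined by \<open>K\<close>\<close>

definition F_K1 :: "(real ^ 'm::finite) set \<Rightarrow> (real ^ 'm) set \<Rightarrow> (real ^ 'm) set" where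
  "F_K1 F K = {x \<in> F. \<forall>l\<in>K. l \<bullet> x = 0}"

definition E_K1 ::
  "(complex ^ 'n) set \<Rightarrow> (real ^ 'm) set \<Rightarrow> ('n::finite, 'm::finite) herm \<Rightarrow> (real ^ 'm) set \<Rightarrow>
   (complex ^ 'n) set" where
  "E_K1 E F \<Phi> K = {\<zeta> \<in> E. \<forall>\<zeta>'\<in>E. \<Phi> \<zeta> \<zeta>' \<in> complexification (F_K1 F K)}"

definition F_K2 :: "(real ^ 'm::finite) set \<Rightarrow> (real ^ 'm) set \<Rightarrow> (real ^ 'm) set" where
  "F_K2 F K = {x \<in> F. \<forall>y\<in>F_K1 F K. x \<bullet> y = 0}"

text \<open>The scalar product of \<open>complex ^ 'n\<close> is \<open>\<Sum>i. \<zeta>\<^sub>i cnj \<eta>\<^sub>i\<close>, whose real part is the library's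
  \<open>\<zeta> \<bullet> \<eta>\<close>.\<close>

definition E_K2 ::
  "(complex ^ 'n) set \<Rightarrow> (real ^ 'm) set \<Rightarrow> ('n::finite, 'm::finite) herm \<Rightarrow> (real ^ 'm) set \<Rightarrow>
   (complex ^ 'n) set" where
  "E_K2 E F \<Phi> K = {\<zeta> \<in> E. \<forall>\<eta>\<in>E_K1 E F \<Phi> K. (\<Sum>i\<in>UNIV. \<zeta> $ i * cnj (\<eta> $ i)) = 0}"

text \<open>Only the values on \<open>E_K2 E F \<Phi> K\<close> matter.\<close>

definition Phi_K2 ::
  "(real ^ 'm) set \<Rightarrow> ('n::finite, 'm::finite) herm \<Rightarrow> (real ^ 'm) set \<Rightarrow> ('n, 'm) herm" where
  "Phi_K2 F \<Phi> K \<zeta> \<zeta>' = (THE w. w \<in> complexification (F_K2 F K) \<and>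
     w - \<Phi> \<zeta> \<zeta>' \<in> complexification (F_K1 F K))"

definition CR_space_K2 ::
  "(complex ^ 'n) set \<Rightarrow> (real ^ 'm) set \<Rightarrow> ('n::finite, 'm::finite) herm \<Rightarrow> (real ^ 'm) set \<Rightarrow>
   (('n, 'm) point \<Rightarrow> complex) set" where
  "CR_space_K2 E F \<Phi> K = CR_space (E_K2 E F \<Phi> K) (F_K2 F K) (Phi_K2 F \<Phi> K) K"

definition Pol_CR_K ::
  "(complex ^ 'n) set \<Rightarrow> (real ^ 'm) set \<Rightarrow> ('n::finite, 'm::finite) herm \<Rightarrow> (real ^ 'm) set \<Rightarrow>
   (('n, 'm) point \<Rightarrow> ('n, 'm) point \<Rightarrow> complex) set" where
  "Pol_CR_K E F \<Phi> K = Pol_CR (E_K1 E F \<Phi> K) (F_K1 F K) \<Phi> (CR_space_K2 E F \<Phi> K)"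

definition shift_K ::
  "(complex ^ 'n) set \<Rightarrow> (real ^ 'm) set \<Rightarrow> ('n::finite, 'm::finite) herm \<Rightarrow> (real ^ 'm) set \<Rightarrow>
   (('n, 'm) point \<Rightarrow> ('n, 'm) point \<Rightarrow> complex) \<Rightarrow> real ^ 'm \<Rightarrow>
   ('n, 'm) point \<Rightarrow> ('n, 'm) point \<Rightarrow> complex" where
  "shift_K E F \<Phi> K = poly_shift (E_K1 E F \<Phi> K) (F_K1 F K) \<Phi> (CR_space_K2 E F \<Phi> K)"

text \<open>The decompositions of \<open>\<zeta>\<close> and \<open>x\<close> are unique, see \<open>iota_apply\<close> below.\<close>

definition iota ::
  "(complex ^ 'n) set \<Rightarrow> (real ^ 'm) set \<Rightarrow> ('n::finite, 'm::finite) herm \<Rightarrow> (real ^ 'm) set \<Rightarrow>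
   (('n, 'm) point \<Rightarrow> ('n, 'm) point \<Rightarrow> complex) \<Rightarrow> ('n, 'm) point \<Rightarrow> complex" where
  "iota E F \<Phi> K P = (\<lambda>(\<zeta>, x).
     if \<zeta> \<in> E \<and> x \<in> F
     then THE y. \<exists>\<zeta>\<^sub>1\<in>E_K1 E F \<Phi> K. \<exists>\<zeta>\<^sub>2\<in>E_K2 E F \<Phi> K. \<exists>x\<^sub>1\<in>F_K1 F K. \<exists>x\<^sub>2\<in>F_K2 F K.
       \<zeta> = \<zeta>\<^sub>1 + \<zeta>\<^sub>2 \<and> x = x\<^sub>1 + x\<^sub>2 \<and>
       y = shift_K E F \<Phi> K P (quad \<Phi> (\<zeta>\<^sub>1 + \<zeta>\<^sub>2) - quad \<Phi> \<zeta>\<^sub>1 - quad (Phi_K2 F \<Phi> K) \<zeta>\<^sub>2)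
             (\<zeta>\<^sub>1, x\<^sub>1) (\<zeta>\<^sub>2, x\<^sub>2)
     else 0)"

text \<open>Isomorphisms between complex vector spaces \<open>V\<close> and \<open>W\<close> given as subspaces of ambient
  spaces with scalar multiplications \<open>s\<close> and \<open>s'\<close>.\<close>

definition complex_linear_iso ::
  "(complex \<Rightarrow> 'a::ab_group_add \<Rightarrow> 'a) \<Rightarrow> (complex \<Rightarrow> 'b::ab_group_add \<Rightarrow> 'b) \<Rightarrow>
   'a set \<Rightarrow> 'b set \<Rightarrow> ('a \<Rightarrow> 'b) \<Rightarrow> bool" where
  "complex_linear_iso s s' V W f \<longleftrightarrow>
     module.subspace s V \<and> module.subspace s' W \<and>
     (\<forall>u\<in>V. \<forall>v\<in>V. f (u + v) = f u + f v) \<and>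
     (\<forall>c. \<forall>v\<in>V. f (s c v) = s' c (f v)) \<and>
     bij_betw f V W"


section \<open>Well-definedness of \<open>Phi_K2\<close> and \<open>iota\<close>\<close>

lemma subspace_F_K1: "subspace F \<Longrightarrow> subspace (F_K1 F K)"
  by (auto simp: F_K1_def subspace_def inner_add_right)

lemma subspace_F_K2: "subspace F \<Longrightarrow> subspace (F_K2 F K)"
  by (auto simp: F_K2_def subspace_def inner_add_left)

lemma F_K1_Int_F_K2: "x \<in> F_K1 F K \<Longrightarrow> x \<in> F_K2 F K \<Longrightarrow> x = 0"
  by (auto simp: F_K2_def)

lemma F_K_decomp_unique:
  assumes "subspace F" "x \<in> F_K1 F K" "y \<in> F_K1 F K" "x' \<in> F_K2 F K" "y' \<in> F_K2 F K"
    and eq: "x + x' = y + y'"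
  shows "x = y \<and> x' = y'"
proof -
  have "x - y \<in> F_K1 F K" "y' - x' \<in> F_K2 F K"
    using assms by (auto intro: subspace_diff subspace_F_K1 subspace_F_K2)
  moreover have "x - y = y' - x'" using eq by (simp add: algebra_simps)
  ultimately have "x - y = 0" using F_K1_Int_F_K2[of "x - y" F K] by simp
  then show ?thesis using eq by simp
qed

lemma F_K_decomp:
  assumes "subspace F" "x \<in> F"
  obtains x1 x2 where "x1 \<in> F_K1 F K" "x2 \<in> F_K2 F K" "x = x1 + x2"
proof -
  have sp: "span (F_K1 F K) = F_K1 F K"
    using subspace_F_K1[OF assms(1)] by simp
  obtain y z where y: "y \<in> span (F_K1 F K)" and z: "\<And>w. w \<in> span (F_K1 F K) \<Longrightarrow> orthogonal z w"
    and x: "x = y + z"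
    using orthogonal_subspace_decomp_exists[of "F_K1 F K" x] by blast
  have y1: "y \<in> F_K1 F K" using y by (simp only: sp)
  then have "y \<in> F" by (simp add: F_K1_def)
  then have "z \<in> F" using x subspace_diff[OF assms(1) assms(2), of y] by simp
  moreover have "z \<bullet> w = 0" if "w \<in> F_K1 F K" for w
    using z[unfolded sp, OF that] by (simp add: orthogonal_def)
  ultimately have "z \<in> F_K2 F K" by (simp add: F_K2_def)
  then show thesis using that[OF y1 _ x] by simp
qed

lemma Re_Im_vec_simps:
  "Re_vec (a + b) = Re_vec a + Re_vec b" "Im_vec (a + b) = Im_vec a + Im_vec b"
  "Re_vec (a - b) = Re_vec a - Re_vec b" "Im_vec (a - b) = Im_vec a - Im_vec b"
  "Re_vec (of_real_vec x + \<i> *s of_real_vec y) = x"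
  "Im_vec (of_real_vec x + \<i> *s of_real_vec y) = y"
  "Re_vec (c *s a) = Re c *\<^sub>R Re_vec a - Im c *\<^sub>R Im_vec a"
  "Im_vec (c *s a) = Re c *\<^sub>R Im_vec a + Im c *\<^sub>R Re_vec a"
  "Re_vec (of_real_vec x) = x" "Im_vec (of_real_vec x) = 0"
  by (simp_all add: Re_vec_def Im_vec_def of_real_vec_def vec_eq_iff)

lemma complex_vec_eqI: "Re_vec a = Re_vec b \<Longrightarrow> Im_vec a = Im_vec b \<Longrightarrow> a = b"
  by (simp add: Re_vec_def Im_vec_def vec_eq_iff complex_eq_iff)

lemma Phi_K2:
  assumes "quadratic_CR E F \<Phi>" "\<zeta> \<in> E" "\<zeta>' \<in> E"
  shows "Phi_K2 F \<Phi> K \<zeta> \<zeta>' \<in> complexification (F_K2 F K)"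
    and "Phi_K2 F \<Phi> K \<zeta> \<zeta>' - \<Phi> \<zeta> \<zeta>' \<in> complexification (F_K1 F K)"
proof -
  let ?z = "\<Phi> \<zeta> \<zeta>'"
  have F: "subspace F" using assms by (simp add: quadratic_CR_def)
  note F1 = subspace_F_K1[OF F, of K]
  have "?z \<in> complexification F"
    using assms unfolding quadratic_CR_def hermitian_map_def by blast
  then have z: "Re_vec ?z \<in> F" "Im_vec ?z \<in> F"
    by (simp_all add: complexification_def)
  obtain a1 a2 where a: "a1 \<in> F_K1 F K" "a2 \<in> F_K2 F K" "Re_vec ?z = a1 + a2"
    using F_K_decomp[OF F z(1)] .
  obtain b1 b2 where b: "b1 \<in> F_K1 F K" "b2 \<in> F_K2 F K" "Im_vec ?z = b1 + b2"
    using F_K_decomp[OF F z(2)] .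
  let ?w = "of_real_vec a2 + \<i> *s of_real_vec b2"
  let ?P = "\<lambda>w. w \<in> complexification (F_K2 F K) \<and> w - ?z \<in> complexification (F_K1 F K)"
  have "?P ?w"
    using a b subspace_neg[OF F1 a(1)] subspace_neg[OF F1 b(1)]
    by (simp add: complexification_def Re_Im_vec_simps)
  moreover have "w = ?w" if "?P w" for w
  proof (rule complex_vec_eqI)
    have u: "Re_vec w \<in> F_K2 F K" "Im_vec w \<in> F_K2 F K"
      "Re_vec w - Re_vec ?z \<in> F_K1 F K" "Im_vec w - Im_vec ?z \<in> F_K1 F K"
      using that by (simp_all add: complexification_def Re_Im_vec_simps)
    have "- (Re_vec w - Re_vec ?z) + Re_vec w = a1 + a2"
      "- (Im_vec w - Im_vec ?z) + Im_vec w = b1 + b2"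
      using a(3) b(3) by simp_all
    then have "Re_vec w = a2" "Im_vec w = b2"
      using F_K_decomp_unique[OF F subspace_neg[OF F1 u(3)] a(1) u(1) a(2)]
        F_K_decomp_unique[OF F subspace_neg[OF F1 u(4)] b(1) u(2) b(2)] by blast+
    then show "Re_vec w = Re_vec ?w" "Im_vec w = Im_vec ?w"
      by (simp_all add: Re_Im_vec_simps)
  qed
  ultimately have "?P (Phi_K2 F \<Phi> K \<zeta> \<zeta>')"
    unfolding Phi_K2_def by (rule theI)
  then show "Phi_K2 F \<Phi> K \<zeta> \<zeta>' \<in> complexification (F_K2 F K)"
    and "Phi_K2 F \<Phi> K \<zeta> \<zeta>' - \<Phi> \<zeta> \<zeta>' \<in> complexification (F_K1 F K)" by auto
qed

lemma E_K_decomp_unique: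
  assumes "quadratic_CR E F \<Phi>" and mem: "x \<in> E_K1 E F \<Phi> K" "y \<in> E_K1 E F \<Phi> K"
    "x' \<in> E_K2 E F \<Phi> K" "y' \<in> E_K2 E F \<Phi> K"
    and eq: "x + x' = y + y'"
  shows "x = y \<and> x' = y'"
proof -
  have ip: "x' \<bullet> a = 0" "y' \<bullet> a = 0" if "a \<in> E_K1 E F \<Phi> K" for a
  proof -
    have *: "u \<bullet> a = Re (\<Sum>i\<in>UNIV. u $ i * cnj (a $ i))" for u :: "complex ^ 'a"
      by (simp add: inner_vec_def inner_complex_def)
    show "x' \<bullet> a = 0" "y' \<bullet> a = 0"
      using mem that unfolding * by (auto simp: E_K2_def)
  qed
  have d: "x - y = y' - x'" using eq by (simp add: algebra_simps)
  have "(x - y) \<bullet> (x - y) = (y' - x') \<bullet> (x - y)" by (simp only: d)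
  also have "\<dots> = 0" using ip mem by (simp add: inner_diff_left inner_diff_right)
  finally show ?thesis using eq by simp
qed

lemma iota_apply:
  fixes \<Phi> :: "('n::finite, 'm::finite) herm"
  assumes "quadratic_CR E F \<Phi>"
    and "\<zeta>\<^sub>1 \<in> E_K1 E F \<Phi> K" "\<zeta>\<^sub>2 \<in> E_K2 E F \<Phi> K" "x\<^sub>1 \<in> F_K1 F K" "x\<^sub>2 \<in> F_K2 F K"
  shows "iota E F \<Phi> K P (\<zeta>\<^sub>1 + \<zeta>\<^sub>2, x\<^sub>1 + x\<^sub>2) =
    shift_K E F \<Phi> K P (quad \<Phi> (\<zeta>\<^sub>1 + \<zeta>\<^sub>2) - quad \<Phi> \<zeta>\<^sub>1 - quad (Phi_K2 F \<Phi> K) \<zeta>\<^sub>2)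
      (\<zeta>\<^sub>1, x\<^sub>1) (\<zeta>\<^sub>2, x\<^sub>2)"
proof -
  have F: "subspace F" and E: "vec.subspace E" using assms(1) by (auto simp: quadratic_CR_def)
  have in_E: "\<zeta>\<^sub>1 + \<zeta>\<^sub>2 \<in> E" using assms(2,3) E by (auto simp: E_K1_def E_K2_def intro: vec.subspace_add)
  have in_F: "x\<^sub>1 + x\<^sub>2 \<in> F"
    using assms(4,5) F by (auto simp: F_K1_def F_K2_def intro: subspace_add)
  have the: "(THE y. \<exists>\<eta>\<^sub>1\<in>E_K1 E F \<Phi> K. \<exists>\<eta>\<^sub>2\<in>E_K2 E F \<Phi> K. \<exists>y\<^sub>1\<in>F_K1 F K. \<exists>y\<^sub>2\<in>F_K2 F K.
       \<zeta>\<^sub>1 + \<zeta>\<^sub>2 = \<eta>\<^sub>1 + \<eta>\<^sub>2 \<and> x\<^sub>1 + x\<^sub>2 = y\<^sub>1 + y\<^sub>2 \<and> y = f \<eta>\<^sub>1 \<eta>\<^sub>2 y\<^sub>1 y\<^sub>2) = f \<zeta>\<^sub>1 \<zeta>\<^sub>2 x\<^sub>1 x\<^sub>2"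
    for f :: "complex ^ 'n \<Rightarrow> complex ^ 'n \<Rightarrow> real ^ 'm \<Rightarrow> real ^ 'm \<Rightarrow> complex"
  proof (rule the_equality, goal_cases)
    case 1
    show ?case using assms(2-5) by blast
  next
    case (2 y)
    then obtain \<eta>\<^sub>1 \<eta>\<^sub>2 y\<^sub>1 y\<^sub>2 where
      m: "\<eta>\<^sub>1 \<in> E_K1 E F \<Phi> K" "\<eta>\<^sub>2 \<in> E_K2 E F \<Phi> K" "y\<^sub>1 \<in> F_K1 F K" "y\<^sub>2 \<in> F_K2 F K"
      and e: "\<zeta>\<^sub>1 + \<zeta>\<^sub>2 = \<eta>\<^sub>1 + \<eta>\<^sub>2" "x\<^sub>1 + x\<^sub>2 = y\<^sub>1 + y\<^sub>2" and y: "y = f \<eta>\<^sub>1 \<eta>\<^sub>2 y\<^sub>1 y\<^sub>2"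
      by blast
    show ?case
      using E_K_decomp_unique[OF assms(1) assms(2) m(1) assms(3) m(2) e(1)]
        F_K_decomp_unique[OF F assms(4) m(3) assms(5) m(4) e(2)] y by simp
  qed
  note the[of "\<lambda>\<eta>\<^sub>1 \<eta>\<^sub>2 y\<^sub>1 y\<^sub>2. shift_K E F \<Phi> K P
      (quad \<Phi> (\<eta>\<^sub>1 + \<eta>\<^sub>2) - quad \<Phi> \<eta>\<^sub>1 - quad (Phi_K2 F \<Phi> K) \<eta>\<^sub>2) (\<eta>\<^sub>1, y\<^sub>1) (\<eta>\<^sub>2, y\<^sub>2)"]
  with in_E in_F show ?thesis
    unfolding iota_def prod.case by (simp only: simp_thms if_True)
qed

end

(*
 Fix z in E.  The spectrum of g(z, .) lies in K, which is orthogonal to F_1, and this makes g(z, .) a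
 polynomial in the directions y of F_1: a combination sum_j c_j g(z, x + t_j y) multiplies the Fourier
 transform by f(<l, y>) with f(s) = sum_j c_j exp(i t_j s), and if enough moments of the c_j vanish, f
 vanishes to such a high order on the hyperplane <l, y> = 0 that the product is 0 (compare it with
 cut-offs that shrink to the hyperplane).  Interpolation then extends x_1 |-> g(z, x_1 + x_2) to the
 complexification of F_1.  As a function of the complex variable x_1 + i Phi(z) and of (z, x_2), the
 extension H is CR in (z, x_2) for the hermitian map Phi_2, whose null space contains E_1; so it is
 entire and of polynomial growth, hence polynomial, along E_1, and it is the holomorphic extension of a
 CR polynomial mapping P with iota(P) = g.  Conversely, iota(P) is a finite sum of products of a CR
 polynomial and the pull-back of an element of O_K(N_2).
*)
theory Submission
 imports Defs "HOL-Probability.Probability" "HOL-Complex_Analysis.Complex_Analysis"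
begin

text \<open>The delicate point is the growth condition: one exponent must serve all left-invariant
  operators. Passing from the fields of \<open>\<Phi>\<close> to those of \<open>Phi_K2\<close> adds
  derivatives along F1 with coefficients linear in \<zeta>, so each differentiation might raise the
  exponent; it stays bounded because g is polynomial along F1 and only boundedly many such
  derivatives survive. To exploit this, degree bounds on g are never stated through coefficients but
  as interpolation identities at the nodes 0, ..., D. Every coefficient is then a finite combination
  of values of g, and smoothness, growth, CR equations and spectrum pass to it. So the vectors of
  O_K(N_2) out of which P is built are sums of translates of g multiplied by polynomials in \<zeta>.
  \<open>leb V\<close> comes from an unspecified orthonormal basis; hence Fubini for orthogonal sums
  rests on the uniqueness of Haar measure. That a CR polynomial has a holomorphic extension is
  proved by the construction used for surjectivity, with the zero map in place of
  \<open>Phi_K2\<close> and all of F in place of F1.\<close>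

abbreviation (input) "leb \<equiv> subspace_lborel"
abbreviation (input) "smooth_on \<equiv> smooth_on_subspace"
abbreviation (input) "onb \<equiv> orthonormal_basis"
abbreviation (input) "jap x \<equiv> 1 + (norm x)\<^sup>2"
abbreviation (input) "rvec \<equiv> of_real_vec"
abbreviation (input) "hpoly \<equiv> holomorphic_polynomial"
abbreviation (input) "qCR \<equiv> quadratic_CR"
abbreviation (input) "cplx \<equiv> complex_of_real"

lemmas set_integral_def = set_lebesgue_integral_def
lemmas integral_congI = Bochner_Integration.integral_cong
lemmas integrable_le = Bochner_Integration.integrable_bound

section \<open>Calculus on a linear subspace\<close>

text \<open>\<open>dir_deriv\<close> is total and carries no differentiability; the calculus rules
  are proved for this relation, which determines its value by
  \<open>has_dir_deriv_eq\<close>.\<close>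

definition has_dir_deriv :: "'a::real_normed_vector => ('a => complex) => complex => 'a => bool" where
 "has_dir_deriv v f D x \<longleftrightarrow> ((%t. f (x + t *\<^sub>R v)) has_vector_derivative D) (at 0)"

lemma has_dir_deriv_eq: "has_dir_deriv v f D x ==> dir_deriv v f x = D"
 unfolding has_dir_deriv_def dir_deriv_def by (rule vector_derivative_at)

lemma has_dir_deriv_dir_deriv:
 "(%t::real. f (x + t *\<^sub>R v)) differentiable at 0 ==> has_dir_deriv v f (dir_deriv v f x) x"
 unfolding has_dir_deriv_def dir_deriv_def by (simp add: vector_derivative_works)

lemma has_dir_deriv_cong:
 assumes "subspace V" "v \<in> V" "x \<in> V" "!!y. y \<in> V ==> f y = g y"
 shows "has_dir_deriv v f D x \<longleftrightarrow> has_dir_deriv v g D x"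
proof -
 have "f (x + t *\<^sub>R v) = g (x + t *\<^sub>R v)" for t
  using assms by (intro assms(4)) (simp add: subspace_add subspace_scale)
 then show ?thesis by (simp add: has_dir_deriv_def)
qed

lemma dir_deriv_cong:
 assumes "subspace V" "v \<in> V" "x \<in> V" "!!y. y \<in> V ==> f y = g y"
 shows "dir_deriv v f x = dir_deriv v g x"
proof -
 have "f (x + t *\<^sub>R v) = g (x + t *\<^sub>R v)" for t
  using assms by (intro assms(4)) (simp add: subspace_add subspace_scale)
 then show ?thesis by (simp add: dir_deriv_def)
qed

lemma has_dir_deriv_const: "has_dir_deriv v (%x. c) 0 x"
 by (simp add: has_dir_deriv_def)

lemma has_dir_deriv_add:
 "has_dir_deriv v f D x ==> has_dir_deriv v g D' x ==> has_dir_deriv v (%y. f y + g y) (D + D') x"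
 unfolding has_dir_deriv_def by (rule has_vector_derivative_add)

lemma has_dir_deriv_mult:
 "has_dir_deriv v f D x ==> has_dir_deriv v g D' x ==>
  has_dir_deriv v (%y. f y * g y) (D * g x + f x * D') x"
 unfolding has_dir_deriv_def
 by (drule (1) has_vector_derivative_mult) (simp add: add.commute)

lemma has_dir_deriv_cmult: "has_dir_deriv v f D x ==> has_dir_deriv v (%y. c * f y) (c * D) x"
 using has_dir_deriv_mult[OF has_dir_deriv_const[of v c x]] by simp

lemma has_dir_deriv_sum:
 "(!!i. i \<in> I ==> has_dir_deriv v (f i) (D i) x) ==>
  has_dir_deriv v (%y. \<Sum>i\<in>I. f i y) (\<Sum>i\<in>I. D i) x"
 unfolding has_dir_deriv_def by (rule has_vector_derivative_sum)

lemma has_dir_deriv_linear: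
 assumes "bounded_linear L" shows "has_dir_deriv v L (L v) x"
proof -
 interpret bounded_linear L by fact
 have "((%t. L x + t *\<^sub>R L v) has_vector_derivative L v) (at 0)"
  by (auto intro!: derivative_eq_intros)
 then show ?thesis by (simp add: has_dir_deriv_def add scaleR)
qed

lemma has_dir_deriv_compose_affine:
 assumes "linear L" "has_dir_deriv (L v) f D (L x + c)"
 shows "has_dir_deriv v (%y. f (L y + c)) D x"
proof -
 have *: "L (x + t *\<^sub>R v) + c = L x + c + t *\<^sub>R L v" for t
  by (simp add: linear_add[OF assms(1)] linear_scale[OF assms(1)])
 show ?thesis using assms(2) unfolding has_dir_deriv_def by (simp only: *)
qed

lemma has_dir_deriv_inverse:
 assumes "has_dir_deriv v f D x" "f x \<noteq> 0"
 shows "has_dir_deriv v (%y. inverse (f y)) (- (D * inverse (f x) * inverse (f x))) x"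
proof -
 have 1: "(inverse has_field_derivative (- (inverse (f x) ^ 2))) (at ((%t. f (x + t *\<^sub>R v)) 0))"
  using assms(2) DERIV_inverse[of "f x" UNIV] by (simp add: power2_eq_square)
 from field_vector_diff_chain_at[OF assms(1)[unfolded has_dir_deriv_def] 1]
 show ?thesis by (simp add: has_dir_deriv_def o_def power2_eq_square mult.assoc)
qed

lemma has_dir_deriv_scale_dir:
 assumes "has_dir_deriv v f D x"
 shows "has_dir_deriv (c *\<^sub>R v) f (c *\<^sub>R D) x"
proof -
 have 1: "((%t. c * t) has_vector_derivative c) (at 0)"
  by (auto intro!: derivative_eq_intros)
 have 2: "((%t. f (x + t *\<^sub>R v)) has_vector_derivative D) (at (c * 0))"
  using assms by (simp add: has_dir_deriv_def)
 from vector_diff_chain_at[OF 1 2] show ?thesis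
  by (simp add: has_dir_deriv_def o_def mult.commute)
qed

text \<open>Smoothness to finite order. \<open>smooth_on_subspace\<close> speaks of iterates of the
  operator \<open>dir_deriv\<close>, which is awkward for products and composites, whose derivatives
  are known only on V. Here a derivative is any function that works on V, and closure properties
  become inductions on \<open>n\<close>.\<close>

primrec differentiable_order :: "'a::euclidean_space set => nat => ('a => complex) => bool" where
 "differentiable_order V 0 f \<longleftrightarrow> continuous_on V f"
| "differentiable_order V (Suc n) f \<longleftrightarrow> continuous_on V f \<and>
   (\<forall>v\<in>V. \<exists>f'. (\<forall>x\<in>V. has_dir_deriv v f (f' x) x) \<and> differentiable_order V n f')"

lemma differentiable_order_cong:
 assumes "subspace V" "!!y. y \<in> V ==> f y = g y"
 shows "differentiable_order V n f \<longleftrightarrow> differentiable_order V n g"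
proof -
 have c: "continuous_on V f \<longleftrightarrow> continuous_on V g"
  using assms(2) by (intro continuous_on_cong) auto
 have d: "has_dir_deriv v f D x \<longleftrightarrow> has_dir_deriv v g D x" if "v \<in> V" "x \<in> V" for v D x
  using has_dir_deriv_cong[OF assms(1) that assms(2)] .
 show ?thesis using c d by (cases n) auto
qed

lemma differentiable_order_continuous: "differentiable_order V n f ==> continuous_on V f"
 by (cases n) auto

lemma differentiable_order_SucD: "differentiable_order V (Suc n) f ==> differentiable_order V n f"
proof (induction n arbitrary: f)
 case (Suc n)
 then have "continuous_on V f" by simp
 moreover have "\<exists>f'. (\<forall>x\<in>V. has_dir_deriv v f (f' x) x) \<and> differentiable_order V n f'"
  if "v \<in> V" for v
  using Suc.prems that Suc.IH by (metis differentiable_order.simps(2))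
 ultimately show ?case by simp
qed simp

lemma smooth_continuous: "smooth_on V f ==> continuous_on V f"
 unfolding smooth_on_subspace_def using foldr.simps(1)
 by (metis empty_set empty_subsetI id_apply)

lemma smooth_has_dir_deriv:
 assumes "smooth_on V f" "v \<in> V" "x \<in> V"
 shows "has_dir_deriv v f (dir_deriv v f x) x"
proof -
 from assms(1) have "set [] \<subseteq> V \<longrightarrow> (\<forall>v\<in>V. \<forall>x\<in>V. (%t::real. foldr dir_deriv [] f (x + t *\<^sub>R v)) differentiable at 0)"
  unfolding smooth_on_subspace_def by blast
 with assms(2,3) show ?thesis by (intro has_dir_deriv_dir_deriv) simp
qed

lemma smooth_dir_deriv:
 assumes "smooth_on V f" "v \<in> V"
 shows "smooth_on V (dir_deriv v f)"
 unfolding smooth_on_subspace_def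
proof (intro allI impI)
 fix vs assume "set vs \<subseteq> V"
 then have "set (vs @ [v]) \<subseteq> V" using assms(2) by simp
 with assms(1) have "continuous_on V (foldr dir_deriv (vs @ [v]) f) \<and>
    (\<forall>w\<in>V. \<forall>x\<in>V. (%t::real. foldr dir_deriv (vs @ [v]) f (x + t *\<^sub>R w)) differentiable at 0)"
  unfolding smooth_on_subspace_def by blast
 then show "continuous_on V (foldr dir_deriv vs (dir_deriv v f)) \<and>
    (\<forall>w\<in>V. \<forall>x\<in>V. (%t::real. foldr dir_deriv vs (dir_deriv v f) (x + t *\<^sub>R w)) differentiable at 0)"
  by simp
qed

text \<open>Derivatives are unique on V, so the existentially chosen ones agree there with
  \<open>dir_deriv\<close>; what they do off V is invisible to both notions.\<close>

lemma smooth_iff_differentiable_order: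
 assumes "subspace V"
 shows "smooth_on V f \<longleftrightarrow> (\<forall>n. differentiable_order V n f)"
proof
 assume "smooth_on V f"
 then have "differentiable_order V n f" for n
 proof (induction n arbitrary: f)
  case 0 then show ?case by (simp add: smooth_continuous)
 next
  case (Suc n)
  then show ?case
   using smooth_continuous smooth_has_dir_deriv smooth_dir_deriv by (simp; blast)
 qed
 then show "\<forall>n. differentiable_order V n f" by blast
next
 have step: "(\<forall>n. differentiable_order V n (dir_deriv v h)) \<and>
   (\<forall>x\<in>V. has_dir_deriv v h (dir_deriv v h x) x)"
  if h: "\<forall>n. differentiable_order V n h" and v: "v \<in> V" for h v
 proof -
  have "differentiable_order V n (dir_deriv v h) \<and> (\<forall>x\<in>V. has_dir_deriv v h (dir_deriv v h x) x)" for n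
  proof -
   obtain f' where f': "!!x. x \<in> V ==> has_dir_deriv v h (f' x) x" "differentiable_order V n f'"
    using h[THEN spec, of "Suc n"] v unfolding differentiable_order.simps by metis
   have "dir_deriv v h x = f' x" if "x \<in> V" for x
    using f'(1)[OF that] by (rule has_dir_deriv_eq)
   then show ?thesis
    using f' differentiable_order_cong[OF assms, of "dir_deriv v h" f' n] by simp
  qed
  then show ?thesis by blast
 qed
 assume f: "\<forall>n. differentiable_order V n f"
 show "smooth_on V f"
  unfolding smooth_on_subspace_def
 proof (intro allI impI)
  fix vs assume "set vs \<subseteq> V"
  then have *: "\<forall>n. differentiable_order V n (foldr dir_deriv vs f)"
   by (induction vs) (use f step in auto)
  then have "continuous_on V (foldr dir_deriv vs f)"
   using differentiable_order_continuous by blast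
  moreover have "(%t::real. foldr dir_deriv vs f (x + t *\<^sub>R v)) differentiable at 0"
   if "v \<in> V" "x \<in> V" for v x
   using step[OF * that(1)] that(2)
   unfolding has_dir_deriv_def by (auto intro: differentiableI_vector)
  ultimately show "continuous_on V (foldr dir_deriv vs f) \<and>
    (\<forall>v\<in>V. \<forall>x\<in>V. (%t::real. foldr dir_deriv vs f (x + t *\<^sub>R v)) differentiable at 0)"
   by blast
 qed
qed

lemma differentiable_order_const: "differentiable_order V n (%x. c)"
 by (induction n arbitrary: c) (auto intro!: exI[of _ "%x. 0"] has_dir_deriv_const)

lemma differentiable_order_add:
 "differentiable_order V n f ==> differentiable_order V n g ==>
  differentiable_order V n (%x. f x + g x)"
proof (induction n arbitrary: f g)
 case 0 then show ?case by (simp add: continuous_on_add)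
next
 case (Suc n)
 have "\<exists>h. (\<forall>x\<in>V. has_dir_deriv v (%x. f x + g x) (h x) x) \<and> differentiable_order V n h"
  if v: "v \<in> V" for v
 proof -
  obtain f' g' where "\<forall>x\<in>V. has_dir_deriv v f (f' x) x" "differentiable_order V n f'"
   "\<forall>x\<in>V. has_dir_deriv v g (g' x) x" "differentiable_order V n g'"
   using Suc.prems v by auto metis
  then show ?thesis
   by (intro exI[of _ "%x. f' x + g' x"]) (auto intro: has_dir_deriv_add Suc.IH)
 qed
 with Suc.prems show ?case by (auto intro: continuous_on_add)
qed

lemma differentiable_order_mult:
 "differentiable_order V n f ==> differentiable_order V n g ==>
  differentiable_order V n (%x. f x * g x)"
proof (induction n arbitrary: f g)
 case 0 then show ?case by (simp add: continuous_on_mult)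
next
 case (Suc n)
 have "\<exists>h. (\<forall>x\<in>V. has_dir_deriv v (%x. f x * g x) (h x) x) \<and> differentiable_order V n h"
  if v: "v \<in> V" for v
 proof -
  obtain f' g' where d: "\<forall>x\<in>V. has_dir_deriv v f (f' x) x" "differentiable_order V n f'"
   "\<forall>x\<in>V. has_dir_deriv v g (g' x) x" "differentiable_order V n g'"
   using Suc.prems v by auto metis
  show ?thesis
   by (rule exI[of _ "%x. f' x * g x + f x * g' x"])
    (use d Suc.prems[THEN differentiable_order_SucD] in
     \<open>auto intro!: has_dir_deriv_mult Suc.IH differentiable_order_add\<close>)
 qed
 with Suc.prems show ?case by (auto intro: continuous_on_mult)
qed

lemma differentiable_order_inverse:
 assumes "!!x. x \<in> V ==> f x \<noteq> 0"
 shows "differentiable_order V n f ==> differentiable_order V n (%x. inverse (f x))"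
proof (induction n)
 case 0 then show ?case using assms by (auto intro: continuous_on_inverse)
next
 case (Suc n)
 have "\<exists>h. (\<forall>x\<in>V. has_dir_deriv v (%x. inverse (f x)) (h x) x) \<and> differentiable_order V n h"
  if v: "v \<in> V" for v
 proof -
  obtain f' where d: "\<forall>x\<in>V. has_dir_deriv v f (f' x) x" "differentiable_order V n f'"
   using Suc.prems v by auto
  have i: "differentiable_order V n (%x. inverse (f x))"
   using Suc.IH Suc.prems differentiable_order_SucD by blast
  have "differentiable_order V n (%x. - 1 * (f' x * inverse (f x) * inverse (f x)))"
   by (intro differentiable_order_mult differentiable_order_const d(2) i)
  then show ?thesis
   using d(1) assms by (intro exI[of _ "%x. - (f' x * inverse (f x) * inverse (f x))"])
    (auto intro: has_dir_deriv_inverse)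
 qed
 with Suc.prems assms show ?case by (auto intro: continuous_on_inverse)
qed

lemma differentiable_order_compose_affine:
 assumes L: "linear L" and V: "!!x. x \<in> V ==> L x \<in> W" and c: "c \<in> W" and W: "subspace W"
 shows "differentiable_order W n f ==> differentiable_order V n (%x. f (L x + c))"
proof (induction n arbitrary: f)
 case 0
 have "continuous_on V (%x. L x + c)"
  by (intro continuous_intros linear_continuous_on linear_conv_bounded_linear[THEN iffD1] L)
 then show ?case using 0 V c subspace_add[OF W]
  by (auto intro!: continuous_on_compose2[of W f])
next
 case (Suc n)
 have "continuous_on V (%x. L x + c)"
  by (intro continuous_intros linear_continuous_on linear_conv_bounded_linear[THEN iffD1] L)
 then have "continuous_on V (%x. f (L x + c))" using Suc.prems V c subspace_add[OF W]
  by (auto intro!: continuous_on_compose2[of W f])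
 moreover have "\<exists>h. (\<forall>x\<in>V. has_dir_deriv v (%x. f (L x + c)) (h x) x) \<and> differentiable_order V n h"
  if v: "v \<in> V" for v
 proof -
  obtain f' where d: "\<forall>x\<in>W. has_dir_deriv (L v) f (f' x) x" "differentiable_order W n f'"
   using Suc.prems V[OF v] by auto
  then show ?thesis using V c subspace_add[OF W]
   by (intro exI[of _ "%x. f' (L x + c)"])
    (auto intro!: has_dir_deriv_compose_affine[OF L] Suc.IH)
 qed
 ultimately show ?case by simp
qed

section \<open>Closure properties of smooth functions\<close>

lemma smooth_cong:
 assumes "subspace V" "!!y. y \<in> V ==> f y = g y"
 shows "smooth_on V f \<longleftrightarrow> smooth_on V g"
 using differentiable_order_cong[OF assms] by (simp add: smooth_iff_differentiable_order[OF assms(1)])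

lemma smooth_const: "subspace V ==> smooth_on V (%x. c)"
 by (simp add: smooth_iff_differentiable_order differentiable_order_const)

lemma smooth_add:
 "subspace V ==> smooth_on V f ==> smooth_on V g ==> smooth_on V (%x. f x + g x)"
 by (simp add: smooth_iff_differentiable_order differentiable_order_add)

lemma smooth_mult:
 "subspace V ==> smooth_on V f ==> smooth_on V g ==> smooth_on V (%x. f x * g x)"
 by (simp add: smooth_iff_differentiable_order differentiable_order_mult)

lemma smooth_cmult:
 "subspace V ==> smooth_on V f ==> smooth_on V (%x. c * f x)"
 by (intro smooth_mult smooth_const)

lemma smooth_sum:
 "subspace V ==> (!!i. i \<in> I ==> smooth_on V (f i)) ==>
  smooth_on V (%x. \<Sum>i\<in>I. f i x)"
 by (induction I rule: infinite_finite_induct) (auto intro: smooth_add smooth_const)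

lemma smooth_prod:
 "subspace V ==> (!!i. i \<in> I ==> smooth_on V (f i)) ==>
  smooth_on V (%x. \<Prod>i\<in>I. f i x)"
 by (induction I rule: infinite_finite_induct) (auto intro: smooth_mult smooth_const)

lemma smooth_inverse:
 "subspace V ==> smooth_on V f ==> (!!x. x \<in> V ==> f x \<noteq> 0) ==>
  smooth_on V (%x. inverse (f x))"
 by (simp add: smooth_iff_differentiable_order differentiable_order_inverse)

lemma smooth_compose_affine:
 assumes "subspace V" "subspace W" "linear L" "!!x. x \<in> V ==> L x \<in> W" "c \<in> W"
  "smooth_on W f"
 shows "smooth_on V (%x. f (L x + c))"
 using assms differentiable_order_compose_affine[OF assms(3,4,5,2)]
 by (simp add: smooth_iff_differentiable_order)

lemma smooth_compose_linear:
 assumes "subspace V" "subspace W" "linear L" "!!x. x \<in> V ==> L x \<in> W"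
  "smooth_on W f"
 shows "smooth_on V (%x. f (L x))"
 using smooth_compose_affine[OF assms(1-4) _ assms(5), of 0] subspace_0[OF assms(2)] by simp

lemma smooth_linear:
 assumes "subspace V" "bounded_linear L"
 shows "smooth_on V L"
proof -
 have "differentiable_order V n L" for n
  using assms(2) by (cases n)
   (auto intro!: has_dir_deriv_linear differentiable_order_const linear_continuous_on
    exI[of _ "%x. L _"])
 then show ?thesis using assms(1) by (simp add: smooth_iff_differentiable_order)
qed

lemma smooth_subset:
 assumes "subspace V" "subspace W" "V \<subseteq> W" "smooth_on W f"
 shows "smooth_on V f"
 using smooth_compose_linear[OF assms(1,2) linear_id _ assms(4)] assms(3) by auto

text \<open>Smoothness was defined by derivatives along lines; continuity of the partial derivatives
  upgrades it to differentiability on planes. Linearity of \<open>dir_deriv\<close> in the direction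
  and complex differentiability of CR functions on complex lines both come from here.\<close>

lemma has_derivative_plane:
 assumes V: "subspace V" and f: "smooth_on V f" and v: "v \<in> V" and w: "w \<in> V" and x: "x \<in> V"
 shows "((%(s, t). f (x + s *\<^sub>R v + t *\<^sub>R w)) has_derivative
  (%(a, b). a *\<^sub>R dir_deriv v f x + b *\<^sub>R dir_deriv w f x)) (at (0, 0))"
proof -
 let ?F = "%s t::real. f (x + s *\<^sub>R v + t *\<^sub>R w)"
 let ?fy = "%s t::real. blinfun_scaleR_left (dir_deriv w f (x + s *\<^sub>R v + t *\<^sub>R w))"
 have inV: "x + s *\<^sub>R v + t *\<^sub>R w \<in> V" for s t
  using V v w x by (simp add: subspace_add subspace_scale)
 have 1: "((%s. ?F s 0) has_derivative (%h. h *\<^sub>R dir_deriv v f x)) (at 0 within UNIV)"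
  using smooth_has_dir_deriv[OF f v x] by (simp add: has_dir_deriv_def has_vector_derivative_def)
 have 2: "(?F s has_derivative blinfun_apply (?fy s t)) (at t within UNIV)" for s t
 proof -
  have "((%r. ?F s t + 0 + (f (x + s *\<^sub>R v + t *\<^sub>R w + r *\<^sub>R w) - ?F s t)) has_vector_derivative dir_deriv w f (x + s *\<^sub>R v + t *\<^sub>R w)) (at (t - t))"
   using smooth_has_dir_deriv[OF f w inV[of s t]] by (simp add: has_dir_deriv_def)
  then have a: "((%r. f (x + s *\<^sub>R v + t *\<^sub>R w + r *\<^sub>R w)) has_vector_derivative dir_deriv w f (x + s *\<^sub>R v + t *\<^sub>R w)) (at (t - t))"
   by simp
  have b: "((%r. r - t) has_vector_derivative 1) (at t)"
   by (auto intro!: derivative_eq_intros)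
  have "(?F s has_vector_derivative dir_deriv w f (x + s *\<^sub>R v + t *\<^sub>R w)) (at t)"
   using vector_diff_chain_at[OF b a] by (simp add: o_def algebra_simps)
  then show ?thesis by (simp add: has_vector_derivative_def blinfun_scaleR_left.rep_eq)
 qed
 have "continuous_on UNIV (%p::real \<times> real. dir_deriv w f (x + fst p *\<^sub>R v + snd p *\<^sub>R w))"
  by (rule continuous_on_compose2[OF smooth_continuous[OF smooth_dir_deriv[OF f w]]])
   (auto intro!: continuous_intros inV)
 then have "continuous_on UNIV (%p::real \<times> real. ?fy (fst p) (snd p))"
  by (rule bounded_linear.continuous_on[OF bounded_linear_blinfun_scaleR_left])
 then have 3: "continuous (at (0, 0) within UNIV \<times> UNIV) (%(s, t). ?fy s t)"
  unfolding continuous_on_eq_continuous_within case_prod_beta UNIV_Times_UNIV by blast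
 have "((%(s, t). ?F s t) has_derivative (%(a, b). a *\<^sub>R dir_deriv v f x + blinfun_apply (?fy 0 0) b)) (at (0, 0) within UNIV \<times> UNIV)"
  by (rule has_derivative_partialsI[OF 1 2 3]) auto
 then show ?thesis
  by (simp add: blinfun_scaleR_left.rep_eq)
qed

lemma dir_deriv_add_dir:
 assumes V: "subspace V" and f: "smooth_on V f" and v: "v \<in> V" and w: "w \<in> V" and x: "x \<in> V"
 shows "dir_deriv (v + w) f x = dir_deriv v f x + dir_deriv w f x"
proof -
 have 5: "((%t::real. (t, t)) has_derivative (%t. (t, t))) (at 0)"
  by (auto intro!: derivative_eq_intros)
 have "((%t. f (x + t *\<^sub>R v + t *\<^sub>R w)) has_derivative (%t. t *\<^sub>R dir_deriv v f x + t *\<^sub>R dir_deriv w f x)) (at 0)"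
  using has_derivative_compose[OF 5 has_derivative_plane[OF V f v w x]] by simp
 then have "has_dir_deriv (v + w) f (dir_deriv v f x + dir_deriv w f x) x"
  by (simp add: has_dir_deriv_def has_vector_derivative_def scaleR_add_right add.assoc)
 then show ?thesis by (rule has_dir_deriv_eq)
qed

lemma dir_deriv_scale_dir:
 assumes "smooth_on V f" "v \<in> V" "x \<in> V"
 shows "dir_deriv (c *\<^sub>R v) f x = c *\<^sub>R dir_deriv v f x"
 using has_dir_deriv_scale_dir[OF smooth_has_dir_deriv[OF assms]] by (rule has_dir_deriv_eq)

lemma dir_deriv_zero_dir: "dir_deriv 0 f x = 0"
 by (simp add: dir_deriv_def)

lemma dir_deriv_sum_dir:
 assumes "subspace V" "smooth_on V f" "x \<in> V" "!!i. i \<in> I ==> v i \<in> V"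
 shows "dir_deriv (\<Sum>i\<in>I. c i *\<^sub>R v i) f x = (\<Sum>i\<in>I. c i *\<^sub>R dir_deriv (v i) f x)"
 using assms(4)
proof (induction I rule: infinite_finite_induct)
 case (insert i I)
 then have "(\<Sum>i\<in>I. c i *\<^sub>R v i) \<in> V"
  by (intro subspace_sum subspace_scale assms(1)) auto
 with insert show ?case using assms
  by (simp add: dir_deriv_add_dir[OF assms(1,2)] dir_deriv_scale_dir[OF assms(2)] subspace_scale)
qed (auto simp: dir_deriv_zero_dir)

lemma dir_deriv_add:
 assumes "smooth_on V f" "smooth_on V g" "v \<in> V" "x \<in> V"
 shows "dir_deriv v (%x. f x + g x) x = dir_deriv v f x + dir_deriv v g x"
 using assms by (intro has_dir_deriv_eq has_dir_deriv_add smooth_has_dir_deriv)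

lemma dir_deriv_cmult:
 assumes "smooth_on V f" "v \<in> V" "x \<in> V"
 shows "dir_deriv v (%x. c * f x) x = c * dir_deriv v f x"
 using assms by (intro has_dir_deriv_eq has_dir_deriv_cmult smooth_has_dir_deriv)

section \<open>Bump functions\<close>

text \<open>Bootstrapping: the derivative stays in \<open>S\<close>, so it can be differentiated
  again. It is applied to families indexed by polynomials or by constants, where one formula covers
  all derivatives.\<close>

lemma smooth_real_if_closed:
 fixes S :: "(real => complex) set"
 assumes "!!f. f \<in> S ==> \<exists>f'\<in>S. \<forall>x. (f has_vector_derivative f' x) (at x)" "f \<in> S"
 shows "smooth_on UNIV f"
proof -
 have "differentiable_order UNIV n f" if "f \<in> S" for n f
  using that
 proof (induction n arbitrary: f)
  case 0
  then show ?case using assms(1)[OF 0]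
   by (auto simp: continuous_on_eq_continuous_within intro: has_vector_derivative_continuous)
 next
  case (Suc n)
  obtain f' where f': "f' \<in> S" "!!x. (f has_vector_derivative f' x) (at x)"
   using assms(1)[OF Suc.prems] by blast
  have "has_dir_deriv v f (of_real v * f' x) x" for v x
  proof -
   have a: "((%t::real. x + t * v) has_vector_derivative v) (at 0)"
    by (auto intro!: derivative_eq_intros)
   have "(f has_vector_derivative f' x) (at (x + 0 * v))" using f'(2) by simp
   from vector_diff_chain_at[OF a this] show ?thesis
    by (simp add: has_dir_deriv_def o_def scaleR_conv_of_real)
  qed
  moreover have "differentiable_order UNIV n (%x. of_real v * f' x)" for v
   by (intro differentiable_order_mult differentiable_order_const Suc.IH f')
  moreover have "continuous_on UNIV f" using f'(2)
   by (auto simp: continuous_on_eq_continuous_within intro: has_vector_derivative_continuous)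
  ultimately show ?case by fastforce
 qed
 then show ?thesis using assms(2) by (simp add: smooth_iff_differentiable_order)
qed

text \<open>With \<open>p = 1\<close> this is the classical flat function exp(-1/x). The factor
  p(1/x) makes the family closed under differentiation, which acts on it as p |-> X^2 (p -
  p').\<close>

definition flat_fun :: "real poly => real => real" where
 "flat_fun p x = (if x > 0 then poly p (1 / x) * exp (- (1 / x)) else 0)"

lemma poly_exp_tendsto_0: "((%y::real. poly p y * exp (- y)) \<longlongrightarrow> 0) at_top"
proof -
 have "((%y. \<Sum>i\<le>degree p. coeff p i * (y ^ i / exp y)) \<longlongrightarrow> (\<Sum>i\<le>degree p. coeff p i * 0)) at_top"
  by (intro tendsto_sum tendsto_mult tendsto_const tendsto_power_div_exp_0)
 then show ?thesis
  by (simp add: poly_altdef exp_minus field_simps sum_distrib_left sum_divide_distrib)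
qed

lemma flat_fun_tendsto_0: "((%x. poly p (1 / x) * exp (- (1 / x))) \<longlongrightarrow> 0) (at_right (0::real))"
 using filterlim_compose[OF poly_exp_tendsto_0 filterlim_inverse_at_top_right]
 by (simp add: inverse_eq_divide)

lemma flat_fun_deriv:
 "(flat_fun p has_real_derivative flat_fun ([:0, 0, 1:] * (p - pderiv p)) x) (at x)"
proof -
 consider "x > 0" | "x < 0" | "x = 0" by linarith
 then show ?thesis
 proof cases
  case 1
  have "((%x. poly p (1 / x) * exp (- (1 / x))) has_real_derivative
    flat_fun ([:0, 0, 1:] * (p - pderiv p)) x) (at x)"
   using 1 by (auto intro!: derivative_eq_intros simp: flat_fun_def field_simps power2_eq_square)
  moreover have "\<forall>\<^sub>F y in nhds x. flat_fun p y = poly p (1 / y) * exp (- (1 / y))"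
   using eventually_nhds_in_open[of "{0<..}" x] 1
   by (auto elim!: eventually_mono simp: flat_fun_def)
  ultimately show ?thesis by (subst DERIV_cong_ev[OF refl _ refl])
 next
  case 2
  have "((%x. 0) has_real_derivative flat_fun ([:0, 0, 1:] * (p - pderiv p)) x) (at x)"
   using 2 by (auto simp: flat_fun_def)
  moreover have "\<forall>\<^sub>F y in nhds x. flat_fun p y = 0"
   using eventually_nhds_in_open[of "{..<0}" x] 2
   by (auto elim!: eventually_mono simp: flat_fun_def)
  ultimately show ?thesis by (subst DERIV_cong_ev[OF refl _ refl])
 next
  case 3
  \<comment> \<open>From the right, the difference quotient at 0 is again of the same shape, with X
    p in place of p.\<close>
  have r: "((%h. flat_fun p h / h) \<longlongrightarrow> 0) (at_right 0)"
  proof (rule Lim_transform_eventually[OF flat_fun_tendsto_0[of "[:0, 1:] * p"]])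
   show "\<forall>\<^sub>F x in at_right 0. poly ([:0, 1:] * p) (1 / x) * exp (- (1 / x)) = flat_fun p x / x"
    by (auto simp: eventually_at_filter flat_fun_def)
  qed
  have l: "((%h. flat_fun p h / h) \<longlongrightarrow> 0) (at_left 0)"
   by (rule tendsto_eventually) (auto simp: eventually_at_filter flat_fun_def)
  have "((%h. flat_fun p h / h) \<longlongrightarrow> 0) (at 0)" using l r by (simp add: filterlim_split_at)
  then show ?thesis using 3 by (simp add: DERIV_def flat_fun_def)
 qed
qed

lemma smooth_flat_fun: "smooth_on UNIV (%x. cplx (flat_fun p x))"
proof (rule smooth_real_if_closed[where S = "range (%p x. cplx (flat_fun p x))"])
 fix f assume "f \<in> range (%p x. cplx (flat_fun p x))"
 then obtain p where f: "f = (%x. cplx (flat_fun p x))" by auto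
 show "\<exists>f'\<in>range (%p x. cplx (flat_fun p x)). \<forall>x. (f has_vector_derivative f' x) (at x)"
  unfolding f
 proof (rule bexI[of _ "%x. cplx (flat_fun ([:0, 0, 1:] * (p - pderiv p)) x)"], intro allI)
  fix x
  show "((%x. cplx (flat_fun p x)) has_vector_derivative
   cplx (flat_fun ([:0, 0, 1:] * (p - pderiv p)) x)) (at x)"
   by (intro has_vector_derivative_of_real flat_fun_deriv)
 qed auto
qed auto

lemma bump_exists:
 obtains \<rho> :: "real => real" where "smooth_on UNIV (%x. cplx (\<rho> x))"
  "!!x. 0 \<le> \<rho> x" "!!x. \<bar>x\<bar> \<le> 1 ==> \<rho> x = 1" "!!x. \<bar>x\<bar> \<ge> 2 ==> \<rho> x = 0"
proof -
 define e where "e = flat_fun 1"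
 \<comment> \<open>\<open>h\<close> rises from 0 on x \<le> 0 to 1 on x \<ge> 1; the denominator is
   positive since x and 1 - x are not both nonpositive. \<open>\<rho>\<close> multiplies an
   increasing step by its mirror image.\<close>
 define h where "h x = e x * inverse (e x + e (1 - x))" for x
 define \<rho> where "\<rho> x = h (2 - x) * h (2 + x)" for x
 have e0: "e x = 0" if "x \<le> 0" for x using that by (simp add: e_def flat_fun_def)
 have e1: "e x > 0" if "x > 0" for x using that by (simp add: e_def flat_fun_def)
 have e2: "e x \<ge> 0" for x using e0[of x] e1[of x] by (cases "x > 0") auto
 have e3: "e x + e (1 - x) > 0" for x using e1[of x] e1[of "1 - x"] e2[of x] e2[of "1 - x"]
  by (cases "x > 0") (auto intro: add_pos_nonneg add_nonneg_pos)
 have se: "smooth_on UNIV (%x. cplx (e x))"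
  unfolding e_def by (rule smooth_flat_fun)
 have se': "smooth_on UNIV (%x. cplx (e (1 - x)))"
  using smooth_compose_affine[of UNIV UNIV "%x::real. - x" 1, OF _ _ _ _ _ se]
  by (auto simp: linear_iff)
 have sh: "smooth_on UNIV (%x. cplx (h x))"
 proof -
  have "smooth_on UNIV (%x. cplx (e x) * inverse (cplx (e x) + cplx (e (1 - x))))"
   using e3 by (intro smooth_mult smooth_inverse smooth_add se se' subspace_UNIV)
    (metis less_irrefl of_real_add of_real_eq_0_iff)
  then show ?thesis by (simp add: h_def)
 qed
 have "smooth_on UNIV (%x. cplx (h (2 - x)))"
  using smooth_compose_affine[of UNIV UNIV "%x::real. - x" 2, OF _ _ _ _ _ sh]
  by (auto simp: linear_iff)
 moreover have "smooth_on UNIV (%x. cplx (h (2 + x)))"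
  using smooth_compose_affine[of UNIV UNIV "%x::real. x" 2, OF _ _ _ _ _ sh]
  by (auto simp: linear_iff add.commute)
 ultimately have "smooth_on UNIV (%x. cplx (\<rho> x))"
  unfolding \<rho>_def of_real_mult by (intro smooth_mult subspace_UNIV)
 moreover have "\<rho> x \<ge> 0" for x
  using e2 e3 by (simp add: \<rho>_def h_def less_imp_le)
 moreover have "\<rho> x = 1" if "\<bar>x\<bar> \<le> 1" for x
 proof -
  have "h y = 1" if "y \<ge> 1" for y using that e0[of "1 - y"] e1[of y] by (simp add: h_def)
  then show ?thesis using that by (simp add: \<rho>_def)
 qed
 moreover have "\<rho> x = 0" if "\<bar>x\<bar> \<ge> 2" for x
 proof -
  have "2 - x \<le> 0 \<or> 2 + x \<le> 0" using that by linarith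
  then show ?thesis using e0[of "2 - x"] e0[of "2 + x"] by (auto simp: \<rho>_def h_def)
 qed
 ultimately show thesis using that by blast
qed

section \<open>Lebesgue measure of a subspace\<close>

lemma onb:
 fixes V :: "'a::euclidean_space set"
 assumes "subspace V"
 shows "onb V \<subseteq> V" "span (onb V) = V"
  "pairwise orthogonal (onb V)" "!!b. b \<in> onb V ==> norm b = 1"
proof -
 obtain B where "B \<subseteq> V" "pairwise orthogonal B" "!!x. x \<in> B ==> norm x = 1" "span B = V"
  using orthonormal_basis_subspace[OF assms] by metis
 then have "\<exists>B. B \<subseteq> V \<and> span B = V \<and> pairwise orthogonal B \<and> (\<forall>b\<in>B. norm b = 1)" by blast
 from someI_ex[OF this]
 show "onb V \<subseteq> V" "span (onb V) = V"
  "pairwise orthogonal (onb V)" "!!b. b \<in> onb V ==> norm b = 1"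
  unfolding orthonormal_basis_def by auto
qed

lemma independent_onb:
 assumes "subspace V" shows "independent (onb V)"
proof (rule pairwise_orthogonal_independent)
 show "pairwise orthogonal (onb V)" by (rule onb[OF assms])
 show "0 \<notin> onb V" using onb(4)[OF assms, of 0] by auto
qed

lemma finite_onb:
 assumes "subspace V" shows "finite (onb V)"
 using independent_onb[OF assms] by (rule independent_imp_finite)

lemma card_onb:
 assumes "subspace V" shows "card (onb V) = dim V"
 using dim_eq_card[OF _ independent_onb[OF assms], of V] onb(2)[OF assms]
  span_eq_iff[THEN iffD2, OF assms] by simp

lemma inner_onb:
 assumes "subspace V" "b \<in> onb V" "b' \<in> onb V"
 shows "b \<bullet> b' = (if b = b' then 1 else 0)"
 using onb(3,4)[OF assms(1)] assms(2,3)
 by (auto simp: pairwise_def orthogonal_def norm_eq_sqrt_inner)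

lemma onb_sum_inner:
 assumes "subspace V" "b \<in> onb V"
 shows "(\<Sum>b'\<in>onb V. c b' *\<^sub>R b') \<bullet> b = c b"
proof -
 have "(\<Sum>b'\<in>onb V. c b' *\<^sub>R b') \<bullet> b =
   (\<Sum>b'\<in>onb V. if b' = b then c b' else 0)"
  using assms by (auto simp: inner_sum_left inner_onb intro!: sum.cong)
 then show ?thesis using assms finite_onb[OF assms(1)] by simp
qed

lemma onb_expand:
 assumes V: "subspace V" and "x \<in> V"
 shows "x = (\<Sum>b\<in>onb V. (x \<bullet> b) *\<^sub>R b)"
proof -
 let ?B = "onb V"
 obtain c where x: "x = (\<Sum>b\<in>?B. c b *\<^sub>R b)"
  using assms(2) onb(2)[OF V] span_finite[OF finite_onb[OF V]] by auto
 have "x \<bullet> b = c b" if "b \<in> ?B" for b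
  using onb_sum_inner[OF V that, of c] by (simp add: x)
 then have "(\<Sum>b\<in>?B. (x \<bullet> b) *\<^sub>R b) = (\<Sum>b\<in>?B. c b *\<^sub>R b)" by (intro sum.cong) auto
 then show ?thesis using x by simp
qed

lemma onb_inner:
 assumes V: "subspace V" and "x \<in> V"
 shows "x \<bullet> y = (\<Sum>b\<in>onb V. (x \<bullet> b) * (b \<bullet> y))"
proof -
 have "x \<bullet> y = (\<Sum>b\<in>onb V. (x \<bullet> b) *\<^sub>R b) \<bullet> y"
  using onb_expand[OF assms] by simp
 then show ?thesis by (simp add: inner_sum_left)
qed

lemma onb_norm2:
 assumes V: "subspace V" and "x \<in> V"
 shows "(norm x)\<^sup>2 = (\<Sum>b\<in>onb V. (x \<bullet> b)\<^sup>2)"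
 unfolding power2_norm_eq_inner onb_inner[OF assms, of x]
 by (simp add: power2_eq_square inner_commute)

section \<open>Uniqueness of Haar measure on a subspace\<close>

definition gauss :: "'a::real_inner => real" where
 "gauss x = exp (- (norm x)\<^sup>2 / 2)"

lemma gauss_pos: "gauss x > 0" by (simp add: gauss_def)

lemma gauss_le_1: "gauss x \<le> 1" by (simp add: gauss_def)

lemma borel_measurable_gauss [measurable]:
 "(gauss :: 'a::euclidean_space => real) \<in> borel_measurable borel"
 unfolding gauss_def by measurable

lemma continuous_on_gauss: "continuous_on S gauss"
 unfolding gauss_def by (intro continuous_intros) auto

text \<open>Finiteness and non-degeneracy are imposed on the integral of a Gaussian rather than on
  compact sets: this one number also fixes the normalisation, and it factors over orthogonal
  sums.\<close>

definition haar_on :: "'a::euclidean_space set => 'a measure => bool" where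
 "haar_on V \<mu> \<longleftrightarrow> sets \<mu> = sets borel \<and> (AE x in \<mu>. x \<in> V) \<and>
  (\<forall>v\<in>V. \<forall>f\<in>borel_measurable borel. (\<integral>\<^sup>+x. f (x + v) \<partial>\<mu>) = (\<integral>\<^sup>+x. f x \<partial>\<mu>)) \<and>
  (\<integral>\<^sup>+x. ennreal (gauss x) \<partial>\<mu>) \<noteq> 0 \<and> (\<integral>\<^sup>+x. ennreal (gauss x) \<partial>\<mu>) \<noteq> \<infinity>"

text \<open>On the ball of radius n the Gaussian is at least exp(-n^2/2), so the ball has finite
  measure.\<close>

lemma haar_on_sigma_finite:
 assumes "haar_on V \<mu>"
 shows "sigma_finite_measure \<mu>"
proof
 have s[measurable_cong, simp]: "sets \<mu> = sets borel" and fin: "(\<integral>\<^sup>+x. ennreal (gauss x) \<partial>\<mu>) \<noteq> \<infinity>"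
  using assms by (auto simp: haar_on_def)
 have "emeasure \<mu> (cball 0 (real n)) \<noteq> \<infinity>" for n
 proof -
  have "emeasure \<mu> (cball 0 (real n)) = (\<integral>\<^sup>+x. indicator (cball 0 (real n)) x \<partial>\<mu>)"
   by (subst nn_integral_indicator) auto
  also have "\<dots> \<le> (\<integral>\<^sup>+x. ennreal (exp ((real n)\<^sup>2 / 2)) * ennreal (gauss x) \<partial>\<mu>)"
  proof (intro nn_integral_mono)
   fix x
   have "1 \<le> exp ((real n)\<^sup>2 / 2) * gauss x" if "norm x \<le> n"
    using that power_mono[OF that, of 2] by (simp add: gauss_def flip: exp_add)
   then show "indicator (cball 0 (real n)) x \<le> ennreal (exp ((real n)\<^sup>2 / 2)) * ennreal (gauss x)"
    by (auto simp: indicator_def ennreal_mult[symmetric] less_imp_le[OF gauss_pos] ennreal_1[symmetric] simp del: ennreal_1 intro!: ennreal_leI)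
  qed
  also have "\<dots> = ennreal (exp ((real n)\<^sup>2 / 2)) * (\<integral>\<^sup>+x. ennreal (gauss x) \<partial>\<mu>)"
   by (intro nn_integral_cmult) simp
  also have "\<dots> < \<infinity>" using fin by (auto simp: ennreal_mult_less_top less_top)
  finally show ?thesis by simp
 qed
 moreover have "(\<Union>n. cball 0 (real n)) = (UNIV :: 'a set)"
  using real_arch_simple by (auto simp: set_eq_iff)
 moreover have "space \<mu> = UNIV" using sets_eq_imp_space_eq[OF s] by simp
 ultimately show "\<exists>A. countable A \<and> A \<subseteq> sets \<mu> \<and> \<Union> A = space \<mu> \<and> (\<forall>a\<in>A. emeasure \<mu> a \<noteq> \<infinity>)"
  by (intro exI[of _ "range (%n. cball 0 (real n))"]) auto
qed

text \<open>The classical uniqueness argument for Haar measure: in \<open>\<integral>\<integral> f (x + y) g (y) d\<mu> d\<nu>\<close> either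
 variable may be translated away; the test function \<open>g\<close> is a Gaussian.\<close>

lemma haar_on_unique:
 assumes V: "subspace V" and \<mu>: "haar_on V \<mu>" and \<nu>: "haar_on V \<nu>"
  and f[measurable]: "f \<in> borel_measurable borel"
 shows "(\<integral>\<^sup>+x. f x \<partial>\<mu>) * (\<integral>\<^sup>+x. ennreal (gauss x) \<partial>\<nu>) = (\<integral>\<^sup>+x. f x \<partial>\<nu>) * (\<integral>\<^sup>+x. ennreal (gauss x) \<partial>\<mu>)"
proof -
 interpret M: sigma_finite_measure \<mu> by (rule haar_on_sigma_finite[OF \<mu>])
 interpret N: sigma_finite_measure \<nu> by (rule haar_on_sigma_finite[OF \<nu>])
 interpret P: pair_sigma_finite \<mu> \<nu> by standard
 have s[measurable_cong, simp]: "sets \<mu> = sets borel" "sets \<nu> = sets borel"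
  using \<mu> \<nu> by (auto simp: haar_on_def)
 have tm: "(\<integral>\<^sup>+x. h (x + v) \<partial>\<mu>) = (\<integral>\<^sup>+x. h x \<partial>\<mu>)" if "v \<in> V" "h \<in> borel_measurable borel" for v h
  using \<mu> that by (auto simp: haar_on_def)
 have tn: "(\<integral>\<^sup>+x. h (x + v) \<partial>\<nu>) = (\<integral>\<^sup>+x. h x \<partial>\<nu>)" if "v \<in> V" "h \<in> borel_measurable borel" for v h
  using \<nu> that by (auto simp: haar_on_def)
 have aem: "AE x in \<mu>. x \<in> V" and aen: "AE x in \<nu>. x \<in> V" using \<mu> \<nu> by (auto simp: haar_on_def)
 let ?g = "%x. ennreal (gauss x)"
 have "(\<integral>\<^sup>+x. f x \<partial>\<mu>) * (\<integral>\<^sup>+y. ?g y \<partial>\<nu>) = (\<integral>\<^sup>+y. (\<integral>\<^sup>+x. f x \<partial>\<mu>) * ?g y \<partial>\<nu>)"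
  by (subst nn_integral_cmult) auto
 also have "\<dots> = (\<integral>\<^sup>+y. (\<integral>\<^sup>+x. f (x + y) * ?g y \<partial>\<mu>) \<partial>\<nu>)"
 proof (rule nn_integral_cong_AE)
  show "AE y in \<nu>. (\<integral>\<^sup>+x. f x \<partial>\<mu>) * ?g y = (\<integral>\<^sup>+x. f (x + y) * ?g y \<partial>\<mu>)"
   using aen by eventually_elim (subst nn_integral_multc, auto simp: tm)
 qed
 also have "\<dots> = (\<integral>\<^sup>+x. (\<integral>\<^sup>+y. f (x + y) * ?g y \<partial>\<nu>) \<partial>\<mu>)"
  by (rule P.Fubini') measurable
 also have "\<dots> = (\<integral>\<^sup>+x. (\<integral>\<^sup>+y. f y * ?g (y - x) \<partial>\<nu>) \<partial>\<mu>)"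
 proof (rule nn_integral_cong_AE)
  show "AE x in \<mu>. (\<integral>\<^sup>+y. f (x + y) * ?g y \<partial>\<nu>) = (\<integral>\<^sup>+y. f y * ?g (y - x) \<partial>\<nu>)"
   using aem
  proof eventually_elim
   fix x assume x: "x \<in> V"
   show "(\<integral>\<^sup>+y. f (x + y) * ?g y \<partial>\<nu>) = (\<integral>\<^sup>+y. f y * ?g (y - x) \<partial>\<nu>)"
    using tn[OF x, of "%y. f y * ?g (y - x)"] by (simp add: add.commute)
  qed
 qed
 also have "\<dots> = (\<integral>\<^sup>+y. (\<integral>\<^sup>+x. f y * ?g (y - x) \<partial>\<mu>) \<partial>\<nu>)"
  by (rule P.Fubini'[symmetric]) measurable
 also have "\<dots> = (\<integral>\<^sup>+y. f y * (\<integral>\<^sup>+x. ?g x \<partial>\<mu>) \<partial>\<nu>)"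
 proof (rule nn_integral_cong_AE)
  show "AE y in \<nu>. (\<integral>\<^sup>+x. f y * ?g (y - x) \<partial>\<mu>) = f y * (\<integral>\<^sup>+x. ?g x \<partial>\<mu>)"
   using aen
  proof eventually_elim
   fix y assume "y \<in> V"
   then have "- y \<in> V" by (rule subspace_neg[OF V])
   have "(\<integral>\<^sup>+x. f y * ?g (y - x) \<partial>\<mu>) = f y * (\<integral>\<^sup>+x. ?g (y - x) \<partial>\<mu>)"
    by (subst nn_integral_cmult) auto
   also have "(\<integral>\<^sup>+x. ?g (y - x) \<partial>\<mu>) = (\<integral>\<^sup>+x. ?g (x + - y) \<partial>\<mu>)"
    by (simp add: gauss_def norm_minus_commute)
   also have "\<dots> = (\<integral>\<^sup>+x. ?g x \<partial>\<mu>)" by (rule tm) (use \<open>- y \<in> V\<close> in auto)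
   finally show "(\<integral>\<^sup>+x. f y * ?g (y - x) \<partial>\<mu>) = f y * (\<integral>\<^sup>+x. ?g x \<partial>\<mu>)" .
  qed
 qed
 also have "\<dots> = (\<integral>\<^sup>+x. f x \<partial>\<nu>) * (\<integral>\<^sup>+x. ?g x \<partial>\<mu>)"
  by (subst nn_integral_multc) auto
 finally show ?thesis .
qed

lemma haar_on_unique_eq:
 assumes "subspace V" "haar_on V \<mu>" "haar_on V \<nu>"
  and "(\<integral>\<^sup>+x. ennreal (gauss x) \<partial>\<nu>) = (\<integral>\<^sup>+x. ennreal (gauss x) \<partial>\<mu>)"
 shows "\<mu> = \<nu>"
proof (rule measure_eqI)
 show s: "sets \<mu> = sets \<nu>" using assms by (auto simp: haar_on_def)
 fix A assume "A \<in> sets \<mu>"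
 then have A: "A \<in> sets \<mu>" "A \<in> sets \<nu>" "A \<in> sets borel"
  using assms s by (auto simp: haar_on_def)
 have "emeasure \<mu> A * (\<integral>\<^sup>+x. ennreal (gauss x) \<partial>\<mu>) = emeasure \<nu> A * (\<integral>\<^sup>+x. ennreal (gauss x) \<partial>\<mu>)"
  using haar_on_unique[OF assms(1-3), of "indicator A"] A by (simp add: assms(4))
 moreover have "(\<integral>\<^sup>+x. ennreal (gauss x) \<partial>\<mu>) \<noteq> 0" "(\<integral>\<^sup>+x. ennreal (gauss x) \<partial>\<mu>) \<noteq> \<top>"
  using assms(2) by (auto simp: haar_on_def)
 ultimately show "emeasure \<mu> A = emeasure \<nu> A"
  by (metis ennreal_mult_cancel_left mult.commute)
qed

section \<open>Invariance of \<open>leb V\<close>, and an integrable weight\<close>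

interpretation lborel_product: product_sigma_finite "%_. lborel :: real measure"
 by standard

lemma distr_PiM_lborel_shift:
 assumes I: "finite I"
 shows "distr (Pi\<^sub>M I (%_. lborel)) (Pi\<^sub>M I (%_. lborel)) (%c. \<lambda>i\<in>I. c i + a i) = Pi\<^sub>M I (%_. lborel :: real measure)"
proof (rule lborel_product.PiM_eqI)
 fix A :: "'a => real set" assume A: "!!i. i \<in> I ==> A i \<in> sets lborel"
 let ?s = "%c. \<lambda>i\<in>I. c i + a i"
 have [measurable]: "?s \<in> Pi\<^sub>M I (%_. lborel) \<rightarrow>\<^sub>M Pi\<^sub>M I (%_. lborel)"
  by (intro measurable_restrict) measurable
 have m: "(%x. x + a i) -` A i \<in> sets lborel" if "i \<in> I" for i
  using measurable_sets[of "%x. x + a i" borel borel "A i"] A[OF that] by simp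
 have "?s -` Pi\<^sub>E I A \<inter> space (Pi\<^sub>M I (%_. lborel)) = Pi\<^sub>E I (%i. (%x. x + a i) -` A i)"
  by (auto simp: space_PiM PiE_iff extensional_def)
 then have "emeasure (distr (Pi\<^sub>M I (%_. lborel)) (Pi\<^sub>M I (%_. lborel)) ?s) (Pi\<^sub>E I A) =
   emeasure (Pi\<^sub>M I (%_. lborel)) (Pi\<^sub>E I (%i. (%x. x + a i) -` A i))"
  using A by (subst emeasure_distr) (auto intro!: sets_PiM_I_finite I)
 also have "\<dots> = (\<Prod>i\<in>I. emeasure lborel ((%x. x + a i) -` A i))"
  using m by (intro lborel_product.emeasure_PiM I)
 also have "\<dots> = (\<Prod>i\<in>I. emeasure lborel (A i))"
 proof (intro prod.cong refl)
  fix i assume "i \<in> I"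
  have "emeasure lborel (A i) = emeasure (distr lborel borel ((+) (a i))) (A i)"
   by (simp add: lborel_distr_plus)
  also have "\<dots> = emeasure lborel ((+) (a i) -` A i)"
   using A[OF \<open>i \<in> I\<close>] by (subst emeasure_distr) auto
  finally show "emeasure lborel ((%x. x + a i) -` A i) = emeasure lborel (A i)"
   by (simp add: add.commute[of _ "a i"])
 qed
 finally show "emeasure (distr (Pi\<^sub>M I (%_. lborel)) (Pi\<^sub>M I (%_. lborel)) ?s) (Pi\<^sub>E I A) =
   (\<Prod>i\<in>I. emeasure lborel (A i))" .
qed (use I in auto)

abbreviation coords_measure :: "'a::euclidean_space set => ('a => real) measure" where
 "coords_measure V \<equiv> Pi\<^sub>M (onb V) (%_. lborel)"

abbreviation of_coords :: "'a::euclidean_space set => ('a => real) => 'a" where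
 "of_coords V c \<equiv> (\<Sum>b\<in>onb V. c b *\<^sub>R b)"

lemma measurable_of_coords [measurable]: "of_coords V \<in> coords_measure V \<rightarrow>\<^sub>M borel"
 by measurable

lemma leb_eq: "leb V = distr (coords_measure V) borel (of_coords V)"
 by (simp add: subspace_lborel_def Let_def)

lemma sets_leb [measurable_cong, simp]: "sets (leb V) = sets borel"
 by (simp add: leb_eq)

lemma space_leb [simp]: "space (leb V) = UNIV"
 by (simp add: leb_eq)

lemma of_coords_in: "subspace V ==> of_coords V c \<in> V"
 using onb(1) by (intro subspace_sum subspace_scale) auto

lemma norm_of_coords:
 assumes "subspace V"
 shows "(norm (of_coords V c))\<^sup>2 = (\<Sum>b\<in>onb V. (c b)\<^sup>2)"
 unfolding onb_norm2[OF assms of_coords_in[OF assms]]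
 using onb_sum_inner[OF assms] by (intro sum.cong) auto

lemma borel_subspace: "subspace (V :: 'a::euclidean_space set) ==> V \<in> sets borel"
 by (rule borel_closed[OF closed_subspace])

lemma measurable_on_subspace:
 fixes f :: "'a::euclidean_space => 'b::real_normed_vector"
 shows "subspace V ==> continuous_on V f ==> (%x. indicator V x *\<^sub>R f x) \<in> borel_measurable borel"
 by (rule borel_measurable_continuous_on_indicator[OF borel_subspace])

lemma AE_leb:
 assumes "subspace V" shows "AE x in leb V. x \<in> V"
proof -
 have "{x \<in> space borel. x \<in> V} \<in> sets borel" using borel_subspace[OF assms] by simp
 then show ?thesis
  unfolding leb_eq by (subst AE_distr_iff) (auto simp: of_coords_in[OF assms])
qed

lemma nn_integral_leb_translate:
 assumes V: "subspace V" and v: "v \<in> V" and f[measurable]: "f \<in> borel_measurable borel"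
 shows "(\<integral>\<^sup>+x. f (x + v) \<partial>leb V) = (\<integral>\<^sup>+x. f x \<partial>leb V)"
proof -
 let ?B = "onb V"
 let ?s = "%c. \<lambda>b\<in>?B. c b + v \<bullet> b"
 have s: "?s \<in> coords_measure V \<rightarrow>\<^sub>M coords_measure V"
  by (intro measurable_restrict) measurable
 have *: "of_coords V (?s c) = of_coords V c + v" for c
 proof -
  have "of_coords V (?s c) = of_coords V c + (\<Sum>b\<in>?B. (v \<bullet> b) *\<^sub>R b)"
   by (simp add: sum.distrib scaleR_add_left)
  then show ?thesis using onb_expand[OF V v] by simp
 qed
 have "(\<integral>\<^sup>+x. f (x + v) \<partial>leb V) = (\<integral>\<^sup>+c. f (of_coords V (?s c)) \<partial>coords_measure V)"
  unfolding leb_eq * by (subst nn_integral_distr) auto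
 also have "\<dots> = (\<integral>\<^sup>+c. f (of_coords V c) \<partial>distr (coords_measure V) (coords_measure V) ?s)"
  by (subst nn_integral_distr[OF s]) auto
 also have "\<dots> = (\<integral>\<^sup>+c. f (of_coords V c) \<partial>coords_measure V)"
  by (simp add: distr_PiM_lborel_shift[OF finite_onb[OF V]])
 also have "\<dots> = (\<integral>\<^sup>+x. f x \<partial>leb V)"
  unfolding leb_eq by (subst nn_integral_distr) auto
 finally show ?thesis .
qed

text \<open>Each coordinate satisfies 1 + c_b^2 \<le> 1 + |x|^2, and there are at most
  \<open>DIM('a)\<close> of them, so the product of the integrable functions 1/(1 + c_b^2) is a
  majorant. Taking \<open>DIM('a)\<close> instead of the dimension of V gives one weight for all
  subspaces.\<close>

lemma integrable_inverse_power_norm: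
 assumes V: "subspace (V :: 'a::euclidean_space set)"
 shows "integrable (leb V) (%x. inverse ((jap x) ^ DIM('a)))"
proof -
 let ?B = "onb V"
 have fin: "finite ?B" by (rule finite_onb[OF V])
 have card: "card ?B \<le> DIM('a)" using card_onb[OF V] dim_subset_UNIV by metis
 have 1: "integrable lborel (%x::real. inverse (1 + x\<^sup>2))"
  using integrable_inverse_1_plus_square by (simp add: set_integrable_def)
 have 2: "integrable (coords_measure V) (%c. \<Prod>b\<in>?B. inverse (1 + (c b)\<^sup>2))"
  by (rule lborel_product.product_integrable_prod[OF fin 1])
 have "integrable (coords_measure V) (%c. inverse ((jap (of_coords V c)) ^ DIM('a)))"
 proof (rule integrable_le[OF 2])
  show "AE c in coords_measure V. norm (inverse ((jap (of_coords V c)) ^ DIM('a)))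
    \<le> norm (\<Prod>b\<in>?B. inverse (1 + (c b)\<^sup>2))"
  proof (rule AE_I2)
   fix c :: "'a => real"
   let ?n = "(norm (of_coords V c))\<^sup>2"
   have "(\<Prod>b\<in>?B. 1 + (c b)\<^sup>2) \<le> (\<Prod>b\<in>?B. 1 + ?n)"
   proof (intro prod_mono conjI)
    fix b assume "b \<in> ?B"
    then show "1 + (c b)\<^sup>2 \<le> 1 + ?n"
     unfolding norm_of_coords[OF V] using fin
     by (auto intro!: member_le_sum)
   qed simp
   also have "\<dots> = (1 + ?n) ^ card ?B" by simp
   also have "\<dots> \<le> (1 + ?n) ^ DIM('a)" by (intro power_increasing card) simp
   finally have "(\<Prod>b\<in>?B. 1 + (c b)\<^sup>2) \<le> (1 + ?n) ^ DIM('a)" .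
   moreover have "0 < (\<Prod>b\<in>?B. 1 + (c b)\<^sup>2)"
    by (intro prod_pos) (auto intro: add_pos_nonneg)
   ultimately have "inverse ((1 + ?n) ^ DIM('a)) \<le> inverse (\<Prod>b\<in>?B. 1 + (c b)\<^sup>2)"
    by (intro le_imp_inverse_le)
   then show "norm (inverse ((1 + ?n) ^ DIM('a))) \<le> norm (\<Prod>b\<in>?B. inverse (1 + (c b)\<^sup>2))"
    by (simp add: prod_inversef[unfolded comp_def] abs_prod)
  qed
 qed measurable
 then show ?thesis
  unfolding leb_eq by (subst integrable_distr_eq) auto
qed

section \<open>The Gaussian as its own Fourier transform\<close>

lemma gauss_fourier_1D:
 "integrable lborel (%x::real. exp (- x\<^sup>2 / 2) * iexp (t * x))"
 "(LINT x|lborel. cplx (exp (- x\<^sup>2 / 2)) * iexp (t * x)) = cplx (sqrt (2 * pi) * exp (- t\<^sup>2 / 2))"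
proof -
 have "cplx (exp (- t\<^sup>2 / 2)) = char std_normal_distribution t"
  by (simp add: char_std_normal_distribution)
 also have "\<dots> = (LINT x|lborel. std_normal_density x *\<^sub>R iexp (t * x))"
  unfolding char_def by (subst integral_density) (auto simp: normal_density_nonneg)
 also have "\<dots> = (LINT x|lborel. cplx (1 / sqrt (2 * pi)) * (cplx (exp (- x\<^sup>2 / 2)) * iexp (t * x)))"
  by (intro integral_congI) (auto simp: std_normal_density_def scaleR_conv_of_real)
 also have "\<dots> = cplx (1 / sqrt (2 * pi)) * (LINT x|lborel. cplx (exp (- x\<^sup>2 / 2)) * iexp (t * x))"
  by simp
 finally show "(LINT x|lborel. cplx (exp (- x\<^sup>2 / 2)) * iexp (t * x)) = cplx (sqrt (2 * pi) * exp (- t\<^sup>2 / 2))"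
  by (simp add: field_simps)
 have "integrable lborel (%x. sqrt (2 * pi) * std_normal_density x)"
  using integrable_std_normal_moment[of 0] by simp
 then have i: "integrable lborel (%x::real. exp (- x\<^sup>2 / 2))" by (simp add: std_normal_density_def)
 show "integrable lborel (%x::real. exp (- x\<^sup>2 / 2) * iexp (t * x))"
  by (rule integrable_le[OF i]) (auto simp: norm_mult)
qed

text \<open>In orthonormal coordinates both the Gaussian and the character are exponentials of sums,
  so the integral factors into one-dimensional ones.\<close>

lemma gauss_fourier:
 assumes V: "subspace V" and y: "y \<in> V"
 shows "integrable (leb V) (%x. gauss x * exp (\<i> * cplx (y \<bullet> x)))"
  and "(LINT x|leb V. cplx (gauss x) * exp (\<i> * cplx (y \<bullet> x)))
   = cplx (sqrt (2 * pi) ^ dim V * gauss y)"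
proof -
 let ?B = "onb V"
 let ?f = "%b t. cplx (exp (- t\<^sup>2 / 2)) * iexp ((y \<bullet> b) * t)"
 have fin: "finite ?B" by (rule finite_onb[OF V])
 have eq: "cplx (gauss (of_coords V c)) * exp (\<i> * cplx (y \<bullet> of_coords V c)) =
   (\<Prod>b\<in>?B. ?f b (c b))" for c
  by (simp add: prod.distrib exp_sum[OF fin, symmetric] gauss_def norm_of_coords[OF V] inner_sum_right
   sum_distrib_left sum_distrib_right sum_divide_distrib sum_negf mult.commute
   of_real_prod[symmetric] del: of_real_exp of_real_prod)
 have i: "integrable lborel (?f b)" for b
  by (rule gauss_fourier_1D(1))
 have "integrable (coords_measure V) (%c. (\<Prod>b\<in>?B. ?f b (c b)))"
  by (rule lborel_product.product_integrable_prod[OF fin i])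
 then show "integrable (leb V) (%x. gauss x * exp (\<i> * cplx (y \<bullet> x)))"
  unfolding leb_eq by (subst integrable_distr_eq) (auto simp: eq)
 have "(LINT x|leb V. cplx (gauss x) * exp (\<i> * cplx (y \<bullet> x))) =
   (LINT c|coords_measure V. (\<Prod>b\<in>?B. ?f b (c b)))"
  unfolding leb_eq by (subst integral_distr) (auto simp: eq)
 also have "\<dots> = (\<Prod>b\<in>?B. (LINT t|lborel. ?f b t))"
  by (rule lborel_product.product_integral_prod[OF fin i])
 also have "\<dots> = (\<Prod>b\<in>?B. cplx (sqrt (2 * pi) * exp (- (y \<bullet> b)\<^sup>2 / 2)))"
  by (simp only: gauss_fourier_1D(2))
 also have "\<dots> = cplx (sqrt (2 * pi) ^ card ?B * exp (\<Sum>b\<in>?B. - (y \<bullet> b)\<^sup>2 / 2))"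
  by (simp add: prod.distrib exp_sum[OF fin])
 also have "(\<Sum>b\<in>?B. - (y \<bullet> b)\<^sup>2 / 2) = - (norm y)\<^sup>2 / 2"
  by (simp add: onb_norm2[OF V y] sum_negf sum_divide_distrib)
 finally show "(LINT x|leb V. cplx (gauss x) * exp (\<i> * cplx (y \<bullet> x)))
   = cplx (sqrt (2 * pi) ^ dim V * gauss y)"
  by (simp add: gauss_def card_onb[OF V])
qed

lemma integrable_gauss:
 assumes V: "subspace V" shows "integrable (leb V) gauss"
proof -
 have "integrable (leb V) (%x. cplx (gauss x))"
  using gauss_fourier(1)[OF V subspace_0[OF V]] by simp
 then show ?thesis by (simp add: complex_of_real_integrable_eq)
qed

lemma nn_integral_gauss:
 assumes V: "subspace V"
 shows "(\<integral>\<^sup>+x. ennreal (gauss x) \<partial>leb V) = ennreal (sqrt (2 * pi) ^ dim V)"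
proof -
 have "cplx (LINT x|leb V. gauss x) = cplx (sqrt (2 * pi) ^ dim V)"
  using gauss_fourier(2)[OF V subspace_0[OF V]] by (simp add: gauss_def del: of_real_power)
 then have "(LINT x|leb V. gauss x) = sqrt (2 * pi) ^ dim V"
  by (simp only: of_real_eq_iff)
 then show ?thesis
  using nn_integral_eq_integral[OF integrable_gauss[OF V]] by (simp add: less_imp_le[OF gauss_pos])
qed

lemma haar_on_leb: "subspace V ==> haar_on V (leb V)"
 by (auto simp: haar_on_def AE_leb nn_integral_leb_translate nn_integral_gauss)

lemma sigma_finite_leb: "subspace V ==> sigma_finite_measure (leb V)"
 by (rule haar_on_sigma_finite[OF haar_on_leb])

lemma leb_translate:
 assumes "subspace V" "v \<in> V"
 shows "distr (leb V) borel (%x. x + v) = leb V"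
proof (rule measure_eqI)
 fix A assume "A \<in> sets (distr (leb V) borel (%x. x + v))"
 then have A[measurable]: "A \<in> sets borel" by simp
 have "emeasure (distr (leb V) borel (%x. x + v)) A =
   (\<integral>\<^sup>+x. indicator A x \<partial>distr (leb V) borel (%x. x + v))" by simp
 also have "\<dots> = (\<integral>\<^sup>+x. indicator A (x + v) \<partial>leb V)"
  by (subst nn_integral_distr) auto
 also have "\<dots> = (\<integral>\<^sup>+x. indicator A x \<partial>leb V)"
  by (rule nn_integral_leb_translate[OF assms]) measurable
 finally show "emeasure (distr (leb V) borel (%x. x + v)) A = emeasure (leb V) A"
  by simp
qed simp

text \<open>The orthonormal bases behind the three measures are unrelated, so coordinates do not
  help. Instead, the image of the product is translation invariant with the Gaussian mass of
  \<open>leb V\<close>, and uniqueness applies. Two maps \<open>J1\<close>, \<open>J2\<close> cover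
  orthogonal sums inside one space as well as Cartesian products.\<close>

lemma leb_product:
 fixes J1 :: "'b::euclidean_space => 'a::euclidean_space" and J2 :: "'c::euclidean_space => 'a"
 assumes V1: "subspace V1" and V2: "subspace V2" and J1: "linear J1" and J2: "linear J2"
  and iso: "!!x y. x \<in> V1 ==> y \<in> V2 ==> (norm (J1 x + J2 y))\<^sup>2 = (norm x)\<^sup>2 + (norm y)\<^sup>2"
  and V: "V = {J1 x + J2 y |x y. x \<in> V1 \<and> y \<in> V2}"
 shows "leb V = distr (leb V1 \<Otimes>\<^sub>M leb V2) borel (%(x, y). J1 x + J2 y)"
  (is "_ = distr ?P borel ?T")
proof -
 interpret M1: sigma_finite_measure "leb V1" by (rule sigma_finite_leb[OF V1])
 interpret M2: sigma_finite_measure "leb V2" by (rule sigma_finite_leb[OF V2])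
 interpret P: pair_sigma_finite "leb V1" "leb V2" by standard
 have VV: "V = {a + b |a b. a \<in> J1 ` V1 \<and> b \<in> J2 ` V2}" unfolding V by blast
 have sub: "subspace V" unfolding VV
  by (intro subspace_sums linear_subspace_image J1 J2 V1 V2)
 have Jm[measurable]: "J1 \<in> borel_measurable borel" "J2 \<in> borel_measurable borel"
  by (auto intro!: borel_measurable_continuous_onI linear_continuous_on linear_conv_bounded_linear[THEN iffD1] J1 J2)
 have Tm[measurable]: "?T \<in> ?P \<rightarrow>\<^sub>M borel" by measurable
 have nn: "(\<integral>\<^sup>+z. f z \<partial>distr ?P borel ?T) = (\<integral>\<^sup>+x. (\<integral>\<^sup>+y. f (J1 x + J2 y) \<partial>leb V2) \<partial>leb V1)"
  if [measurable]: "f \<in> borel_measurable borel" for f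
  by (subst nn_integral_distr, simp, simp, subst M2.nn_integral_fst[symmetric]) auto
 have z1: "norm (J1 x) = norm x" if "x \<in> V1" for x
  using iso[OF that subspace_0[OF V2]] linear_0[OF J2] by simp
 have z2: "norm (J2 x) = norm x" if "x \<in> V2" for x
  using iso[OF subspace_0[OF V1] that] linear_0[OF J1] by simp
 have AE1: "AE x in leb V1. x \<in> V1" and AE2: "AE x in leb V2. x \<in> V2"
  by (intro AE_leb V1 V2)+
 have gauss: "(\<integral>\<^sup>+z. ennreal (gauss z) \<partial>distr ?P borel ?T) = ennreal (sqrt (2 * pi) ^ dim V1) * ennreal (sqrt (2 * pi) ^ dim V2)"
 proof -
  have "(\<integral>\<^sup>+z. ennreal (gauss z) \<partial>distr ?P borel ?T) =
   (\<integral>\<^sup>+x. (\<integral>\<^sup>+y. ennreal (gauss (J1 x + J2 y)) \<partial>leb V2) \<partial>leb V1)"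
   by (rule nn) measurable
  also have "\<dots> = (\<integral>\<^sup>+x. (\<integral>\<^sup>+y. ennreal (gauss x) * ennreal (gauss y) \<partial>leb V2) \<partial>leb V1)"
  proof (rule nn_integral_cong_AE, use AE1 in eventually_elim, rule nn_integral_cong_AE, use AE2 in eventually_elim)
   fix x y assume "x \<in> V1" "y \<in> V2"
   then show "ennreal (gauss (J1 x + J2 y)) = ennreal (gauss x) * ennreal (gauss y)"
    by (simp add: gauss_def iso ennreal_mult[symmetric] exp_add[symmetric] add_divide_distrib)
  qed
  also have "\<dots> = (\<integral>\<^sup>+x. ennreal (gauss x) * ennreal (sqrt (2 * pi) ^ dim V2) \<partial>leb V1)"
   by (subst nn_integral_cmult) (auto simp: nn_integral_gauss[OF V2])
  also have "\<dots> = ennreal (sqrt (2 * pi) ^ dim V1) * ennreal (sqrt (2 * pi) ^ dim V2)"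
   by (subst nn_integral_multc) (auto simp: nn_integral_gauss[OF V1])
  finally show ?thesis .
 qed
 \<comment> \<open>The Gaussian mass of \<open>leb V\<close> is a power with exponent dim V, so the
   dimensions have to add up for the masses to agree.\<close>
 have dim: "dim V = dim V1 + dim V2"
 proof -
  have i1: "inj_on J1 (span V1)" "inj_on J2 (span V2)"
   using z1 z2 V1 V2 J1 J2
   by (auto simp: linear_inj_on_iff_eq_0 span_eq_iff[THEN iffD2] linear_injective_on_subspace_0)
    (metis norm_eq_zero)+
  have "J1 ` V1 \<inter> J2 ` V2 \<subseteq> {0}"
  proof
   fix z assume "z \<in> J1 ` V1 \<inter> J2 ` V2"
   then obtain x y where xy: "x \<in> V1" "y \<in> V2" "z = J1 x" "z = J2 y" by auto
   have "(norm (J1 x + J2 (- y)))\<^sup>2 = (norm x)\<^sup>2 + (norm (- y))\<^sup>2"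
    by (intro iso xy subspace_neg[OF V2])
   then have "(norm x)\<^sup>2 + (norm y)\<^sup>2 = 0" using xy by (simp add: linear_neg[OF J2])
   then have "x = 0" by (simp add: sum_power2_eq_zero_iff)
   then show "z \<in> {0}" using xy linear_0[OF J1] by simp
  qed
  then have "dim (J1 ` V1 \<inter> J2 ` V2) = 0" using dim_subset[of "J1 ` V1 \<inter> J2 ` V2" "{0}"] by simp
  then show ?thesis
   using dim_sums_Int[OF linear_subspace_image[OF J1 V1] linear_subspace_image[OF J2 V2]]
    dim_image_eq[OF J1 i1(1)] dim_image_eq[OF J2 i1(2)] unfolding VV by linarith
 qed
 have haar: "haar_on V (distr ?P borel ?T)"
  unfolding haar_on_def
 proof (intro conjI ballI)
  have "AE z in ?P. ?T z \<in> V"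
  proof (rule P.AE_pair_measure)
   show "{x \<in> space ?P. ?T x \<in> V} \<in> sets ?P"
    using measurable_sets[OF Tm borel_subspace[OF sub]] by (simp add: vimage_def Int_def conj_commute)
   show "AE x in leb V1. AE y in leb V2. ?T (x, y) \<in> V"
    using AE1 by eventually_elim (use AE2 in eventually_elim, auto simp: V)
  qed
  then show "AE x in distr ?P borel ?T. x \<in> V"
   using borel_subspace[OF sub] by (subst AE_distr_iff) auto
 next
  fix v and f :: "'a => ennreal" assume "v \<in> V" and f[measurable]: "f \<in> borel_measurable borel"
  then obtain a b where ab: "a \<in> V1" "b \<in> V2" "v = J1 a + J2 b" unfolding V by auto
  have "(\<integral>\<^sup>+x. f (x + v) \<partial>distr ?P borel ?T) =
   (\<integral>\<^sup>+x. (\<integral>\<^sup>+y. f (J1 (x + a) + J2 (y + b)) \<partial>leb V2) \<partial>leb V1)"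
   by (subst nn) (auto simp: ab linear_add[OF J1] linear_add[OF J2] algebra_simps)
  also have "\<dots> = (\<integral>\<^sup>+x. (\<integral>\<^sup>+y. f (J1 (x + a) + J2 y) \<partial>leb V2) \<partial>leb V1)"
   by (subst nn_integral_leb_translate[OF V2 ab(2), where f = "%y. f (J1 (_ + a) + J2 y)"]) auto
  also have "\<dots> = (\<integral>\<^sup>+x. (\<integral>\<^sup>+y. f (J1 x + J2 y) \<partial>leb V2) \<partial>leb V1)"
   by (rule nn_integral_leb_translate[OF V1 ab(1), where f = "%x. (\<integral>\<^sup>+y. f (J1 x + J2 y) \<partial>leb V2)"]) measurable
  also have "\<dots> = (\<integral>\<^sup>+x. f x \<partial>distr ?P borel ?T)" by (subst nn) auto
  finally show "(\<integral>\<^sup>+x. f (x + v) \<partial>distr ?P borel ?T) = (\<integral>\<^sup>+x. f x \<partial>distr ?P borel ?T)" .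
 qed (auto simp: gauss ennreal_mult[symmetric])
 show ?thesis
  by (rule haar_on_unique_eq[OF sub haar_on_leb[OF sub] haar])
   (simp add: gauss nn_integral_gauss[OF sub] dim power_add ennreal_mult)
qed

text \<open>The dilated measure is again Haar, hence a multiple of the original one. The factor is
  left uncomputed, since it drops out wherever the lemma is applied; r \<ge> 1 bounds the dilated
  Gaussian by the Gaussian itself.\<close>

lemma leb_scale:
 assumes V: "subspace V" and r: "r \<ge> 1"
 obtains s :: real where "s > 0"
  "!!f :: 'a::euclidean_space => complex. f \<in> borel_measurable borel ==>
    (LINT x|leb V. f (r *\<^sub>R x)) = of_real s * (LINT x|leb V. f x)"
proof -
 let ?M = "leb V" and ?D = "distr (leb V) borel (%x. r *\<^sub>R x)"
 define c where "c = sqrt (2 * pi) ^ dim V"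
 have c: "c > 0" by (simp add: c_def)
 have le: "(\<integral>\<^sup>+x. ennreal (gauss (r *\<^sub>R x)) \<partial>?M) \<le> ennreal c"
 proof -
  have "gauss (r *\<^sub>R x) \<le> gauss x" for x :: 'a
  proof -
   have "1 * norm x \<le> r * norm x" using r by (intro mult_right_mono) auto
   then have "norm x \<le> norm (r *\<^sub>R x)" using r by simp
   then have "(norm x)\<^sup>2 \<le> (norm (r *\<^sub>R x))\<^sup>2" by (intro power_mono) auto
   then show ?thesis by (simp add: gauss_def)
  qed
  then have "(\<integral>\<^sup>+x. ennreal (gauss (r *\<^sub>R x)) \<partial>?M) \<le> (\<integral>\<^sup>+x. ennreal (gauss x) \<partial>?M)"
   by (intro nn_integral_mono ennreal_leI)
  then show ?thesis by (simp add: nn_integral_gauss[OF V] c_def)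
 qed
 have g: "(\<integral>\<^sup>+x. ennreal (gauss x) \<partial>?D) = (\<integral>\<^sup>+x. ennreal (gauss (r *\<^sub>R x)) \<partial>?M)"
  by (subst nn_integral_distr) auto
 have ne0: "(\<integral>\<^sup>+x. ennreal (gauss (r *\<^sub>R x)) \<partial>?M) \<noteq> 0"
 proof
  assume "(\<integral>\<^sup>+x. ennreal (gauss (r *\<^sub>R x)) \<partial>?M) = 0"
  then have "AE x in ?M. ennreal (gauss (r *\<^sub>R x)) = 0"
   by (subst (asm) nn_integral_0_iff_AE) auto
  then have "AE x in ?M. False" by (rule AE_mp) (use gauss_pos in \<open>auto simp: ennreal_eq_0_iff not_le\<close>)
  then have "AE x in ?M. ennreal (gauss x) = 0" by auto
  then have "(\<integral>\<^sup>+x. ennreal (gauss x) \<partial>?M) = 0" by (subst nn_integral_0_iff_AE) auto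
  then show False using c by (simp add: nn_integral_gauss[OF V] c_def)
 qed
 obtain d where d: "(\<integral>\<^sup>+x. ennreal (gauss (r *\<^sub>R x)) \<partial>?M) = ennreal d" "d > 0"
  using le ne0 by (metis ennreal_cases ennreal_0 ennreal_neq_top less_eq_real_def neq_top_trans)
 have h: "haar_on V ?D"
  unfolding haar_on_def
 proof (intro conjI ballI)
  show "AE x in ?D. x \<in> V"
   using AE_leb[OF V] V borel_subspace[OF V]
   by (subst AE_distr_iff) (auto elim!: eventually_mono intro: subspace_scale)
 next
  fix v and f :: "'a => ennreal" assume v: "v \<in> V" and f[measurable]: "f \<in> borel_measurable borel"
  have "(\<integral>\<^sup>+x. f (x + v) \<partial>?D) = (\<integral>\<^sup>+x. f (r *\<^sub>R (x + (1 / r) *\<^sub>R v)) \<partial>?M)"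
   using r by (subst nn_integral_distr) (auto simp: scaleR_add_right)
  also have "\<dots> = (\<integral>\<^sup>+x. f (r *\<^sub>R x) \<partial>?M)"
   by (rule nn_integral_leb_translate[OF V subspace_scale[OF V v], where f = "%x. f (r *\<^sub>R x)"]) measurable
  also have "\<dots> = (\<integral>\<^sup>+x. f x \<partial>?D)" by (subst nn_integral_distr) auto
  finally show "(\<integral>\<^sup>+x. f (x + v) \<partial>?D) = (\<integral>\<^sup>+x. f x \<partial>?D)" .
 qed (use d ne0 in \<open>auto simp: g\<close>)
 have eq: "?D = density ?M (%_. ennreal (d / c))"
 proof (rule measure_eqI)
  fix A assume "A \<in> sets ?D"
  then have A[measurable]: "A \<in> sets borel" by simp
  have "emeasure ?D A * ennreal c = emeasure ?M A * ennreal d"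
   using haar_on_unique[OF V h haar_on_leb[OF V], of "indicator A"]
   by (simp add: g d nn_integral_gauss[OF V] c_def)
  also have "\<dots> = (ennreal (d / c) * emeasure ?M A) * ennreal c"
  proof -
   have "ennreal d = ennreal (d / c) * ennreal c"
    using c d(2) by (simp add: ennreal_mult[symmetric])
   then show ?thesis by (simp only: mult_ac)
  qed
  finally have "emeasure ?D A = ennreal (d / c) * emeasure ?M A"
   using c by (simp add: mult_right_ennreal_cancel)
  then show "emeasure ?D A = emeasure (density ?M (%_. ennreal (d / c))) A"
   by (subst emeasure_density) (auto simp: nn_integral_cmult_indicator)
 qed simp
 show thesis
 proof (rule that[of "d / c"])
  show "d / c > 0" using c d by simp
  fix f :: "'a => complex" assume f[measurable]: "f \<in> borel_measurable borel"
  have "(LINT x|?M. f (r *\<^sub>R x)) = (LINT x|?D. f x)" by (subst integral_distr) auto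
  also have "\<dots> = (LINT x|?M. (d / c) *\<^sub>R f x)"
   unfolding eq using c d by (subst integral_density) auto
  finally show "(LINT x|?M. f (r *\<^sub>R x)) = of_real (d / c) * (LINT x|?M. f x)"
   by (simp add: scaleR_conv_of_real)
 qed
qed

section \<open>Test functions and their Fourier transforms\<close>

lemma has_dir_deriv_line:
 assumes "has_dir_deriv v f D (x + t *\<^sub>R v)"
 shows "((%r. f (x + r *\<^sub>R v)) has_vector_derivative D) (at t)"
proof -
 have a: "((%r. f (x + t *\<^sub>R v + r *\<^sub>R v)) has_vector_derivative D) (at (t - t))"
  using assms by (simp add: has_dir_deriv_def)
 have b: "((%r. r - t) has_vector_derivative 1) (at t)"
  by (auto intro!: derivative_eq_intros)
 show ?thesis using vector_diff_chain_at[OF b a] by (simp add: o_def algebra_simps)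
qed

section \<open>Test functions and their supports\<close>

definition supp_on :: "'a::euclidean_space set => ('a => complex) => 'a set" where
 "supp_on V f = closure {x \<in> V. f x \<noteq> 0}"

lemma test_function_alt: "test_function V \<phi> \<longleftrightarrow> smooth_on V \<phi> \<and> compact (supp_on V \<phi>)"
 by (simp add: test_function_def supp_on_def)

lemma test_smooth: "test_function V \<phi> ==> smooth_on V \<phi>"
 by (simp add: test_function_def)

lemma test_continuous: "test_function V \<phi> ==> continuous_on V \<phi>"
 by (intro smooth_continuous test_smooth)

lemma compact_supp_on_subset:
 assumes "compact S" "supp_on V f \<subseteq> S"
 shows "compact (supp_on V f)"
proof -
 have "S \<inter> supp_on V f = supp_on V f" using assms(2) by auto
 then show ?thesis using compact_Int_closed[OF assms(1), of "supp_on V f"] by (simp add: supp_on_def)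
qed

lemma test_subset:
 assumes "test_function V \<phi>" "smooth_on V \<psi>" "!!x. x \<in> V ==> \<psi> x \<noteq> 0 ==> x \<in> supp_on V \<phi>"
 shows "test_function V \<psi>" "supp_on V \<psi> \<subseteq> supp_on V \<phi>"
proof -
 show sub: "supp_on V \<psi> \<subseteq> supp_on V \<phi>"
  unfolding supp_on_def[of V \<psi>]
  by (rule closure_minimal) (use assms(3) in \<open>auto simp: supp_on_def\<close>)
 then show "test_function V \<psi>"
  using assms(1,2) compact_supp_on_subset by (auto simp: test_function_alt)
qed

lemma in_supp_on: "x \<in> V ==> \<phi> x \<noteq> 0 ==> x \<in> supp_on V \<phi>"
 unfolding supp_on_def using closure_subset by fastforce

lemma test_mult:
 assumes "subspace V" "test_function V \<phi>" "smooth_on V f"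
 shows "test_function V (%x. f x * \<phi> x)" "supp_on V (%x. f x * \<phi> x) \<subseteq> supp_on V \<phi>"
proof -
 have s: "smooth_on V (%x. f x * \<phi> x)"
  by (rule smooth_mult[OF assms(1,3) test_smooth[OF assms(2)]])
 have m: "x \<in> supp_on V \<phi>" if "x \<in> V" "f x * \<phi> x \<noteq> 0" for x
  using that by (intro in_supp_on) auto
 show "test_function V (%x. f x * \<phi> x)" by (rule test_subset(1)[OF assms(2) s]) (rule m)
 show "supp_on V (%x. f x * \<phi> x) \<subseteq> supp_on V \<phi>" by (rule test_subset(2)[OF assms(2) s]) (rule m)
qed

lemma test_cmult:
 assumes "subspace V" "test_function V \<phi>"
 shows "test_function V (%x. c * \<phi> x)"
 by (rule test_mult(1)[OF assms smooth_const[OF assms(1)]])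

lemma test_add:
 assumes "subspace V" "test_function V \<phi>" "test_function V \<psi>"
 shows "test_function V (%x. \<phi> x + \<psi> x)"
proof -
 have c: "supp_on V (%x. \<phi> x + \<psi> x) \<subseteq> supp_on V \<phi> \<union> supp_on V \<psi>"
  unfolding supp_on_def closure_Un[symmetric] by (intro closure_mono) auto
 have "compact (supp_on V \<phi> \<union> supp_on V \<psi>)" using assms by (auto simp: test_function_alt)
 then have "compact (supp_on V (%x. \<phi> x + \<psi> x))"
  using c compact_supp_on_subset by blast
 then show ?thesis using assms by (auto simp: test_function_alt smooth_add)
qed

lemma test_zero: "subspace V ==> test_function V (%x. 0)"
 by (simp add: test_function_alt smooth_const supp_on_def)

lemma test_sum:
 "subspace V ==> (!!i. i \<in> I ==> test_function V (f i)) ==> test_function V (%x. \<Sum>i\<in>I. f i x)"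
 by (induction I rule: infinite_finite_induct) (auto intro: test_add test_zero)

lemma test_dir_deriv:
 assumes V: "subspace V" and \<phi>: "test_function V \<phi>" and v: "v \<in> V"
 shows "test_function V (dir_deriv v \<phi>)" "supp_on V (dir_deriv v \<phi>) \<subseteq> supp_on V \<phi>"
proof -
 have "x \<in> supp_on V \<phi>" if x: "x \<in> V" and nz: "dir_deriv v \<phi> x \<noteq> 0" for x
 proof (rule ccontr)
  assume n: "x \<notin> supp_on V \<phi>"
  have "\<forall>\<^sub>F t in at 0. x + t *\<^sub>R v \<in> - supp_on V \<phi>"
  proof (rule topological_tendstoD)
   have "((%t. x + t *\<^sub>R v) \<longlongrightarrow> x + 0 *\<^sub>R v) (at 0)" by (intro tendsto_intros)
   then show "((%t. x + t *\<^sub>R v) \<longlongrightarrow> x) (at 0)" by simp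
  qed (use n in \<open>auto simp: supp_on_def\<close>)
  then have "\<forall>\<^sub>F t in at 0. x + t *\<^sub>R v \<notin> supp_on V \<phi>" by simp
  then have "\<forall>\<^sub>F t in at 0. \<phi> (x + t *\<^sub>R v) = 0"
   by eventually_elim (use x v V in \<open>metis in_supp_on subspace_add subspace_scale\<close>)
  moreover have "\<phi> x = 0" using n x in_supp_on by blast
  ultimately have "\<forall>\<^sub>F t in nhds 0. \<phi> (x + t *\<^sub>R v) = 0"
   by (simp add: eventually_nhds_conv_at)
  then have "vector_derivative (%t. \<phi> (x + t *\<^sub>R v)) (at 0) = vector_derivative (%t. 0) (at (0::real))"
   by (intro vector_derivative_cong_eq) auto
  then show False using nz by (simp add: dir_deriv_def)
 qed
 then show "test_function V (dir_deriv v \<phi>)" "supp_on V (dir_deriv v \<phi>) \<subseteq> supp_on V \<phi>"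
  using test_subset[OF \<phi> smooth_dir_deriv[OF test_smooth[OF \<phi>] v]] by blast+
qed

lemma test_decay:
 assumes V: "subspace V" and \<phi>: "test_function V \<phi>"
 obtains C where "C \<ge> 0" "!!x. x \<in> V ==> norm (\<phi> x) * (jap x) ^ m \<le> C"
proof -
 let ?f = "%x. norm (\<phi> x) * (jap x) ^ m"
 let ?S = "supp_on V \<phi>"
 have sub: "?S \<subseteq> V" unfolding supp_on_def
  by (rule closure_minimal[OF _ closed_subspace[OF V]]) auto
 have "compact (?f ` ?S)"
  by (intro compact_continuous_image continuous_intros continuous_on_subset[OF test_continuous[OF \<phi>] sub])
   (use \<phi> in \<open>auto simp: test_function_alt\<close>)
 then obtain C where C: "!!y. y \<in> ?f ` ?S ==> norm y \<le> C"
  using compact_imp_bounded bounded_iff by metis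
 show thesis
 proof (rule that[of "max C 0"])
  fix x assume "x \<in> V"
  then show "?f x \<le> max C 0"
   using C[of "?f x"] in_supp_on[of x V \<phi>] by (cases "\<phi> x = 0") auto
 qed simp
qed

section \<open>The Fourier transform of test functions\<close>

definition FT :: "'a::euclidean_space set => ('a => complex) => 'a => complex" where
 "FT V \<phi> x = (LINT l:V|leb V. \<phi> l * exp (- (\<i> * cplx (l \<bullet> x))))"

definition total_weight :: "'a::euclidean_space set => real" where
 "total_weight V = (LINT x|leb V. inverse ((jap x) ^ DIM('a)))"

lemma total_weight_nonneg: "total_weight V \<ge> 0"
 unfolding total_weight_def by (intro integral_nonneg_AE AE_I2) auto

lemma set_integrable_decay:
 fixes f :: "'a::euclidean_space => complex"
 assumes V: "subspace V" and f: "continuous_on V f"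
  and bound: "!!x. x \<in> V ==> norm (f x) * (jap x) ^ DIM('a) \<le> C"
 shows "set_integrable (leb V) V f"
  and "norm (LINT x:V|leb V. f x) \<le> C * total_weight V"
proof -
 let ?w = "%x::'a. inverse ((jap x) ^ DIM('a))"
 have C: "C \<ge> 0" using bound[OF subspace_0[OF V]] by (simp add: order_trans[OF norm_ge_zero])
 have le: "norm (indicator V x *\<^sub>R f x) \<le> C * ?w x" for x
 proof (cases "x \<in> V")
  case True
  have "(jap x) ^ DIM('a) > 0" by (intro zero_less_power) (auto intro: add_pos_nonneg)
  then show ?thesis using bound[OF True] True by (simp add: field_simps)
 qed (use C in auto)
 have i: "integrable (leb V) (%x. C * ?w x)"
  using integrable_inverse_power_norm[OF V] by simp
 have m: "(%x. indicator V x *\<^sub>R f x) \<in> borel_measurable (leb V)"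
  using measurable_on_subspace[OF V f] by simp
 have C': "0 \<le> C * ?w x" for x using C by simp
 show int: "set_integrable (leb V) V f"
  unfolding set_integrable_def
  by (rule integrable_le[OF i m]) (use le C' in \<open>auto simp: abs_of_nonneg intro!: AE_I2\<close>)
 have "norm (LINT x:V|leb V. f x) \<le> (LINT x|leb V. norm (indicator V x *\<^sub>R f x))"
  unfolding set_integral_def by (rule integral_norm_bound)
 also have "\<dots> \<le> (LINT x|leb V. C * ?w x)"
  using int le by (intro Bochner_Integration.integral_mono i integrable_norm) (auto simp: set_integrable_def)
 finally have "norm (LINT x:V|leb V. f x) \<le> (LINT x|leb V. C * ?w x)" .
 then show "norm (LINT x:V|leb V. f x) \<le> C * total_weight V"
  by (simp add: total_weight_def)
qed

lemma continuous_on_fourier_kernel: "continuous_on S (%l. exp (- (\<i> * cplx (l \<bullet> x))))"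
 by (intro continuous_intros)

lemma FT_integrable:
 fixes \<phi> :: "'a::euclidean_space => complex"
 assumes V: "subspace V" and \<phi>: "test_function V \<phi>"
 shows "set_integrable (leb V) V (%l. \<phi> l * exp (- (\<i> * cplx (l \<bullet> x))))"
proof -
 obtain C where "C \<ge> 0" "!!x. x \<in> V ==> norm (\<phi> x) * (jap x) ^ DIM('a) \<le> C"
  using test_decay[OF V \<phi>] by metis
 then show ?thesis
  by (intro set_integrable_decay(1)[OF V, of _ C] continuous_on_mult test_continuous[OF \<phi>]
   continuous_on_fourier_kernel) (auto simp: norm_mult)
qed

lemma FT_bound:
 fixes \<phi> :: "'a::euclidean_space => complex"
 assumes V: "subspace V" and \<phi>: "continuous_on V \<phi>"
  and "!!x. x \<in> V ==> norm (\<phi> x) * (jap x) ^ DIM('a) \<le> C"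
 shows "norm (FT V \<phi> x) \<le> C * total_weight V"
 unfolding FT_def using assms
 by (intro set_integrable_decay(2)[OF V, of _ C] continuous_on_mult continuous_on_fourier_kernel)
  (auto simp: norm_mult)

lemma FT_add:
 assumes "subspace V" "test_function V \<phi>" "test_function V \<psi>"
 shows "FT V (%l. \<phi> l + \<psi> l) x = FT V \<phi> x + FT V \<psi> x"
 unfolding FT_def using FT_integrable[OF assms(1,2), of x] FT_integrable[OF assms(1,3), of x]
 by (simp add: distrib_right set_integral_add)

lemma FT_cmult: "FT V (%l. c * \<phi> l) x = c * FT V \<phi> x"
 unfolding FT_def by (simp add: mult.assoc)

lemma FT_sum:
 assumes "subspace V" "!!i. i \<in> I ==> test_function V (f i)"
 shows "FT V (%l. \<Sum>i\<in>I. f i l) x = (\<Sum>i\<in>I. FT V (f i) x)"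
 using assms(2)
proof (induction I rule: infinite_finite_induct)
 case (insert i I)
 then show ?case using assms(1) by (simp add: FT_add test_sum)
qed (auto simp: FT_def set_integral_def)

lemma isCont_FT:
 fixes \<phi> :: "'a::euclidean_space => complex"
 assumes V: "subspace V" and \<phi>: "test_function V \<phi>"
 shows "continuous_on UNIV (FT V \<phi>)"
 unfolding continuous_on_sequentially
proof (intro ballI allI impI)
 fix x :: "nat => 'a" and a assume "(\<forall>n. x n \<in> UNIV) \<and> x \<longlonglongrightarrow> a"
 then have x: "x \<longlonglongrightarrow> a" by simp
 have i: "integrable (leb V) (%l. norm (indicator V l *\<^sub>R \<phi> l))"
  by (rule integrable_norm) (use FT_integrable[OF V \<phi>, of 0] in \<open>simp add: set_integrable_def\<close>)
 have m: "(%l. indicator V l *\<^sub>R \<phi> l) \<in> borel_measurable borel"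
  by (rule measurable_on_subspace[OF V test_continuous[OF \<phi>]])
 have e: "indicator V l *\<^sub>R (\<phi> l * exp (- (\<i> * cplx (l \<bullet> y)))) =
   indicator V l *\<^sub>R \<phi> l * exp (- (\<i> * cplx (l \<bullet> y)))" for l y by simp
 show "(FT V \<phi> \<circ> x) \<longlonglongrightarrow> FT V \<phi> a"
  unfolding FT_def set_integral_def o_def e
 proof (rule integral_dominated_convergence[OF _ _ i])
  show "AE l in leb V. (%n. indicator V l *\<^sub>R \<phi> l * exp (- (\<i> * cplx (l \<bullet> x n))))
    \<longlonglongrightarrow> indicator V l *\<^sub>R \<phi> l * exp (- (\<i> * cplx (l \<bullet> a)))"
   by (intro AE_I2 tendsto_intros x)
 next
  have e: "(%l. exp (- (\<i> * cplx (l \<bullet> y)))) \<in> borel_measurable borel" for y :: 'a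
   by (intro borel_measurable_continuous_onI continuous_on_fourier_kernel)
  show "(%l. indicator V l *\<^sub>R \<phi> l * exp (- (\<i> * cplx (l \<bullet> a)))) \<in> borel_measurable (leb V)"
   using borel_measurable_times[OF m e] by simp
  show "(%l. indicator V l *\<^sub>R \<phi> l * exp (- (\<i> * cplx (l \<bullet> x n)))) \<in> borel_measurable (leb V)" for n
   using borel_measurable_times[OF m e] by simp
 qed (auto simp: norm_mult intro!: AE_I2)
qed

lemma LINT_subspace_translate:
 fixes f :: "'a::euclidean_space => complex"
 assumes V: "subspace V" and v: "v \<in> V" and f: "continuous_on V f"
 shows "(LINT x:V|leb V. f (x + v)) = (LINT x:V|leb V. f x)"
proof -
 let ?g = "%x. indicator V x *\<^sub>R f x"
 have m: "?g \<in> borel_measurable borel"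
  by (rule measurable_on_subspace[OF V f])
 have "x + v \<in> V \<longleftrightarrow> x \<in> V" for x
  using subspace_add[OF V _ v] subspace_diff[OF V _ v, of "x + v"] by auto
 then have e: "indicator V x *\<^sub>R f (x + v) = ?g (x + v)" for x by (simp add: indicator_def)
 have "(LINT x:V|leb V. f (x + v)) = (LINT x|leb V. ?g (x + v))"
  by (simp only: set_integral_def e)
 also have "\<dots> = (LINT x|distr (leb V) borel (%x. x + v). ?g x)"
  by (subst integral_distr) (use m in auto)
 finally show ?thesis by (simp add: leb_translate[OF V v] set_integral_def)
qed

lemma has_vector_derivative_quotient:
 fixes g :: "real => 'a::real_normed_vector"
 assumes "(g has_vector_derivative D) (at 0)"
 shows "((%t. (1 / t) *\<^sub>R (g t - g 0)) \<longlongrightarrow> D) (at 0)"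
proof -
 have "((%h. norm (g h - g 0 - h *\<^sub>R D) / norm h) \<longlongrightarrow> 0) (at 0)"
  using assms by (simp add: has_vector_derivative_def has_derivative_at)
 moreover have "\<forall>\<^sub>F h in at 0. norm (g h - g 0 - h *\<^sub>R D) / norm h = norm ((1 / h) *\<^sub>R (g h - g 0) - D)"
 proof -
  have "norm (g h - g 0 - h *\<^sub>R D) / norm h = norm ((1 / h) *\<^sub>R (g h - g 0) - D)" if "h \<noteq> 0" for h
  proof -
   have "(1 / h) *\<^sub>R (g h - g 0) - D = (1 / h) *\<^sub>R (g h - g 0 - h *\<^sub>R D)"
    using that by (simp add: scaleR_diff_right)
   then show ?thesis by (simp add: divide_inverse mult.commute)
  qed
  then show ?thesis by (simp add: eventually_at_filter)
 qed
 ultimately have "((%h. norm ((1 / h) *\<^sub>R (g h - g 0) - D)) \<longlongrightarrow> 0) (at 0)"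
  by (rule Lim_transform_eventually)
 then have "((%h. (1 / h) *\<^sub>R (g h - g 0) - D) \<longlongrightarrow> 0) (at 0)" by (rule tendsto_norm_zero_cancel)
 then show ?thesis by (simp add: Lim_null[symmetric])
qed

text \<open>By translation invariance the difference quotients of \<open>\<phi>\<close> have
  integral 0; they converge to the derivative under a common integrable majorant.\<close>

lemma integral_dir_deriv_test:
 assumes V: "subspace V" and \<phi>: "test_function V \<phi>" and v: "v \<in> V"
 shows "(LINT x:V|leb V. dir_deriv v \<phi> x) = 0"
proof -
 let ?M = "leb V"
 let ?d = "dir_deriv v \<phi>"
 let ?h = "%n::nat. 1 / real (Suc n)"
 let ?q = "%n x. indicator V x *\<^sub>R (of_real (real (Suc n)) * (\<phi> (x + ?h n *\<^sub>R v) - \<phi> x))"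
 obtain R where R: "!!x. x \<in> supp_on V \<phi> ==> norm x \<le> R"
  using \<phi> compact_imp_bounded bounded_iff unfolding test_function_alt by metis
 obtain B where B: "B \<ge> 0" "!!x. x \<in> V ==> norm (?d x) * (jap x) ^ 0 \<le> B"
  using test_decay[OF V test_dir_deriv(1)[OF V \<phi> v]] by metis
 \<comment> \<open>The steps are at most 1 in size, so every quotient vanishes outside the ball of
   radius R + |v|; on that ball W times the integrable weight is at least 1.\<close>
 define W where "W = (1 + (R + norm v)\<^sup>2) ^ DIM('a)"
 have inV: "x + t *\<^sub>R v \<in> V" if "x \<in> V" for x t using that v V by (simp add: subspace_add subspace_scale)
 have diff: "norm (\<phi> (x + t *\<^sub>R v) - \<phi> x) \<le> B * t" if x: "x \<in> V" and t: "t \<ge> 0" for x t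
 proof -
  have "norm (\<phi> (x + t *\<^sub>R v) - \<phi> (x + 0 *\<^sub>R v)) \<le> B * norm (t - 0)"
  proof (rule differentiable_bound[where f = "%r. \<phi> (x + r *\<^sub>R v)" and S = UNIV and f' = "%r h. h *\<^sub>R ?d (x + r *\<^sub>R v)"])
   fix r :: real
   show "((%r. \<phi> (x + r *\<^sub>R v)) has_derivative (%h. h *\<^sub>R ?d (x + r *\<^sub>R v))) (at r)"
    using has_dir_deriv_line[OF smooth_has_dir_deriv[OF test_smooth[OF \<phi>] v inV[OF x, of r]]]
    by (simp add: has_vector_derivative_def)
   show "onorm (%h. h *\<^sub>R ?d (x + r *\<^sub>R v)) \<le> B"
    using mult_right_mono[OF B(2)[OF inV[OF x, of r]], of "\<bar>h\<bar>" for h]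
    by (intro onorm_bound[OF B(1)]) (simp add: mult.commute)
  qed auto
  then show ?thesis using t by simp
 qed
 have bound: "norm (?q n x) \<le> B * W * inverse ((jap x) ^ DIM('a))" for n x
 proof (cases "x \<in> V \<and> ?q n x \<noteq> 0")
  case True
  then have x: "x \<in> V" and nz: "\<phi> (x + ?h n *\<^sub>R v) \<noteq> 0 \<or> \<phi> x \<noteq> 0" by auto
  have "norm x \<le> R + norm v"
  proof (cases "\<phi> x = 0")
   case True
   then have "norm (x + ?h n *\<^sub>R v) \<le> R" using nz inV[OF x] by (intro R in_supp_on) auto
   moreover have "norm x \<le> norm (x + ?h n *\<^sub>R v) + norm (?h n *\<^sub>R v)"
    by (metis norm_minus_commute add_diff_cancel_right' norm_triangle_sub add.commute norm_triangle_ineq4)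
   moreover have "norm (?h n *\<^sub>R v) \<le> 1 * norm v"
    unfolding norm_scaleR by (intro mult_right_mono) auto
   ultimately show ?thesis by linarith
  next
   case False
   then show ?thesis using R[OF in_supp_on[of x V \<phi>]] x by (simp add: add_increasing2)
  qed
  then have "(jap x) ^ DIM('a) \<le> W"
   unfolding W_def by (intro power_mono add_left_mono) auto
  moreover have p: "(jap x) ^ DIM('a) > 0" by (intro zero_less_power) (auto intro: add_pos_nonneg)
  ultimately have "1 \<le> W * inverse ((jap x) ^ DIM('a))"
   by (simp add: field_simps)
  then have "B * 1 \<le> B * (W * inverse ((jap x) ^ DIM('a)))"
   by (intro mult_left_mono B)
  moreover have "norm (?q n x) \<le> B"
  proof -
   have "norm (?q n x) = real (Suc n) * norm (\<phi> (x + ?h n *\<^sub>R v) - \<phi> x)"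
    using x by (simp add: norm_mult del: of_nat_Suc)
   also have "\<dots> \<le> real (Suc n) * (B * ?h n)" by (intro mult_left_mono diff x) auto
   finally show ?thesis by simp
  qed
  ultimately show ?thesis by (simp add: mult.assoc)
 next
  case False
  have "W \<ge> 0" by (simp add: W_def)
  then show ?thesis using False B by auto
 qed
 have q0: "(LINT x|?M. ?q n x) = 0" for n
 proof -
  have c: "continuous_on V \<phi>" by (rule test_continuous[OF \<phi>])
  have c': "continuous_on V (%x. \<phi> (x + ?h n *\<^sub>R v))"
   by (rule continuous_on_compose2[OF c]) (auto intro!: continuous_intros inV)
  have i: "set_integrable ?M V \<phi>" using FT_integrable[OF V \<phi>, of 0] by simp
  have hv: "?h n *\<^sub>R v \<in> V" by (rule subspace_scale[OF V v])
  have i': "set_integrable ?M V (%x. \<phi> (x + ?h n *\<^sub>R v))"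
  proof -
   have "test_function V (%x. \<phi> (x + ?h n *\<^sub>R v))"
    unfolding test_function_alt
   proof
    show "smooth_on V (%x. \<phi> (x + ?h n *\<^sub>R v))"
     using smooth_compose_affine[OF V V linear_id _ hv test_smooth[OF \<phi>]] by simp
    have "supp_on V (%x. \<phi> (x + ?h n *\<^sub>R v)) \<subseteq> cball 0 (R + norm v)"
     unfolding supp_on_def
    proof (rule closure_minimal)
     show "{x \<in> V. \<phi> (x + ?h n *\<^sub>R v) \<noteq> 0} \<subseteq> cball 0 (R + norm v)"
     proof safe
      fix x assume x: "x \<in> V" "\<phi> (x + ?h n *\<^sub>R v) \<noteq> 0"
      have "norm (x + ?h n *\<^sub>R v) \<le> R" using x inV[OF x(1)] by (intro R in_supp_on) auto
      moreover have "norm x \<le> norm (x + ?h n *\<^sub>R v) + norm (?h n *\<^sub>R v)"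
       using norm_triangle_ineq4[of "x + ?h n *\<^sub>R v" "?h n *\<^sub>R v"] by simp
      moreover have "norm (?h n *\<^sub>R v) \<le> 1 * norm v"
       unfolding norm_scaleR by (intro mult_right_mono) auto
      ultimately show "x \<in> cball 0 (R + norm v)" by simp
     qed
    qed simp
    then show "compact (supp_on V (%x. \<phi> (x + ?h n *\<^sub>R v)))"
     by (rule compact_supp_on_subset[OF compact_cball])
   qed
   from FT_integrable[OF V this, of 0] show ?thesis by simp
  qed
  have "(LINT x|?M. ?q n x) = of_real (real (Suc n)) * (LINT x:V|?M. \<phi> (x + ?h n *\<^sub>R v) - \<phi> x)"
   unfolding set_integral_def by (subst integral_mult_right_zero[symmetric]) (simp del: of_nat_Suc)
  also have "(LINT x:V|?M. \<phi> (x + ?h n *\<^sub>R v) - \<phi> x) = 0"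
   unfolding set_integral_diff(2)[OF i' i] LINT_subspace_translate[OF V hv c] by simp
  finally show ?thesis by simp
 qed
 have "(%n. LINT x|?M. ?q n x) \<longlonglongrightarrow> (LINT x|?M. indicator V x *\<^sub>R ?d x)"
 proof (rule integral_dominated_convergence[where w = "%x. B * W * inverse ((jap x) ^ DIM('a))"])
  have c: "continuous_on V \<phi>" by (rule test_continuous[OF \<phi>])
  show "(%x. indicator V x *\<^sub>R ?d x) \<in> borel_measurable ?M"
   using measurable_on_subspace[OF V
     smooth_continuous[OF smooth_dir_deriv[OF test_smooth[OF \<phi>] v]]] by simp
  show "?q n \<in> borel_measurable ?M" for n
  proof -
   have "continuous_on V (%x. \<phi> (x + ?h n *\<^sub>R v))"
    by (rule continuous_on_compose2[OF c]) (auto intro!: continuous_intros inV)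
   then have "continuous_on V (%x. of_real (real (Suc n)) * (\<phi> (x + ?h n *\<^sub>R v) - \<phi> x))"
    by (intro continuous_intros c)
   from measurable_on_subspace[OF V this]
   show ?thesis by simp
  qed
  show "integrable ?M (%x. B * W * inverse ((jap x) ^ DIM('a)))"
   using integrable_inverse_power_norm[OF V] by simp
  show "AE x in ?M. norm (?q n x) \<le> B * W * inverse ((jap x) ^ DIM('a))" for n
   using bound by (intro AE_I2)
  show "AE x in ?M. (%n. ?q n x) \<longlonglongrightarrow> indicator V x *\<^sub>R ?d x"
  proof (rule AE_I2)
   fix x
   show "(%n. ?q n x) \<longlonglongrightarrow> indicator V x *\<^sub>R ?d x"
   proof (cases "x \<in> V")
    case True
    have "((%t. \<phi> (x + t *\<^sub>R v)) has_vector_derivative ?d x) (at 0)"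
     using smooth_has_dir_deriv[OF test_smooth[OF \<phi>] v True] by (simp add: has_dir_deriv_def)
    from has_vector_derivative_quotient[OF this]
    have "((%t. (1 / t) *\<^sub>R (\<phi> (x + t *\<^sub>R v) - \<phi> x)) \<longlongrightarrow> ?d x) (at 0)" by simp
    moreover have "filterlim ?h (at 0) sequentially"
     unfolding filterlim_at using LIMSEQ_inverse_real_of_nat by (auto simp: inverse_eq_divide)
    ultimately have "(%n. (1 / ?h n) *\<^sub>R (\<phi> (x + ?h n *\<^sub>R v) - \<phi> x)) \<longlonglongrightarrow> ?d x"
     by (rule filterlim_compose)
    then show ?thesis using True by (simp add: scaleR_conv_of_real del: of_nat_Suc)
   qed simp
  qed
 qed
 then have "(%n. 0) \<longlonglongrightarrow> (LINT x|?M. indicator V x *\<^sub>R ?d x)" by (simp only: q0)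
 then have "(LINT x|?M. indicator V x *\<^sub>R ?d x) = 0" by (simp only: LIMSEQ_const_iff)
 then show ?thesis by (simp add: set_integral_def)
qed

lemma smooth_cexp: "smooth_on UNIV (%s::real. c * exp (a * cplx s))"
proof (rule smooth_real_if_closed[where S = "range (%c s. c * exp (a * cplx s))"])
 fix f assume "f \<in> range (%c (s::real). c * exp (a * cplx s))"
 then obtain c where f: "f = (%s. c * exp (a * cplx s))" by auto
 have "(f has_vector_derivative (c * a) * exp (a * cplx x)) (at x)" for x
  unfolding f by (rule has_vector_derivative_real_field) (auto intro!: derivative_eq_intros)
 then show "\<exists>f'\<in>range (%c (s::real). c * exp (a * cplx s)). \<forall>x. (f has_vector_derivative f' x) (at x)"
  by (intro bexI[of _ "%x. (c * a) * exp (a * cplx x)"]) auto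
qed auto

lemma linear_inner_left: "linear (%l. l \<bullet> x)"
 by (simp add: linear_iff inner_add_left)

lemma smooth_ridge:
 assumes "subspace V" "smooth_on UNIV \<theta>"
 shows "smooth_on V (%l. \<theta> (l \<bullet> x))"
 by (rule smooth_compose_linear[OF assms(1) subspace_UNIV linear_inner_left _ assms(2)]) simp

lemma smooth_character: "subspace V ==> smooth_on V (%l. exp (a * cplx (l \<bullet> x)))"
 using smooth_ridge[OF _ smooth_cexp[of 1 a]] by simp

lemma has_dir_deriv_ridge:
 assumes "(\<theta> has_vector_derivative D) (at (l \<bullet> x))"
 shows "has_dir_deriv v (%l. \<theta> (l \<bullet> x)) (of_real (v \<bullet> x) * D) l"
proof -
 have a: "((%t. l \<bullet> x + t * (v \<bullet> x)) has_vector_derivative (v \<bullet> x)) (at 0)"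
  by (auto intro!: derivative_eq_intros)
 have "(\<theta> has_vector_derivative D) (at (l \<bullet> x + 0 * (v \<bullet> x)))" using assms by simp
 from vector_diff_chain_at[OF a this] show ?thesis
  by (simp add: has_dir_deriv_def o_def scaleR_conv_of_real inner_add_left)
qed

lemma dir_deriv_character:
 "has_dir_deriv v (%l. exp (a * cplx (l \<bullet> x))) (of_real (v \<bullet> x) * (a * exp (a * cplx (l \<bullet> x)))) l"
 by (intro has_dir_deriv_ridge has_vector_derivative_real_field) (auto intro!: derivative_eq_intros)

text \<open>Integration by parts: the product of \<open>\<phi>\<close> with a character is a test
  function, so its derivative has integral 0.\<close>

lemma FT_dir_deriv:
 assumes V: "subspace V" and \<phi>: "test_function V \<phi>" and v: "v \<in> V"
 shows "FT V (dir_deriv v \<phi>) x = \<i> * of_real (v \<bullet> x) * FT V \<phi> x"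
proof -
 let ?e = "%l. exp (- \<i> * cplx (l \<bullet> x))"
 let ?M = "leb V"
 have t: "test_function V (%l. ?e l * \<phi> l)" by (rule test_mult(1)[OF V \<phi> smooth_character[OF V]])
 have "has_dir_deriv v (%l. ?e l * \<phi> l) (of_real (v \<bullet> x) * (- \<i> * ?e l) * \<phi> l + ?e l * dir_deriv v \<phi> l) l" if "l \<in> V" for l
  by (intro has_dir_deriv_mult dir_deriv_character smooth_has_dir_deriv[OF test_smooth[OF \<phi>] v that])
 then have d: "dir_deriv v (%l. ?e l * \<phi> l) l = (- \<i> * of_real (v \<bullet> x)) * (\<phi> l * ?e l) + dir_deriv v \<phi> l * ?e l" if "l \<in> V" for l
  using has_dir_deriv_eq that by (fastforce simp: algebra_simps)
 have i1: "set_integrable ?M V (%l. (- \<i> * of_real (v \<bullet> x)) * (\<phi> l * ?e l))"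
  using FT_integrable[OF V \<phi>, of x] by (intro set_integrable_mult_right) simp
 have i2: "set_integrable ?M V (%l. dir_deriv v \<phi> l * ?e l)"
  using FT_integrable[OF V test_dir_deriv(1)[OF V \<phi> v], of x] by simp
 have "0 = (LINT l:V|?M. dir_deriv v (%l. ?e l * \<phi> l) l)"
  by (rule integral_dir_deriv_test[OF V t v, symmetric])
 also have "\<dots> = (LINT l:V|?M. (- \<i> * of_real (v \<bullet> x)) * (\<phi> l * ?e l) + dir_deriv v \<phi> l * ?e l)"
  unfolding set_integral_def
  by (intro integral_congI refl) (use d in \<open>auto simp: indicator_def\<close>)
 also have "\<dots> = (- \<i> * of_real (v \<bullet> x)) * FT V \<phi> x + FT V (dir_deriv v \<phi>) x"
  unfolding set_integral_add(2)[OF i1 i2] FT_def set_integral_mult_right by simp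
 finally show ?thesis by (simp add: algebra_simps)
qed

text \<open>The operator 1 - Laplacian of V, whose transform is multiplication by
  \<open>jap\<close>; its powers trade derivatives of \<open>\<phi>\<close> for decay of the
  transform.\<close>

definition helmholtz :: "'a::euclidean_space set => ('a => complex) => 'a => complex" where
 "helmholtz V \<phi> x = \<phi> x + (\<Sum>b\<in>onb V. - 1 * dir_deriv b (dir_deriv b \<phi>) x)"

lemma test_helmholtz:
 assumes "subspace V" "test_function V \<phi>"
 shows "test_function V (helmholtz V \<phi>)"
 unfolding helmholtz_def using assms onb(1)[OF assms(1)]
 by (intro test_add test_sum test_cmult test_dir_deriv) auto

lemma test_helmholtz_funpow:
 "subspace V ==> test_function V \<phi> ==> test_function V ((helmholtz V ^^ m) \<phi>)"
 by (induction m) (auto intro: test_helmholtz)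

lemma FT_helmholtz:
 assumes V: "subspace V" and \<phi>: "test_function V \<phi>" and x: "x \<in> V"
 shows "FT V (helmholtz V \<phi>) x = of_real (jap x) * FT V \<phi> x"
proof -
 let ?B = "onb V"
 have B: "b \<in> V" if "b \<in> ?B" for b using that onb(1)[OF V] by auto
 note t = test_dir_deriv(1)[OF V]
 have "FT V (helmholtz V \<phi>) x = FT V \<phi> x + (\<Sum>b\<in>?B. FT V (%x. - 1 * dir_deriv b (dir_deriv b \<phi>) x) x)"
 proof -
  have s: "test_function V (%x. - 1 * dir_deriv b (dir_deriv b \<phi>) x)" if "b \<in> ?B" for b
   by (intro test_cmult V t \<phi> B that)
  have "FT V (helmholtz V \<phi>) x = FT V \<phi> x + FT V (%x. \<Sum>b\<in>?B. - 1 * dir_deriv b (dir_deriv b \<phi>) x) x"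
   unfolding helmholtz_def[abs_def] by (intro FT_add V \<phi> test_sum s)
  then show ?thesis by (subst (asm) FT_sum[OF V]) (use s in auto)
 qed
 also have "\<dots> = FT V \<phi> x + (\<Sum>b\<in>?B. of_real ((x \<bullet> b)\<^sup>2) * FT V \<phi> x)"
 proof -
  have "FT V (%x. - 1 * dir_deriv b (dir_deriv b \<phi>) x) x = of_real ((x \<bullet> b)\<^sup>2) * FT V \<phi> x" if "b \<in> ?B" for b
   unfolding FT_cmult FT_dir_deriv[OF V t[OF \<phi> B[OF that]] B[OF that]] FT_dir_deriv[OF V \<phi> B[OF that]]
   by (simp add: power2_eq_square inner_commute algebra_simps)
  then show ?thesis by simp
 qed
 also have "\<dots> = of_real (jap x) * FT V \<phi> x"
  by (simp add: onb_norm2[OF V x] algebra_simps sum_distrib_left)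
 finally show ?thesis .
qed

lemma FT_helmholtz_funpow:
 assumes "subspace V" "test_function V \<phi>" "x \<in> V"
 shows "FT V ((helmholtz V ^^ m) \<phi>) x = of_real ((jap x) ^ m) * FT V \<phi> x"
 using assms by (induction m) (auto simp: FT_helmholtz test_helmholtz_funpow mult.assoc)

text \<open>The constant is kept explicit, because the estimate is later applied to a family of test
  functions for which \<open>C\<close> tends to 0.\<close>

lemma FT_decay_bound:
 fixes \<phi> :: "'a::euclidean_space => complex"
 assumes V: "subspace V" and \<phi>: "test_function V \<phi>" and x: "x \<in> V"
  and C: "!!x. x \<in> V ==> norm ((helmholtz V ^^ m) \<phi> x) * (jap x) ^ DIM('a) \<le> C"
 shows "norm (FT V \<phi> x) * (jap x) ^ m \<le> C * total_weight V"
proof -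
 have "norm (FT V ((helmholtz V ^^ m) \<phi>) x) \<le> C * total_weight V"
  by (intro FT_bound[OF V] C test_continuous test_helmholtz_funpow V \<phi>)
 then show ?thesis
  by (simp add: FT_helmholtz_funpow[OF V \<phi> x] norm_mult norm_power mult.commute del: of_real_add of_real_power)
qed

lemma FT_decay:
 fixes \<phi> :: "'a::euclidean_space => complex"
 assumes V: "subspace V" and \<phi>: "test_function V \<phi>"
 obtains C where "C \<ge> 0" "!!x. x \<in> V ==> norm (FT V \<phi> x) * (jap x) ^ m \<le> C"
proof -
 obtain C where "C \<ge> 0" "!!x. x \<in> V ==> norm ((helmholtz V ^^ m) \<phi> x) * (jap x) ^ DIM('a) \<le> C"
  using test_decay[OF V test_helmholtz_funpow[OF V \<phi>]] by metis
 then have "norm (FT V \<phi> x) * (jap x) ^ m \<le> C * total_weight V" if "x \<in> V" for x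
  using FT_decay_bound[OF V \<phi> that] by blast
 moreover have "C * total_weight V \<ge> 0" using \<open>C \<ge> 0\<close> total_weight_nonneg by (intro mult_nonneg_nonneg)
 ultimately show thesis using that by blast
qed

section \<open>Spectra of tempered functions\<close>

lemma FT_translate: "FT V (%l. exp (\<i> * cplx (l \<bullet> a)) * \<phi> l) x = FT V \<phi> (x - a)"
proof -
 have "exp (\<i> * cplx (l \<bullet> a)) * \<phi> l * exp (- (\<i> * cplx (l \<bullet> x))) =
   \<phi> l * exp (- (\<i> * cplx (l \<bullet> (x - a))))" for l
  by (simp add: inner_diff_right algebra_simps exp_diff exp_minus divide_inverse)
 then show ?thesis unfolding FT_def by presburger
qed

section \<open>Tempered functions as distributions\<close>

definition tempered_on :: "'a::euclidean_space set => ('a => complex) => bool" where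
 "tempered_on V u \<longleftrightarrow> continuous_on V u \<and> (\<exists>C k. \<forall>x\<in>V. norm (u x) \<le> C * (jap x) ^ k)"

text \<open>Of the k + \<open>DIM('a)\<close> powers of \<open>helmholtz\<close>, k pay for the
  growth of \<open>u\<close> and the others for integrability. The bound depends on
  \<open>\<phi>\<close> only through one supremum, as the cut-off argument requires.\<close>

lemma pairing:
 fixes u :: "'a::euclidean_space => complex"
 assumes V: "subspace V" and \<phi>: "test_function V \<phi>" and u: "continuous_on V u"
  and uA: "!!x. x \<in> V ==> norm (u x) \<le> A * (jap x) ^ k" and A: "A \<ge> 0"
 shows pairing_integrable: "set_integrable (leb V) V (%x. u x * FT V \<phi> x)"
  and pairing_bound: "!!C. (!!x. x \<in> V ==> norm ((helmholtz V ^^ (k + DIM('a))) \<phi> x) * (jap x) ^ DIM('a) \<le> C) ==>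
    norm (LINT x:V|leb V. u x * FT V \<phi> x) \<le> A * (C * total_weight V) * total_weight V"
proof -
 have c: "continuous_on V (%x. u x * FT V \<phi> x)"
  by (intro continuous_on_mult u continuous_on_subset[OF isCont_FT[OF V \<phi>]]) auto
 have b: "norm (u x * FT V \<phi> x) * (jap x) ^ DIM('a) \<le> A * D"
  if x: "x \<in> V" and D: "norm (FT V \<phi> x) * (jap x) ^ (k + DIM('a)) \<le> D" for x D
 proof -
  have "norm (u x * FT V \<phi> x) * (jap x) ^ DIM('a) \<le>
    A * (jap x) ^ k * norm (FT V \<phi> x) * (jap x) ^ DIM('a)"
   unfolding norm_mult by (intro mult_right_mono uA x) auto
  also have "\<dots> = A * (norm (FT V \<phi> x) * (jap x) ^ (k + DIM('a)))"
   by (simp add: power_add)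
  also have "\<dots> \<le> A * D" by (intro mult_left_mono D A)
  finally show ?thesis .
 qed
 obtain D where "!!x. x \<in> V ==> norm (FT V \<phi> x) * (jap x) ^ (k + DIM('a)) \<le> D"
  using FT_decay[OF V \<phi>] by metis
 then show "set_integrable (leb V) V (%x. u x * FT V \<phi> x)"
  using b by (intro set_integrable_decay(1)[OF V c]) blast
 fix C assume "!!x. x \<in> V ==> norm ((helmholtz V ^^ (k + DIM('a))) \<phi> x) * (jap x) ^ DIM('a) \<le> C"
 then have "norm (FT V \<phi> x) * (jap x) ^ (k + DIM('a)) \<le> C * total_weight V" if "x \<in> V" for x
  by (intro FT_decay_bound[OF V \<phi> that])
 then show "norm (LINT x:V|leb V. u x * FT V \<phi> x) \<le> A * (C * total_weight V) * total_weight V"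
  using b by (intro set_integrable_decay(2)[OF V c]) blast
qed

lemma tempered_onE:
 assumes "tempered_on V u"
 obtains A k where "continuous_on V u" "A \<ge> 0" "!!x. x \<in> V ==> norm (u x) \<le> A * (jap x) ^ k"
proof -
 obtain C k where c: "continuous_on V u" "!!x. x \<in> V ==> norm (u x) \<le> C * (jap x) ^ k"
  using assms by (auto simp: tempered_on_def)
 have "norm (u x) \<le> max C 0 * (jap x) ^ k" if "x \<in> V" for x
  by (rule order_trans[OF c(2)[OF that]]) (auto intro!: mult_right_mono)
 then show thesis using that[of "max C 0" k] c(1) by auto
qed

lemma tempered_pairing_integrable:
 assumes "subspace V" "test_function V \<phi>" "tempered_on V u"
 shows "set_integrable (leb V) V (%x. u x * FT V \<phi> x)"
proof -
 obtain A k where "continuous_on V u" "A \<ge> 0" "!!x. x \<in> V ==> norm (u x) \<le> A * (jap x) ^ k"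
  using tempered_onE[OF assms(3)] by metis
 then show ?thesis using pairing_integrable[OF assms(1,2)] by blast
qed

lemma tempered_on_const: "tempered_on V (%x. c)"
 unfolding tempered_on_def by (intro conjI exI[of _ "norm c"] exI[of _ 0]) auto

lemma tempered_on_add:
 assumes "tempered_on V u" "tempered_on V w"
 shows "tempered_on V (%x. u x + w x)"
proof -
 obtain A k where u: "continuous_on V u" "A \<ge> 0" "!!x. x \<in> V ==> norm (u x) \<le> A * (jap x) ^ k"
  using tempered_onE[OF assms(1)] by metis
 obtain B l where w: "continuous_on V w" "B \<ge> 0" "!!x. x \<in> V ==> norm (w x) \<le> B * (jap x) ^ l"
  using tempered_onE[OF assms(2)] by metis
 have "norm (u x + w x) \<le> (A + B) * (jap x) ^ (k + l)" if "x \<in> V" for x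
 proof -
  have "A * (jap x) ^ k \<le> A * (jap x) ^ (k + l)"
   "B * (jap x) ^ l \<le> B * (jap x) ^ (k + l)"
   using u w by (auto intro!: mult_left_mono power_increasing)
  then show ?thesis using norm_triangle_ineq[of "u x" "w x"] u(3)[OF that] w(3)[OF that]
   by (simp add: distrib_right)
 qed
 then show ?thesis using u w by (auto simp: tempered_on_def intro: continuous_on_add)
qed

lemma tempered_on_mult:
 assumes "tempered_on V u" "tempered_on V w"
 shows "tempered_on V (%x. u x * w x)"
proof -
 obtain A k where u: "continuous_on V u" "A \<ge> 0" "!!x. x \<in> V ==> norm (u x) \<le> A * (jap x) ^ k"
  using tempered_onE[OF assms(1)] by metis
 obtain B l where w: "continuous_on V w" "B \<ge> 0" "!!x. x \<in> V ==> norm (w x) \<le> B * (jap x) ^ l"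
  using tempered_onE[OF assms(2)] by metis
 have "norm (u x * w x) \<le> (A * B) * (jap x) ^ (k + l)" if "x \<in> V" for x
 proof -
  have "norm (u x * w x) \<le> (A * (jap x) ^ k) * (B * (jap x) ^ l)"
   unfolding norm_mult using u w that by (intro mult_mono) auto
  then show ?thesis by (simp add: power_add mult_ac)
 qed
 then show ?thesis using u w by (auto simp: tempered_on_def intro: continuous_on_mult)
qed

lemma tempered_on_sum:
 "(!!i. i \<in> I ==> tempered_on V (u i)) ==> tempered_on V (%x. \<Sum>i\<in>I. u i x)"
 by (induction I rule: infinite_finite_induct) (auto intro: tempered_on_add tempered_on_const)

lemma tempered_on_cong:
 assumes "!!x. x \<in> V ==> u x = w x" shows "tempered_on V u \<longleftrightarrow> tempered_on V w"
proof -
 have "continuous_on V u \<longleftrightarrow> continuous_on V w" using assms by (intro continuous_on_cong) auto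
 then show ?thesis using assms by (auto simp: tempered_on_def)
qed

lemma one_plus_norm_add_le: "1 + (norm (x + a))\<^sup>2 \<le> 2 * (jap a) * (jap x)"
proof -
 have "(norm (x + a))\<^sup>2 \<le> (norm x + norm a)\<^sup>2" by (intro power_mono norm_triangle_ineq) auto
 also have "\<dots> \<le> 2 * (norm x)\<^sup>2 + 2 * (norm a)\<^sup>2"
  using sum_squares_bound[of "norm x" "norm a"] by (simp add: power2_sum)
 finally have "(norm (x + a))\<^sup>2 \<le> 2 * (norm x)\<^sup>2 + 2 * (norm a)\<^sup>2" .
 moreover have "0 \<le> (norm a)\<^sup>2 * (norm x)\<^sup>2" by simp
 moreover have "2 * (jap a) * (jap x) =
   2 + 2 * (norm x)\<^sup>2 + 2 * (norm a)\<^sup>2 + 2 * ((norm a)\<^sup>2 * (norm x)\<^sup>2)" by (simp add: algebra_simps)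
 ultimately show ?thesis by linarith
qed

lemma tempered_on_compose_affine:
 assumes "tempered_on W u" and L: "linear L" and V: "!!x. x \<in> V ==> L x + a \<in> W"
 shows "tempered_on V (%x. u (L x + a))"
proof -
 obtain A k where u: "continuous_on W u" "A \<ge> 0" "!!x. x \<in> W ==> norm (u x) \<le> A * (jap x) ^ k"
  using tempered_onE[OF assms(1)] by metis
 have bl: "bounded_linear L" using L by (simp add: linear_conv_bounded_linear)
 obtain B where B: "B > 0" "!!x. norm (L x) \<le> norm x * B"
  using bounded_linear.pos_bounded[OF bl] by auto
 have "norm (u (L x + a)) \<le> (A * (2 * (jap a) * (1 + B\<^sup>2)) ^ k) * (jap x) ^ k" if "x \<in> V" for x
 proof -
  have "(norm (L x))\<^sup>2 \<le> (norm x * B)\<^sup>2" by (intro power_mono B) auto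
  then have "1 + (norm (L x))\<^sup>2 \<le> (1 + B\<^sup>2) * (jap x)"
   by (simp add: power_mult_distrib algebra_simps) (smt (verit) zero_le_power2)
  then have "2 * (jap a) * (jap (L x)) \<le> 2 * (jap a) * ((1 + B\<^sup>2) * (jap x))"
   by (intro mult_left_mono) auto
  then have "1 + (norm (L x + a))\<^sup>2 \<le> 2 * (jap a) * (1 + B\<^sup>2) * (jap x)"
   using one_plus_norm_add_le[of "L x" a] by (simp add: mult.assoc)
  then have "(jap (L x + a)) ^ k \<le> (2 * (jap a) * (1 + B\<^sup>2) * (jap x)) ^ k"
   by (intro power_mono) auto
  then have "A * (jap (L x + a)) ^ k \<le> A * (2 * (jap a) * (1 + B\<^sup>2) * (jap x)) ^ k"
   by (intro mult_left_mono u)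
  then show ?thesis using u(3)[OF V[OF that]] by (simp add: power_mult_distrib mult.assoc)
 qed
 moreover have "continuous_on V (%x. u (L x + a))"
  by (rule continuous_on_compose2[OF u(1)])
   (use V in \<open>auto intro!: continuous_on_add[OF linear_continuous_on[OF bl] continuous_on_const]\<close>)
 ultimately show ?thesis by (auto simp: tempered_on_def)
qed

lemma tempered_on_linear:
 assumes "bounded_linear L" shows "tempered_on V (%x. L x :: complex)"
proof -
 obtain B where B: "B > 0" "!!x. norm (L x) \<le> norm x * B"
  using bounded_linear.pos_bounded[OF assms] by auto
 have "norm (L x) \<le> B * (jap x) ^ 1" for x
 proof -
  have "norm x \<le> 1 + (norm x)\<^sup>2"
   using sum_squares_bound[of 1 "norm x"] by (simp add: power2_eq_square) (smt (verit) norm_ge_zero)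
  then have "norm x * B \<le> (jap x) * B" using B by (intro mult_right_mono) auto
  then show ?thesis using B(2)[of x] by (simp add: mult.commute)
 qed
 then show ?thesis unfolding tempered_on_def
  by (intro conjI linear_continuous_on assms exI[of _ B] exI[of _ 1]) auto
qed

text \<open>The Fourier transform of \<open>u\<close> as a tempered distribution is supported in
  \<open>K\<close>, tested by transposition; the support itself is never formed. Temperedness is
  included so that all pairings converge.\<close>

definition spectrum_in :: "'a::euclidean_space set => 'a set => ('a => complex) => bool" where
 "spectrum_in V K u \<longleftrightarrow> tempered_on V u \<and>
  (\<forall>\<phi>. test_function V \<phi> \<and> supp_on V \<phi> \<inter> K = {} \<longrightarrow> (LINT x:V|leb V. u x * FT V \<phi> x) = 0)"

lemma LINT_cong_subspace:
 "(!!x. x \<in> V ==> f x = g x) ==> (LINT x:V|M. f x) = (LINT x:V|M. g x :: complex)"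
 unfolding set_integral_def
 by (intro integral_congI refl) (auto simp: indicator_def)

lemma spectrum_in_cong:
 assumes "!!x. x \<in> V ==> u x = w x" shows "spectrum_in V K u \<longleftrightarrow> spectrum_in V K w"
proof -
 have "(LINT x:V|leb V. u x * FT V \<phi> x) = (LINT x:V|leb V. w x * FT V \<phi> x)" for \<phi>
  using assms by (intro LINT_cong_subspace) auto
 then show ?thesis using tempered_on_cong[of V u w] assms by (simp add: spectrum_in_def)
qed

lemma spectrum_in_zero: "spectrum_in V K (%x. 0)"
 by (simp add: spectrum_in_def tempered_on_const)

lemma spectrum_in_add:
 assumes V: "subspace V" and "spectrum_in V K u" "spectrum_in V K w"
 shows "spectrum_in V K (%x. u x + w x)"
 unfolding spectrum_in_def
proof (intro conjI allI impI)
 show "tempered_on V (%x. u x + w x)" using assms by (intro tempered_on_add) (auto simp: spectrum_in_def)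
 fix \<phi> assume \<phi>: "test_function V \<phi> \<and> supp_on V \<phi> \<inter> K = {}"
 have "(LINT x:V|leb V. (u x + w x) * FT V \<phi> x) =
   (LINT x:V|leb V. u x * FT V \<phi> x) + (LINT x:V|leb V. w x * FT V \<phi> x)"
  unfolding distrib_right using assms \<phi>
  by (intro set_integral_add(2) tempered_pairing_integrable) (auto simp: spectrum_in_def)
 then show "(LINT x:V|leb V. (u x + w x) * FT V \<phi> x) = 0"
  using assms \<phi> by (simp add: spectrum_in_def)
qed

lemma spectrum_in_cmult:
 assumes "spectrum_in V K u"
 shows "spectrum_in V K (%x. c * u x)"
 using assms unfolding spectrum_in_def
 by (auto intro: tempered_on_mult tempered_on_const simp: mult.assoc)

lemma spectrum_in_sum:
 "subspace V ==> (!!i. i \<in> I ==> spectrum_in V K (u i)) ==> spectrum_in V K (%x. \<Sum>i\<in>I. u i x)"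
 by (induction I rule: infinite_finite_induct) (auto intro: spectrum_in_add spectrum_in_zero)

lemma LINT_pairing_translate:
 assumes V: "subspace V" and \<phi>: "test_function V \<phi>" and u: "continuous_on V u" and a: "a \<in> V"
 shows "(LINT x:V|leb V. u (x + a) * FT V \<phi> x) =
  (LINT x:V|leb V. u x * FT V (%l. exp (\<i> * cplx (l \<bullet> a)) * \<phi> l) x)"
proof -
 have c: "continuous_on V (%x. u x * FT V \<phi> (x - a))"
  by (intro continuous_on_mult u continuous_on_compose2[OF isCont_FT[OF V \<phi>]] continuous_intros) auto
 have "(LINT x:V|leb V. u (x + a) * FT V \<phi> x) =
  (LINT x:V|leb V. u (x + a) * FT V \<phi> (x + a - a))" by simp
 also have "\<dots> = (LINT x:V|leb V. u x * FT V \<phi> (x - a))"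
  by (rule LINT_subspace_translate[OF V a c])
 finally show ?thesis by (simp add: FT_translate)
qed

text \<open>Translating \<open>u\<close> multiplies the test function by a character, which does not
  enlarge its support.\<close>

lemma spectrum_in_translate:
 assumes V: "subspace V" and u: "spectrum_in V K u" and a: "a \<in> V"
 shows "spectrum_in V K (%x. u (x + a))"
 unfolding spectrum_in_def
proof (intro conjI allI impI)
 show "tempered_on V (%x. u (x + a))"
  using tempered_on_compose_affine[OF _ linear_id, of V u V a] u a V
  by (auto simp: spectrum_in_def intro: subspace_add)
 fix \<phi> assume \<phi>: "test_function V \<phi> \<and> supp_on V \<phi> \<inter> K = {}"
 let ?\<psi> = "%l. exp (\<i> * cplx (l \<bullet> a)) * \<phi> l"
 have c: "continuous_on V u" using u by (simp add: spectrum_in_def tempered_on_def)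
 have t: "test_function V ?\<psi>" "supp_on V ?\<psi> \<subseteq> supp_on V \<phi>"
  using test_mult[OF V _ smooth_character[OF V]] \<phi> by auto
 have "(LINT x:V|leb V. u (x + a) * FT V \<phi> x) = (LINT x:V|leb V. u x * FT V ?\<psi> x)"
  using \<phi> by (intro LINT_pairing_translate[OF V _ c a]) auto
 then show "(LINT x:V|leb V. u (x + a) * FT V \<phi> x) = 0"
  using u t \<phi> by (auto simp: spectrum_in_def)
qed

text \<open>Multiplication by a coordinate is transposed to a derivative of the test function, which
  does not enlarge its support. This makes polynomial factors harmless for the spectrum.\<close>

lemma spectrum_in_mult_inner:
 assumes V: "subspace V" and u: "spectrum_in V K u" and v: "v \<in> V"
 shows "spectrum_in V K (%x. of_real (x \<bullet> v) * u x)"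
 unfolding spectrum_in_def
proof (intro conjI allI impI)
 have "tempered_on V (%x. cplx (x \<bullet> v))"
  by (intro tempered_on_linear bounded_linear_compose[OF bounded_linear_of_real bounded_linear_inner_left])
 then show "tempered_on V (%x. of_real (x \<bullet> v) * u x)"
  using u by (auto intro!: tempered_on_mult simp: spectrum_in_def)
 fix \<phi> assume \<phi>: "test_function V \<phi> \<and> supp_on V \<phi> \<inter> K = {}"
 have "(LINT x:V|leb V. of_real (x \<bullet> v) * u x * FT V \<phi> x) =
   (LINT x:V|leb V. - \<i> * (u x * FT V (dir_deriv v \<phi>) x))"
  using \<phi> v by (simp add: FT_dir_deriv[OF V] inner_commute algebra_simps)
 also have "\<dots> = - \<i> * (LINT x:V|leb V. u x * FT V (dir_deriv v \<phi>) x)"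
  by (rule set_integral_mult_right)
 also have "\<dots> = 0"
  using u \<phi> test_dir_deriv[OF V _ v, of \<phi>] by (auto simp: spectrum_in_def)
 finally show "(LINT x:V|leb V. of_real (x \<bullet> v) * u x * FT V \<phi> x) = 0" .
qed

section \<open>Weights for dominated convergence\<close>

lemma power_le_fact_exp:
 fixes t :: real assumes "t \<ge> 0" shows "t ^ n \<le> fact n * exp t"
proof -
 have "(\<Sum>i\<in>{n}. t ^ i /\<^sub>R fact i) \<le> (\<Sum>i. t ^ i /\<^sub>R fact i)"
  using assms by (intro sum_le_suminf summable_exp_generic) auto
 then have "t ^ n /\<^sub>R fact n \<le> exp t" by (simp add: exp_def)
 then show ?thesis by (simp add: field_simps)
qed

lemma gauss_decay:
 obtains C where "C \<ge> 0" "!!x :: 'a::real_inner. gauss x * (jap x) ^ n \<le> C"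
proof (rule that[of "2 ^ n * fact n * exp (1 / 2)"])
 fix x :: 'a
 let ?t = "(jap x) / 2"
 have "?t ^ n \<le> fact n * exp ?t" by (rule power_le_fact_exp) simp
 then have "(jap x) ^ n \<le> 2 ^ n * (fact n * exp ?t)"
  by (simp add: power_divide field_simps)
 then have "gauss x * (jap x) ^ n \<le> gauss x * (2 ^ n * (fact n * exp ?t))"
  by (intro mult_left_mono) (auto simp: less_imp_le[OF gauss_pos])
 also have "\<dots> = 2 ^ n * fact n * (exp (- (norm x)\<^sup>2 / 2) * exp ?t)" by (simp add: gauss_def)
 also have "exp (- (norm x)\<^sup>2 / 2) * exp ?t = exp (1 / 2)" by (simp add: exp_add[symmetric] add_divide_distrib)
 finally show "gauss x * (jap x) ^ n \<le> 2 ^ n * fact n * exp (1 / 2)" .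
qed simp

definition weight :: "'a::euclidean_space => real" where
 "weight x = inverse ((jap x) ^ DIM('a))"

lemma weight_pos: "weight x > 0"
 unfolding weight_def by (intro positive_imp_inverse_positive zero_less_power) (auto intro: add_pos_nonneg)

lemma weight_nonneg: "weight x \<ge> 0" using weight_pos[of x] by simp

lemma integrable_weight: "subspace V ==> integrable (leb V) weight"
 using integrable_inverse_power_norm by (simp add: weight_def[abs_def])

lemma le_weight_iff: "a \<le> C * weight x \<longleftrightarrow> a * (jap x) ^ DIM('a) \<le> C"
 for x :: "'a::euclidean_space"
proof -
 have "(jap x) ^ DIM('a) > 0" by (intro zero_less_power) (auto intro: add_pos_nonneg)
 then show ?thesis by (simp add: weight_def field_simps)
qed

lemma weight_antimono: "norm x \<le> norm y ==> weight y \<le> weight x"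
 for x y :: "'a::euclidean_space"
 unfolding weight_def
 by (intro le_imp_inverse_le power_mono add_left_mono zero_less_power) (auto intro: add_pos_nonneg)

lemma borel_measurable_weight [measurable]: "weight \<in> borel_measurable borel"
 unfolding weight_def by measurable

lemma norm_exp_i [simp]: "norm (exp (- (\<i> * cplx t))) = 1"
 using norm_exp_i_times[of "- t"] by simp

section \<open>Integrals over products of subspaces\<close>

lemma pair_sigma_finite_leb:
 "subspace V1 ==> subspace V2 ==> pair_sigma_finite (leb V1) (leb V2)"
 by (intro pair_sigma_finite.intro sigma_finite_leb)

lemma AE_pair_leb:
 fixes V1 :: "'a::euclidean_space set" and V2 :: "'b::euclidean_space set"
 assumes sub1: "subspace V1" and sub2: "subspace V2"
 shows "AE z in leb V1 \<Otimes>\<^sub>M leb V2. fst z \<in> V1 \<and> snd z \<in> V2"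
proof -
 let ?M1 = "leb V1" and ?M2 = "leb V2"
 interpret P: pair_sigma_finite ?M1 ?M2 by (rule pair_sigma_finite_leb[OF sub1 sub2])
 show ?thesis
 proof (rule P.AE_pair_measure)
  have "{x \<in> space (?M1 \<Otimes>\<^sub>M ?M2). fst x \<in> V1 \<and> snd x \<in> V2} = V1 \<times> V2"
   by (auto simp: space_pair_measure)
  then show "{x \<in> space (?M1 \<Otimes>\<^sub>M ?M2). fst x \<in> V1 \<and> snd x \<in> V2} \<in> sets (?M1 \<Otimes>\<^sub>M ?M2)"
   using borel_subspace[OF sub1] borel_subspace[OF sub2] by simp
  show "AE x in ?M1. AE y in ?M2. fst (x, y) \<in> V1 \<and> snd (x, y) \<in> V2"
   using AE_leb[OF sub1] by eventually_elim (use AE_leb[OF sub2] in simp)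
 qed
qed

lemma integrable_pair_leb:
 fixes V1 :: "'a::euclidean_space set" and V2 :: "'b::euclidean_space set" and f :: "'a \<times> 'b => complex"
 assumes sub1: "subspace V1" and sub2: "subspace V2"
  and f: "f \<in> borel_measurable (leb V1 \<Otimes>\<^sub>M leb V2)"
  and w: "integrable (leb V1) wl" "integrable (leb V2) wr"
  and le: "!!x y. x \<in> V1 ==> y \<in> V2 ==> norm (f (x, y)) \<le> wl x * wr y"
 shows "integrable (leb V1 \<Otimes>\<^sub>M leb V2) f"
proof -
 let ?M1 = "leb V1" and ?M2 = "leb V2"
 interpret P: pair_sigma_finite ?M1 ?M2 by (rule pair_sigma_finite_leb[OF sub1 sub2])
 have m[measurable]: "wl \<in> borel_measurable ?M1" "wr \<in> borel_measurable ?M2" using w by auto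
 have "integrable (?M1 \<Otimes>\<^sub>M ?M2) (%z. wl (fst z) * wr (snd z))"
 proof (rule P.Fubini_integrable)
  have "(%x. LINT y|?M2. norm (wl (fst (x, y)) * wr (snd (x, y)))) = (%x. norm (wl x) * (LINT y|?M2. norm (wr y)))"
   by (simp add: abs_mult)
  then show "integrable ?M1 (%x. LINT y|?M2. norm (wl (fst (x, y)) * wr (snd (x, y))))"
   using w by simp
 qed (use w in auto)
 moreover have "AE z in ?M1 \<Otimes>\<^sub>M ?M2. norm (f z) \<le> norm (wl (fst z) * wr (snd z))"
  using AE_pair_leb[OF sub1 sub2]
 proof eventually_elim
  fix z :: "'a \<times> 'b" assume "fst z \<in> V1 \<and> snd z \<in> V2"
  then have "norm (f (fst z, snd z)) \<le> wl (fst z) * wr (snd z)" by (intro le) auto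
  then show "norm (f z) \<le> norm (wl (fst z) * wr (snd z))" by simp
 qed
 ultimately show ?thesis using integrable_le[OF _ f] by blast
qed

text \<open>The decompositions of E and of F determined by K are instances; so is V = V + {0}, which
  supplies a linear projection onto V and turns the formula for sections into Fourier inversion at
  0.\<close>

locale orthogonal_sum =
 fixes V V1 V2 :: "'a::euclidean_space set"
 assumes sub1: "subspace V1" and sub2: "subspace V2"
  and orth: "!!a b. a \<in> V1 ==> b \<in> V2 ==> a \<bullet> b = 0"
  and V_eq: "V = {a + b |a b. a \<in> V1 \<and> b \<in> V2}"
begin

lemma sub: "subspace V" unfolding V_eq by (rule subspace_sums[OF sub1 sub2])

lemma add_in: "a \<in> V1 ==> b \<in> V2 ==> a + b \<in> V" unfolding V_eq by auto

lemma in1: "a \<in> V1 ==> a \<in> V" using add_in[OF _ subspace_0[OF sub2]] by fastforce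

lemma in2: "b \<in> V2 ==> b \<in> V" using add_in[OF subspace_0[OF sub1]] by fastforce

lemma norm_add: "a \<in> V1 ==> b \<in> V2 ==> (norm (a + b))\<^sup>2 = (norm a)\<^sup>2 + (norm b)\<^sup>2"
 by (simp add: norm_add_Pythagorean orthogonal_def orth)

lemma norm_le_add: "a \<in> V1 ==> b \<in> V2 ==> norm a \<le> norm (a + b)"
 "a \<in> V1 ==> b \<in> V2 ==> norm b \<le> norm (a + b)"
 by (rule power2_le_imp_le; simp add: norm_add)+

lemma inner_add_add:
 "a \<in> V1 ==> b \<in> V2 ==> c \<in> V1 ==> d \<in> V2 ==> (a + b) \<bullet> (c + d) = a \<bullet> c + b \<bullet> d"
 using orth[of a d] orth[of c b] by (simp add: inner_add_left inner_add_right inner_commute)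

definition proj1 :: "'a => 'a" where "proj1 x = (\<Sum>b\<in>onb V1. (x \<bullet> b) *\<^sub>R b)"
definition proj2 :: "'a => 'a" where "proj2 x = (\<Sum>b\<in>onb V2. (x \<bullet> b) *\<^sub>R b)"

lemma linear_proj: "linear proj1" "linear proj2"
 unfolding proj1_def proj2_def
 by (auto simp: linear_iff inner_add_left scaleR_add_left sum.distrib scaleR_right.sum)

lemma proj_in: "proj1 x \<in> V1" "proj2 x \<in> V2"
 unfolding proj1_def proj2_def
 using onb(1)[OF sub1] onb(1)[OF sub2]
 by (auto intro!: subspace_sum subspace_scale sub1 sub2)

lemma proj_add: assumes "a \<in> V1" "b \<in> V2" shows "proj1 (a + b) = a" "proj2 (a + b) = b"
proof -
 have "proj1 (a + b) = (\<Sum>e\<in>onb V1. (a \<bullet> e) *\<^sub>R e)"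
  unfolding proj1_def using onb(1)[OF sub1] orth assms
  by (intro sum.cong) (auto simp: inner_add_left inner_commute[of b] dest!: subsetD)
 then show "proj1 (a + b) = a" using onb_expand[OF sub1 assms(1)] by simp
 have "proj2 (a + b) = (\<Sum>e\<in>onb V2. (b \<bullet> e) *\<^sub>R e)"
  unfolding proj2_def using onb(1)[OF sub2] orth assms
  by (intro sum.cong) (auto simp: inner_add_left dest!: subsetD)
 then show "proj2 (a + b) = b" using onb_expand[OF sub2 assms(2)] by simp
qed

lemma proj_sum: "x \<in> V ==> proj1 x + proj2 x = x"
 by (auto simp: V_eq proj_add)

lemma proj_simps: "a \<in> V1 ==> proj1 a = a" "a \<in> V1 ==> proj2 a = 0"
  "b \<in> V2 ==> proj2 b = b" "b \<in> V2 ==> proj1 b = 0"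
 using proj_add[OF _ subspace_0[OF sub2], of a] proj_add[OF subspace_0[OF sub1], of b] by auto

abbreviation "M1 \<equiv> leb V1"
abbreviation "M2 \<equiv> leb V2"

lemmas sigma_finite_pair = pair_sigma_finite_leb[OF sub1 sub2]
lemmas AE_split = AE_pair_leb[OF sub1 sub2]
lemmas integrable_pair = integrable_pair_leb[OF sub1 sub2]

lemma leb_eq_distr: "leb V = distr (M1 \<Otimes>\<^sub>M M2) borel (%(x, y). x + y)"
 by (rule leb_product[OF sub1 sub2 linear_id linear_id, simplified])
  (auto simp: norm_add V_eq)

lemma LINT_split:
 fixes f :: "'a => complex"
 assumes [measurable]: "f \<in> borel_measurable borel"
 shows "(LINT x|leb V. f x) = (LINT z|(M1 \<Otimes>\<^sub>M M2). f (fst z + snd z))"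
 unfolding leb_eq_distr by (subst integral_distr) (auto simp: case_prod_beta)

text \<open>Fourier inversion in the V1 variable alone, at the origin: only the values of
  \<open>\<phi>\<close> on V2 remain. Transform and integral over V1 cannot be exchanged directly,
  so a Gaussian of increasing width is inserted, its transform is computed, and the width is sent to
  infinity.\<close>

lemma FT_section:
 assumes \<phi>: "test_function V \<phi>" and x2: "x2 \<in> V2"
 shows "(LINT x1:V1|M1. FT V \<phi> (x1 + x2)) = of_real ((sqrt (2 * pi) ^ dim V1)\<^sup>2) * FT V2 \<phi> x2"
proof -
 interpret P: pair_sigma_finite M1 M2 by (rule sigma_finite_pair)
 let ?M = "leb V"
 interpret Q: pair_sigma_finite M1 ?M
  by (intro pair_sigma_finite.intro sigma_finite_leb sub1 sub)
 define c1 where "c1 = sqrt (2 * pi) ^ dim V1"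
 \<comment> \<open>\<open>\<phi>\<close> is arbitrary off V, so measurability on the whole space
   needs this cut.\<close>
 define \<psi> where "\<psi> l = indicator V l *\<^sub>R \<phi> l" for l
 define e where "e l x = exp (- (\<i> * cplx (l \<bullet> x)))" for l x :: 'a
 have norm_e[simp]: "norm (e l x) = 1" for l x by (simp add: e_def)
 have [measurable]: "\<psi> \<in> borel_measurable borel"
  unfolding \<psi>_def[abs_def]
  by (rule measurable_on_subspace[OF sub test_continuous[OF \<phi>]])
 have [measurable]: "(%z. e (fst z) (snd z)) \<in> borel_measurable borel"
  unfolding e_def by (intro borel_measurable_continuous_onI continuous_intros)
 have em1[measurable]: "(%l. e l x) \<in> borel_measurable borel" "(%l. e x l) \<in> borel_measurable borel" for x
  unfolding e_def by (intro borel_measurable_continuous_onI continuous_intros)+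
 have em[measurable (raw)]: "(%z. e (f z) (g z)) \<in> borel_measurable M"
  if [measurable]: "f \<in> borel_measurable M" "g \<in> borel_measurable M" for f g and M :: "'z measure"
  unfolding e_def by measurable
 obtain C where C: "C \<ge> 0" "!!x. x \<in> V ==> norm (\<phi> x) * (jap x) ^ DIM('a) \<le> C"
  using test_decay[OF sub \<phi>] by metis
 have \<psi>_le: "norm (\<psi> l) \<le> C * weight l" for l
  using C weight_nonneg[of l] by (cases "l \<in> V") (auto simp: \<psi>_def le_weight_iff)
 have FT_\<psi>: "FT V \<phi> x = (LINT l|?M. \<psi> l * e l x)" for x
  by (simp add: FT_def set_integral_def \<psi>_def e_def)
 obtain D where D: "D \<ge> 0" "!!x. x \<in> V ==> norm (FT V \<phi> x) * (jap x) ^ DIM('a) \<le> D"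
  using FT_decay[OF sub \<phi>] by metis
 let ?g = "%n x. gauss ((1 / real (Suc n)) *\<^sub>R x)"
 have g1: "?g n x \<le> 1" "?g n x \<ge> 0" for n and x :: 'a using gauss_le_1 gauss_pos less_imp_le by blast+
 have int_g: "integrable M1 (?g n)" for n
 proof -
  obtain G where G: "G \<ge> 0" "!!x :: 'a. gauss x * (jap x) ^ DIM('a) \<le> G"
   using gauss_decay by metis
  have "?g n x \<le> G * real (Suc n) ^ (2 * DIM('a)) * weight x" for x :: 'a
  proof -
   let ?N = "real (Suc n)"
   have "1 + (norm x)\<^sup>2 \<le> ?N\<^sup>2 * (1 + (norm ((1 / ?N) *\<^sub>R x))\<^sup>2)"
    by (simp add: power_mult_distrib power_divide distrib_left del: of_nat_Suc)
   then have "(jap x) ^ DIM('a) \<le> (?N\<^sup>2 * (1 + (norm ((1 / ?N) *\<^sub>R x))\<^sup>2)) ^ DIM('a)"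
    by (intro power_mono) auto
   then have "?g n x * (jap x) ^ DIM('a) \<le> ?g n x * (?N\<^sup>2 * (1 + (norm ((1 / ?N) *\<^sub>R x))\<^sup>2)) ^ DIM('a)"
    by (intro mult_left_mono g1)
   also have "\<dots> = ?N ^ (2 * DIM('a)) * (?g n x * (1 + (norm ((1 / ?N) *\<^sub>R x))\<^sup>2) ^ DIM('a))"
    by (simp add: power_mult_distrib power_mult del: of_nat_Suc norm_scaleR)
   also have "\<dots> \<le> ?N ^ (2 * DIM('a)) * G" by (intro mult_left_mono G) simp
   finally show ?thesis by (subst le_weight_iff) (simp add: mult.commute del: of_nat_Suc norm_scaleR)
  qed
  then show ?thesis
   using g1(2) by (intro integrable_le[OF integrable_mult_right[OF integrable_weight[OF sub1]]])
    (auto intro!: AE_I2 order_trans[OF _ abs_ge_self])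
 qed
 let ?I = "%n. LINT x1|M1. (indicator V1 x1 *\<^sub>R FT V \<phi> (x1 + x2)) * of_real (?g n x1)"
 have cF: "continuous_on V1 (%x1. FT V \<phi> (x1 + x2))"
  by (rule continuous_on_compose2[OF isCont_FT[OF sub \<phi>]]) (auto intro!: continuous_intros)
 have mF: "(%x1. indicator V1 x1 *\<^sub>R FT V \<phi> (x1 + x2)) \<in> borel_measurable borel"
  by (rule measurable_on_subspace[OF sub1 cF])
 have lim1: "?I \<longlonglongrightarrow> (LINT x1:V1|M1. FT V \<phi> (x1 + x2))"
  unfolding set_integral_def
 proof (rule integral_dominated_convergence[where w = "%x. D * weight x"])
  show "integrable M1 (%x. D * weight x)" by (intro integrable_mult_right integrable_weight sub1)
  show "AE x1 in M1. (%n. (indicator V1 x1 *\<^sub>R FT V \<phi> (x1 + x2)) * of_real (?g n x1)) \<longlonglongrightarrow> indicator V1 x1 *\<^sub>R FT V \<phi> (x1 + x2)"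
  proof (rule AE_I2)
   fix x1 :: 'a
   have "(%n. 1 / real (Suc n)) \<longlonglongrightarrow> 0" using LIMSEQ_inverse_real_of_nat by (simp add: inverse_eq_divide)
   then have "(%n. (1 / real (Suc n)) *\<^sub>R x1) \<longlonglongrightarrow> 0 *\<^sub>R x1" by (intro tendsto_intros)
   then have "(%n. ?g n x1) \<longlonglongrightarrow> gauss (0 *\<^sub>R x1)"
    using continuous_on_tendsto_compose[OF continuous_on_gauss[of UNIV]] by auto
   then have "(%n. (indicator V1 x1 *\<^sub>R FT V \<phi> (x1 + x2)) * of_real (?g n x1)) \<longlonglongrightarrow> (indicator V1 x1 *\<^sub>R FT V \<phi> (x1 + x2)) * of_real (gauss (0 *\<^sub>R x1))"
    by (intro tendsto_intros)
   then show "(%n. (indicator V1 x1 *\<^sub>R FT V \<phi> (x1 + x2)) * of_real (?g n x1)) \<longlonglongrightarrow> indicator V1 x1 *\<^sub>R FT V \<phi> (x1 + x2)"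
    by (simp add: gauss_def)
  qed
  show "AE x1 in M1. norm ((indicator V1 x1 *\<^sub>R FT V \<phi> (x1 + x2)) * of_real (?g n x1)) \<le> D * weight x1" for n
   using AE_leb[OF sub1]
  proof eventually_elim
   fix x1 assume x1: "x1 \<in> V1"
   have "norm (FT V \<phi> (x1 + x2)) \<le> D * weight (x1 + x2)"
    using D(2)[OF add_in[OF x1 x2]] by (simp add: le_weight_iff)
   also have "\<dots> \<le> D * weight x1" by (intro mult_left_mono weight_antimono norm_le_add x1 x2 D)
   finally have "norm (FT V \<phi> (x1 + x2)) * ?g n x1 \<le> (D * weight x1) * 1"
    using g1 D(1) weight_nonneg[of x1] by (intro mult_mono) auto
   then show "norm ((indicator V1 x1 *\<^sub>R FT V \<phi> (x1 + x2)) * of_real (?g n x1)) \<le> D * weight x1"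
    using x1 g1(2)[of n x1] by (simp add: norm_mult)
  qed
 qed (use mF in measurable)
 \<comment> \<open>An unnormalised Gaussian average of \<open>\<psi>\<close> around b, of width
   1/(n+1) in the directions of V1.\<close>
 let ?J = "%n b. LINT a|M1. \<psi> ((1 / real (Suc n)) *\<^sub>R a + b) * of_real (gauss a)"
 have I_eq: "?I n = of_real c1 * (LINT b|M2. e b x2 * ?J n b)" for n
 proof -
  \<comment> \<open>The dilation by n + 1 is used once in the Gaussian transform and once in the
    average, so its factor appears as 1/s and as s.\<close>
  have "real (Suc n) \<ge> 1" by simp
  then obtain s where s: "s > 0"
   "!!f :: 'a => complex. f \<in> borel_measurable borel ==>
    (LINT x|M1. f (real (Suc n) *\<^sub>R x)) = of_real s * (LINT x|M1. f x)"
   using leb_scale[OF sub1] by metis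
  let ?N = "real (Suc n)"
  have B: "(LINT x1|M1. e a x1 * of_real (?g n x1)) = of_real (c1 / s * gauss (?N *\<^sub>R a))" if a: "a \<in> V1" for a
  proof -
   have "of_real s * (LINT x1|M1. e a x1 * of_real (?g n x1)) = (LINT x1|M1. e a (?N *\<^sub>R x1) * of_real (gauss x1))"
    by (subst s(2)[symmetric]) (auto simp del: of_nat_Suc)
   also have "\<dots> = (LINT x1|M1. cplx (gauss x1) * exp (\<i> * cplx ((- (?N *\<^sub>R a)) \<bullet> x1)))"
    by (intro integral_congI) (auto simp: e_def mult.commute simp del: of_nat_Suc)
   also have "\<dots> = cplx (c1 * gauss (- (?N *\<^sub>R a)))"
    unfolding c1_def by (rule gauss_fourier(2)[OF sub1]) (intro subspace_neg subspace_scale sub1 a)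
   finally show ?thesis using s(1) by (simp add: gauss_def field_simps del: of_nat_Suc)
  qed
  have "?I n = (LINT x1|M1. (LINT l|?M. \<psi> l * e l (x1 + x2) * of_real (?g n x1)))"
  proof (rule integral_cong_AE)
   show "(%x1. LINT l|?M. \<psi> l * e l (x1 + x2) * of_real (?g n x1)) \<in> borel_measurable M1"
    by (rule Q.M2.borel_measurable_lebesgue_integral) measurable
   show "AE x1 in M1. (indicator V1 x1 *\<^sub>R FT V \<phi> (x1 + x2)) * of_real (?g n x1) = (LINT l|?M. \<psi> l * e l (x1 + x2) * of_real (?g n x1))"
    using AE_leb[OF sub1] by eventually_elim (simp add: FT_\<psi>)
  qed (use mF in measurable)
  also have "\<dots> = (LINT l|?M. (LINT x1|M1. \<psi> l * e l (x1 + x2) * of_real (?g n x1)))"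
  proof (rule Q.Fubini_integral[symmetric])
   have "integrable (M1 \<Otimes>\<^sub>M ?M) (%z. \<psi> (snd z) * e (snd z) (fst z + x2) * of_real (?g n (fst z)))"
   proof (rule Q.Fubini_integrable)
    have i: "integrable ?M (%l. norm (\<psi> l))"
     by (rule integrable_le[OF integrable_mult_right[OF integrable_weight[OF sub]]])
      (use \<psi>_le in \<open>auto intro!: AE_I2 order_trans[OF _ abs_ge_self]\<close>)
    have "(%x. LINT y|?M. norm (\<psi> (snd (x, y)) * e (snd (x, y)) (fst (x, y) + x2) * of_real (?g n (fst (x, y))))) =
      (%x. ?g n x * (LINT y|?M. norm (\<psi> y)))"
     using g1(2)[of n] by (simp add: norm_mult mult.commute del: of_nat_Suc)
    then show "integrable M1 (%x. LINT y|?M. norm (\<psi> (snd (x, y)) * e (snd (x, y)) (fst (x, y) + x2) * of_real (?g n (fst (x, y)))))"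
     using int_g[of n] by simp
    have "integrable ?M (%y. \<psi> y * e y (x + x2) * of_real (?g n x))" for x
     by (rule integrable_le[OF i])
      (use g1[of n x] in \<open>auto intro!: AE_I2 mult_left_le simp: norm_mult\<close>)
    then show "AE x in M1. integrable ?M (%y. \<psi> (snd (x, y)) * e (snd (x, y)) (fst (x, y) + x2) * of_real (?g n (fst (x, y))))"
     by simp
   qed measurable
   then show "integrable (M1 \<Otimes>\<^sub>M ?M) (%(x1, l). \<psi> l * e l (x1 + x2) * of_real (?g n x1))"
    by (simp only: case_prod_unfold)
  qed
  also have "\<dots> = (LINT z|(M1 \<Otimes>\<^sub>M M2). (LINT x1|M1. \<psi> (fst z + snd z) * e (fst z + snd z) (x1 + x2) * of_real (?g n x1)))"
   by (rule LINT_split) (rule P.M1.borel_measurable_lebesgue_integral, measurable)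
  also have "\<dots> = (LINT z|(M1 \<Otimes>\<^sub>M M2). of_real (c1 / s) * (e (snd z) x2 * (\<psi> (fst z + snd z) * of_real (gauss (?N *\<^sub>R fst z)))))"
  proof (rule integral_cong_AE)
   show "AE z in M1 \<Otimes>\<^sub>M M2. (LINT x1|M1. \<psi> (fst z + snd z) * e (fst z + snd z) (x1 + x2) * of_real (?g n x1)) =
     of_real (c1 / s) * (e (snd z) x2 * (\<psi> (fst z + snd z) * of_real (gauss (?N *\<^sub>R fst z))))"
    using AE_split
   proof eventually_elim
    fix z :: "'a \<times> 'a" assume z: "fst z \<in> V1 \<and> snd z \<in> V2"
    have "(LINT x1|M1. \<psi> (fst z + snd z) * e (fst z + snd z) (x1 + x2) * of_real (?g n x1)) =
     (LINT x1|M1. (\<psi> (fst z + snd z) * e (snd z) x2) * (e (fst z) x1 * of_real (?g n x1)))"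
    proof (rule integral_cong_AE)
     show "AE x1 in M1. \<psi> (fst z + snd z) * e (fst z + snd z) (x1 + x2) * of_real (?g n x1) =
       (\<psi> (fst z + snd z) * e (snd z) x2) * (e (fst z) x1 * of_real (?g n x1))"
      using AE_leb[OF sub1]
     proof eventually_elim
      fix x1 assume "x1 \<in> V1"
      then have "(fst z + snd z) \<bullet> (x1 + x2) = fst z \<bullet> x1 + snd z \<bullet> x2"
       using z x2 by (intro inner_add_add) auto
      then have "e (fst z + snd z) (x1 + x2) = e (snd z) x2 * e (fst z) x1"
       by (simp add: e_def distrib_left exp_diff exp_minus field_simps)
      then show "\<psi> (fst z + snd z) * e (fst z + snd z) (x1 + x2) * of_real (?g n x1) =
       (\<psi> (fst z + snd z) * e (snd z) x2) * (e (fst z) x1 * of_real (?g n x1))" by simp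
     qed
    qed measurable
    also have "\<dots> = (\<psi> (fst z + snd z) * e (snd z) x2) * (LINT x1|M1. e (fst z) x1 * of_real (?g n x1))"
     by (rule integral_mult_right_zero)
    finally show "(LINT x1|M1. \<psi> (fst z + snd z) * e (fst z + snd z) (x1 + x2) * of_real (?g n x1)) =
     of_real (c1 / s) * (e (snd z) x2 * (\<psi> (fst z + snd z) * of_real (gauss (?N *\<^sub>R fst z))))"
     using z by (simp add: B del: of_nat_Suc)
   qed
   show "(%z. LINT x1|M1. \<psi> (fst z + snd z) * e (fst z + snd z) (x1 + x2) * of_real (?g n x1)) \<in> borel_measurable (M1 \<Otimes>\<^sub>M M2)"
    by (rule P.M1.borel_measurable_lebesgue_integral) measurable
  qed measurable
  also have "\<dots> = of_real (c1 / s) * (LINT z|(M1 \<Otimes>\<^sub>M M2). e (snd z) x2 * (\<psi> (fst z + snd z) * of_real (gauss (?N *\<^sub>R fst z))))"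
   by (rule integral_mult_right_zero)
  also have "(LINT z|(M1 \<Otimes>\<^sub>M M2). e (snd z) x2 * (\<psi> (fst z + snd z) * of_real (gauss (?N *\<^sub>R fst z)))) =
    (LINT b|M2. (LINT a|M1. e b x2 * (\<psi> (a + b) * of_real (gauss (?N *\<^sub>R a)))))"
  proof -
   have "integrable (M1 \<Otimes>\<^sub>M M2) (%z. e (snd z) x2 * (\<psi> (fst z + snd z) * of_real (gauss (?N *\<^sub>R fst z))))"
   proof (rule integrable_pair[where wl = "%a. gauss a" and wr = "%b. C * weight b"])
    fix a b assume ab: "a \<in> V1" "b \<in> V2"
    have "norm (\<psi> (a + b)) \<le> C * weight b"
     by (rule order_trans[OF \<psi>_le]) (intro mult_left_mono weight_antimono norm_le_add ab C)
    moreover have "gauss (?N *\<^sub>R a) \<le> gauss a"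
    proof -
     have "1 * norm a \<le> ?N * norm a" by (intro mult_right_mono) auto
     then have "(norm a)\<^sup>2 \<le> (norm (?N *\<^sub>R a))\<^sup>2" by (intro power_mono) auto
     then show ?thesis by (simp add: gauss_def del: of_nat_Suc)
    qed
    ultimately have "norm (\<psi> (a + b)) * gauss (?N *\<^sub>R a) \<le> (C * weight b) * gauss a"
     using C weight_nonneg[of b] less_imp_le[OF gauss_pos] by (intro mult_mono) auto
    then show "norm (e (snd (a, b)) x2 * (\<psi> (fst (a, b) + snd (a, b)) * of_real (gauss (?N *\<^sub>R fst (a, b))))) \<le> gauss a * (C * weight b)"
     by (simp add: norm_mult mult.commute abs_of_pos[OF gauss_pos] del: of_nat_Suc)
   qed (auto intro!: integrable_gauss[OF sub1] integrable_weight[OF sub2] simp del: of_nat_Suc)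
   then have "(LINT b|M2. (LINT a|M1. e b x2 * (\<psi> (a + b) * of_real (gauss (?N *\<^sub>R a))))) =
    (LINT z|(M1 \<Otimes>\<^sub>M M2). (%(a, b). e b x2 * (\<psi> (a + b) * of_real (gauss (?N *\<^sub>R a)))) z)"
    by (intro P.integral_snd) (simp only: case_prod_unfold)
   then show ?thesis by (simp only: case_prod_unfold)
  qed
  also have "\<dots> = (LINT b|M2. of_real s * (e b x2 * ?J n b))"
  proof (intro integral_congI refl)
   fix b
   have "(LINT a|M1. \<psi> (a + b) * of_real (gauss (?N *\<^sub>R a))) =
     (LINT a|M1. (%a. \<psi> ((1 / ?N) *\<^sub>R a + b) * of_real (gauss a)) (?N *\<^sub>R a))"
    by (simp del: of_nat_Suc)
   also have "\<dots> = of_real s * ?J n b" by (rule s(2)) (simp del: of_nat_Suc)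
   finally show "(LINT a|M1. e b x2 * (\<psi> (a + b) * of_real (gauss (?N *\<^sub>R a)))) = of_real s * (e b x2 * ?J n b)"
    by (simp add: mult.left_commute del: of_nat_Suc)
  qed
  also have "\<dots> = of_real s * (LINT b|M2. e b x2 * ?J n b)" by (rule integral_mult_right_zero)
  finally show ?thesis using s(1) by (simp add: field_simps del: of_nat_Suc)
 qed
 have J_le: "norm (?J n b) \<le> C * weight b * c1" if b: "b \<in> V2" for n b
 proof -
  have i: "integrable M1 (%a. C * weight b * gauss a)" by (intro integrable_mult_right integrable_gauss sub1)
  have le: "norm (\<psi> ((1 / real (Suc n)) *\<^sub>R a + b) * of_real (gauss a)) \<le> C * weight b * gauss a" if a: "a \<in> V1" for a
  proof -
   have "norm (\<psi> ((1 / real (Suc n)) *\<^sub>R a + b)) \<le> C * weight b"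
    by (rule order_trans[OF \<psi>_le]) (intro mult_left_mono weight_antimono norm_le_add subspace_scale sub1 a b C)
   then show ?thesis using gauss_pos[of a] by (simp add: norm_mult)
  qed
  have "norm (?J n b) \<le> (LINT a|M1. norm (\<psi> ((1 / real (Suc n)) *\<^sub>R a + b) * of_real (gauss a)))"
   by (rule integral_norm_bound)
  also have "\<dots> \<le> (LINT a|M1. C * weight b * gauss a)"
  proof (rule integral_mono_AE)
   show ae: "AE a in M1. norm (\<psi> ((1 / real (Suc n)) *\<^sub>R a + b) * of_real (gauss a)) \<le> C * weight b * gauss a"
    using AE_leb[OF sub1] by eventually_elim (rule le)
   show "integrable M1 (%a. norm (\<psi> ((1 / real (Suc n)) *\<^sub>R a + b) * of_real (gauss a)))"
    by (rule integrable_norm, rule integrable_le[OF i])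
     (use ae in \<open>auto elim!: eventually_mono intro: order_trans[OF _ abs_ge_self]\<close>)
  qed (rule i)
  also have "\<dots> = C * weight b * c1"
  proof -
   have "cplx (LINT x|M1. gauss x) = cplx c1"
    using gauss_fourier(2)[OF sub1 subspace_0[OF sub1]] by (simp add: gauss_def c1_def del: of_real_power)
   then show ?thesis by simp
  qed
  finally show ?thesis .
 qed
 have limJ: "(%n. ?J n b) \<longlonglongrightarrow> of_real c1 * \<psi> b" if b: "b \<in> V2" for b
 proof -
  have "(%n. ?J n b) \<longlonglongrightarrow> (LINT a|M1. \<psi> b * of_real (gauss a))"
  proof (rule integral_dominated_convergence[where w = "%a. C * weight b * gauss a"])
   show "integrable M1 (%a. C * weight b * gauss a)" by (intro integrable_mult_right integrable_gauss sub1)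
   show "AE a in M1. (%n. \<psi> ((1 / real (Suc n)) *\<^sub>R a + b) * of_real (gauss a)) \<longlonglongrightarrow> \<psi> b * of_real (gauss a)"
    using AE_leb[OF sub1]
   proof eventually_elim
    fix a assume a: "a \<in> V1"
    have inV: "(1 / real (Suc n)) *\<^sub>R a + b \<in> V" for n by (intro add_in subspace_scale sub1 a b)
    have "(%n. 1 / real (Suc n)) \<longlonglongrightarrow> 0" using LIMSEQ_inverse_real_of_nat by (simp add: inverse_eq_divide)
    then have "(%n. (1 / real (Suc n)) *\<^sub>R a + b) \<longlonglongrightarrow> 0 *\<^sub>R a + b" by (intro tendsto_intros)
    then have "(%n. \<phi> ((1 / real (Suc n)) *\<^sub>R a + b)) \<longlonglongrightarrow> \<phi> b"
     using inV in2[OF b] by (intro continuous_on_tendsto_compose[OF test_continuous[OF \<phi>], of _ b]) auto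
    then have "(%n. \<phi> ((1 / real (Suc n)) *\<^sub>R a + b) * of_real (gauss a)) \<longlonglongrightarrow> \<phi> b * of_real (gauss a)"
     by (intro tendsto_intros)
    then show "(%n. \<psi> ((1 / real (Suc n)) *\<^sub>R a + b) * of_real (gauss a)) \<longlonglongrightarrow> \<psi> b * of_real (gauss a)"
     using inV in2[OF b] by (simp add: \<psi>_def)
   qed
   show "AE a in M1. norm (\<psi> ((1 / real (Suc n)) *\<^sub>R a + b) * of_real (gauss a)) \<le> C * weight b * gauss a" for n
    using AE_leb[OF sub1]
   proof eventually_elim
    fix a assume a: "a \<in> V1"
    have "norm (\<psi> ((1 / real (Suc n)) *\<^sub>R a + b)) \<le> C * weight b"
     by (rule order_trans[OF \<psi>_le]) (intro mult_left_mono weight_antimono norm_le_add subspace_scale sub1 a b C)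
    then show "norm (\<psi> ((1 / real (Suc n)) *\<^sub>R a + b) * of_real (gauss a)) \<le> C * weight b * gauss a"
     using gauss_pos[of a] by (simp add: norm_mult)
   qed
  qed measurable
  also have "(LINT a|M1. \<psi> b * of_real (gauss a)) = of_real c1 * \<psi> b"
   using gauss_fourier(2)[OF sub1 subspace_0[OF sub1]] by (simp add: gauss_def c1_def)
  finally show ?thesis .
 qed
 have "(%n. LINT b|M2. e b x2 * ?J n b) \<longlonglongrightarrow> (LINT b|M2. e b x2 * (of_real c1 * \<psi> b))"
 proof (rule integral_dominated_convergence[where w = "%b. C * weight b * c1"])
  show "integrable M2 (%b. C * weight b * c1)" by (intro integrable_mult_left integrable_mult_right integrable_weight sub2)
  show "AE b in M2. (%n. e b x2 * ?J n b) \<longlonglongrightarrow> e b x2 * (of_real c1 * \<psi> b)"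
   using AE_leb[OF sub2] by eventually_elim (intro tendsto_intros limJ)
  show "AE b in M2. norm (e b x2 * ?J n b) \<le> C * weight b * c1" for n
   using AE_leb[OF sub2] by eventually_elim (use J_le in \<open>simp add: norm_mult\<close>)
  show "(%b. e b x2 * ?J n b) \<in> borel_measurable M2" for n
   by (intro borel_measurable_times P.M1.borel_measurable_lebesgue_integral) measurable
 qed measurable
 also have "(LINT b|M2. e b x2 * (of_real c1 * \<psi> b)) = (LINT b|M2. of_real c1 * (indicator V2 b *\<^sub>R (\<phi> b * e b x2)))"
 proof (rule integral_cong_AE)
  show "AE b in M2. e b x2 * (of_real c1 * \<psi> b) = of_real c1 * (indicator V2 b *\<^sub>R (\<phi> b * e b x2))"
   using AE_leb[OF sub2] by eventually_elim (auto simp: \<psi>_def in2)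
  have "continuous_on V2 (%b. \<phi> b * e b x2)"
   unfolding e_def by (intro continuous_intros continuous_on_subset[OF test_continuous[OF \<phi>]]) (auto simp: in2)
  then show "(%b. of_real c1 * (indicator V2 b *\<^sub>R (\<phi> b * e b x2))) \<in> borel_measurable M2"
   using measurable_on_subspace[OF sub2, of "%b. \<phi> b * e b x2"]
   by (intro borel_measurable_times) auto
 qed measurable
 also have "\<dots> = of_real c1 * FT V2 \<phi> x2"
  unfolding FT_def set_integral_def e_def by (rule integral_mult_right_zero)
 finally have "(%n. LINT b|M2. e b x2 * ?J n b) \<longlonglongrightarrow> of_real c1 * FT V2 \<phi> x2" .
 then have "?I \<longlonglongrightarrow> of_real c1 * (of_real c1 * FT V2 \<phi> x2)"
  unfolding I_eq by (intro tendsto_intros)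
 from LIMSEQ_unique[OF lim1 this] show ?thesis by (simp add: c1_def power2_eq_square)
qed

end

lemma test_bump_at:
 fixes c :: "'a::euclidean_space"
 assumes V: "subspace V" and e: "e > 0"
 obtains \<alpha> :: "'a => real" where "test_function V (%x. cplx (\<alpha> x))" "!!x. \<alpha> x \<ge> 0"
  "\<alpha> c = 1" "!!x. \<alpha> x \<noteq> 0 ==> dist c x < e" "continuous_on UNIV \<alpha>"
proof -
 obtain \<rho> :: "real => real" where \<rho>: "smooth_on UNIV (%x. cplx (\<rho> x))"
  "!!x. 0 \<le> \<rho> x" "!!x. \<bar>x\<bar> \<le> 1 ==> \<rho> x = 1" "!!x. \<bar>x\<bar> \<ge> 2 ==> \<rho> x = 0"
  using bump_exists by blast
 \<comment> \<open>The one-dimensional bump vanishes from 2 on, so at this scale every coordinate of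
   x - c is below e divided by the dimension, and the sum of the coordinates bounds the
   norm.\<close>
 define n where "n = 2 * real DIM('a) / e"
 have n: "n > 0" using e by (simp add: n_def)
 define \<alpha> where "\<alpha> x = (\<Prod>b\<in>Basis. \<rho> (n * (x \<bullet> b) + - n * (c \<bullet> b)))" for x
 have d: "dist c x < e" if "\<alpha> x \<noteq> 0" for x
 proof -
  have *: "\<bar>(x - c) \<bullet> b\<bar> < e / real DIM('a)" if b: "b \<in> Basis" for b
  proof -
   have "\<rho> (n * (x \<bullet> b) + - n * (c \<bullet> b)) \<noteq> 0" using \<open>\<alpha> x \<noteq> 0\<close> b by (simp add: \<alpha>_def)
   then have "\<bar>n * (x \<bullet> b) + - n * (c \<bullet> b)\<bar> < 2" using \<rho>(4) by (meson not_less)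
   moreover have "n * (x \<bullet> b) + - n * (c \<bullet> b) = n * ((x - c) \<bullet> b)" by (simp add: inner_diff_left algebra_simps)
   ultimately have "n * \<bar>(x - c) \<bullet> b\<bar> < 2" using n by (simp add: abs_mult)
   then show ?thesis using e by (simp add: n_def field_simps)
  qed
  have "norm (x - c) \<le> (\<Sum>b\<in>Basis. \<bar>(x - c) \<bullet> b\<bar>)" by (rule norm_le_l1)
  also have "\<dots> < (\<Sum>b\<in>(Basis::'a set). e / real DIM('a))" by (intro sum_strict_mono *) auto
  finally show ?thesis by (simp add: dist_norm norm_minus_commute)
 qed
 have "smooth_on UNIV (%x. cplx (\<rho> (n * (x \<bullet> b) + - n * (c \<bullet> b))))" for b
  by (rule smooth_compose_affine[OF subspace_UNIV subspace_UNIV _ _ _ \<rho>(1), of "%x. n * (x \<bullet> b)"])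
   (auto simp: linear_iff inner_add_left algebra_simps)
 then have sm: "smooth_on UNIV (%x. cplx (\<alpha> x))"
  unfolding \<alpha>_def of_real_prod by (intro smooth_prod subspace_UNIV)
 show thesis
 proof (rule that[of \<alpha>])
  have "supp_on V (%x. cplx (\<alpha> x)) \<subseteq> cball c e"
   unfolding supp_on_def by (rule closure_minimal) (use d in force)+
  then show "test_function V (%x. cplx (\<alpha> x))"
   unfolding test_function_alt
   using smooth_subset[OF V subspace_UNIV _ sm] compact_supp_on_subset[OF compact_cball] by auto
  show "\<alpha> x \<ge> 0" for x unfolding \<alpha>_def by (intro prod_nonneg \<rho>)
  show "\<alpha> c = 1" unfolding \<alpha>_def using \<rho>(3)[of 0] by simp
  have "continuous_on UNIV (%x. Re (cplx (\<alpha> x)))"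
   by (intro continuous_intros smooth_continuous[OF sm])
  then show "continuous_on UNIV \<alpha>" by simp
 qed (rule d)
qed

lemma orthogonal_sum_trivial: "subspace V ==> orthogonal_sum V V {0}"
 by unfold_locales auto

text \<open>The case V2 = {0} of \<open>FT_section\<close>; the measure of the zero space is the
  unit mass at 0, as its Gaussian integral shows.\<close>

lemma integral_FT:
 assumes V: "subspace V" and \<phi>: "test_function V \<phi>"
 shows "(LINT x:V|leb V. FT V \<phi> x) = of_real ((sqrt (2 * pi) ^ dim V)\<^sup>2) * \<phi> 0"
proof -
 interpret orthogonal_sum V V "{0}" by (rule orthogonal_sum_trivial[OF V])
 have "FT {0} \<phi> 0 = (LINT x|leb {0::'a}. \<phi> 0 * of_real (gauss x))"
  unfolding FT_def set_integral_def
 proof (rule integral_cong_AE)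
  show "AE x in leb {0::'a}. indicator {0} x *\<^sub>R (\<phi> x * exp (- (\<i> * cplx (x \<bullet> 0)))) = \<phi> 0 * of_real (gauss x)"
   using AE_leb[OF subspace_single_0] by eventually_elim (auto simp: gauss_def)
  have "(%x. indicator {0} x *\<^sub>R (\<phi> x * exp (- (\<i> * cplx (x \<bullet> 0))))) = (%x. indicator {0} x *\<^sub>R \<phi> 0)"
   by (auto simp: indicator_def)
  then show "(%x. indicator {0} x *\<^sub>R (\<phi> x * exp (- (\<i> * cplx (x \<bullet> 0))))) \<in> borel_measurable (leb {0::'a})"
   by simp
 qed measurable
 also have "\<dots> = \<phi> 0"
  using gauss_fourier(2)[of "{0::'a}" 0] by (simp add: gauss_def)
 finally show ?thesis using FT_section[OF \<phi>, of 0] by simp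
qed

text \<open>Pair \<open>u\<close> with the transforms of the dilates \<phi>(l / N): they concentrate
  at 0, so the pairings, all of them 0, tend after rescaling to u(0) times the integral of the
  transform of \<open>\<phi>\<close>, which is a nonzero multiple of \<phi>(0) = 1.\<close>

lemma spectrum_in_empty_0:
 assumes V: "subspace V" and u: "spectrum_in V {} u"
 shows "u 0 = 0"
proof -
 let ?M = "leb V"
 obtain \<beta> :: "'a => real" where "test_function V (%x. cplx (\<beta> x))" "\<beta> 0 = 1"
  using test_bump_at[OF V, of 1 0] by (metis zero_less_one)
 then obtain \<phi> where \<phi>: "test_function V \<phi>" "\<phi> 0 = 1"
  by (metis of_real_1)
 obtain A k where Ak: "continuous_on V u" "A \<ge> 0" "!!x. x \<in> V ==> norm (u x) \<le> A * (jap x) ^ k"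
  using u tempered_onE unfolding spectrum_in_def by metis
 obtain D where D: "D \<ge> 0" "!!x. x \<in> V ==> norm (FT V \<phi> x) * (jap x) ^ (k + DIM('a)) \<le> D"
  using FT_decay[OF V \<phi>(1)] by metis
 let ?G = "%n x. indicator V x *\<^sub>R (u ((1 / real (Suc n)) *\<^sub>R x) * FT V \<phi> x)"
 have cF: "continuous_on S (FT V \<phi>)" for S using isCont_FT[OF V \<phi>(1)] continuous_on_subset by blast
 have cG: "continuous_on V (%x. u ((1 / real (Suc n)) *\<^sub>R x) * FT V \<phi> x)" for n
  by (intro continuous_on_mult cF continuous_on_compose2[OF Ak(1)] continuous_intros)
   (auto intro: subspace_scale[OF V])
 have mG: "?G n \<in> borel_measurable borel" for n
  by (rule measurable_on_subspace[OF V cG])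
 have zero: "(LINT x|?M. ?G n x) = 0" for n
 proof -
  let ?N = "real (Suc n)"
  have "?N \<ge> 1" by simp
  then obtain s where s: "s > 0"
   "!!f :: 'a => complex. f \<in> borel_measurable borel ==> (LINT x|?M. f (?N *\<^sub>R x)) = of_real s * (LINT x|?M. f x)"
   using leb_scale[OF V] by metis
  let ?\<psi> = "%l. \<phi> ((1 / ?N) *\<^sub>R l)"
  have \<psi>: "test_function V ?\<psi>"
  proof -
   obtain R where R: "!!x. x \<in> supp_on V \<phi> ==> norm x \<le> R"
    using \<phi>(1) compact_imp_bounded bounded_iff unfolding test_function_alt by metis
   have "supp_on V ?\<psi> \<subseteq> cball 0 (?N * R)"
    unfolding supp_on_def
   proof (rule closure_minimal)
    show "{x \<in> V. \<phi> ((1 / ?N) *\<^sub>R x) \<noteq> 0} \<subseteq> cball 0 (?N * R)"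
    proof safe
     fix x assume x: "x \<in> V" "\<phi> ((1 / ?N) *\<^sub>R x) \<noteq> 0"
     have "norm ((1 / ?N) *\<^sub>R x) \<le> R" by (intro R in_supp_on x subspace_scale V)
     then show "x \<in> cball 0 (?N * R)" by (simp add: field_simps del: of_nat_Suc)
    qed
   qed simp
   moreover have "smooth_on V ?\<psi>"
    by (rule smooth_compose_linear[OF V V _ _ test_smooth[OF \<phi>(1)]])
     (auto simp: linear_iff scaleR_add_right intro: subspace_scale[OF V])
   ultimately show ?thesis using compact_supp_on_subset[OF compact_cball] by (auto simp: test_function_alt)
  qed
  have FT\<psi>: "FT V \<phi> (?N *\<^sub>R x) = of_real s * FT V ?\<psi> x" for x
  proof -
   let ?f = "%l. indicator V ((1 / ?N) *\<^sub>R l) *\<^sub>R (\<phi> ((1 / ?N) *\<^sub>R l) * exp (- (\<i> * cplx (l \<bullet> x))))"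
   have ind: "indicator V ((1 / ?N) *\<^sub>R l) = (indicator V l :: real)" for l
    using subspace_scale[OF V, of l "1 / ?N"] subspace_scale[OF V, of "(1 / ?N) *\<^sub>R l" ?N]
    by (auto simp: indicator_def simp del: of_nat_Suc)
   have "continuous_on V (%l. ?\<psi> l * exp (- (\<i> * cplx (l \<bullet> x))))"
    by (intro continuous_on_mult test_continuous[OF \<psi>] continuous_on_fourier_kernel)
   from measurable_on_subspace[OF V this]
   have m: "?f \<in> borel_measurable borel" unfolding ind .
   have "FT V \<phi> (?N *\<^sub>R x) = (LINT l|?M. ?f (?N *\<^sub>R l))"
    unfolding FT_def set_integral_def by (intro integral_congI) (auto simp del: of_nat_Suc)
   also have "\<dots> = of_real s * (LINT l|?M. ?f l)" by (rule s(2)[OF m])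
   finally show ?thesis unfolding ind by (simp only: FT_def set_integral_def)
  qed
  have "of_real s * (LINT x|?M. ?G n x) = (LINT x|?M. ?G n (?N *\<^sub>R x))" by (rule s(2)[OF mG, symmetric])
  also have "\<dots> = (LINT x|?M. of_real s * (indicator V x *\<^sub>R (u x * FT V ?\<psi> x)))"
  proof (intro integral_congI refl)
   fix x
   have "?N *\<^sub>R x \<in> V \<longleftrightarrow> x \<in> V"
    using subspace_scale[OF V, of x ?N] subspace_scale[OF V, of "?N *\<^sub>R x" "1 / ?N"] by (auto simp del: of_nat_Suc)
   then show "?G n (?N *\<^sub>R x) = of_real s * (indicator V x *\<^sub>R (u x * FT V ?\<psi> x))"
    unfolding FT\<psi> by (auto simp: indicator_def simp del: of_nat_Suc)
  qed
  also have "\<dots> = of_real s * (LINT x:V|?M. u x * FT V ?\<psi> x)"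
   unfolding set_integral_def by (rule integral_mult_right_zero)
  also have "\<dots> = 0" using u \<psi> by (simp add: spectrum_in_def)
  finally show ?thesis using s(1) by simp
 qed
 have "(%n. LINT x|?M. ?G n x) \<longlonglongrightarrow> (LINT x|?M. indicator V x *\<^sub>R (u 0 * FT V \<phi> x))"
 proof (rule integral_dominated_convergence[where w = "%x. A * D * weight x"])
  show "integrable ?M (%x. A * D * weight x)" by (intro integrable_mult_right integrable_weight V)
  have "continuous_on V (%x. u 0 * FT V \<phi> x)" by (intro continuous_intros cF)
  from measurable_on_subspace[OF V this]
  show "(%x. indicator V x *\<^sub>R (u 0 * FT V \<phi> x)) \<in> borel_measurable ?M" by simp
  show "?G n \<in> borel_measurable ?M" for n using mG[of n] by simp
  show "AE x in ?M. (%n. ?G n x) \<longlonglongrightarrow> indicator V x *\<^sub>R (u 0 * FT V \<phi> x)"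
   using AE_leb[OF V]
  proof eventually_elim
   fix x assume x: "x \<in> V"
   have "(%n. 1 / real (Suc n)) \<longlonglongrightarrow> 0" using LIMSEQ_inverse_real_of_nat by (simp add: inverse_eq_divide)
   then have "(%n. (1 / real (Suc n)) *\<^sub>R x) \<longlonglongrightarrow> 0 *\<^sub>R x" by (intro tendsto_intros)
   then have "(%n. u ((1 / real (Suc n)) *\<^sub>R x)) \<longlonglongrightarrow> u (0 *\<^sub>R x)"
    using x by (intro continuous_on_tendsto_compose[OF Ak(1)]) (auto intro!: always_eventually subspace_scale[OF V] subspace_0[OF V])
   then show "(%n. ?G n x) \<longlonglongrightarrow> indicator V x *\<^sub>R (u 0 * FT V \<phi> x)"
    by (intro tendsto_intros) simp
  qed
  show "AE x in ?M. norm (?G n x) \<le> A * D * weight x" for n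
   using AE_leb[OF V]
  proof eventually_elim
   fix x assume x: "x \<in> V"
   let ?y = "(1 / real (Suc n)) *\<^sub>R x"
   have "norm ?y \<le> 1 * norm x" unfolding norm_scaleR by (intro mult_right_mono) auto
   then have "(jap ?y) ^ k \<le> (jap x) ^ k" by (intro power_mono add_left_mono) auto
   then have "norm (u ?y) \<le> A * (jap x) ^ k"
    using Ak(3)[OF subspace_scale[OF V x]] Ak(2) by (meson mult_left_mono order_trans)
   then have "norm (u ?y * FT V \<phi> x) * (jap x) ^ DIM('a) \<le> A * (jap x) ^ k * norm (FT V \<phi> x) * (jap x) ^ DIM('a)"
    unfolding norm_mult by (intro mult_right_mono) auto
   also have "\<dots> = A * (norm (FT V \<phi> x) * (jap x) ^ (k + DIM('a)))" by (simp add: power_add)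
   also have "\<dots> \<le> A * D" by (intro mult_left_mono D Ak x)
   finally show "norm (?G n x) \<le> A * D * weight x" using x by (subst le_weight_iff) simp
  qed
 qed
 then have "0 = (LINT x|?M. indicator V x *\<^sub>R (u 0 * FT V \<phi> x))" unfolding zero LIMSEQ_const_iff .
 also have "\<dots> = u 0 * (LINT x:V|?M. FT V \<phi> x)"
  unfolding set_integral_def by (subst integral_mult_right_zero[symmetric]) simp
 finally show ?thesis by (simp add: integral_FT[OF V \<phi>(1)] \<phi>(2))
qed

lemma spectrum_in_empty:
 assumes V: "subspace V" and u: "spectrum_in V {} u" and a: "a \<in> V"
 shows "u a = 0"
 using spectrum_in_empty_0[OF V spectrum_in_translate[OF V u a]] by simp

context orthogonal_sum
begin

text \<open>Integrating the test transform over V1 first gives, by \<open>FT_section\<close>, the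
  transform of the restriction of \<open>\<phi>\<close> to V2, so the pairing reduces to that of
  \<open>w\<close>.\<close>

lemma spectrum_in_proj2:
 assumes w: "spectrum_in V2 K w" and K: "K \<subseteq> V2"
 shows "spectrum_in V K (%x. w (proj2 x))"
 unfolding spectrum_in_def
proof (intro conjI allI impI)
 interpret P: pair_sigma_finite M1 M2 by (rule sigma_finite_pair)
 show t: "tempered_on V (%x. w (proj2 x))"
  using tempered_on_compose_affine[OF _ linear_proj(2), of V2 w V 0] w proj_in(2) by (auto simp: spectrum_in_def)
 fix \<phi> assume \<phi>: "test_function V \<phi> \<and> supp_on V \<phi> \<inter> K = {}"
 let ?h = "%x. indicator V x *\<^sub>R (w (proj2 x) * FT V \<phi> x)"
 have i: "integrable (leb V) ?h"
  using tempered_pairing_integrable[OF sub _ t, of \<phi>] \<phi> by (simp add: set_integrable_def)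
 then have m[measurable]: "?h \<in> borel_measurable borel" by auto
 have i': "integrable (M1 \<Otimes>\<^sub>M M2) (%(a, b). ?h (a + b))"
  using i unfolding leb_eq_distr by (subst (asm) integrable_distr_eq) (simp_all add: case_prod_unfold)
 have t2: "test_function V2 \<phi>"
 proof -
  have "supp_on V2 \<phi> \<subseteq> supp_on V \<phi>" unfolding supp_on_def by (intro closure_mono) (auto simp: in2)
  moreover have "V2 \<subseteq> V" using in2 by auto
  ultimately show ?thesis using \<phi> smooth_subset[OF sub2 sub] compact_supp_on_subset
   by (auto simp: test_function_alt)
 qed
 have s2: "supp_on V2 \<phi> \<inter> K = {}"
 proof -
  have "supp_on V2 \<phi> \<subseteq> supp_on V \<phi>" unfolding supp_on_def by (intro closure_mono) (auto simp: in2)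
  then show ?thesis using \<phi> by auto
 qed
 let ?c = "cplx ((sqrt (2 * pi) ^ dim V1)\<^sup>2)"
 have "(LINT x:V|leb V. w (proj2 x) * FT V \<phi> x) = (LINT z|(M1 \<Otimes>\<^sub>M M2). ?h (fst z + snd z))"
  unfolding set_integral_def by (rule LINT_split[OF m])
 also have "\<dots> = (LINT b|M2. LINT a|M1. ?h (a + b))"
  using P.integral_snd[OF i'] by (simp add: case_prod_unfold)
 also have "\<dots> = (LINT b|M2. ?c * (indicator V2 b *\<^sub>R (w b * FT V2 \<phi> b)))"
 proof (rule integral_cong_AE)
  show "AE b in M2. (LINT a|M1. ?h (a + b)) = ?c * (indicator V2 b *\<^sub>R (w b * FT V2 \<phi> b))"
   using AE_leb[OF sub2]
  proof eventually_elim
   fix b assume b: "b \<in> V2"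
   have "continuous_on V1 (%a. FT V \<phi> (a + b))"
    using \<phi> by (intro continuous_on_compose2[OF isCont_FT[OF sub]] continuous_intros) auto
   from measurable_on_subspace[OF sub1 this]
   have m1: "(%a. w b * (indicator V1 a *\<^sub>R FT V \<phi> (a + b))) \<in> borel_measurable M1" by (intro borel_measurable_times) auto
   have "(LINT a|M1. ?h (a + b)) = (LINT a|M1. w b * (indicator V1 a *\<^sub>R FT V \<phi> (a + b)))"
   proof (rule integral_cong_AE)
    show "AE a in M1. ?h (a + b) = w b * (indicator V1 a *\<^sub>R FT V \<phi> (a + b))"
     using AE_leb[OF sub1] by eventually_elim (use b in \<open>auto simp: add_in proj_add\<close>)
   qed (use m1 in measurable)
   also have "\<dots> = w b * (LINT a:V1|M1. FT V \<phi> (a + b))"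
    unfolding set_integral_def by (rule integral_mult_right_zero)
   finally show "(LINT a|M1. ?h (a + b)) = ?c * (indicator V2 b *\<^sub>R (w b * FT V2 \<phi> b))"
    using FT_section[of \<phi> b] b \<phi> by simp
  qed
  have "set_integrable M2 V2 (%b. w b * FT V2 \<phi> b)"
   using tempered_pairing_integrable[OF sub2 t2] w by (auto simp: spectrum_in_def)
  then show "(%b. ?c * (indicator V2 b *\<^sub>R (w b * FT V2 \<phi> b))) \<in> borel_measurable M2"
   unfolding set_integrable_def by (intro borel_measurable_times borel_measurable_const borel_measurable_integrable)
  show "(%b. LINT a|M1. ?h (a + b)) \<in> borel_measurable M2"
   by (rule P.M1.borel_measurable_lebesgue_integral) (use m in measurable)
 qed
 also have "\<dots> = ?c * (LINT b:V2|M2. w b * FT V2 \<phi> b)"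
  unfolding set_integral_def by (rule integral_mult_right_zero)
 also have "\<dots> = 0" using w t2 s2 by (simp add: spectrum_in_def)
 finally show "(LINT x:V|leb V. w (proj2 x) * FT V \<phi> x) = 0" .
qed

section \<open>Products of test functions on the summands\<close>

lemma test_tensor:
 assumes f: "test_function V1 f" and g: "test_function V2 g"
 shows "test_function V (%l. f (proj1 l) * g (proj2 l))"
  "!!l. l \<in> supp_on V (%l. f (proj1 l) * g (proj2 l)) ==> proj1 l \<in> supp_on V1 f \<and> proj2 l \<in> supp_on V2 g"
proof -
 let ?\<phi> = "%l. f (proj1 l) * g (proj2 l)"
 have cl: "continuous_on UNIV proj1" "continuous_on UNIV proj2"
  using linear_proj linear_continuous_on linear_conv_bounded_linear by blast+
 have s: "supp_on V ?\<phi> \<subseteq> proj1 -` supp_on V1 f \<inter> proj2 -` supp_on V2 g"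
  unfolding supp_on_def[of V]
 proof (rule closure_minimal)
  show "{x \<in> V. ?\<phi> x \<noteq> 0} \<subseteq> proj1 -` supp_on V1 f \<inter> proj2 -` supp_on V2 g"
   by (auto intro!: in_supp_on proj_in)
  show "closed (proj1 -` supp_on V1 f \<inter> proj2 -` supp_on V2 g)"
   using continuous_closed_vimage[of "supp_on V1 f" proj1] continuous_closed_vimage[of "supp_on V2 g" proj2] cl
   by (intro closed_Int) (auto simp: supp_on_def continuous_on_eq_continuous_at)
 qed
 then show "proj1 l \<in> supp_on V1 f \<and> proj2 l \<in> supp_on V2 g" if "l \<in> supp_on V ?\<phi>" for l
  using that by auto
 have c: "compact ((%(x, y). x + y) ` (supp_on V1 f \<times> supp_on V2 g))"
  using f g by (intro compact_continuous_image compact_Times) (auto simp: test_function_alt case_prod_beta intro!: continuous_intros)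
 have "supp_on V ?\<phi> \<subseteq> V" unfolding supp_on_def by (rule closure_minimal[OF _ closed_subspace[OF sub]]) auto
 then have "supp_on V ?\<phi> \<subseteq> (%(x, y). x + y) ` (supp_on V1 f \<times> supp_on V2 g)"
  using s proj_sum by (force simp: image_iff)
 moreover have "smooth_on V ?\<phi>"
  using f g by (intro smooth_mult sub smooth_compose_linear[OF sub sub1 linear_proj(1)] smooth_compose_linear[OF sub sub2 linear_proj(2)] proj_in test_smooth)
 ultimately show "test_function V ?\<phi>" using compact_supp_on_subset[OF c] by (simp add: test_function_alt)
qed

lemma FT_tensor:
 assumes f: "test_function V1 f" and g: "test_function V2 g" and x: "x1 \<in> V1" "x2 \<in> V2"
 shows "FT V (%l. f (proj1 l) * g (proj2 l)) (x1 + x2) = FT V1 f x1 * FT V2 g x2"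
proof -
 interpret P: pair_sigma_finite M1 M2 by (rule sigma_finite_pair)
 let ?\<phi> = "%l. f (proj1 l) * g (proj2 l)"
 let ?h = "%l. indicator V l *\<^sub>R (?\<phi> l * exp (- (\<i> * cplx (l \<bullet> (x1 + x2)))))"
 let ?f = "%l. indicator V1 l *\<^sub>R (f l * exp (- (\<i> * cplx (l \<bullet> x1))))"
 let ?g = "%l. indicator V2 l *\<^sub>R (g l * exp (- (\<i> * cplx (l \<bullet> x2))))"
 have i: "integrable (leb V) ?h"
  using FT_integrable[OF sub test_tensor(1)[OF f g]] by (simp add: set_integrable_def)
 then have m[measurable]: "?h \<in> borel_measurable borel" by auto
 have fi: "integrable M1 ?f" "integrable M2 ?g"
  using FT_integrable[OF sub1 f] FT_integrable[OF sub2 g] by (simp_all add: set_integrable_def)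
 then have fm[measurable]: "?f \<in> borel_measurable borel" "?g \<in> borel_measurable borel" by auto
 have pi: "integrable (M1 \<Otimes>\<^sub>M M2) (%z. ?f (fst z) * ?g (snd z))"
 proof (rule integrable_pair[where wl = "%a. norm (?f a)" and wr = "%a. norm (?g a)"])
  show "(%z. ?f (fst z) * ?g (snd z)) \<in> borel_measurable (M1 \<Otimes>\<^sub>M M2)" using fm by measurable
  show "integrable M1 (%a. norm (?f a))" "integrable M2 (%a. norm (?g a))"
   by (intro integrable_norm fi)+
 qed (auto simp: norm_mult)
 have "FT V ?\<phi> (x1 + x2) = (LINT z|(M1 \<Otimes>\<^sub>M M2). ?h (fst z + snd z))"
  unfolding FT_def set_integral_def by (rule LINT_split[OF m])
 also have "\<dots> = (LINT z|(M1 \<Otimes>\<^sub>M M2). ?f (fst z) * ?g (snd z))"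
 proof (rule integral_cong_AE)
  show "AE z in M1 \<Otimes>\<^sub>M M2. ?h (fst z + snd z) = ?f (fst z) * ?g (snd z)"
   using AE_split
  proof eventually_elim
   fix z :: "'a \<times> 'a" assume z: "fst z \<in> V1 \<and> snd z \<in> V2"
   then have "(fst z + snd z) \<bullet> (x1 + x2) = fst z \<bullet> x1 + snd z \<bullet> x2" using x by (intro inner_add_add) auto
   then show "?h (fst z + snd z) = ?f (fst z) * ?g (snd z)"
    using z by (simp add: add_in proj_add distrib_left exp_diff exp_minus field_simps)
  qed
 qed (use m fm in measurable)
 also have "\<dots> = (LINT b|M2. LINT a|M1. ?f a * ?g b)"
  using P.integral_snd[of "%a b. ?f a * ?g b"] pi by (simp only: case_prod_unfold)
 also have "\<dots> = (LINT b|M2. (LINT a|M1. ?f a) * ?g b)" by (simp only: integral_mult_left_zero)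
 also have "\<dots> = (LINT a|M1. ?f a) * (LINT b|M2. ?g b)" by (rule integral_mult_right_zero)
 finally show ?thesis by (simp add: FT_def set_integral_def)
qed

text \<open>Evaluation at a fixed \<open>a\<close> is not the transpose of an operation on test
  functions. So the pairing over V2 is regarded as a function of the V1 variable; tested against an
  arbitrary \<open>f\<close>, it becomes a pairing of \<open>u\<close> with a tensor product whose
  support misses K. Hence it has empty spectrum and vanishes at every point.\<close>

lemma spectrum_in_section:
 assumes u: "spectrum_in V K u" and K: "K \<subseteq> V2" and a: "a \<in> V1"
 shows "spectrum_in V2 K (%x2. u (a + x2))"
 unfolding spectrum_in_def
proof (intro conjI allI impI)
 interpret P: pair_sigma_finite M1 M2 by (rule sigma_finite_pair)
 have tu: "tempered_on V u" using u by (simp add: spectrum_in_def)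
 show "tempered_on V2 (%x2. u (a + x2))"
  using tempered_on_compose_affine[OF tu linear_id, of V2 a] add_in[OF a] by (simp add: add.commute)
 fix g assume g: "test_function V2 g \<and> supp_on V2 g \<inter> K = {}"
 obtain A k where Ak: "continuous_on V u" "A \<ge> 0" "!!x. x \<in> V ==> norm (u x) \<le> A * (jap x) ^ k"
  using tempered_onE[OF tu] by metis
 obtain D where D: "D \<ge> 0" "!!x. x \<in> V2 ==> norm (FT V2 g x) * (jap x) ^ (k + DIM('a)) \<le> D"
  using FT_decay[OF sub2] g by metis
 have cg: "continuous_on S (FT V2 g)" for S using isCont_FT[OF sub2] g continuous_on_subset by blast
 define p where "p x1 = (LINT x2:V2|M2. u (x1 + x2) * FT V2 g x2)" for x1
 have split_le: "(jap (x1 + x2)) ^ k \<le> (jap x1) ^ k * (jap x2) ^ k" if "x1 \<in> V1" "x2 \<in> V2" for x1 x2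
  unfolding power_mult_distrib[symmetric] norm_add[OF that]
  by (intro power_mono) (auto simp: algebra_simps)
 have le: "norm (u (x1 + x2) * FT V2 g x2) * (jap x2) ^ DIM('a) \<le> A * (jap x1) ^ k * D"
  if x: "x1 \<in> V1" "x2 \<in> V2" for x1 x2
 proof -
  have "norm (u (x1 + x2)) \<le> A * ((jap x1) ^ k * (jap x2) ^ k)"
   using Ak(3)[OF add_in[OF x]] split_le[OF x] Ak(2) by (meson mult_left_mono order_trans)
  then have "norm (u (x1 + x2) * FT V2 g x2) * (jap x2) ^ DIM('a) \<le>
    A * ((jap x1) ^ k * (jap x2) ^ k) * norm (FT V2 g x2) * (jap x2) ^ DIM('a)"
   unfolding norm_mult by (intro mult_right_mono) auto
  also have "\<dots> = A * (jap x1) ^ k * (norm (FT V2 g x2) * (jap x2) ^ (k + DIM('a)))"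
   by (simp add: power_add)
  also have "\<dots> \<le> A * (jap x1) ^ k * D" by (intro mult_left_mono D x) (use Ak in auto)
  finally show ?thesis .
 qed
 have cu: "continuous_on V2 (%x2. u (x1 + x2) * FT V2 g x2)" if "x1 \<in> V1" for x1
  by (intro continuous_on_mult cg continuous_on_compose2[OF Ak(1)] continuous_intros) (auto intro: add_in that)
 have p_le: "norm (p x1) \<le> (A * D * total_weight V2) * (jap x1) ^ k" if "x1 \<in> V1" for x1
  using set_integrable_decay(2)[OF sub2 cu[OF that] le[OF that]] unfolding p_def by (simp add: mult_ac)
 have p_cont: "continuous_on V1 p"
  unfolding continuous_on_sequentially
 proof (intro ballI allI impI)
  fix s x assume x: "x \<in> V1" and s: "(\<forall>n. s n \<in> V1) \<and> s \<longlonglongrightarrow> x"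
  then obtain R where R: "!!n. norm (s n) \<le> R" by (metis Bseq_def convergentI convergent_imp_Bseq)
  show "(p \<circ> s) \<longlonglongrightarrow> p x"
   unfolding p_def o_def set_integral_def
  proof (rule integral_dominated_convergence[where w = "%x2. (A * (1 + R\<^sup>2) ^ k * D) * weight x2"])
   show "integrable M2 (%x2. (A * (1 + R\<^sup>2) ^ k * D) * weight x2)"
    by (intro integrable_mult_right integrable_weight sub2)
   show "(%xa. indicator V2 xa *\<^sub>R (u (x + xa) * FT V2 g xa)) \<in> borel_measurable M2"
    using measurable_on_subspace[OF sub2 cu[OF x]] by simp
   show "(%xa. indicator V2 xa *\<^sub>R (u (s n + xa) * FT V2 g xa)) \<in> borel_measurable M2" for n
    using measurable_on_subspace[OF sub2 cu] s by simp
   show "AE x2 in M2. (%n. indicator V2 x2 *\<^sub>R (u (s n + x2) * FT V2 g x2)) \<longlonglongrightarrow> indicator V2 x2 *\<^sub>R (u (x + x2) * FT V2 g x2)"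
    using AE_leb[OF sub2]
   proof eventually_elim
    fix x2 assume "x2 \<in> V2"
    then have "(%n. u (s n + x2)) \<longlonglongrightarrow> u (x + x2)"
     using s x by (intro continuous_on_tendsto_compose[OF Ak(1)] tendsto_intros) (auto intro!: always_eventually add_in)
    then show "(%n. indicator V2 x2 *\<^sub>R (u (s n + x2) * FT V2 g x2)) \<longlonglongrightarrow> indicator V2 x2 *\<^sub>R (u (x + x2) * FT V2 g x2)"
     by (intro tendsto_intros)
   qed
   show "AE x2 in M2. norm (indicator V2 x2 *\<^sub>R (u (s n + x2) * FT V2 g x2)) \<le> (A * (1 + R\<^sup>2) ^ k * D) * weight x2" for n
    using AE_leb[OF sub2]
   proof eventually_elim
    fix x2 assume x2: "x2 \<in> V2"
    have "(norm (s n))\<^sup>2 \<le> R\<^sup>2" using R[of n] by (intro power_mono) auto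
    then have "A * (jap (s n)) ^ k * D \<le> A * (1 + R\<^sup>2) ^ k * D"
     using Ak(2) D(1) by (intro mult_right_mono mult_left_mono power_mono) auto
    then show "norm (indicator V2 x2 *\<^sub>R (u (s n + x2) * FT V2 g x2)) \<le> (A * (1 + R\<^sup>2) ^ k * D) * weight x2"
     using le[of "s n" x2] s x2 by (subst le_weight_iff) auto
   qed
  qed
 qed
 have "spectrum_in V1 {} p"
  unfolding spectrum_in_def
 proof (intro conjI allI impI)
  show tp: "tempered_on V1 p" using p_le p_cont unfolding tempered_on_def by blast
  fix f assume "test_function V1 f \<and> supp_on V1 f \<inter> {} = {}"
  then have f: "test_function V1 f" by simp
  let ?\<phi> = "%l. f (proj1 l) * g (proj2 l)"
  let ?h = "%x. indicator V x *\<^sub>R (u x * FT V ?\<phi> x)"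
  have t: "test_function V ?\<phi>" using test_tensor(1)[OF f] g by blast
  have s: "supp_on V ?\<phi> \<inter> K = {}"
  proof (rule ccontr)
   assume "supp_on V ?\<phi> \<inter> K \<noteq> {}"
   then obtain l where l: "l \<in> supp_on V ?\<phi>" "l \<in> K" by auto
   have "proj2 l = l" by (rule proj_simps(3)) (use K l in auto)
   moreover have "proj2 l \<in> supp_on V2 g" using test_tensor(2)[OF f _ l(1)] g by simp
   ultimately show False using g l by auto
  qed
  have i: "integrable (leb V) ?h"
   using tempered_pairing_integrable[OF sub t tu] by (simp add: set_integrable_def)
  then have m[measurable]: "?h \<in> borel_measurable borel" by auto
  have i': "integrable (M1 \<Otimes>\<^sub>M M2) (%(a, b). ?h (a + b))"
   using i unfolding leb_eq_distr by (subst (asm) integrable_distr_eq) (simp_all add: case_prod_unfold)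
  have "0 = (LINT x:V|leb V. u x * FT V ?\<phi> x)" using u t s by (simp add: spectrum_in_def)
  also have "\<dots> = (LINT z|(M1 \<Otimes>\<^sub>M M2). ?h (fst z + snd z))"
   unfolding set_integral_def by (rule LINT_split[OF m])
  also have "\<dots> = (LINT a|M1. LINT b|M2. ?h (a + b))"
   using P.integral_fst'[OF i'] by (simp add: case_prod_unfold)
  also have "\<dots> = (LINT a:V1|M1. p a * FT V1 f a)"
   unfolding set_integral_def[of M1]
  proof (rule integral_cong_AE)
   show "(%a. LINT b|M2. ?h (a + b)) \<in> borel_measurable M1"
    by (rule P.M2.borel_measurable_lebesgue_integral) (use m in measurable)
   show "(%a. indicator V1 a *\<^sub>R (p a * FT V1 f a)) \<in> borel_measurable M1"
    using tempered_pairing_integrable[OF sub1 f tp] by (auto simp: set_integrable_def)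
   show "AE a in M1. (LINT b|M2. ?h (a + b)) = indicator V1 a *\<^sub>R (p a * FT V1 f a)"
    using AE_leb[OF sub1]
   proof eventually_elim
    fix a assume a: "a \<in> V1"
    have "(LINT b|M2. ?h (a + b)) = (LINT b|M2. FT V1 f a * (indicator V2 b *\<^sub>R (u (a + b) * FT V2 g b)))"
    proof (rule integral_cong_AE)
     show "AE b in M2. ?h (a + b) = FT V1 f a * (indicator V2 b *\<^sub>R (u (a + b) * FT V2 g b))"
      using AE_leb[OF sub2] by eventually_elim (use a g in \<open>auto simp: add_in FT_tensor[OF f]\<close>)
     have "(%b. indicator V2 b *\<^sub>R (u (a + b) * FT V2 g b)) \<in> borel_measurable borel"
      by (rule measurable_on_subspace[OF sub2 cu[OF a]])
     then show "(%b. FT V1 f a * (indicator V2 b *\<^sub>R (u (a + b) * FT V2 g b))) \<in> borel_measurable M2"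
      by (intro borel_measurable_times) auto
    qed (use m in measurable)
    also have "\<dots> = FT V1 f a * p a" unfolding p_def set_integral_def by (rule integral_mult_right_zero)
    finally show "(LINT b|M2. ?h (a + b)) = indicator V1 a *\<^sub>R (p a * FT V1 f a)" using a by simp
   qed
  qed
  finally show "(LINT a:V1|M1. p a * FT V1 f a) = 0" by simp
 qed
 from spectrum_in_empty[OF sub1 this a] show "(LINT x2:V2|M2. u (a + x2) * FT V2 g x2) = 0" by (simp add: p_def)
qed

end

section \<open>Functions whose spectrum is orthogonal to a direction\<close>

text \<open>A zero of order n at the origin, in recursive form so that each derivative lowers the
  index by one.\<close>

primrec vanishes :: "nat => (real => complex) => bool" where
 "vanishes 0 f \<longleftrightarrow> smooth_on UNIV f"
| "vanishes (Suc n) f \<longleftrightarrow> smooth_on UNIV f \<and> f 0 = 0 \<and> vanishes n (dir_deriv 1 f)"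

lemma vanishes_smooth: "vanishes n f ==> smooth_on UNIV f"
 by (cases n) auto

lemma vanishes_dir_deriv: "vanishes n f ==> vanishes (n - 1) (dir_deriv 1 f)"
 by (cases n) (auto intro: smooth_dir_deriv)

lemma smooth_real_deriv:
 assumes "smooth_on UNIV (f :: real => complex)"
 shows "(f has_vector_derivative dir_deriv 1 f s) (at s)"
proof -
 have "has_dir_deriv 1 f (dir_deriv 1 f s) s" by (rule smooth_has_dir_deriv[OF assms]) auto
 then have "((%r. f (0 + r *\<^sub>R 1)) has_vector_derivative dir_deriv 1 f s) (at s)"
  by (intro has_dir_deriv_line) simp
 then show ?thesis by simp
qed

text \<open>Mean value theorem, once for each order. The interval [-2, 2] is the one to which the
  cut-offs \<open>\<theta>\<close> are confined.\<close>

lemma vanishes_bound: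
 assumes "vanishes n f"
 shows "\<exists>C\<ge>0. \<forall>s. \<bar>s\<bar> \<le> 2 \<longrightarrow> norm (f s) \<le> C * \<bar>s\<bar> ^ n"
 using assms
proof (induction n arbitrary: f)
 case 0
 then have "compact (f ` cball 0 2)"
  by (intro compact_continuous_image continuous_on_subset[OF smooth_continuous]) auto
 then obtain C where "!!y. y \<in> f ` cball 0 2 ==> norm y \<le> C"
  using compact_imp_bounded bounded_iff by metis
 then show ?case by (intro exI[of _ "max C 0"]) (auto simp: le_max_iff_disj)
next
 case (Suc n)
 then obtain C where C: "C \<ge> 0" "!!s. \<bar>s\<bar> \<le> 2 ==> norm (dir_deriv 1 f s) \<le> C * \<bar>s\<bar> ^ n"
  by (metis vanishes.simps(2))
 have "norm (f s) \<le> C * \<bar>s\<bar> ^ Suc n" if s: "\<bar>s\<bar> \<le> 2" for s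
 proof -
  have "norm (f s - f 0) \<le> (C * \<bar>s\<bar> ^ n) * norm (s - 0)"
  proof (rule differentiable_bound[where S = "closed_segment 0 s" and f' = "%r h. h *\<^sub>R dir_deriv 1 f r"])
   fix r assume r: "r \<in> closed_segment 0 s"
   then have rs: "\<bar>r\<bar> \<le> \<bar>s\<bar>" by (auto simp: closed_segment_eq_real_ivl split: if_splits)
   show "(f has_derivative (%h. h *\<^sub>R dir_deriv 1 f r)) (at r within closed_segment 0 s)"
    using smooth_real_deriv[OF vanishes_smooth[OF Suc.prems], of r]
    by (simp add: has_vector_derivative_def has_derivative_at_withinI)
   have "norm (dir_deriv 1 f r) \<le> C * \<bar>s\<bar> ^ n"
    using C(2)[of r] rs s C(1) by (smt (verit) abs_ge_zero mult_left_mono power_mono)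
   then show "onorm (%h. h *\<^sub>R dir_deriv 1 f r) \<le> C * \<bar>s\<bar> ^ n"
    using C(1) by (intro onorm_bound) (auto simp: mult.commute[of _ "\<bar>_\<bar>"] intro: mult_left_mono)
  qed auto
  then show ?thesis using Suc.prems by (simp add: mult_ac)
 qed
 with C(1) show ?case by blast
qed

text \<open>The i-th derivative at 0 is the i-th moment of the coefficients.\<close>

lemma vanishes_exp_sum:
 assumes "finite J" "!!i. i < n ==> (\<Sum>j\<in>J. c j * a j ^ i) = 0"
 shows "vanishes n (%s. \<Sum>j\<in>J. c j * exp (a j * cplx s))"
 using assms(2)
proof (induction n arbitrary: c)
 case 0
 then show ?case by (auto intro!: smooth_sum smooth_cexp subspace_UNIV)
next
 case (Suc n)
 have sm: "smooth_on UNIV (%s. \<Sum>j\<in>J. c j * exp (a j * cplx s))"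
  by (auto intro!: smooth_sum smooth_cexp subspace_UNIV)
 have "dir_deriv 1 (%s. \<Sum>j\<in>J. c j * exp (a j * cplx s)) = (%s. \<Sum>j\<in>J. (c j * a j) * exp (a j * cplx s))"
 proof
  fix s :: real
  have d: "((%s. c j * exp (a j * cplx s)) has_vector_derivative c j * a j * exp (a j * cplx s)) (at s)" for j
   by (rule has_vector_derivative_real_field) (auto intro!: derivative_eq_intros)
  have "((%s. \<Sum>j\<in>J. c j * exp (a j * cplx s)) has_vector_derivative
    (\<Sum>j\<in>J. (c j * a j) * exp (a j * cplx s))) (at s)"
   by (intro has_vector_derivative_sum d)
  then show "dir_deriv 1 (%s. \<Sum>j\<in>J. c j * exp (a j * cplx s)) s = (\<Sum>j\<in>J. (c j * a j) * exp (a j * cplx s))"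
   using smooth_real_deriv[OF sm] vector_derivative_unique_at by blast
 qed
 moreover have "vanishes n (%s. \<Sum>j\<in>J. (c j * a j) * exp (a j * cplx s))"
  using Suc.prems[of "Suc _"] by (intro Suc.IH) (simp add: mult.assoc)
 ultimately show ?case using sm Suc.prems[of 0] by simp
qed

text \<open>Rescaled cut-offs \<open>M ^ c * f (l \<bullet> y) * \<theta> (M * (l \<bullet> y)) * \<beta> l\<close>: each derivative costs one power of
 \<open>M\<close>, compensated by the order of vanishing of \<open>f\<close> on the strip where \<open>\<theta> (M * (l \<bullet> y))\<close> lives.\<close>

inductive cutoff_family :: "'a::euclidean_space set => 'a => nat => (nat => 'a => complex) => bool"
 for V y where
 gen: "vanishes n f ==> smooth_on UNIV \<theta> ==> (!!s. \<bar>s\<bar> > 2 ==> \<theta> s = 0) ==>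
  test_function V \<beta> ==> n \<ge> c + a ==>
  cutoff_family V y a (%M l. of_nat M ^ c * (f (l \<bullet> y) * (\<theta> (l \<bullet> (real M *\<^sub>R y)) * \<beta> l)))"
| zero: "cutoff_family V y a (%M l. 0)"
| add: "cutoff_family V y a \<gamma> ==> cutoff_family V y a \<delta> ==> cutoff_family V y a (%M l. \<gamma> M l + \<delta> M l)"
| cmult: "cutoff_family V y a \<gamma> ==> cutoff_family V y a (%M l. k * \<gamma> M l)"
| cong: "cutoff_family V y a \<gamma> ==> (!!M l. l \<in> V ==> \<delta> M l = \<gamma> M l) ==> cutoff_family V y a \<delta>"

lemma test_cong:
 assumes "subspace V" "!!x. x \<in> V ==> \<phi> x = \<psi> x"
 shows "test_function V \<phi> \<longleftrightarrow> test_function V \<psi>"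
proof -
 have "supp_on V \<phi> = supp_on V \<psi>"
  unfolding supp_on_def by (rule arg_cong[where f = closure]) (use assms(2) in auto)
 then show ?thesis using smooth_cong[OF assms] by (simp add: test_function_alt)
qed

lemma test_gen:
 assumes V: "subspace V" and "smooth_on UNIV f" "smooth_on UNIV \<theta>" "test_function V \<beta>"
 shows "test_function V (%l. k * (f (l \<bullet> y) * (\<theta> (l \<bullet> z) * \<beta> l)))"
 using assms by (intro test_cmult[OF V] test_mult(1)[OF V] smooth_ridge[OF V])

lemma cutoff_family_test:
 assumes V: "subspace V"
 shows "cutoff_family V y a \<gamma> ==> test_function V (\<gamma> M)"
proof (induction rule: cutoff_family.induct)
 case (gen n f \<theta> \<beta> c a)
 then show ?case using test_gen[OF V vanishes_smooth[OF gen(1)]] by blast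
next
 case (cong a \<gamma> \<delta>)
 then show ?case using test_cong[OF V] by blast
qed (auto intro: test_zero test_add test_cmult V)

lemma cutoff_family_mono:
 "cutoff_family V y a \<gamma> ==> b \<le> a ==> cutoff_family V y b \<gamma>"
proof (induction rule: cutoff_family.induct)
 case (gen n f \<theta> \<beta> c a)
 then show ?case by (intro cutoff_family.gen) auto
next
 case (cong a \<gamma> \<delta>)
 then show ?case using cutoff_family.cong by blast
qed (auto intro: cutoff_family.zero cutoff_family.add cutoff_family.cmult)

text \<open>In the product rule a derivative of \<open>f\<close> lowers its order of vanishing, one
  of \<open>\<theta>\<close> brings out a factor M, and one of \<open>\<beta>\<close> is free; in
  each case the surplus n - c drops by at most 1.\<close>

lemma cutoff_family_dir_deriv:
 assumes V: "subspace V" and v: "v \<in> V"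
 shows "cutoff_family V y a' \<gamma> ==> a' = Suc a ==> cutoff_family V y a (%M. dir_deriv v (\<gamma> M))"
proof (induction rule: cutoff_family.induct)
 case (gen n f \<theta> \<beta> c a')
 let ?f' = "dir_deriv 1 f" and ?\<theta>' = "dir_deriv 1 \<theta>"
 note sf = vanishes_smooth[OF gen(1)]
 let ?\<delta> = "%M l. of_real (v \<bullet> y) * (of_nat M ^ c * (?f' (l \<bullet> y) * (\<theta> (l \<bullet> (real M *\<^sub>R y)) * \<beta> l)))
   + (of_real (v \<bullet> y) * (of_nat M ^ Suc c * (f (l \<bullet> y) * (?\<theta>' (l \<bullet> (real M *\<^sub>R y)) * \<beta> l)))
   + of_nat M ^ c * (f (l \<bullet> y) * (\<theta> (l \<bullet> (real M *\<^sub>R y)) * dir_deriv v \<beta> l)))"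
 have \<theta>': "?\<theta>' s = 0" if "\<bar>s\<bar> > 2" for s
 proof -
  have "\<forall>\<^sub>F r in nhds s. \<bar>r\<bar> > 2"
   using that by (intro order_tendstoD(1)[of abs "\<bar>s\<bar>"] tendsto_intros filterlim_ident)
  then have "\<forall>\<^sub>F r in nhds s. \<theta> r = 0" by eventually_elim (rule gen(3))
  then have "(\<theta> has_vector_derivative 0) (at s)"
   by (subst has_vector_derivative_cong_ev[where g = "%_. 0"]) (auto elim: eventually_mono dest: eventually_nhds_x_imp_x)
  then show ?thesis using smooth_real_deriv[OF gen(2)] vector_derivative_unique_at by blast
 qed
 have "cutoff_family V y a ?\<delta>"
 proof (intro cutoff_family.add cutoff_family.cmult)
  show "cutoff_family V y a (%M l. of_nat M ^ c * (?f' (l \<bullet> y) * (\<theta> (l \<bullet> (real M *\<^sub>R y)) * \<beta> l)))"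
   using gen by (intro cutoff_family.gen[OF vanishes_dir_deriv[OF gen(1)]]) auto
  show "cutoff_family V y a (%M l. of_nat M ^ Suc c * (f (l \<bullet> y) * (?\<theta>' (l \<bullet> (real M *\<^sub>R y)) * \<beta> l)))"
   using gen \<theta>' by (intro cutoff_family.gen[OF gen(1)] smooth_dir_deriv) auto
  show "cutoff_family V y a (%M l. of_nat M ^ c * (f (l \<bullet> y) * (\<theta> (l \<bullet> (real M *\<^sub>R y)) * dir_deriv v \<beta> l)))"
   using gen by (intro cutoff_family.gen[OF gen(1)] test_dir_deriv(1)[OF V _ v]) auto
 qed
 moreover have "dir_deriv v (%l. of_nat M ^ c * (f (l \<bullet> y) * (\<theta> (l \<bullet> (real M *\<^sub>R y)) * \<beta> l))) l = ?\<delta> M l" if "l \<in> V" for M l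
 proof -
  have "has_dir_deriv v (%l. of_nat M ^ c * (f (l \<bullet> y) * (\<theta> (l \<bullet> (real M *\<^sub>R y)) * \<beta> l)))
    (of_nat M ^ c * ((of_real (v \<bullet> y) * ?f' (l \<bullet> y)) * (\<theta> (l \<bullet> (real M *\<^sub>R y)) * \<beta> l) + f (l \<bullet> y) *
     ((of_real (v \<bullet> (real M *\<^sub>R y)) * ?\<theta>' (l \<bullet> (real M *\<^sub>R y))) * \<beta> l + \<theta> (l \<bullet> (real M *\<^sub>R y)) * dir_deriv v \<beta> l))) l"
   by (intro has_dir_deriv_cmult has_dir_deriv_mult has_dir_deriv_ridge smooth_real_deriv sf gen(2)
    smooth_has_dir_deriv[OF test_smooth[OF gen(4)] v that])
  then show ?thesis by (simp add: has_dir_deriv_eq algebra_simps)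
 qed
 ultimately show ?case by (rule cutoff_family.cong)
next
 case (zero a')
 have "dir_deriv v (%l. 0) = (%l. 0)" by (auto intro: has_dir_deriv_eq has_dir_deriv_const)
 then show ?case by (simp add: cutoff_family.zero)
next
 case (add a' \<gamma> \<delta>)
 show ?case
  by (rule cutoff_family.cong[OF cutoff_family.add[OF add.IH(1)[OF add.prems] add.IH(2)[OF add.prems]]])
   (rule dir_deriv_add[OF test_smooth test_smooth v], auto intro: cutoff_family_test[OF V] add.hyps)
next
 case (cmult a' \<gamma> k)
 show ?case
  by (rule cutoff_family.cong[OF cutoff_family.cmult[OF cmult.IH[OF cmult.prems]]])
   (rule dir_deriv_cmult[OF test_smooth v], auto intro: cutoff_family_test[OF V] cmult.hyps)
next
 case (cong a' \<gamma> \<delta>)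
 show ?case
  by (rule cutoff_family.cong[OF cong.IH[OF cong.prems]]) (rule dir_deriv_cong[OF V v], auto intro: cong.hyps)
qed

lemma cutoff_family_sum:
 "(!!i. i \<in> I ==> cutoff_family V y a (\<gamma> i)) ==> cutoff_family V y a (%M l. \<Sum>i\<in>I. \<gamma> i M l)"
 by (induction I rule: infinite_finite_induct) (auto intro: cutoff_family.zero cutoff_family.add)

text \<open>Each application of \<open>helmholtz\<close> takes two derivatives and thus costs two
  units of the surplus.\<close>

lemma cutoff_family_helmholtz:
 assumes V: "subspace V"
 shows "cutoff_family V y (a + 2 * m) \<gamma> ==> cutoff_family V y a (%M. (helmholtz V ^^ m) (\<gamma> M))"
proof (induction m arbitrary: a)
 case (Suc m)
 have "cutoff_family V y (Suc (Suc a)) (%M. (helmholtz V ^^ m) (\<gamma> M))" (is "cutoff_family _ _ _ ?\<delta>")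
  using Suc.prems by (intro Suc.IH) simp
 note h = this
 have "cutoff_family V y a (%M. dir_deriv b (dir_deriv b (?\<delta> M)))" if "b \<in> onb V" for b
 proof -
  have b: "b \<in> V" using that onb(1)[OF V] by auto
  show ?thesis by (rule cutoff_family_dir_deriv[OF V b cutoff_family_dir_deriv[OF V b h refl] refl])
 qed
 then have "cutoff_family V y a (%M l. ?\<delta> M l + (\<Sum>b\<in>onb V. - 1 * dir_deriv b (dir_deriv b (?\<delta> M)) l))"
  by (intro cutoff_family.add cutoff_family_sum cutoff_family.cmult cutoff_family_mono[OF h]) auto
 then show ?case by (simp add: helmholtz_def[abs_def])
qed simp

text \<open>On the strip |l . y| \<le> 2/M a generator is of size at most M^c (2/M)^n up to a
  constant, and n \<ge> c + 1 leaves a factor 1/M.\<close>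

lemma cutoff_family_bound:
 fixes V :: "'a::euclidean_space set"
 assumes V: "subspace V"
 shows "cutoff_family V y a \<gamma> ==> a = 1 ==>
  \<exists>C. \<forall>M\<ge>1. \<forall>l\<in>V. norm (\<gamma> M l) * (jap l) ^ DIM('a) \<le> C / real M"
proof (induction rule: cutoff_family.induct)
 case (gen n f \<theta> \<beta> c a)
 obtain A where A: "A \<ge> 0" "!!s. \<bar>s\<bar> \<le> 2 ==> norm (f s) \<le> A * \<bar>s\<bar> ^ n"
  using vanishes_bound[OF gen(1)] by blast
 obtain B where B: "B \<ge> 0" "!!s. \<bar>s\<bar> \<le> 2 ==> norm (\<theta> s) \<le> B"
  using vanishes_bound[of 0 \<theta>] gen(2) by auto
 obtain D where D: "D \<ge> 0" "!!x. x \<in> V ==> norm (\<beta> x) * (jap x) ^ DIM('a) \<le> D"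
  using test_decay[OF V gen(4)] by metis
 have "norm (of_nat M ^ c * (f (l \<bullet> y) * (\<theta> (l \<bullet> (real M *\<^sub>R y)) * \<beta> l))) * (jap l) ^ DIM('a) \<le> (A * 2 ^ n * B * D) / real M"
  if M: "M \<ge> 1" and l: "l \<in> V" for M l
 proof (cases "\<bar>l \<bullet> (real M *\<^sub>R y)\<bar> \<le> 2")
  case True
  let ?s = "\<bar>l \<bullet> y\<bar>"
  have s: "?s \<le> 2 / real M" using True M by (simp add: abs_mult field_simps)
  also have "\<dots> \<le> 2" using M by (simp add: field_simps)
  finally have s2: "?s \<le> 2" .
  have "real M ^ c * ?s ^ n \<le> real M ^ c * (2 / real M) ^ n" using s by (intro mult_left_mono power_mono) auto
  also have "\<dots> = 2 ^ n * (real M ^ c / real M ^ n)" by (simp add: power_divide)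
  also have "real M ^ c / real M ^ n \<le> 1 / real M"
  proof -
   have "real M ^ Suc c \<le> real M ^ n" using M gen(5,6) by (intro power_increasing) auto
   then show ?thesis using M by (simp add: field_simps)
  qed
  finally have k: "real M ^ c * ?s ^ n \<le> 2 ^ n * (1 / real M)" by simp
  have "norm (of_nat M ^ c * (f (l \<bullet> y) * (\<theta> (l \<bullet> (real M *\<^sub>R y)) * \<beta> l))) * (jap l) ^ DIM('a) =
   (real M ^ c * norm (f (l \<bullet> y))) * (norm (\<theta> (l \<bullet> (real M *\<^sub>R y))) * (norm (\<beta> l) * (jap l) ^ DIM('a)))"
   by (simp add: norm_mult norm_power)
  also have "\<dots> \<le> (real M ^ c * (A * ?s ^ n)) * (B * D)"
   using A B D s2 True l by (intro mult_mono mult_nonneg_nonneg) auto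
  also have "\<dots> = (real M ^ c * ?s ^ n) * (A * B * D)" by simp
  also have "\<dots> \<le> (2 ^ n * (1 / real M)) * (A * B * D)" using k A B D by (intro mult_right_mono) auto
  finally show ?thesis by (simp add: mult_ac)
 next
  case False
  then show ?thesis using gen(3) A B D by simp
 qed
 then show ?case by blast
next
 case (zero a)
 then show ?case by (intro exI[of _ 0]) simp
next
 case (add a \<gamma> \<delta>)
 then obtain C D where C: "\<forall>M\<ge>1. \<forall>l\<in>V. norm (\<gamma> M l) * (jap l) ^ DIM('a) \<le> C / real M"
  and D: "\<forall>M\<ge>1. \<forall>l\<in>V. norm (\<delta> M l) * (jap l) ^ DIM('a) \<le> D / real M" by blast
 have "norm (\<gamma> M l + \<delta> M l) * (jap l) ^ DIM('a) \<le> (C + D) / real M" if M: "M \<ge> 1" and l: "l \<in> V" for M l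
 proof -
  have "norm (\<gamma> M l + \<delta> M l) * (jap l) ^ DIM('a) \<le> (norm (\<gamma> M l) + norm (\<delta> M l)) * (jap l) ^ DIM('a)"
   by (intro mult_right_mono norm_triangle_ineq) simp
  also have "\<dots> \<le> C / real M + D / real M" unfolding distrib_right using C D M l by (intro add_mono) auto
  finally show ?thesis by (simp add: add_divide_distrib)
 qed
 then show ?case by blast
next
 case (cmult a \<gamma> k)
 then obtain C where C: "\<forall>M\<ge>1. \<forall>l\<in>V. norm (\<gamma> M l) * (jap l) ^ DIM('a) \<le> C / real M" by blast
 have "norm (k * \<gamma> M l) * (jap l) ^ DIM('a) \<le> (norm k * C) / real M" if M: "M \<ge> 1" and l: "l \<in> V" for M l
  using C M l mult_left_mono[of "norm (\<gamma> M l) * (jap l) ^ DIM('a)" "C / real M" "norm k"]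
  by (simp add: norm_mult mult.assoc)
 then show ?case by blast
next
 case (cong a \<gamma> \<delta>)
 then show ?case by fastforce
qed

lemma LINT_sum_pairing:
 assumes V: "subspace V" and u: "tempered_on V u" and \<phi>: "!!j. j \<in> J ==> test_function V (\<phi> j)"
 shows "(LINT x:V|leb V. u x * FT V (%l. \<Sum>j\<in>J. \<phi> j l) x) =
  (\<Sum>j\<in>J. LINT x:V|leb V. u x * FT V (\<phi> j) x)"
proof -
 have "(LINT x:V|leb V. u x * FT V (%l. \<Sum>j\<in>J. \<phi> j l) x) =
   (LINT x|leb V. (\<Sum>j\<in>J. indicator V x *\<^sub>R (u x * FT V (\<phi> j) x)))"
  unfolding set_integral_def
  by (subst FT_sum[OF V \<phi>]) (auto simp: sum_distrib_left scaleR_right.sum)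
 also have "\<dots> = (\<Sum>j\<in>J. LINT x|leb V. indicator V x *\<^sub>R (u x * FT V (\<phi> j) x))"
  using tempered_pairing_integrable[OF V \<phi> u]
  by (intro Bochner_Integration.integral_sum) (auto simp: set_integrable_def)
 finally show ?thesis by (simp add: set_integral_def)
qed

text \<open>The number of moments is dictated by \<open>pairing\<close>: k + \<open>DIM('a)\<close>
  powers of \<open>helmholtz\<close> are 2 (k + \<open>DIM('a)\<close>) derivatives. As i = 0 counts
  too, the exponential sum vanishes to one order more than is differentiated away, and this surplus
  is the factor 1/M.\<close>

lemma spectrum_in_line:
 fixes V :: "'a::euclidean_space set"
 assumes V: "subspace V" and u: "spectrum_in V K u" and y: "y \<in> V" and K: "!!l. l \<in> K ==> l \<bullet> y = 0"
  and A: "A \<ge> 0" "!!x. x \<in> V ==> norm (u x) \<le> A * (jap x) ^ k"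
  and J: "finite J" and c: "!!i. i \<le> 2 * (k + DIM('a)) ==> (\<Sum>j\<in>J. c j * cplx (t j) ^ i) = 0"
  and x: "x \<in> V"
 shows "(\<Sum>j\<in>J. c j * u (x + t j *\<^sub>R y)) = 0"
proof -
 have tu: "tempered_on V u" and cu: "continuous_on V u" using u by (auto simp: spectrum_in_def tempered_on_def)
 have ty: "t j *\<^sub>R y \<in> V" for j by (rule subspace_scale[OF V y])
 let ?M = "leb V"
 let ?f = "%s. \<Sum>j\<in>J. c j * exp ((\<i> * of_real (t j)) * cplx s)"
 have van: "vanishes (1 + 2 * (k + DIM('a))) ?f"
 proof (rule vanishes_exp_sum[OF J])
  fix i assume "i < 1 + 2 * (k + DIM('a))"
  then have "(\<Sum>j\<in>J. c j * cplx (t j) ^ i) = 0" by (intro c) simp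
  moreover have "(\<Sum>j\<in>J. c j * (\<i> * of_real (t j)) ^ i) = \<i> ^ i * (\<Sum>j\<in>J. c j * cplx (t j) ^ i)"
   by (simp add: power_mult_distrib sum_distrib_left mult_ac)
  ultimately show "(\<Sum>j\<in>J. c j * (\<i> * of_real (t j)) ^ i) = 0" by simp
 qed
 obtain \<rho> :: "real => real" where \<rho>: "smooth_on UNIV (%x. cplx (\<rho> x))"
  "!!x. 0 \<le> \<rho> x" "!!x. \<bar>x\<bar> \<le> 1 ==> \<rho> x = 1" "!!x. \<bar>x\<bar> \<ge> 2 ==> \<rho> x = 0"
  using bump_exists by blast
 let ?U = "%x. \<Sum>j\<in>J. c j * u (x + t j *\<^sub>R y)"
 have "spectrum_in V {} ?U"
  unfolding spectrum_in_def
 proof (intro conjI allI impI)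
  have "tempered_on V (%x. u (x + t j *\<^sub>R y))" for j
   using spectrum_in_translate[OF V u ty] by (simp add: spectrum_in_def)
  then show tU: "tempered_on V ?U" by (intro tempered_on_sum tempered_on_mult tempered_on_const)
  fix \<phi> assume "test_function V \<phi> \<and> supp_on V \<phi> \<inter> {} = {}"
  then have \<phi>: "test_function V \<phi>" by simp
  let ?e = "%j l. exp (\<i> * cplx (l \<bullet> (t j *\<^sub>R y))) * \<phi> l"
  have te: "test_function V (?e j)" for j by (rule test_mult(1)[OF V \<phi> smooth_character[OF V]])
  have "(LINT x:V|?M. ?U x * FT V \<phi> x) = (\<Sum>j\<in>J. LINT x:V|?M. c j * (u (x + t j *\<^sub>R y) * FT V \<phi> x))"
  proof -
   have "set_integrable ?M V (%x. c j * (u (x + t j *\<^sub>R y) * FT V \<phi> x))" for j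
    using tempered_pairing_integrable[OF V \<phi>, of "%x. u (x + t j *\<^sub>R y)"] spectrum_in_translate[OF V u ty]
    by (intro set_integrable_mult_right) (auto simp: spectrum_in_def)
   then show ?thesis
    unfolding set_integral_def set_integrable_def
    by (subst Bochner_Integration.integral_sum[symmetric])
     (auto simp: sum_distrib_right scaleR_right.sum mult.assoc)
  qed
  also have "\<dots> = (\<Sum>j\<in>J. LINT x:V|?M. u x * FT V (%l. c j * ?e j l) x)"
  proof (intro sum.cong refl)
   fix j
   have "(LINT x:V|?M. c j * (u (x + t j *\<^sub>R y) * FT V \<phi> x)) = c j * (LINT x:V|?M. u (x + t j *\<^sub>R y) * FT V \<phi> x)"
    by (rule set_integral_mult_right)
   also have "\<dots> = c j * (LINT x:V|?M. u x * FT V (?e j) x)"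
    by (simp only: LINT_pairing_translate[OF V \<phi> cu ty])
   also have "\<dots> = (LINT x:V|?M. c j * (u x * FT V (?e j) x))" by (rule set_integral_mult_right[symmetric])
   finally show "(LINT x:V|?M. c j * (u (x + t j *\<^sub>R y) * FT V \<phi> x)) = (LINT x:V|?M. u x * FT V (%l. c j * ?e j l) x)"
    by (simp only: FT_cmult mult.left_commute)
  qed
  also have "\<dots> = (LINT x:V|?M. u x * FT V (%l. \<Sum>j\<in>J. c j * ?e j l) x)"
   by (rule LINT_sum_pairing[OF V tu, symmetric]) (rule test_cmult[OF V te])
  finally have I1: "(LINT x:V|?M. ?U x * FT V \<phi> x) = (LINT x:V|?M. u x * FT V (%l. \<Sum>j\<in>J. c j * ?e j l) x)" .
  have fe: "(\<Sum>j\<in>J. c j * ?e j l) = ?f (l \<bullet> y) * \<phi> l" for l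
   by (simp add: sum_distrib_left mult_ac)
  let ?\<gamma> = "%M l. of_nat M ^ 0 * (?f (l \<bullet> y) * (cplx (\<rho> (l \<bullet> (real M *\<^sub>R y))) * \<phi> l))"
  have cf: "cutoff_family V y (1 + 2 * (k + DIM('a))) ?\<gamma>"
   by (rule cutoff_family.gen[OF van \<rho>(1) _ \<phi>]) (use \<rho>(4) in auto)
  have t\<gamma>: "test_function V (?\<gamma> M)" for M by (rule cutoff_family_test[OF V cf])
  obtain C where C: "!!M l. M \<ge> 1 ==> l \<in> V ==> norm ((helmholtz V ^^ (k + DIM('a))) (?\<gamma> M) l) * (jap l) ^ DIM('a) \<le> C / real M"
   using cutoff_family_bound[OF V cutoff_family_helmholtz[OF V cf] refl] by blast
  \<comment> \<open>The rest of the test function lives where |l . y| \<ge> 1/M, away from K, and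
    pairs to 0 with \<open>u\<close>.\<close>
  have I2: "(LINT x:V|?M. ?U x * FT V \<phi> x) = (LINT x:V|?M. u x * FT V (?\<gamma> M) x)" if M: "M \<ge> 1" for M
  proof -
   let ?\<delta> = "%l. ?f (l \<bullet> y) * ((1 + - 1 * cplx (\<rho> (l \<bullet> (real M *\<^sub>R y)))) * \<phi> l)"
   have t\<delta>: "test_function V ?\<delta>"
    by (intro test_mult(1)[OF V] \<phi> smooth_add smooth_cmult smooth_const V
     smooth_ridge[OF V vanishes_smooth[OF van]] smooth_ridge[OF V \<rho>(1)])
   have "supp_on V ?\<delta> \<subseteq> {l. \<bar>l \<bullet> (real M *\<^sub>R y)\<bar> \<ge> 1}"
    unfolding supp_on_def
   proof (rule closure_minimal)
    show "{l \<in> V. ?\<delta> l \<noteq> 0} \<subseteq> {l. \<bar>l \<bullet> (real M *\<^sub>R y)\<bar> \<ge> 1}"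
    proof safe
     fix l assume "?\<delta> l \<noteq> 0"
     then have "\<rho> (l \<bullet> (real M *\<^sub>R y)) \<noteq> 1" by auto
     then show "\<bar>l \<bullet> (real M *\<^sub>R y)\<bar> \<ge> 1" using \<rho>(3)[of "l \<bullet> (real M *\<^sub>R y)"] by linarith
    qed
    show "closed {l. \<bar>l \<bullet> (real M *\<^sub>R y)\<bar> \<ge> 1}" by (intro closed_Collect_le continuous_intros)
   qed
   then have "supp_on V ?\<delta> \<inter> K = {}" using K by force
   then have z: "(LINT x:V|?M. u x * FT V ?\<delta> x) = 0" using u t\<delta> by (simp add: spectrum_in_def)
   have s: "?f (l \<bullet> y) * \<phi> l = ?\<gamma> M l + ?\<delta> l" for l by (simp add: algebra_simps)
   have "(LINT x:V|?M. ?U x * FT V \<phi> x) = (LINT x:V|?M. u x * FT V (?\<gamma> M) x + u x * FT V ?\<delta> x)"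
    unfolding I1 fe s FT_add[OF V t\<gamma> t\<delta>] distrib_left ..
   also have "\<dots> = (LINT x:V|?M. u x * FT V (?\<gamma> M) x) + (LINT x:V|?M. u x * FT V ?\<delta> x)"
    by (intro set_integral_add(2) tempered_pairing_integrable[OF V _ tu] t\<gamma> t\<delta>)
   finally show ?thesis by (simp only: z add_0_right)
  qed
  have le: "norm (LINT x:V|?M. ?U x * FT V \<phi> x) \<le> (A * (C * total_weight V) * total_weight V) * (1 / real M)" if M: "M \<ge> 1" for M
   using pairing_bound[OF V t\<gamma> cu A(2) A(1) C[OF M]] I2[OF M] by (simp add: mult_ac)
  have "norm (LINT x:V|?M. ?U x * FT V \<phi> x) \<le> 0"
  proof (rule LIMSEQ_le_const)
   have "(%n. (A * (C * total_weight V) * total_weight V) * (1 / real (Suc n))) \<longlonglongrightarrow> (A * (C * total_weight V) * total_weight V) * 0"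
    using LIMSEQ_inverse_real_of_nat by (intro tendsto_intros) (simp add: inverse_eq_divide)
   then show "(%n. (A * (C * total_weight V) * total_weight V) * (1 / real (Suc n))) \<longlonglongrightarrow> 0" by simp
  qed (use le in \<open>auto intro!: exI[of _ 0] simp del: of_nat_Suc\<close>)
  then show "(LINT x:V|?M. ?U x * FT V \<phi> x) = 0" by simp
 qed
 from spectrum_in_empty[OF V this x] show ?thesis .
qed

section \<open>Supports of partial Fourier transforms\<close>

lemma partial_fourier_eq: "partial_fourier F \<phi> (\<zeta>, x) = FT F (%l. \<phi> (\<zeta>, l)) x"
 by (simp add: partial_fourier_def FT_def)

lemma subspace_Times: "subspace E ==> subspace F ==> subspace (E \<times> F)"
 by (auto simp: subspace_def zero_prod_def)

lemma sets_pair_leb: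
 "sets (leb (E :: 'a::euclidean_space set) \<Otimes>\<^sub>M leb (F :: 'b::euclidean_space set)) = sets borel"
proof -
 have "sets (leb E \<Otimes>\<^sub>M leb F) = sets (borel \<Otimes>\<^sub>M borel)"
  by (rule sets_pair_measure_cong) auto
 then show ?thesis by (simp only: borel_prod)
qed

lemma leb_Times:
 fixes E :: "'a::euclidean_space set" and F :: "'b::euclidean_space set"
 assumes "subspace E" "subspace F"
 shows "leb (E \<times> F) = leb E \<Otimes>\<^sub>M leb F"
proof -
 have "leb (E \<times> F) =
   distr (leb E \<Otimes>\<^sub>M leb F) borel (%(x, y). (x, 0) + (0, y))"
  by (rule leb_product[OF assms])
   (auto simp: linear_iff norm_Pair)
 then show ?thesis using distr_id2[OF sets_pair_leb[of E F, symmetric]] by (simp add: id_def)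
qed

text \<open>A null ball centred in E would make all its translates along E null; countably many of
  them cover E, and \<open>leb E\<close> would vanish.\<close>

lemma not_AE_outside_ball:
 fixes E :: "'a::euclidean_space set"
 assumes E: "subspace E" and c: "c \<in> E" and e: "e > 0"
 shows "\<not> (AE x in leb E. x \<notin> ball c e)"
proof
 let ?M = "leb E"
 assume ae: "AE x in ?M. x \<notin> ball c e"
 have all: "AE x in ?M. x \<notin> ball d e" if d: "d \<in> E" for d
 proof -
  have "AE x in distr ?M borel (%x. x + (c - d)). x \<notin> ball c e"
   using ae by (simp only: leb_translate[OF E subspace_diff[OF E c d]])
  then have "AE x in ?M. x + (c - d) \<notin> ball c e"
   by (subst (asm) AE_distr_iff) auto
  then show ?thesis by eventually_elim (auto simp: dist_norm algebra_simps)
 qed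
 obtain T where T: "countable T" "T \<subseteq> E" "E \<subseteq> closure T" using separable by metis
 have "AE x in ?M. \<forall>d\<in>T. x \<notin> ball d e"
  using T all by (subst AE_ball_countable) auto
 then have "AE x in ?M. False"
  using AE_leb[OF E]
 proof eventually_elim
  fix x assume x: "\<forall>d\<in>T. x \<notin> ball d e" "x \<in> E"
  then obtain d where "d \<in> T" "dist d x < e" using T(3) e closure_approachable by blast
  then show False using x by auto
 qed
 then have "AE x in ?M. ennreal (gauss x) = 0" by auto
 then have "(\<integral>\<^sup>+x. ennreal (gauss x) \<partial>?M) = 0" by (subst nn_integral_0_iff_AE) auto
 then show False by (simp add: nn_integral_gauss[OF E])
qed

lemma test_function_fibre:
 fixes E :: "'a::euclidean_space set" and F :: "'b::euclidean_space set"
 assumes E: "subspace E" and F: "subspace F" and \<phi>: "test_function (E \<times> F) \<phi>" and \<zeta>: "\<zeta> \<in> E"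
 shows "test_function F (%l. \<phi> (\<zeta>, l))" "l \<in> supp_on F (%l. \<phi> (\<zeta>, l)) ==> (\<zeta>, l) \<in> supp_on (E \<times> F) \<phi>"
proof -
 let ?\<psi> = "%l. \<phi> (\<zeta>, l)"
 have sub: "supp_on F ?\<psi> \<subseteq> Pair \<zeta> -` supp_on (E \<times> F) \<phi>"
  unfolding supp_on_def[of F]
 proof (rule closure_minimal)
  show "{x \<in> F. \<phi> (\<zeta>, x) \<noteq> 0} \<subseteq> Pair \<zeta> -` supp_on (E \<times> F) \<phi>"
   using \<zeta> by (auto intro!: in_supp_on)
  have "closed (supp_on (E \<times> F) \<phi>)" by (simp add: supp_on_def)
  then show "closed (Pair \<zeta> -` supp_on (E \<times> F) \<phi>)"
   by (rule continuous_closed_vimage) (intro continuous_intros)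
 qed
 then show "l \<in> supp_on F ?\<psi> ==> (\<zeta>, l) \<in> supp_on (E \<times> F) \<phi>" by auto
 have "compact (snd ` supp_on (E \<times> F) \<phi>)"
  using \<phi> by (intro compact_continuous_image continuous_intros) (auto simp: test_function_alt)
 moreover have "supp_on F ?\<psi> \<subseteq> snd ` supp_on (E \<times> F) \<phi>" using sub by force
 ultimately have "compact (supp_on F ?\<psi>)" by (rule compact_supp_on_subset)
 moreover have "smooth_on F ?\<psi>"
 proof -
  have "smooth_on F (%l. \<phi> ((0, l) + (\<zeta>, 0)))"
   by (rule smooth_compose_affine[OF F subspace_Times[OF E F] _ _ _ test_smooth[OF \<phi>]])
    (use \<zeta> subspace_0[OF E] subspace_0[OF F] in \<open>auto simp: linear_iff\<close>)
  then show ?thesis by simp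
 qed
 ultimately show "test_function F ?\<psi>" by (simp add: test_function_alt)
qed

lemma tempered_on_fibre:
 fixes E :: "'a::euclidean_space set" and F :: "'b::euclidean_space set"
 assumes F: "subspace F" and g: "tempered_on (E \<times> F) g" and \<zeta>: "\<zeta> \<in> E"
 shows "tempered_on F (%x. g (\<zeta>, x))"
 using tempered_on_compose_affine[OF g, of "Pair 0" F "(\<zeta>, 0)"] \<zeta> by (auto simp: linear_iff)

text \<open>From fibres to the product by Fubini. Conversely, the pairing J on the fibre over
  \<zeta> depends continuously on \<zeta>; if it were nonzero at \<zeta>0, a bump
  \<open>\<alpha>\<close> around \<zeta>0 would make the pairing with the product of
  \<open>\<alpha>\<close> and \<open>\<beta>\<close> nonzero.\<close>

lemma dist_supported_in_iff_fibres:
 fixes E :: "(complex ^ 'n::finite) set" and F :: "(real ^ 'm::finite) set"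
 assumes E: "subspace E" and F: "subspace F" and g: "tempered_on (E \<times> F) g"
 shows "dist_supported_in (E \<times> F) (dist_partial_fourier F (distribution_of (E \<times> F) g)) (E \<times> K) \<longleftrightarrow>
  (\<forall>\<zeta>\<in>E. spectrum_in F K (%x. g (\<zeta>, x)))"
proof
 let ?V = "E \<times> F"
 let ?ME = "leb E" and ?MF = "leb F" and ?M = "leb (E \<times> F)"
 interpret P: pair_sigma_finite ?ME ?MF by (rule pair_sigma_finite_leb[OF E F])
 {
  assume fib: "\<forall>\<zeta>\<in>E. spectrum_in F K (%x. g (\<zeta>, x))"
  show "dist_supported_in ?V (dist_partial_fourier F (distribution_of ?V g)) (E \<times> K)"
   unfolding dist_supported_in_def
  proof (intro allI impI)
   fix \<phi> assume \<phi>: "test_function ?V \<phi> \<and> closure {x \<in> ?V. \<phi> x \<noteq> 0} \<inter> E \<times> K = {}"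
   let ?h = "%p. indicator ?V p *\<^sub>R (g p * partial_fourier F \<phi> p)"
   have "(LINT p|?M. ?h p) = 0"
   \<comment> \<open>A non-integrable function has Bochner integral 0 by convention, so no bound
     uniform in \<zeta> has to be established.\<close>
   proof (cases "integrable ?M ?h")
    case True
    then have m: "?h \<in> borel_measurable borel" by auto
    have i': "integrable (?ME \<Otimes>\<^sub>M ?MF) ?h"
     using True unfolding leb_Times[OF E F] .
    have "(LINT p|?M. ?h p) = (LINT p|(?ME \<Otimes>\<^sub>M ?MF). ?h p)"
     unfolding leb_Times[OF E F] ..
    also have "\<dots> = (LINT \<zeta>|?ME. LINT x|?MF. ?h (\<zeta>, x))" by (rule P.integral_fst'[OF i', symmetric])
    also have "\<dots> = (LINT \<zeta>|?ME. 0)"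
    proof (rule integral_cong_AE)
     show "(%\<zeta>. LINT x|?MF. ?h (\<zeta>, x)) \<in> borel_measurable ?ME"
      using P.integrable_fst'[OF i'] by auto
     show "AE \<zeta> in ?ME. (LINT x|?MF. ?h (\<zeta>, x)) = 0"
      using AE_leb[OF E]
     proof eventually_elim
      fix \<zeta> assume \<zeta>: "\<zeta> \<in> E"
      have t: "test_function F (%l. \<phi> (\<zeta>, l))" using test_function_fibre(1)[OF E F _ \<zeta>] \<phi> by blast
      have "supp_on F (%l. \<phi> (\<zeta>, l)) \<inter> K = {}"
       using test_function_fibre(2)[OF E F _ \<zeta>, of \<phi>] \<phi> \<zeta> by (fastforce simp: supp_on_def[of "E \<times> F"])
      then have "(LINT x:F|?MF. g (\<zeta>, x) * FT F (%l. \<phi> (\<zeta>, l)) x) = 0"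
       using fib \<zeta> t by (auto simp: spectrum_in_def)
      then show "(LINT x|?MF. ?h (\<zeta>, x)) = 0"
       using \<zeta> by (simp add: set_integral_def partial_fourier_eq indicator_times)
     qed
    qed simp
    finally show ?thesis by simp
   qed (rule not_integrable_integral_eq)
   then show "dist_partial_fourier F (distribution_of ?V g) \<phi> = 0"
    by (simp add: dist_partial_fourier_def distribution_of_def set_integral_def)
  qed
 }
 assume supp: "dist_supported_in ?V (dist_partial_fourier F (distribution_of ?V g)) (E \<times> K)"
 obtain A k where Ak: "continuous_on ?V g" "A \<ge> 0" "!!p. p \<in> ?V ==> norm (g p) \<le> A * (jap p) ^ k"
  using tempered_onE[OF g] by metis
 have gle: "norm (g (\<zeta>, x)) \<le> A * ((1 + (norm \<zeta>)\<^sup>2) ^ k * (jap x) ^ k)" if "\<zeta> \<in> E" "x \<in> F" for \<zeta> x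
 proof -
  have "1 + (norm (\<zeta>, x))\<^sup>2 \<le> (1 + (norm \<zeta>)\<^sup>2) * (jap x)" by (simp add: norm_Pair algebra_simps)
  then have "(jap (\<zeta>, x)) ^ k \<le> ((1 + (norm \<zeta>)\<^sup>2) * (jap x)) ^ k" by (intro power_mono) auto
  then have "A * (jap (\<zeta>, x)) ^ k \<le> A * ((1 + (norm \<zeta>)\<^sup>2) * (jap x)) ^ k"
   by (intro mult_left_mono Ak)
  then show ?thesis using Ak(3)[of "(\<zeta>, x)"] that by (simp add: power_mult_distrib)
 qed
 show "\<forall>\<zeta>\<in>E. spectrum_in F K (%x. g (\<zeta>, x))"
  unfolding spectrum_in_def
 proof (intro ballI conjI allI impI)
  fix \<zeta>0 assume \<zeta>0: "\<zeta>0 \<in> E"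
  show "tempered_on F (%x. g (\<zeta>0, x))" by (rule tempered_on_fibre[OF F g \<zeta>0])
  fix \<beta> assume \<beta>: "test_function F \<beta> \<and> supp_on F \<beta> \<inter> K = {}"
  define J where "J \<zeta> = (LINT x:F|?MF. g (\<zeta>, x) * FT F \<beta> x)" for \<zeta>
  obtain D where D: "D \<ge> 0" "!!x. x \<in> F ==> norm (FT F \<beta> x) * (jap x) ^ (k + DIM(real ^ 'm)) \<le> D"
   using FT_decay[OF F] \<beta> by metis
  have cb: "continuous_on S (FT F \<beta>)" for S using isCont_FT[OF F] \<beta> continuous_on_subset by blast
  have le: "norm (g (\<zeta>, x) * FT F \<beta> x) * (jap x) ^ DIM(real ^ 'm) \<le> A * (1 + (norm \<zeta>)\<^sup>2) ^ k * D"
   if x: "\<zeta> \<in> E" "x \<in> F" for \<zeta> x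
  proof -
   have "norm (g (\<zeta>, x) * FT F \<beta> x) * (jap x) ^ DIM(real ^ 'm) \<le>
     A * ((1 + (norm \<zeta>)\<^sup>2) ^ k * (jap x) ^ k) * norm (FT F \<beta> x) * (jap x) ^ DIM(real ^ 'm)"
    unfolding norm_mult by (intro mult_right_mono gle x) auto
   also have "\<dots> = A * (1 + (norm \<zeta>)\<^sup>2) ^ k * (norm (FT F \<beta> x) * (jap x) ^ (k + DIM(real ^ 'm)))"
    by (simp add: power_add)
   also have "\<dots> \<le> A * (1 + (norm \<zeta>)\<^sup>2) ^ k * D" by (intro mult_left_mono D x) (use Ak in auto)
   finally show ?thesis .
  qed
  have cu: "continuous_on F (%x. g (\<zeta>, x) * FT F \<beta> x)" if "\<zeta> \<in> E" for \<zeta>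
   by (intro continuous_on_mult cb continuous_on_compose2[OF Ak(1)] continuous_intros) (auto intro: that)
  have J_cont: "continuous_on E J"
   unfolding continuous_on_sequentially
  proof (intro ballI allI impI)
   fix s \<zeta> assume \<zeta>: "\<zeta> \<in> E" and s: "(\<forall>n. s n \<in> E) \<and> s \<longlonglongrightarrow> \<zeta>"
   then obtain R where R: "!!n. norm (s n) \<le> R" by (metis Bseq_def convergentI convergent_imp_Bseq)
   show "(J \<circ> s) \<longlonglongrightarrow> J \<zeta>"
    unfolding J_def o_def set_integral_def
   proof (rule integral_dominated_convergence[where w = "%x2. (A * (1 + R\<^sup>2) ^ k * D) * weight x2"])
    show "integrable ?MF (%x2. (A * (1 + R\<^sup>2) ^ k * D) * weight x2)"
     by (intro integrable_mult_right integrable_weight F)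
    show "(%xa. indicator F xa *\<^sub>R (g (\<zeta>, xa) * FT F \<beta> xa)) \<in> borel_measurable ?MF"
     using measurable_on_subspace[OF F cu[OF \<zeta>]] by simp
    show "(%xa. indicator F xa *\<^sub>R (g (s n, xa) * FT F \<beta> xa)) \<in> borel_measurable ?MF" for n
     using measurable_on_subspace[OF F cu[of "s n"]] s by simp
    show "AE x2 in ?MF. (%n. indicator F x2 *\<^sub>R (g (s n, x2) * FT F \<beta> x2)) \<longlonglongrightarrow> indicator F x2 *\<^sub>R (g (\<zeta>, x2) * FT F \<beta> x2)"
     using AE_leb[OF F]
    proof eventually_elim
     fix x2 assume "x2 \<in> F"
     then have "(%n. g (s n, x2)) \<longlonglongrightarrow> g (\<zeta>, x2)"
      using s \<zeta> by (intro continuous_on_tendsto_compose[OF Ak(1)] tendsto_intros) auto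
     then show "(%n. indicator F x2 *\<^sub>R (g (s n, x2) * FT F \<beta> x2)) \<longlonglongrightarrow> indicator F x2 *\<^sub>R (g (\<zeta>, x2) * FT F \<beta> x2)"
      by (intro tendsto_intros)
    qed
    show "AE x2 in ?MF. norm (indicator F x2 *\<^sub>R (g (s n, x2) * FT F \<beta> x2)) \<le> (A * (1 + R\<^sup>2) ^ k * D) * weight x2" for n
     using AE_leb[OF F]
    proof eventually_elim
     fix x2 assume x2: "x2 \<in> F"
     have "(norm (s n))\<^sup>2 \<le> R\<^sup>2" using R[of n] by (intro power_mono) auto
     then have "A * (jap (s n)) ^ k * D \<le> A * (1 + R\<^sup>2) ^ k * D"
      using Ak(2) D(1) by (intro mult_right_mono mult_left_mono power_mono) auto
     then show "norm (indicator F x2 *\<^sub>R (g (s n, x2) * FT F \<beta> x2)) \<le> (A * (1 + R\<^sup>2) ^ k * D) * weight x2"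
      using le[of "s n" x2] s x2 by (subst le_weight_iff) auto
    qed
   qed
  qed
  show "(LINT x:F|?MF. g (\<zeta>0, x) * FT F \<beta> x) = 0"
  proof (rule ccontr)
   assume "(LINT x:F|?MF. g (\<zeta>0, x) * FT F \<beta> x) \<noteq> 0"
   then have J0: "J \<zeta>0 \<noteq> 0" by (simp add: J_def)
   \<comment> \<open>\<open>r\<close> is real and positive at \<zeta>0; its positivity near \<zeta>0
     excludes cancellation in the integral.\<close>
   define r where "r \<zeta> = Re (cnj (J \<zeta>0) * J \<zeta>)" for \<zeta>
   have r_cont: "continuous_on E r" unfolding r_def by (intro continuous_intros J_cont)
   have r0: "r \<zeta>0 > 0"
   proof -
    have "cnj (J \<zeta>0) * J \<zeta>0 = of_real ((norm (J \<zeta>0))\<^sup>2)" by (simp add: complex_norm_square mult.commute del: of_real_power)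
    then show ?thesis using J0 by (simp add: r_def)
   qed
   obtain e where e: "e > 0" "!!\<zeta>. \<zeta> \<in> E ==> dist \<zeta>0 \<zeta> < e ==> r \<zeta> > 0"
   proof -
    obtain d where "d > 0" "!!\<zeta>. \<zeta> \<in> E ==> dist \<zeta> \<zeta>0 < d ==> dist (r \<zeta>) (r \<zeta>0) < r \<zeta>0"
     using r_cont \<zeta>0 r0 unfolding continuous_on_iff by metis
    then show thesis by (intro that[of d]) (auto simp: dist_commute[of \<zeta>0] dist_real_def abs_less_iff)
   qed
   obtain \<alpha> :: "complex ^ 'n => real" where \<alpha>: "test_function E (%x. cplx (\<alpha> x))" "!!x. \<alpha> x \<ge> 0"
    "\<alpha> \<zeta>0 = 1" "!!x. \<alpha> x \<noteq> 0 ==> dist \<zeta>0 x < e" "continuous_on UNIV \<alpha>"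
    using test_bump_at[OF E e(1)] by metis
   let ?\<phi> = "%(\<zeta>, l). cplx (\<alpha> \<zeta>) * \<beta> l"
   have V: "subspace ?V" by (rule subspace_Times[OF E F])
   have sub: "supp_on ?V ?\<phi> \<subseteq> supp_on E (%x. cplx (\<alpha> x)) \<times> supp_on F \<beta>"
    unfolding supp_on_def[of ?V]
    by (rule closure_minimal) (auto intro: in_supp_on closed_Times simp: supp_on_def[symmetric], simp add: supp_on_def closed_Times)
   have "smooth_on ?V (%p. cplx (\<alpha> (fst p)) * \<beta> (snd p))"
    using \<alpha>(1) \<beta>
    by (intro smooth_mult V smooth_compose_linear[OF V E linear_fst _ test_smooth[OF \<alpha>(1)]] smooth_compose_linear[OF V F linear_snd] test_smooth) auto
   then have t: "test_function ?V ?\<phi>"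
    using compact_supp_on_subset[OF compact_Times sub] \<alpha>(1) \<beta> by (simp add: test_function_alt case_prod_unfold)
   have pf: "partial_fourier F ?\<phi> p = cplx (\<alpha> (fst p)) * FT F \<beta> (snd p)" for p
    by (cases p) (simp add: partial_fourier_eq FT_cmult)
   have "supp_on ?V ?\<phi> \<inter> E \<times> K = {}" using sub \<beta> by auto
   then have "dist_partial_fourier F (distribution_of ?V g) ?\<phi> = 0"
    using supp t unfolding dist_supported_in_def supp_on_def by blast
   then have z: "(LINT p|?M. indicator ?V p *\<^sub>R (g p * (cplx (\<alpha> (fst p)) * FT F \<beta> (snd p)))) = 0"
    by (simp add: dist_partial_fourier_def distribution_of_def set_integral_def pf)
   let ?h = "%p. indicator ?V p *\<^sub>R (g p * (cplx (\<alpha> (fst p)) * FT F \<beta> (snd p)))"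
   have "continuous_on ?V (%p. g p * (cplx (\<alpha> (fst p)) * FT F \<beta> (snd p)))"
    by (intro continuous_on_mult Ak(1) continuous_on_of_real continuous_on_compose2[OF \<alpha>(5)] continuous_on_compose2[OF cb[of UNIV]] continuous_intros) auto
   from measurable_on_subspace[OF V this]
   have m: "?h \<in> borel_measurable borel" .
   obtain B where B: "B \<ge> 0" "!!x. x \<in> E ==> norm (cplx (\<alpha> x)) * (jap x) ^ (k + DIM(complex ^ 'n)) \<le> B"
    using test_decay[OF E \<alpha>(1)] by metis
   have hi: "integrable (?ME \<Otimes>\<^sub>M ?MF) ?h"
   proof (rule integrable_pair_leb[OF E F, where wl = "%\<zeta>. (A * D) * (B * weight \<zeta>)" and wr = weight])
    show "?h \<in> borel_measurable (?ME \<Otimes>\<^sub>M ?MF)" using m by (simp add: leb_Times[OF E F, symmetric])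
    fix \<zeta> x assume p: "\<zeta> \<in> E" "x \<in> F"
    have "norm (g (\<zeta>, x) * FT F \<beta> x) \<le> A * (1 + (norm \<zeta>)\<^sup>2) ^ k * D * weight x"
     using le[OF p] by (subst le_weight_iff)
    then have "norm (g (\<zeta>, x) * FT F \<beta> x) * \<alpha> \<zeta> \<le> A * (1 + (norm \<zeta>)\<^sup>2) ^ k * D * weight x * \<alpha> \<zeta>"
     by (intro mult_right_mono \<alpha>)
    also have "\<dots> = (A * D * weight x) * (\<alpha> \<zeta> * (1 + (norm \<zeta>)\<^sup>2) ^ k)" by simp
    also have "\<dots> \<le> (A * D * weight x) * (B * weight \<zeta>)"
    proof (rule mult_left_mono)
     have "\<alpha> \<zeta> * (1 + (norm \<zeta>)\<^sup>2) ^ k * (1 + (norm \<zeta>)\<^sup>2) ^ DIM(complex ^ 'n) \<le> B"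
      using B(2)[OF p(1)] \<alpha>(2)[of \<zeta>] by (simp add: power_add mult.assoc)
     then show "\<alpha> \<zeta> * (1 + (norm \<zeta>)\<^sup>2) ^ k \<le> B * weight \<zeta>" by (subst le_weight_iff)
    qed (use Ak D weight_nonneg[of x] in auto)
    finally show "norm (?h (\<zeta>, x)) \<le> (A * D) * (B * weight \<zeta>) * weight x"
     using p \<alpha>(2)[of \<zeta>] by (simp add: norm_mult mult_ac)
   qed (intro integrable_mult_right integrable_weight E F)+
   have "0 = (LINT p|(?ME \<Otimes>\<^sub>M ?MF). ?h p)"
    using z unfolding leb_Times[OF E F] by simp
   also have "\<dots> = (LINT \<zeta>|?ME. LINT x|?MF. ?h (\<zeta>, x))" by (rule P.integral_fst'[OF hi, symmetric])
   finally have zz: "(LINT \<zeta>|?ME. LINT x|?MF. ?h (\<zeta>, x)) = 0" by simp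
   have inner: "(LINT x|?MF. ?h (\<zeta>, x)) = of_real (\<alpha> \<zeta>) * J \<zeta>" if "\<zeta> \<in> E" for \<zeta>
   proof -
    have "(LINT x|?MF. ?h (\<zeta>, x)) = (LINT x|?MF. of_real (\<alpha> \<zeta>) * (indicator F x *\<^sub>R (g (\<zeta>, x) * FT F \<beta> x)))"
     using that by (intro integral_congI) (auto simp: indicator_times)
    then show ?thesis unfolding J_def set_integral_def by (simp only: integral_mult_right_zero)
   qed
   have ii: "integrable ?ME (%\<zeta>. LINT x|?MF. ?h (\<zeta>, x))" by (rule P.integrable_fst'[OF hi])
   let ?q = "%\<zeta>. Re (cnj (J \<zeta>0) * (LINT x|?MF. ?h (\<zeta>, x)))"
   have qi: "integrable ?ME ?q" by (intro integrable_Re integrable_mult_right ii)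
   have "(LINT \<zeta>|?ME. ?q \<zeta>) = Re (LINT \<zeta>|?ME. cnj (J \<zeta>0) * (LINT x|?MF. ?h (\<zeta>, x)))"
    by (rule integral_Re[OF integrable_mult_right[OF ii]])
   also have "\<dots> = 0" unfolding integral_mult_right_zero zz by simp
   finally have q0: "(LINT \<zeta>|?ME. ?q \<zeta>) = 0" .
   have qeq: "?q \<zeta> = \<alpha> \<zeta> * r \<zeta>" if "\<zeta> \<in> E" for \<zeta>
   proof -
    have "cnj (J \<zeta>0) * (of_real (\<alpha> \<zeta>) * J \<zeta>) = of_real (\<alpha> \<zeta>) * (cnj (J \<zeta>0) * J \<zeta>)" by simp
    then show ?thesis unfolding inner[OF that] r_def by (simp only: Re_complex_of_real times_complex.sel Im_complex_of_real mult_zero_left diff_zero)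
   qed
   have "AE \<zeta> in ?ME. 0 \<le> ?q \<zeta>"
    using AE_leb[OF E]
   proof eventually_elim
    fix \<zeta> assume \<zeta>: "\<zeta> \<in> E"
    show "0 \<le> ?q \<zeta>" unfolding qeq[OF \<zeta>] using e(2)[OF \<zeta>] \<alpha>(2,4)[of \<zeta>] by (cases "\<alpha> \<zeta> = 0") auto
   qed
   then have q_AE: "AE \<zeta> in ?ME. ?q \<zeta> = 0" using integral_nonneg_eq_0_iff_AE[OF qi] q0 by simp
   obtain d where d: "d > 0" "!!\<zeta>. dist \<zeta> \<zeta>0 < d ==> dist (\<alpha> \<zeta>) (\<alpha> \<zeta>0) < 1"
    using \<alpha>(5) unfolding continuous_on_iff by (metis UNIV_I zero_less_one)
   have "AE \<zeta> in ?ME. \<zeta> \<notin> ball \<zeta>0 d"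
    using q_AE AE_leb[OF E]
   proof eventually_elim
    fix \<zeta> assume z: "?q \<zeta> = 0" and \<zeta>: "\<zeta> \<in> E"
    show "\<zeta> \<notin> ball \<zeta>0 d"
    proof
     assume "\<zeta> \<in> ball \<zeta>0 d"
     then have "\<alpha> \<zeta> > 0" using d(2)[of \<zeta>] \<alpha>(3) by (auto simp: dist_commute dist_real_def abs_less_iff)
     moreover have "r \<zeta> > 0" using calculation \<alpha>(4)[of \<zeta>] e(2)[OF \<zeta>] by simp
     ultimately show False using z qeq[OF \<zeta>] by simp
    qed
   qed
   then show False using not_AE_outside_ball[OF E \<zeta>0 d(1)] by blast
  qed
 qed
qed

section \<open>Left-invariant vector fields and growth\<close>

lemma CR_subspaces:
 assumes "qCR E F \<Phi>"
 shows "subspace E" "subspace F" "subspace (E \<times> F)"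
proof -
 have E: "vec.subspace E" and F: "subspace F" using assms by (auto simp: quadratic_CR_def)
 have "c *\<^sub>R x = of_real c *s x" for c and x :: "complex ^ 'a"
  by (simp add: vec_eq_iff) (simp add: scaleR_conv_of_real)
 then show "subspace E" using E
  by (auto simp: subspace_def intro: vec.subspace_0 vec.subspace_add vec.subspace_scale)
 then show "subspace F" "subspace (E \<times> F)" using F by (auto intro: subspace_Times)
qed

section \<open>Hermitian maps\<close>

lemma cnj_vec_simps:
 "cnj_vec (a + b) = cnj_vec a + cnj_vec b" "cnj_vec (c *s a) = cnj c *s cnj_vec a"
 "Re_vec (cnj_vec a) = Re_vec a" "Im_vec (cnj_vec a) = - Im_vec a"
 by (simp_all add: cnj_vec_def Re_vec_def Im_vec_def vec_eq_iff)

lemma hermD: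
 assumes "qCR E F \<Phi>"
 shows "!!\<zeta> \<zeta>'. \<zeta> \<in> E ==> \<zeta>' \<in> E ==> \<Phi> \<zeta> \<zeta>' \<in> complexification F"
  "!!\<zeta> \<eta> \<zeta>'. \<zeta> \<in> E ==> \<eta> \<in> E ==> \<zeta>' \<in> E ==> \<Phi> (\<zeta> + \<eta>) \<zeta>' = \<Phi> \<zeta> \<zeta>' + \<Phi> \<eta> \<zeta>'"
  "!!c \<zeta> \<zeta>'. \<zeta> \<in> E ==> \<zeta>' \<in> E ==> \<Phi> (c *s \<zeta>) \<zeta>' = c *s \<Phi> \<zeta> \<zeta>'"
  "!!\<zeta> \<zeta>'. \<zeta> \<in> E ==> \<zeta>' \<in> E ==> \<Phi> \<zeta>' \<zeta> = cnj_vec (\<Phi> \<zeta> \<zeta>')"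
 using assms unfolding quadratic_CR_def hermitian_map_def by blast+

lemma herm_right:
 assumes Q: "qCR E F \<Phi>"
 shows "!!\<zeta> \<eta> \<zeta>'. \<zeta> \<in> E ==> \<eta> \<in> E ==> \<zeta>' \<in> E ==> \<Phi> \<zeta>' (\<zeta> + \<eta>) = \<Phi> \<zeta>' \<zeta> + \<Phi> \<zeta>' \<eta>"
  "!!c \<zeta> \<zeta>'. \<zeta> \<in> E ==> \<zeta>' \<in> E ==> \<Phi> \<zeta>' (c *s \<zeta>) = cnj c *s \<Phi> \<zeta>' \<zeta>"
proof -
 have E: "vec.subspace E" using Q by (simp add: quadratic_CR_def)
 note h = hermD[OF Q]
 show "\<Phi> \<zeta>' (\<zeta> + \<eta>) = \<Phi> \<zeta>' \<zeta> + \<Phi> \<zeta>' \<eta>" if "\<zeta> \<in> E" "\<eta> \<in> E" "\<zeta>' \<in> E" for \<zeta> \<eta> \<zeta>'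
  using h(4)[of "\<zeta> + \<eta>" \<zeta>'] h(4)[of \<zeta> \<zeta>'] h(4)[of \<eta> \<zeta>'] h(2)[of \<zeta> \<eta> \<zeta>'] that vec.subspace_add[OF E]
  by (simp add: cnj_vec_simps)
 show "\<Phi> \<zeta>' (c *s \<zeta>) = cnj c *s \<Phi> \<zeta>' \<zeta>" if "\<zeta> \<in> E" "\<zeta>' \<in> E" for c \<zeta> \<zeta>'
  using h(4)[of "c *s \<zeta>" \<zeta>'] h(4)[of \<zeta> \<zeta>'] h(3)[of \<zeta> \<zeta>' c] that vec.subspace_scale[OF E]
  by (simp add: cnj_vec_simps)
qed

lemma scaleR_eq_vector_scale: "c *\<^sub>R x = of_real c *s (x :: complex ^ 'n)"
 by (simp add: vec_eq_iff) (simp add: scaleR_conv_of_real)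

lemma complexification_parts: "z \<in> complexification F \<longleftrightarrow> Re_vec z \<in> F \<and> Im_vec z \<in> F"
 by (simp add: complexification_def)

lemma Re_Im_vec_scaleR: "Re_vec (c *\<^sub>R z) = c *\<^sub>R Re_vec z" "Im_vec (c *\<^sub>R z) = c *\<^sub>R Im_vec z"
 by (simp_all add: Re_vec_def Im_vec_def vec_eq_iff)

text \<open>\<open>\<Phi>\<close> is linear only on E and unspecified elsewhere, so its components
  are linear maps in this restricted sense.\<close>

definition linear_on_sub :: "'a::real_vector set => ('a => 'b::real_vector) => bool" where
 "linear_on_sub V L \<longleftrightarrow> (\<forall>x\<in>V. \<forall>y\<in>V. L (x + y) = L x + L y) \<and> (\<forall>c. \<forall>x\<in>V. L (c *\<^sub>R x) = c *\<^sub>R L x)"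

text \<open>Composition with the orthogonal projection onto V.\<close>

lemma linear_on_sub_extend:
 fixes V :: "'a::euclidean_space set"
 assumes V: "subspace V" and L: "linear_on_sub V L"
 obtains g where "linear g" "!!x. x \<in> V ==> g x = L x"
proof -
 interpret orthogonal_sum V V "{0}" by (rule orthogonal_sum_trivial[OF V])
 have "linear (%x. L (proj1 x))"
  using L proj_in(1) linear_proj(1) by (auto simp: linear_iff linear_on_sub_def)
 then show thesis using that[of "%x. L (proj1 x)"] proj_simps(1) by auto
qed

lemma linear_on_sub_smooth:
 fixes L :: "'a::euclidean_space => complex"
 assumes V: "subspace V" and L: "linear_on_sub V L"
 shows "smooth_on V L"
proof -
 obtain g where "linear g" "!!x. x \<in> V ==> g x = L x" using linear_on_sub_extend[OF assms] by blast
 then show ?thesis using smooth_linear[OF V, of g] smooth_cong[OF V, of g L] by (simp add: linear_conv_bounded_linear)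
qed

lemma linear_on_sub_dir_deriv:
 fixes L :: "'a::euclidean_space => complex"
 assumes V: "subspace V" and L: "linear_on_sub V L" and v: "v \<in> V" and x: "x \<in> V"
 shows "has_dir_deriv v L (L v) x"
proof -
 obtain g where g: "linear g" "!!x. x \<in> V ==> g x = L x" using linear_on_sub_extend[OF V L] by blast
 then have "has_dir_deriv v g (g v) x" by (intro has_dir_deriv_linear) (simp add: linear_conv_bounded_linear)
 then show ?thesis using has_dir_deriv_cong[OF V v x, of g L] g v by simp
qed

section \<open>Polynomial growth\<close>

definition grows :: "nat => 'a::real_normed_vector set => ('a => complex) => bool" where
 "grows k V f \<longleftrightarrow> (\<exists>C. \<forall>p\<in>V. norm (f p) \<le> C * (1 + norm p) ^ k)"

lemma growsE:
 assumes "grows k V f"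
 obtains C where "C \<ge> 0" "!!p. p \<in> V ==> norm (f p) \<le> C * (1 + norm p) ^ k"
proof -
 obtain C where C: "!!p. p \<in> V ==> norm (f p) \<le> C * (1 + norm p) ^ k" using assms by (auto simp: grows_def)
 have "norm (f p) \<le> max C 0 * (1 + norm p) ^ k" if "p \<in> V" for p
  by (rule order_trans[OF C[OF that]]) (auto intro!: mult_right_mono)
 then show thesis using that[of "max C 0"] by auto
qed

lemma grows_iff_bounded: "grows k V f \<longleftrightarrow> bounded ((%p. f p /\<^sub>R (1 + norm p) ^ k) ` V)"
proof -
 have p: "(1 + norm p) ^ k > 0" for p :: 'a by (intro zero_less_power) (auto intro: add_pos_nonneg)
 have "norm (f p /\<^sub>R (1 + norm p) ^ k) \<le> C \<longleftrightarrow> norm (f p) \<le> C * (1 + norm p) ^ k" for p C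
  using p[of p] by (simp add: field_simps)
 then show ?thesis by (auto simp: grows_def bounded_iff)
qed

lemma grows_cong: "(!!p. p \<in> V ==> f p = g p) ==> grows k V f \<longleftrightarrow> grows k V g"
 by (simp add: grows_def)

lemma grows_mono:
 assumes "grows k V f" "k \<le> l" shows "grows l V f"
proof -
 obtain C where C: "C \<ge> 0" "!!p. p \<in> V ==> norm (f p) \<le> C * (1 + norm p) ^ k" using growsE[OF assms(1)] by blast
 have "norm (f p) \<le> C * (1 + norm p) ^ l" if "p \<in> V" for p
  by (rule order_trans[OF C(2)[OF that]]) (intro mult_left_mono power_increasing assms C; simp)
 then show ?thesis by (auto simp: grows_def)
qed

lemma grows_add:
 assumes "grows k V f" "grows k V g" shows "grows k V (%p. f p + g p)"
proof -
 obtain C where C: "!!p. p \<in> V ==> norm (f p) \<le> C * (1 + norm p) ^ k" using growsE[OF assms(1)] by blast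
 obtain D where D: "!!p. p \<in> V ==> norm (g p) \<le> D * (1 + norm p) ^ k" using growsE[OF assms(2)] by blast
 have "norm (f p + g p) \<le> (C + D) * (1 + norm p) ^ k" if "p \<in> V" for p
  unfolding distrib_right by (rule norm_triangle_le[OF add_mono[OF C[OF that] D[OF that]]])
 then show ?thesis by (auto simp: grows_def)
qed

lemma grows_mult:
 assumes "grows k V f" "grows l V g" shows "grows (k + l) V (%p. f p * g p)"
proof -
 obtain C where C: "C \<ge> 0" "!!p. p \<in> V ==> norm (f p) \<le> C * (1 + norm p) ^ k" using growsE[OF assms(1)] by blast
 obtain D where D: "D \<ge> 0" "!!p. p \<in> V ==> norm (g p) \<le> D * (1 + norm p) ^ l" using growsE[OF assms(2)] by blast
 have "norm (f p * g p) \<le> (C * D) * (1 + norm p) ^ (k + l)" if "p \<in> V" for p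
 proof -
  have "norm (f p) * norm (g p) \<le> (C * (1 + norm p) ^ k) * (D * (1 + norm p) ^ l)"
   by (intro mult_mono C D that) (use C in auto)
  then show ?thesis by (simp add: norm_mult power_add mult_ac)
 qed
 then show ?thesis by (auto simp: grows_def)
qed

lemma grows_const: "grows k V (%p. c)"
 by (rule grows_mono[of 0]) (auto simp: grows_def)

lemma grows_cmult: "grows k V f ==> grows k V (%p. c * f p)"
 using grows_mult[OF grows_const[of 0 V c]] by simp

lemma grows_linear_on_sub:
 fixes L :: "'a::euclidean_space => complex"
 assumes V: "subspace V" and L: "linear_on_sub V L"
 shows "grows 1 V L"
proof -
 obtain g where g: "linear g" "!!x. x \<in> V ==> g x = L x" using linear_on_sub_extend[OF V L] by blast
 obtain B where B: "B > 0" "!!x. norm (g x) \<le> norm x * B"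
  using bounded_linear.pos_bounded[OF g(1)[unfolded linear_conv_bounded_linear]] by auto
 have "norm (L p) \<le> B * (1 + norm p) ^ 1" if "p \<in> V" for p
  using B(2)[of p] B(1) g(2)[OF that] by (simp add: distrib_left mult.commute)
 then show ?thesis by (auto simp: grows_def)
qed

lemma grows_compose_affine:
 fixes J :: "'a::euclidean_space => 'b::real_normed_vector"
 assumes J: "linear J" and V: "!!p. p \<in> V ==> J p + c \<in> W" and f: "grows k W f"
 shows "grows k V (%p. f (J p + c))"
proof -
 obtain B where B: "B > 0" "!!x. norm (J x) \<le> norm x * B"
  using bounded_linear.pos_bounded[OF J[unfolded linear_conv_bounded_linear]] by auto
 obtain C where C: "C \<ge> 0" "!!p. p \<in> W ==> norm (f p) \<le> C * (1 + norm p) ^ k" using growsE[OF f] by blast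
 have "norm (f (J p + c)) \<le> (C * (1 + B + norm c) ^ k) * (1 + norm p) ^ k" if p: "p \<in> V" for p
 proof -
  have "norm (J p + c) \<le> norm p * B + norm c" using norm_triangle_ineq[of "J p" c] B(2)[of p] by linarith
  moreover have "1 + norm p * B + norm c \<le> (1 + B + norm c) * (1 + norm p)"
   using B(1) by (simp add: algebra_simps)
  ultimately have "1 + norm (J p + c) \<le> (1 + B + norm c) * (1 + norm p)" by linarith
  then have "(1 + norm (J p + c)) ^ k \<le> ((1 + B + norm c) * (1 + norm p)) ^ k" by (intro power_mono) auto
  then have "C * (1 + norm (J p + c)) ^ k \<le> C * ((1 + B + norm c) * (1 + norm p)) ^ k" by (intro mult_left_mono C)
  then show ?thesis using C(2)[OF V[OF p]] by (simp add: power_mult_distrib mult.assoc)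
 qed
 then show ?thesis by (auto simp: grows_def)
qed

section \<open>Left-invariant fields as directional derivatives\<close>

definition left_dir :: "('n::finite, 'm::finite) herm => ('n, 'm) point => ('n, 'm) point => ('n, 'm) point" where
 "left_dir \<Phi> u p = (fst u, snd u + 2 *\<^sub>R Im_vec (\<Phi> (fst p) (fst u)))"

lemma left_dir_in:
 assumes Q: "qCR E F \<Phi>" and "u \<in> E \<times> F" "p \<in> E \<times> F"
 shows "left_dir \<Phi> u p \<in> E \<times> F"
 using hermD(1)[OF Q, of "fst p" "fst u"] assms CR_subspaces(2)[OF Q]
 by (auto simp: left_dir_def complexification_parts
  intro!: subspace_add[OF CR_subspaces(2)[OF Q]] subspace_scale[OF CR_subspaces(2)[OF Q]])

lemma left_field_eq:
 assumes Q: "qCR E F \<Phi>" and u: "u \<in> E \<times> F" and p: "p \<in> E \<times> F"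
 shows "left_field \<Phi> u f p = dir_deriv (left_dir \<Phi> u p) f p"
proof -
 have "\<Phi> (fst p) (t *\<^sub>R fst u) = t *\<^sub>R \<Phi> (fst p) (fst u)" for t
  using herm_right(2)[OF Q, of "fst u" "fst p" "of_real t"] u p by (auto simp: scaleR_eq_vector_scale)
 then have "group_mult \<Phi> p (t *\<^sub>R u) = p + t *\<^sub>R left_dir \<Phi> u p" for t
  by (auto simp: group_mult_def case_prod_beta left_dir_def Re_Im_vec_scaleR scaleR_add_right prod_eq_iff)
 then show ?thesis by (simp add: left_field_def dir_deriv_def)
qed

lemma left_field_cong:
 assumes Q: "qCR E F \<Phi>" and u: "u \<in> E \<times> F" and p: "p \<in> E \<times> F"
  and "!!p. p \<in> E \<times> F ==> f p = g p"
 shows "left_field \<Phi> u f p = left_field \<Phi> u g p"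
 unfolding left_field_eq[OF Q u p]
 by (rule dir_deriv_cong[OF CR_subspaces(3)[OF Q] left_dir_in[OF Q u p] p assms(4)])

lemma left_field_has_dir_deriv:
 assumes Q: "qCR E F \<Phi>" and u: "u \<in> E \<times> F" and p: "p \<in> E \<times> F"
  and "has_dir_deriv (left_dir \<Phi> u p) f D p"
 shows "left_field \<Phi> u f p = D"
 unfolding left_field_eq[OF Q u p] using assms(4) by (rule has_dir_deriv_eq)

lemma left_field_smooth_has_dir_deriv:
 assumes Q: "qCR E F \<Phi>" and u: "u \<in> E \<times> F" and p: "p \<in> E \<times> F"
  and f: "smooth_on (E \<times> F) f"
 shows "has_dir_deriv (left_dir \<Phi> u p) f (left_field \<Phi> u f p) p"
 unfolding left_field_eq[OF Q u p] by (rule smooth_has_dir_deriv[OF f left_dir_in[OF Q u p] p])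

lemma left_field_add:
 assumes Q: "qCR E F \<Phi>" and u: "u \<in> E \<times> F" and p: "p \<in> E \<times> F"
  and f: "smooth_on (E \<times> F) f" and g: "smooth_on (E \<times> F) g"
 shows "left_field \<Phi> u (%p. f p + g p) p = left_field \<Phi> u f p + left_field \<Phi> u g p"
 by (intro left_field_has_dir_deriv[OF Q u p] has_dir_deriv_add left_field_smooth_has_dir_deriv[OF Q u p] f g)

lemma left_field_mult:
 assumes Q: "qCR E F \<Phi>" and u: "u \<in> E \<times> F" and p: "p \<in> E \<times> F"
  and f: "smooth_on (E \<times> F) f" and g: "smooth_on (E \<times> F) g"
 shows "left_field \<Phi> u (%p. f p * g p) p = left_field \<Phi> u f p * g p + f p * left_field \<Phi> u g p"
 by (intro left_field_has_dir_deriv[OF Q u p] has_dir_deriv_mult left_field_smooth_has_dir_deriv[OF Q u p] f g)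

lemma left_field_cmult:
 assumes Q: "qCR E F \<Phi>" and u: "u \<in> E \<times> F" and p: "p \<in> E \<times> F"
  and f: "smooth_on (E \<times> F) f"
 shows "left_field \<Phi> u (%p. c * f p) p = c * left_field \<Phi> u f p"
 by (intro left_field_has_dir_deriv[OF Q u p] has_dir_deriv_cmult left_field_smooth_has_dir_deriv[OF Q u p] f)

lemma left_field_const:
 assumes Q: "qCR E F \<Phi>" and u: "u \<in> E \<times> F" and p: "p \<in> E \<times> F"
 shows "left_field \<Phi> u (%p. c) p = 0"
 by (intro left_field_has_dir_deriv[OF Q u p] has_dir_deriv_const)

lemma left_field_sum:
 assumes Q: "qCR E F \<Phi>" and u: "u \<in> E \<times> F" and p: "p \<in> E \<times> F"
  and f: "!!i. i \<in> I ==> smooth_on (E \<times> F) (f i)"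
 shows "left_field \<Phi> u (%p. \<Sum>i\<in>I. f i p) p = (\<Sum>i\<in>I. left_field \<Phi> u (f i) p)"
 by (intro left_field_has_dir_deriv[OF Q u p] has_dir_deriv_sum left_field_smooth_has_dir_deriv[OF Q u p] f)

text \<open>Constant directions with coefficients linear in p: in this form smoothness of the result
  is evident.\<close>

lemma left_field_expand:
 assumes Q: "qCR E F \<Phi>" and u: "u \<in> E \<times> F" and p: "p \<in> E \<times> F" and f: "smooth_on (E \<times> F) f"
 shows "left_field \<Phi> u f p = dir_deriv u f p +
  (\<Sum>b\<in>onb F. of_real (2 * (Im_vec (\<Phi> (fst p) (fst u)) \<bullet> b)) * dir_deriv (0, b) f p)"
proof -
 note S = CR_subspaces[OF Q]
 let ?y = "Im_vec (\<Phi> (fst p) (fst u))"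
 have y: "?y \<in> F" using hermD(1)[OF Q] u p by (auto simp: complexification_parts)
 have b: "(0, b) \<in> E \<times> F" if "b \<in> onb F" for b
  using that onb(1)[OF S(2)] subspace_0[OF S(1)] by auto
 have sn: "snd (\<Sum>b\<in>B. g b) = (\<Sum>b\<in>B. snd (g b))" for g :: "real ^ 'b => (complex ^ 'a) \<times> (real ^ 'b)" and B
  by (induction B rule: infinite_finite_induct) auto
 have fs: "fst (\<Sum>b\<in>B. g b) = (\<Sum>b\<in>B. fst (g b))" for g :: "real ^ 'b => (complex ^ 'a) \<times> (real ^ 'b)" and B
  by (induction B rule: infinite_finite_induct) auto
 have "(\<Sum>b\<in>onb F. (2 * (?y \<bullet> b)) *\<^sub>R b) = 2 *\<^sub>R ?y"
  using onb_expand[OF S(2) y] by (metis (no_types, lifting) scaleR_right.sum scaleR_scaleR sum.cong)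
 then have "left_dir \<Phi> u p = u + (\<Sum>b\<in>onb F. (2 * (?y \<bullet> b)) *\<^sub>R (0, b))"
  by (simp add: left_dir_def prod_eq_iff sn fs)
 then have "left_field \<Phi> u f p = dir_deriv (u + (\<Sum>b\<in>onb F. (2 * (?y \<bullet> b)) *\<^sub>R (0, b))) f p"
  by (simp add: left_field_eq[OF Q u p])
 also have "\<dots> = dir_deriv u f p + dir_deriv (\<Sum>b\<in>onb F. (2 * (?y \<bullet> b)) *\<^sub>R (0, b)) f p"
  by (rule dir_deriv_add_dir[OF S(3) f u _ p]) (intro subspace_sum subspace_scale S b)
 also have "dir_deriv (\<Sum>b\<in>onb F. (2 * (?y \<bullet> b)) *\<^sub>R (0, b)) f p =
   (\<Sum>b\<in>onb F. (2 * (?y \<bullet> b)) *\<^sub>R dir_deriv (0, b) f p)"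
  by (rule dir_deriv_sum_dir[OF S(3) f p b])
 finally show ?thesis by (simp add: scaleR_conv_of_real)
qed

lemma linear_on_sub_Im_Phi:
 assumes Q: "qCR E F \<Phi>" and v: "v \<in> E"
 shows "linear_on_sub (E \<times> F) (%p. Im_vec (\<Phi> (fst p) v))"
 using hermD(2,3)[OF Q] v
 by (auto simp: linear_on_sub_def Re_Im_vec_simps Re_Im_vec_scaleR scaleR_eq_vector_scale)

lemma smooth_left_field:
 assumes Q: "qCR E F \<Phi>" and u: "u \<in> E \<times> F" and f: "smooth_on (E \<times> F) f"
 shows "smooth_on (E \<times> F) (left_field \<Phi> u f)"
proof -
 note S = CR_subspaces[OF Q]
 have b: "(0, b) \<in> E \<times> F" if "b \<in> onb F" for b
  using that onb(1)[OF S(2)] subspace_0[OF S(1)] by auto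
 have l: "linear_on_sub (E \<times> F) (%p. cplx (2 * (Im_vec (\<Phi> (fst p) (fst u)) \<bullet> b)))" for b
  using linear_on_sub_Im_Phi[OF Q, of "fst u"] u
  by (auto simp: linear_on_sub_def inner_add_left scaleR_conv_of_real[where 'a = complex] distrib_left)
 have "smooth_on (E \<times> F) (%p. dir_deriv u f p +
  (\<Sum>b\<in>onb F. of_real (2 * (Im_vec (\<Phi> (fst p) (fst u)) \<bullet> b)) * dir_deriv (0, b) f p))"
  by (intro smooth_add smooth_sum smooth_mult S smooth_dir_deriv f u b linear_on_sub_smooth l)
 then show ?thesis by (subst smooth_cong[OF S(3) left_field_expand[OF Q u _ f]])
qed

lemma left_invariant_ops_cong:
 assumes Q: "qCR E F \<Phi>" and X: "X \<in> left_invariant_ops E F \<Phi>"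
  and "!!p. p \<in> E \<times> F ==> f p = g p" "p \<in> E \<times> F"
 shows "X f p = X g p"
 using X assms(3,4)
proof (induction arbitrary: p)
 case (field X u)
 then show ?case by (intro left_field_cong[OF Q]) auto
qed auto

lemma left_invariant_ops_smooth:
 assumes Q: "qCR E F \<Phi>" and X: "X \<in> left_invariant_ops E F \<Phi>" and f: "smooth_on (E \<times> F) f"
 shows "smooth_on (E \<times> F) (X f)"
 using X
proof induction
 case (field X u)
 then show ?case by (intro smooth_left_field[OF Q]) auto
qed (auto intro: f smooth_add smooth_cmult CR_subspaces(3)[OF Q])

lemma left_invariant_ops_comp:
 assumes X: "X \<in> left_invariant_ops E F \<Phi>" and Y: "Y \<in> left_invariant_ops E F \<Phi>"
 shows "(%f. X (Y f)) \<in> left_invariant_ops E F \<Phi>"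
 using X by induction (auto intro: Y left_invariant_ops.intros)

lemma left_field_in_ops: "u \<in> E \<times> F ==> left_field \<Phi> u \<in> left_invariant_ops E F \<Phi>"
 by (rule left_invariant_ops.field[OF left_invariant_ops.ident])

text \<open>The exponent is the same for all operators, as in \<open>CR_space\<close>; only the
  constant may depend on the operator.\<close>

definition moderate :: "(complex ^ 'n) set => (real ^ 'm) set => ('n::finite, 'm::finite) herm => nat =>
  (('n, 'm) point => complex) => bool" where
 "moderate E F \<Phi> k f \<longleftrightarrow> smooth_on (E \<times> F) f \<and>
  (\<forall>X\<in>left_invariant_ops E F \<Phi>. grows k (E \<times> F) (X f))"

lemma moderate_smooth: "moderate E F \<Phi> k f ==> smooth_on (E \<times> F) f"
 by (simp add: moderate_def)

lemma moderate_grows: "moderate E F \<Phi> k f ==> grows k (E \<times> F) f"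
 using left_invariant_ops.ident unfolding moderate_def by fastforce

lemma moderate_mono: "moderate E F \<Phi> k f ==> k \<le> l ==> moderate E F \<Phi> l f"
 by (auto simp: moderate_def intro: grows_mono)

lemma moderate_left_field:
 assumes "qCR E F \<Phi>" "moderate E F \<Phi> k f" "u \<in> E \<times> F"
 shows "moderate E F \<Phi> k (left_field \<Phi> u f)"
 unfolding moderate_def
proof (intro conjI ballI)
 show "smooth_on (E \<times> F) (left_field \<Phi> u f)"
  by (rule smooth_left_field[OF assms(1,3) moderate_smooth[OF assms(2)]])
 fix X assume "X \<in> left_invariant_ops E F \<Phi>"
 then have "(%f. X (left_field \<Phi> u f)) \<in> left_invariant_ops E F \<Phi>"
  by (rule left_invariant_ops_comp[OF _ left_field_in_ops[OF assms(3)]])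
 then show "grows k (E \<times> F) (X (left_field \<Phi> u f))" using assms(2) by (auto simp: moderate_def)
qed

text \<open>A linear span in which functions count only through their values on V; this is what the
  \<open>cong\<close> clause provides.\<close>

inductive_set fun_span :: "'a set => ('a => complex) set => ('a => complex) set" for V G where
 gen: "f \<in> G ==> f \<in> fun_span V G"
| zero: "(%p. 0) \<in> fun_span V G"
| add: "f \<in> fun_span V G ==> g \<in> fun_span V G ==> (%p. f p + g p) \<in> fun_span V G"
| cmult: "f \<in> fun_span V G ==> (%p. c * f p) \<in> fun_span V G"
| cong: "f \<in> fun_span V G ==> (!!p. p \<in> V ==> g p = f p) ==> g \<in> fun_span V G"

lemma fun_span_sum: "(!!i. i \<in> I ==> f i \<in> fun_span V G) ==> (%p. \<Sum>i\<in>I. f i p) \<in> fun_span V G"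
 by (induction I rule: infinite_finite_induct) (auto intro: fun_span.zero fun_span.add)

text \<open>Operators are built from fields, so a space of functions of growth k that is stable
  under the fields is stable under all operators, with the same k. Uniformity of the exponent thus
  reduces to finding an invariant space, and generators suffice.\<close>

lemma moderate_coinduct:
 assumes Q: "qCR E F \<Phi>"
  and G: "!!f. f \<in> G ==> smooth_on (E \<times> F) f \<and> grows k (E \<times> F) f"
  and inv: "!!f u. f \<in> G ==> u \<in> E \<times> F ==> left_field \<Phi> u f \<in> fun_span (E \<times> F) G"
  and f: "f \<in> fun_span (E \<times> F) G"
 shows "moderate E F \<Phi> k f"
proof -
 note S = CR_subspaces[OF Q]
 have sg: "smooth_on (E \<times> F) f \<and> grows k (E \<times> F) f" if "f \<in> fun_span (E \<times> F) G" for f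
  using that
 proof induction
  case (cong f g)
  then show ?case using smooth_cong[OF S(3), of g f] grows_cong[of "E \<times> F" g f] by blast
 qed (use G in \<open>auto intro: smooth_add smooth_cmult smooth_const S grows_add grows_cmult grows_const\<close>)
 have lf: "left_field \<Phi> u f \<in> fun_span (E \<times> F) G" if "f \<in> fun_span (E \<times> F) G" and u: "u \<in> E \<times> F" for f u
  using that(1)
 proof induction
  case (gen f) then show ?case by (rule inv[OF _ u])
 next
  case zero
  show ?case by (rule fun_span.cong[OF fun_span.zero]) (rule left_field_const[OF Q u])
 next
  case (add f g)
  show ?case by (rule fun_span.cong[OF fun_span.add[OF add.IH]])
    (rule left_field_add[OF Q u], use sg add.hyps in auto)
 next
  case (cmult f c)
  show ?case by (rule fun_span.cong[OF fun_span.cmult[OF cmult.IH]])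
    (rule left_field_cmult[OF Q u], use sg cmult.hyps in auto)
 next
  case (cong f g)
  show ?case by (rule fun_span.cong[OF cong.IH]) (rule left_field_cong[OF Q u], use cong.hyps in auto)
 qed
 have "X f \<in> fun_span (E \<times> F) G" if "X \<in> left_invariant_ops E F \<Phi>" for X
  using that by induction (auto intro: f lf fun_span.add fun_span.cmult)
 then show ?thesis using sg f by (auto simp: moderate_def)
qed

lemma moderate_cong:
 assumes Q: "qCR E F \<Phi>" and "!!p. p \<in> E \<times> F ==> f p = g p"
 shows "moderate E F \<Phi> k f \<longleftrightarrow> moderate E F \<Phi> k g"
proof -
 have "grows k (E \<times> F) (X f) \<longleftrightarrow> grows k (E \<times> F) (X g)" if "X \<in> left_invariant_ops E F \<Phi>" for X
  using left_invariant_ops_cong[OF Q that assms(2)] by (intro grows_cong) auto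
 then show ?thesis using smooth_cong[OF CR_subspaces(3)[OF Q] assms(2)] by (auto simp: moderate_def)
qed

lemma moderate_family:
 assumes Q: "qCR E F \<Phi>" and f: "f \<in> fun_span (E \<times> F) {f. moderate E F \<Phi> k f}"
 shows "moderate E F \<Phi> k f"
 by (rule moderate_coinduct[OF Q _ _ f])
  (auto intro: moderate_smooth moderate_grows fun_span.gen moderate_left_field[OF Q])

lemma moderate_add:
 assumes Q: "qCR E F \<Phi>" and "moderate E F \<Phi> k f" "moderate E F \<Phi> k g"
 shows "moderate E F \<Phi> k (%p. f p + g p)"
 using assms by (intro moderate_family fun_span.add fun_span.gen) auto

lemma moderate_cmult:
 assumes Q: "qCR E F \<Phi>" and "moderate E F \<Phi> k f"
 shows "moderate E F \<Phi> k (%p. c * f p)"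
 using assms by (intro moderate_family fun_span.cmult fun_span.gen) auto

lemma moderate_const:
 assumes Q: "qCR E F \<Phi>"
 shows "moderate E F \<Phi> k (%p. c)"
proof (rule moderate_coinduct[OF Q, where G = "range (%c p. c)"])
 fix f :: "('a, 'b) point => complex" and u assume "f \<in> range (%c p. c)" and u: "u \<in> E \<times> F"
 then show "left_field \<Phi> u f \<in> fun_span (E \<times> F) (range (%c p. c))"
  using left_field_const[OF Q u] by (intro fun_span.cong[OF fun_span.zero]) auto
qed (auto intro: fun_span.gen smooth_const CR_subspaces[OF Q] grows_const)

lemma moderate_sum:
 assumes Q: "qCR E F \<Phi>"
 shows "(!!i. i \<in> I ==> moderate E F \<Phi> k (f i)) ==> moderate E F \<Phi> k (%p. \<Sum>i\<in>I. f i p)"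
 by (induction I rule: infinite_finite_induct) (auto intro: moderate_add moderate_const Q)

text \<open>By the product rule, the span of all products of a function with exponent k and a
  function with exponent l is invariant under the fields.\<close>

lemma moderate_mult:
 assumes Q: "qCR E F \<Phi>" and f: "moderate E F \<Phi> k f" and g: "moderate E F \<Phi> l g"
 shows "moderate E F \<Phi> (k + l) (%p. f p * g p)"
proof (rule moderate_coinduct[OF Q, where G = "{h. \<exists>f g. moderate E F \<Phi> k f \<and> moderate E F \<Phi> l g \<and> h = (%p. f p * g p)}"])
 let ?G = "{h. \<exists>f g. moderate E F \<Phi> k f \<and> moderate E F \<Phi> l g \<and> h = (%p. f p * g p)}"
 fix h u assume "h \<in> ?G" and u: "u \<in> E \<times> F"
 then obtain f g where fg: "moderate E F \<Phi> k f" "moderate E F \<Phi> l g" "h = (%p. f p * g p)" by auto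
 have "(%p. left_field \<Phi> u f p * g p + f p * left_field \<Phi> u g p) \<in> fun_span (E \<times> F) ?G"
  using fg moderate_left_field[OF Q _ u] by (intro fun_span.add fun_span.gen) blast+
 then show "left_field \<Phi> u h \<in> fun_span (E \<times> F) ?G"
  by (rule fun_span.cong) (simp add: fg(3) left_field_mult[OF Q u _ moderate_smooth[OF fg(1)] moderate_smooth[OF fg(2)]])
next
 let ?G = "{h. \<exists>f g. moderate E F \<Phi> k f \<and> moderate E F \<Phi> l g \<and> h = (%p. f p * g p)}"
 show "(%p. f p * g p) \<in> fun_span (E \<times> F) ?G" using f g by (intro fun_span.gen) blast
 fix h assume "h \<in> ?G"
 then obtain f g where fg: "moderate E F \<Phi> k f" "moderate E F \<Phi> l g" "h = (%p. f p * g p)" by auto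
 show "smooth_on (E \<times> F) h \<and> grows (k + l) (E \<times> F) h"
  unfolding fg(3)
  by (intro conjI smooth_mult grows_mult CR_subspaces(3)[OF Q]
   moderate_smooth[OF fg(1)] moderate_smooth[OF fg(2)] moderate_grows[OF fg(1)] moderate_grows[OF fg(2)])
qed

text \<open>A left-invariant field maps an affine function to an affine function, so affine
  functions form an invariant space of growth 1.\<close>

lemma moderate_linear_on_sub:
 assumes Q: "qCR E F \<Phi>" and L: "linear_on_sub (E \<times> F) L"
 shows "moderate E F \<Phi> 1 L"
proof (rule moderate_coinduct[OF Q, where G = "{h. \<exists>L c. linear_on_sub (E \<times> F) L \<and> h = (%p. L p + c)}"])
 note S = CR_subspaces[OF Q]
 let ?G = "{h :: ('a, 'b) point => complex. \<exists>L c. linear_on_sub (E \<times> F) L \<and> h = (%p. L p + c)}"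
 show "L \<in> fun_span (E \<times> F) ?G"
  by (rule fun_span.gen, simp, rule exI[of _ L], rule conjI[OF L], rule exI[of _ 0], simp)
 fix h assume "h \<in> ?G"
 then obtain L c where L: "linear_on_sub (E \<times> F) L" "h = (%p. L p + c)" by auto
 show "smooth_on (E \<times> F) h \<and> grows 1 (E \<times> F) h"
  unfolding L(2) by (intro conjI smooth_add S linear_on_sub_smooth L smooth_const grows_add grows_linear_on_sub grows_const)
 fix u assume u: "u \<in> E \<times> F"
 let ?M = "%p. L (0, 2 *\<^sub>R Im_vec (\<Phi> (fst p) (fst u)))"
 have inF: "(0, 2 *\<^sub>R Im_vec (\<Phi> (fst p) (fst u))) \<in> E \<times> F" if "p \<in> E \<times> F" for p
  using hermD(1)[OF Q, of "fst p" "fst u"] u that S by (auto simp: complexification_parts intro: subspace_0 subspace_scale)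
 have "linear_on_sub (E \<times> F) ?M"
 proof -
  let ?v = "%p. (0 :: complex ^ 'a, 2 *\<^sub>R Im_vec (\<Phi> (fst p) (fst u)))"
  have v: "?v (p + q) = ?v p + ?v q" "?v (c *\<^sub>R p) = c *\<^sub>R ?v p" if "p \<in> E \<times> F" "q \<in> E \<times> F" for p q c
   using linear_on_sub_Im_Phi[OF Q, of "fst u"] u that
   by (auto simp: linear_on_sub_def scaleR_add_right prod_eq_iff)
  have L': "L (x + y) = L x + L y" "L (c *\<^sub>R x) = c *\<^sub>R L x" if "x \<in> E \<times> F" "y \<in> E \<times> F" for x y c
   using L(1) that unfolding linear_on_sub_def by blast+
  show ?thesis unfolding linear_on_sub_def
  proof (intro conjI ballI allI)
   fix p q assume p: "p \<in> E \<times> F" and q: "q \<in> E \<times> F"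
   show "?M (p + q) = ?M p + ?M q" unfolding v(1)[OF p q] by (rule L'(1)[OF inF[OF p] inF[OF q]])
  next
   fix c p assume p: "p \<in> E \<times> F"
   show "?M (c *\<^sub>R p) = c *\<^sub>R ?M p" unfolding v(2)[OF p p] by (rule L'(2)[OF inF[OF p] inF[OF p]])
  qed
 qed
 moreover have "left_field \<Phi> u h p = ?M p + L u" if p: "p \<in> E \<times> F" for p
 proof (rule left_field_has_dir_deriv[OF Q u p])
  have "left_dir \<Phi> u p = u + (0, 2 *\<^sub>R Im_vec (\<Phi> (fst p) (fst u)))"
   by (simp add: left_dir_def prod_eq_iff)
  moreover have "L (u + (0, 2 *\<^sub>R Im_vec (\<Phi> (fst p) (fst u)))) = L u + ?M p"
   using L(1) u inF[OF p] unfolding linear_on_sub_def by blast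
  ultimately have "L (left_dir \<Phi> u p) = ?M p + L u" by (simp only: add.commute)
  then show "has_dir_deriv (left_dir \<Phi> u p) h (?M p + L u) p"
   using has_dir_deriv_add[OF linear_on_sub_dir_deriv[OF S(3) L(1) left_dir_in[OF Q u p] p] has_dir_deriv_const[of _ c]]
   by (simp add: L(2))
 qed
 ultimately show "left_field \<Phi> u h \<in> fun_span (E \<times> F) ?G"
  by (intro fun_span.cong[OF fun_span.gen[of "%p. ?M p + L u"]]) blast+
qed

lemma left_field_pullback:
 fixes \<Phi> :: "('n::finite, 'm::finite) herm" and \<Phi>' :: "('k::finite, 'l::finite) herm"
 assumes Q: "qCR E F \<Phi>" and Q': "qCR E' F' \<Phi>'" and J: "linear J"
  and JV: "!!p. p \<in> E \<times> F ==> J p \<in> E' \<times> F'" and c: "c \<in> E' \<times> F'"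
  and hom: "!!u p. u \<in> E \<times> F ==> p \<in> E \<times> F ==> J (left_dir \<Phi> u p) = left_dir \<Phi>' (J u) (J p + c)"
  and f: "smooth_on (E' \<times> F') f" and u: "u \<in> E \<times> F" and p: "p \<in> E \<times> F"
 shows "left_field \<Phi> u (%p. f (J p + c)) p = left_field \<Phi>' (J u) f (J p + c)"
proof (rule left_field_has_dir_deriv[OF Q u p])
 show "has_dir_deriv (left_dir \<Phi> u p) (%p. f (J p + c)) (left_field \<Phi>' (J u) f (J p + c)) p"
  by (rule has_dir_deriv_compose_affine[OF J], unfold hom[OF u p])
   (rule left_field_smooth_has_dir_deriv[OF Q' JV[OF u] subspace_add[OF CR_subspaces(3)[OF Q'] JV[OF p] c] f])
qed

text \<open>\<open>hom\<close> says that x |-> J x + c maps left-invariant fields to left-invariant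
  fields. This covers central translations, the projection of N onto N_2, and translations along
  null directions.\<close>

lemma moderate_pullback:
 fixes \<Phi> :: "('n::finite, 'm::finite) herm" and \<Phi>' :: "('k::finite, 'l::finite) herm"
 assumes Q: "qCR E F \<Phi>" and Q': "qCR E' F' \<Phi>'" and J: "linear J"
  and JV: "!!p. p \<in> E \<times> F ==> J p \<in> E' \<times> F'" and c: "c \<in> E' \<times> F'"
  and hom: "!!u p. u \<in> E \<times> F ==> p \<in> E \<times> F ==> J (left_dir \<Phi> u p) = left_dir \<Phi>' (J u) (J p + c)"
  and f: "moderate E' F' \<Phi>' k f"
 shows "moderate E F \<Phi> k (%p. f (J p + c))"
proof (rule moderate_coinduct[OF Q, where G = "{h. \<exists>f. moderate E' F' \<Phi>' k f \<and> h = (%p. f (J p + c))}"])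
 note S = CR_subspaces[OF Q] and S' = CR_subspaces[OF Q']
 let ?G = "{h. \<exists>f. moderate E' F' \<Phi>' k f \<and> h = (%p. f (J p + c))}"
 show "(%p. f (J p + c)) \<in> fun_span (E \<times> F) ?G" using f by (intro fun_span.gen) auto
 have JV': "J p + c \<in> E' \<times> F'" if "p \<in> E \<times> F" for p by (rule subspace_add[OF S'(3) JV[OF that] c])
 fix h assume "h \<in> ?G"
 then obtain f where f: "moderate E' F' \<Phi>' k f" "h = (%p. f (J p + c))" by auto
 have "grows k (E \<times> F) h" unfolding f(2) by (rule grows_compose_affine[OF J JV' moderate_grows[OF f(1)]])
 then show "smooth_on (E \<times> F) h \<and> grows k (E \<times> F) h"
  unfolding f(2) using smooth_compose_affine[OF S(3) S'(3) J JV c moderate_smooth[OF f(1)]] by blast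
 fix u assume u: "u \<in> E \<times> F"
 have "left_field \<Phi> u h p = left_field \<Phi>' (J u) f (J p + c)" if p: "p \<in> E \<times> F" for p
  unfolding f(2) by (rule left_field_pullback[OF Q Q' J JV c hom moderate_smooth[OF f(1)] u p])
 then show "left_field \<Phi> u h \<in> fun_span (E \<times> F) ?G"
  using moderate_left_field[OF Q' f(1) JV[OF u]]
  by (intro fun_span.cong[OF fun_span.gen[of "%p. left_field \<Phi>' (J u) f (J p + c)"]]) blast+
qed

section \<open>Interpolation\<close>

text \<open>The Lagrange basis polynomial of the node l, for the nodes 0, ..., D.\<close>

definition lag :: "nat => nat => complex poly" where
 "lag D l = smult (inverse (\<Prod>j\<in>{..D} - {l}. of_nat l - of_nat j)) (\<Prod>j\<in>{..D} - {l}. [:- of_nat j, 1:])"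

lemma poly_lagrange_poly:
 assumes "i \<le> D" "l \<le> D"
 shows "poly (lag D l) (of_nat i) = (if i = l then 1 else 0)"
proof (cases "i = l")
 case True
 have "(\<Prod>j\<in>{..D} - {l}. of_nat l - of_nat j :: complex) \<noteq> 0" by (subst prod_zero_iff) auto
 then show ?thesis using True by (simp add: lag_def poly_prod)
next
 case False
 then have "(\<Prod>j\<in>{..D} - {l}. of_nat i - of_nat j :: complex) = 0"
  using assms by (subst prod_zero_iff) auto
 then show ?thesis using False by (simp add: lag_def poly_prod)
qed

lemma degree_lagrange_poly: "l \<le> D ==> degree (lag D l) \<le> D"
proof -
 assume "l \<le> D"
 have "degree (\<Prod>j\<in>{..D} - {l}. [:- of_nat j, 1:] :: complex poly) \<le> (\<Sum>j\<in>{..D} - {l}. degree [:- of_nat j, 1::complex:])"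
  using degree_prod_sum_le[of "{..D} - {l}" "%j. [:- of_nat j, 1::complex:]"] by (simp add: o_def)
 also have "\<dots> = D" using \<open>l \<le> D\<close> by simp
 finally show ?thesis unfolding lag_def using degree_smult_le le_trans by blast
qed

lemma lagrange_interpolation:
 assumes "degree r \<le> D"
 shows "poly r t = (\<Sum>l\<le>D. poly (lag D l) t * poly r (of_nat l))"
proof -
 let ?q = "\<Sum>l\<le>D. smult (poly r (of_nat l)) (lag D l)"
 have "r = ?q"
 proof (rule poly_eqI_degree[where A = "of_nat ` {..D}"])
  fix x :: complex assume "x \<in> of_nat ` {..D}"
  then obtain i where i: "i \<le> D" "x = of_nat i" by auto
  have "poly ?q x = (\<Sum>l\<le>D. if i = l then poly r (of_nat l) else 0)"
   unfolding poly_sum using i by (intro sum.cong) (auto simp: poly_lagrange_poly)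
  then show "poly r x = poly ?q x" using i by simp
 next
  have "inj_on (of_nat :: nat => complex) {..D}" by (auto simp: inj_on_def)
  then have c: "card (of_nat ` {..D} :: complex set) = Suc D" by (simp add: card_image)
  then show "degree r < card (of_nat ` {..D} :: complex set)" using assms by simp
  have "degree ?q \<le> D"
   by (rule degree_sum_le) (auto simp: degree_lagrange_poly)
  then show "degree ?q < card (of_nat ` {..D} :: complex set)" using c by simp
 qed
 then have "poly r t = poly ?q t" by simp
 then show ?thesis by (simp add: poly_sum mult.commute)
qed

text \<open>Interpolation is exact on monomials. This is the source of coefficients with vanishing
  moments: the Lagrange values at the nodes, together with -1 at t.\<close>

lemma lagrange_moment:
 assumes "i \<le> D" shows "(\<Sum>l\<le>D. poly (lag D l) t * of_nat l ^ i) = t ^ i"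
 using lagrange_interpolation[of "monom 1 i" D t] assms by (simp add: poly_monom degree_monom_eq)

text \<open>One variable at a time. The parameter set \<open>T\<close> is the real line for the
  directions of F1, along which \<open>f\<close> is a function of real variables, and the whole
  plane for complex directions.\<close>

lemma multi_interpolation:
 fixes f :: "'v::comm_monoid_add => complex" and \<sigma> :: "'i => complex => 'v"
 assumes I: "finite I" and T: "!!l. of_nat l \<in> T"
  and C: "!!x i t. x \<in> C ==> i \<in> I ==> t \<in> T ==> x + \<sigma> i t \<in> C"
  and line: "!!x i t. x \<in> C ==> i \<in> I ==> t \<in> T ==>
   f (x + \<sigma> i t) = (\<Sum>l\<le>D. poly (lag D l) t * f (x + \<sigma> i (of_nat l)))"
  and x: "x \<in> C" and t: "!!i. i \<in> I ==> t i \<in> T"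
 shows "f (x + (\<Sum>i\<in>I. \<sigma> i (t i))) =
  (\<Sum>m\<in>I \<rightarrow>\<^sub>E {..D}. (\<Prod>i\<in>I. poly (lag D (m i)) (t i)) * f (x + (\<Sum>i\<in>I. \<sigma> i (of_nat (m i)))))"
 using I C line x t
proof (induction I arbitrary: x)
 case empty
 then show ?case by simp
next
 case (insert i I)
 note C = insert.prems(1)
 let ?L = "%l. poly (lag D l)"
 let ?P = "%m. \<Prod>j\<in>I. ?L (m j) (t j)" and ?S = "%m. \<Sum>j\<in>I. \<sigma> j (of_nat (m j))"
 have S_in: "y + ?S m \<in> C" if "y \<in> C" for y m
 proof -
  have "J \<subseteq> I ==> y + (\<Sum>j\<in>J. \<sigma> j (of_nat (m j))) \<in> C" for J
  proof (induction J rule: infinite_finite_induct)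
   case (insert j J)
   then have "y + (\<Sum>j\<in>J. \<sigma> j (of_nat (m j))) + \<sigma> j (of_nat (m j)) \<in> C"
    by (intro C) (auto intro: T)
   then show ?case using insert by (simp add: add_ac)
  qed (use that in auto)
  then show ?thesis by blast
 qed
 have inj: "inj_on (%(l, m). m(i := l)) ({..D} \<times> (I \<rightarrow>\<^sub>E {..D}))"
  using inj_combinator'[OF insert.hyps(2), of "%_. {..D}"] by (auto simp: inj_on_def)
 have "f (x + (\<Sum>j\<in>insert i I. \<sigma> j (t j))) = f ((x + \<sigma> i (t i)) + (\<Sum>j\<in>I. \<sigma> j (t j)))"
  using insert.hyps by (simp add: add_ac)
 also have "\<dots> = (\<Sum>m\<in>I \<rightarrow>\<^sub>E {..D}. ?P m * f ((x + \<sigma> i (t i)) + ?S m))"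
  by (rule insert.IH) (use insert.prems in auto)
 also have "\<dots> = (\<Sum>m\<in>I \<rightarrow>\<^sub>E {..D}. ?P m * (\<Sum>l\<le>D. ?L l (t i) * f ((x + \<sigma> i (of_nat l)) + ?S m)))"
 proof (intro sum.cong refl)
  fix m
  have "f ((x + ?S m) + \<sigma> i (t i)) = (\<Sum>l\<le>D. ?L l (t i) * f ((x + ?S m) + \<sigma> i (of_nat l)))"
   using insert.prems S_in by auto
  then show "?P m * f ((x + \<sigma> i (t i)) + ?S m) = ?P m * (\<Sum>l\<le>D. ?L l (t i) * f ((x + \<sigma> i (of_nat l)) + ?S m))"
   by (simp add: add_ac)
 qed
 also have "\<dots> = (\<Sum>m\<in>I \<rightarrow>\<^sub>E {..D}. \<Sum>l\<le>D. ?L l (t i) * ?P m * f ((x + \<sigma> i (of_nat l)) + ?S m))"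
  by (simp add: sum_distrib_left mult_ac)
 also have "\<dots> = (\<Sum>l\<le>D. \<Sum>m\<in>I \<rightarrow>\<^sub>E {..D}. ?L l (t i) * ?P m * f ((x + \<sigma> i (of_nat l)) + ?S m))"
  by (rule sum.swap)
 also have "\<dots> = (\<Sum>(l, m)\<in>{..D} \<times> (I \<rightarrow>\<^sub>E {..D}). ?L l (t i) * ?P m * f ((x + \<sigma> i (of_nat l)) + ?S m))"
  by (rule sum.cartesian_product)
 also have "\<dots> = (\<Sum>(l, m)\<in>{..D} \<times> (I \<rightarrow>\<^sub>E {..D}). (%m. (\<Prod>j\<in>insert i I. ?L (m j) (t j)) * f (x + (\<Sum>j\<in>insert i I. \<sigma> j (of_nat (m j))))) (m(i := l)))"
 proof (intro sum.cong refl, clarify)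
  fix l m
  have "(\<Prod>j\<in>I. ?L ((m(i := l)) j) (t j)) = ?P m" using insert.hyps(2) by (intro prod.cong) auto
  moreover have "(\<Sum>j\<in>I. \<sigma> j (of_nat ((m(i := l)) j))) = ?S m" using insert.hyps(2) by (intro sum.cong) auto
  ultimately show "?L l (t i) * ?P m * f ((x + \<sigma> i (of_nat l)) + ?S m) =
    (\<Prod>j\<in>insert i I. ?L ((m(i := l)) j) (t j)) * f (x + (\<Sum>j\<in>insert i I. \<sigma> j (of_nat ((m(i := l)) j))))"
   using insert.hyps by (simp add: add_ac)
 qed
 also have "\<dots> = (\<Sum>m\<in>(%(l, m). m(i := l)) ` ({..D} \<times> (I \<rightarrow>\<^sub>E {..D})). (\<Prod>j\<in>insert i I. ?L (m j) (t j)) * f (x + (\<Sum>j\<in>insert i I. \<sigma> j (of_nat (m j)))))"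
  by (subst sum.reindex[OF inj]) (simp add: case_prod_unfold comp_def)
 also have "(%(l, m). m(i := l)) ` ({..D} \<times> (I \<rightarrow>\<^sub>E {..D})) = insert i I \<rightarrow>\<^sub>E {..D}"
  by (simp add: PiE_insert_eq)
 finally show ?case .
qed

section \<open>Tensor Lagrange polynomials on a complexification\<close>

definition cdot :: "complex ^ 'm::finite => real ^ 'm => complex" where
 "cdot z b = (\<Sum>j\<in>UNIV. z $ j * cplx (b $ j))"

lemma cdot_simps:
 "cdot (z + w) b = cdot z b + cdot w b" "cdot (z - w) b = cdot z b - cdot w b"
 "cdot (c *s z) b = c * cdot z b" "cdot (rvec x) b = cplx (x \<bullet> b)" "cdot 0 b = 0"
 by (simp_all add: cdot_def distrib_right left_diff_distrib sum.distrib sum_subtractf sum_distrib_left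
  mult.assoc of_real_vec_def inner_vec_def)

lemma complex_vec_decomp: "z = rvec (Re_vec z) + \<i> *s rvec (Im_vec z)"
 by (rule complex_vec_eqI) (simp_all add: Re_Im_vec_simps)

lemma of_real_vec_simps:
 "rvec (x + y) = rvec x + rvec y" "rvec (x - y) = rvec x - rvec y"
 "rvec (c *\<^sub>R x) = of_real c *s rvec x" "rvec 0 = 0"
 by (simp_all add: of_real_vec_def vec_eq_iff)

lemma of_real_vec_sum: "rvec (\<Sum>i\<in>I. f i) = (\<Sum>i\<in>I. rvec (f i))"
 by (induction I rule: infinite_finite_induct) (auto simp: of_real_vec_simps)

text \<open>Lagrange polynomial of the grid point with coordinates \<open>m\<close>; the coordinates
  \<open>cdot z b\<close> are complex linear in z, so it makes sense off the real points.\<close>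

definition gpoly :: "(real ^ 'm::finite) set => nat => (real ^ 'm => nat) => complex ^ 'm => complex" where
 "gpoly B D m z = (\<Prod>b\<in>B. poly (lag D (m b)) (cdot z b))"

definition grid_point :: "(real ^ 'm::finite) set => (real ^ 'm => nat) => real ^ 'm" where
 "grid_point B m = (\<Sum>b\<in>B. real (m b) *\<^sub>R b)"

definition grid_poly_deriv :: "(real ^ 'm::finite) set => nat => (real ^ 'm => nat) => complex ^ 'm => complex ^ 'm => complex" where
 "grid_poly_deriv B D m z e = (\<Sum>b\<in>B. cdot e b * (poly (pderiv (lag D (m b))) (cdot z b) *
   (\<Prod>b'\<in>B - {b}. poly (lag D (m b')) (cdot z b'))))"

lemma grid_poly_cong: "(!!b. b \<in> B ==> cdot z b = cdot w b) ==> gpoly B D m z = gpoly B D m w"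
 by (simp add: gpoly_def)

lemma grid_poly_deriv_cong: "(!!b. b \<in> B ==> cdot e b = cdot e' b) ==> grid_poly_deriv B D m z e = grid_poly_deriv B D m z e'"
 by (simp add: grid_poly_deriv_def)

lemma grid_poly_deriv_linear:
 "grid_poly_deriv B D m z (e + e') = grid_poly_deriv B D m z e + grid_poly_deriv B D m z e'"
 "grid_poly_deriv B D m z (c *s e) = c * grid_poly_deriv B D m z e"
 by (simp_all add: grid_poly_deriv_def cdot_simps distrib_right sum.distrib sum_distrib_left mult.assoc)

lemma has_vector_derivative_grid_poly:
 assumes "!!b. b \<in> B ==> ((%t. cdot (\<gamma> t) b) has_vector_derivative cdot e b) (at (t0 :: real))"
 shows "((%t. gpoly B D m (\<gamma> t)) has_vector_derivative grid_poly_deriv B D m (\<gamma> t0) e) (at t0)"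
proof -
 have 1: "((%t. poly (lag D (m b)) (cdot (\<gamma> t) b)) has_vector_derivative
   cdot e b * poly (pderiv (lag D (m b))) (cdot (\<gamma> t0) b)) (at t0)" if "b \<in> B" for b
  using field_vector_diff_chain_at[OF assms[OF that] poly_DERIV[of "lag D (m b)"]] by (simp add: o_def)
 have "((%t. \<Prod>b\<in>B. poly (lag D (m b)) (cdot (\<gamma> t) b)) has_derivative
   (%h. \<Sum>b\<in>B. h *\<^sub>R (cdot e b * poly (pderiv (lag D (m b))) (cdot (\<gamma> t0) b)) *
    (\<Prod>b'\<in>B - {b}. poly (lag D (m b')) (cdot (\<gamma> t0) b')))) (at t0)"
  using 1 by (intro has_derivative_prod) (auto simp: has_vector_derivative_def)
 then show ?thesis
  by (simp add: gpoly_def[abs_def] grid_poly_deriv_def has_vector_derivative_def scaleR_right.sum mult.assoc)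
qed

lemma cdot_orthonormal:
 assumes "subspace V" "b \<in> onb V" "b' \<in> onb V"
 shows "cdot (rvec b) b' = (if b = b' then 1 else 0)"
 using inner_onb[OF assms] by (simp add: cdot_simps)

text \<open>A translated basis polynomial still has degree at most D in every coordinate, so its
  values on the grid reproduce it. The expansion separates z from w, and this turns the extension
  \<open>hol_ext\<close> into a finite sum of products.\<close>

lemma grid_poly_interpolation:
 fixes V :: "(real ^ 'm::finite) set"
 assumes V: "subspace V" and m: "m \<in> onb V \<rightarrow>\<^sub>E {..D}"
 shows "gpoly (onb V) D m (z + w) = (\<Sum>m'\<in>onb V \<rightarrow>\<^sub>E {..D}.
  gpoly (onb V) D m' z * gpoly (onb V) D m (rvec (grid_point (onb V) m') + w))"
proof -
 let ?B = "onb V"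
 let ?f = "%y. gpoly ?B D m (y + w)"
 have fin: "finite ?B" by (rule finite_onb[OF V])
 have line: "?f (x + t *s rvec b) = (\<Sum>l\<le>D. poly (lag D l) t * ?f (x + of_nat l *s rvec b))"
  if b: "b \<in> ?B" for x b t
 proof -
  define c where "c = (\<Prod>b'\<in>?B - {b}. poly (lag D (m b')) (cdot (x + w) b'))"
  define r where "r = smult c (lag D (m b) \<circ>\<^sub>p [:cdot (x + w) b, 1:])"
  have deg: "degree r \<le> D"
  proof -
   have "degree r \<le> degree (lag D (m b) \<circ>\<^sub>p [:cdot (x + w) b, 1:])"
    unfolding r_def by (rule degree_smult_le)
   also have "\<dots> \<le> degree (lag D (m b)) * degree [:cdot (x + w) b, 1:]" by (rule degree_pcompose_le)
   also have "\<dots> \<le> D" using degree_lagrange_poly[of "m b" D] m b by (auto simp: PiE_iff)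
   finally show ?thesis .
  qed
  have r: "?f (x + s *s rvec b) = poly r s" for s
  proof -
   have "?f (x + s *s rvec b) = poly (lag D (m b)) (cdot (x + s *s rvec b + w) b) *
     (\<Prod>b'\<in>?B - {b}. poly (lag D (m b')) (cdot (x + s *s rvec b + w) b'))"
    unfolding gpoly_def using fin b by (simp add: prod.remove)
   also have "(\<Prod>b'\<in>?B - {b}. poly (lag D (m b')) (cdot (x + s *s rvec b + w) b')) = c"
    unfolding c_def using b by (intro prod.cong refl) (auto simp: cdot_simps inner_onb[OF V])
   also have "cdot (x + s *s rvec b + w) b = cdot (x + w) b + s"
    using b by (simp add: cdot_simps inner_onb[OF V])
   finally show ?thesis by (simp add: r_def poly_pcompose)
  qed
  show ?thesis unfolding r by (rule lagrange_interpolation[OF deg])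
 qed
 have "?f z = ?f (0 + (\<Sum>b\<in>?B. cdot z b *s rvec b))"
 proof (rule grid_poly_cong)
  fix b assume b: "b \<in> ?B"
  have s: "cdot (\<Sum>b\<in>J. g b) b = (\<Sum>b'\<in>J. cdot (g b') b)" for g :: "real ^ 'm => complex ^ 'm" and J
   by (induction J rule: infinite_finite_induct) (auto simp: cdot_simps)
  have "(\<Sum>b'\<in>?B. cdot z b' * cdot (rvec b') b) = (\<Sum>b'\<in>?B. if b' = b then cdot z b' else 0)"
   using b by (intro sum.cong) (auto simp: cdot_orthonormal[OF V])
  then show "cdot (z + w) b = cdot (0 + (\<Sum>b\<in>?B. cdot z b *s rvec b) + w) b"
   using b fin by (simp add: cdot_simps(1,3,5) s)
 qed
 also have "\<dots> = (\<Sum>m'\<in>?B \<rightarrow>\<^sub>E {..D}. (\<Prod>b\<in>?B. poly (lag D (m' b)) (cdot z b)) * ?f (0 + (\<Sum>b\<in>?B. of_nat (m' b) *s rvec b)))"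
  by (rule multi_interpolation[OF fin, where T = UNIV and C = UNIV and \<sigma> = "%b t. t *s rvec b"])
   (use line in auto)
 finally show ?thesis
  by (simp add: gpoly_def[symmetric] grid_point_def of_real_vec_sum of_real_vec_simps)
qed

text \<open>The derivative of \<open>grid_poly_interpolation\<close> at t = 0 along w = t e.\<close>

lemma grid_poly_deriv_interpolation:
 fixes V :: "(real ^ 'm::finite) set"
 assumes V: "subspace V" and m: "m \<in> onb V \<rightarrow>\<^sub>E {..D}"
 shows "grid_poly_deriv (onb V) D m z e = (\<Sum>m'\<in>onb V \<rightarrow>\<^sub>E {..D}.
  gpoly (onb V) D m' z * grid_poly_deriv (onb V) D m (rvec (grid_point (onb V) m')) e)"
proof -
 let ?B = "onb V"
 have d: "((%t. gpoly ?B D m (y + of_real t *s e)) has_vector_derivative grid_poly_deriv ?B D m y e) (at 0)" for y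
 proof -
  have "((%t. cdot (y + of_real t *s e) b) has_vector_derivative cdot e b) (at 0)" for b
   unfolding cdot_simps by (auto intro!: derivative_eq_intros has_vector_derivative_of_real simp: has_vector_derivative_def scaleR_conv_of_real)
  from has_vector_derivative_grid_poly[where \<gamma> = "%t. y + of_real t *s e", OF this] show ?thesis by simp
 qed
 have "((%t. \<Sum>m'\<in>?B \<rightarrow>\<^sub>E {..D}. gpoly ?B D m' z * gpoly ?B D m (rvec (grid_point ?B m') + of_real t *s e))
   has_vector_derivative (\<Sum>m'\<in>?B \<rightarrow>\<^sub>E {..D}. gpoly ?B D m' z * grid_poly_deriv ?B D m (rvec (grid_point ?B m')) e)) (at 0)"
  by (intro has_vector_derivative_sum has_vector_derivative_mult_right d)
 then show ?thesis
  unfolding grid_poly_interpolation[OF V m, symmetric] using d vector_derivative_unique_at by blast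
qed

section \<open>Holomorphic functions and polynomials\<close>

text \<open>\<open>has_derivative_plane\<close> gives real differentiability, and the Cauchy-Riemann
  equation makes the derivative complex linear.\<close>

lemma smooth_CR_has_field_derivative:
 fixes f :: "complex => complex"
 assumes f: "smooth_on UNIV f" and cr: "dir_deriv \<i> f s = \<i> * dir_deriv 1 f s"
 shows "(f has_field_derivative dir_deriv 1 f s) (at s)"
proof -
 have 1: "((%h. (Re (h - s), Im (h - s))) has_derivative (%h. (Re h, Im h))) (at s)"
  by (auto intro!: derivative_eq_intros has_derivative_Re has_derivative_Im)
 have 2: "((%(a, b). f (s + a *\<^sub>R 1 + b *\<^sub>R \<i>)) has_derivative (%(a, b). a *\<^sub>R dir_deriv 1 f s + b *\<^sub>R dir_deriv \<i> f s))
   (at (Re (s - s), Im (s - s)))"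
  using has_derivative_plane[OF subspace_UNIV f, of 1 \<i> s] by simp
 have "((%h. f (s + Re (h - s) *\<^sub>R 1 + Im (h - s) *\<^sub>R \<i>)) has_derivative (%h. Re h *\<^sub>R dir_deriv 1 f s + Im h *\<^sub>R dir_deriv \<i> f s)) (at s)"
  using has_derivative_compose[OF 1 2] by simp
 moreover have "s + Re (h - s) *\<^sub>R 1 + Im (h - s) *\<^sub>R \<i> = h" for h by (simp add: complex_eq_iff)
 moreover have "(%h. Re h *\<^sub>R dir_deriv 1 f s + Im h *\<^sub>R dir_deriv \<i> f s) = (*) (dir_deriv 1 f s)"
  unfolding cr by (auto simp: complex_eq_iff algebra_simps)
 ultimately show ?thesis by (simp add: has_field_derivative_def)
qed

text \<open>By Liouville's theorem \<open>f\<close> is a polynomial of degree at most D, so its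
  values at the nodes determine it.\<close>

lemma entire_polynomial_growth:
 fixes f :: "complex => complex"
 assumes f: "!!s. (f has_field_derivative f' s) (at s)" and g: "grows D UNIV f"
 shows "f t = (\<Sum>l\<le>D. poly (lag D l) t * f (of_nat l))"
proof -
 have hol: "f holomorphic_on UNIV" by (subst holomorphic_on_open) (use f in blast)+
 obtain C where C: "C \<ge> 0" "!!s. norm (f s) \<le> C * (1 + norm s) ^ D" using growsE[OF g] by auto
 have le: "norm (f s) \<le> (C * 2 ^ D) * norm s ^ D" if "1 \<le> norm s" for s
 proof -
  have "(1 + norm s) ^ D \<le> (2 * norm s) ^ D" using that by (intro power_mono) auto
  then have "C * (1 + norm s) ^ D \<le> C * (2 * norm s) ^ D" by (intro mult_left_mono C)
  then show ?thesis using C(2)[of s] by (simp add: power_mult_distrib mult.assoc)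
 qed
 define r where "r = (\<Sum>k\<le>D. monom ((deriv ^^ k) f 0 / fact k) k)"
 have r: "f s = poly r s" for s
  using Liouville_polynomial[OF hol le, where \<xi> = s] by (simp add: r_def poly_sum poly_monom)
 have "degree r \<le> D" unfolding r_def by (rule degree_sum_le) (auto intro: le_trans[OF degree_monom_le])
 from lagrange_interpolation[OF this, of t] show ?thesis by (simp add: r)
qed

lemma holomorphic_polynomial_line:
 "hpoly p ==> \<exists>r. \<forall>s. p (fst a + s *s fst b, snd a + s *s snd b) = poly r s"
proof (induction rule: holomorphic_polynomial.induct)
 case (const c)
 show ?case by (rule exI[of _ "[:c:]"]) simp
next
 case (coord1 i)
 show ?case by (rule exI[of _ "[:fst a $ i, fst b $ i:]"]) simp
next
 case (coord2 i)
 show ?case by (rule exI[of _ "[:snd a $ i, snd b $ i:]"]) simp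
next
 case (add p q)
 then obtain r r' where "\<forall>s. p (fst a + s *s fst b, snd a + s *s snd b) = poly r s" "\<forall>s. q (fst a + s *s fst b, snd a + s *s snd b) = poly r' s" by blast
 then show ?case by (intro exI[of _ "r + r'"]) simp
next
 case (mult p q)
 then obtain r r' where "\<forall>s. p (fst a + s *s fst b, snd a + s *s snd b) = poly r s" "\<forall>s. q (fst a + s *s fst b, snd a + s *s snd b) = poly r' s" by blast
 then show ?case by (intro exI[of _ "r * r'"]) simp
qed

text \<open>\<open>x + \<i> h\<close>, with \<open>x\<close> ranging over \<open>F\<close>, is a totally real subspace of the complexification.\<close>

lemma holomorphic_polynomial_unique:
 fixes p :: "(complex ^ 'n::finite) \<times> (complex ^ 'm::finite) => complex"
 assumes p: "hpoly p" and F: "subspace F" and h: "h \<in> F"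
  and zero: "!!x. x \<in> F ==> p (\<zeta>, rvec x + \<i> *s rvec h) = 0"
  and z: "z \<in> complexification F"
 shows "p (\<zeta>, z) = 0"
proof -
 \<comment> \<open>On this complex line real parameters stay in F + i h, where p vanishes, and the
   parameter i reaches z.\<close>
 let ?a = "(\<zeta>, rvec (Re_vec z) + \<i> *s rvec h)" and ?b = "(0 :: complex ^ 'n, rvec (Im_vec z - h))"
 from holomorphic_polynomial_line[OF p, of ?a ?b]
 obtain r where r': "\<forall>s. p (fst ?a + s *s fst ?b, snd ?a + s *s snd ?b) = poly r s" ..
 note r = r'[rule_format]
 have parts: "Re_vec z \<in> F" "Im_vec z \<in> F" using z by (auto simp: complexification_parts)
 have "poly r (of_real t) = 0" for t
 proof -
  have e1: "fst ?a + of_real t *s fst ?b = \<zeta>" by simp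
  have e2: "snd ?a + of_real t *s snd ?b = rvec (Re_vec z + t *\<^sub>R (Im_vec z - h)) + \<i> *s rvec h"
   by (simp only: of_real_vec_simps snd_conv) simp
  have "Re_vec z + t *\<^sub>R (Im_vec z - h) \<in> F"
   by (intro subspace_add subspace_scale subspace_diff F parts h)
  from zero[OF this] show ?thesis using r[of "of_real t"] by (simp only: e1 e2)
 qed
 then have "range cplx \<subseteq> {x. poly r x = 0}" by auto
 moreover have "infinite (range cplx)"
  using finite_imageD[of cplx UNIV] infinite_UNIV_char_0 by (auto simp: inj_on_def)
 ultimately have "r = 0" using poly_roots_finite finite_subset by blast
 moreover have "snd ?a + \<i> *s snd ?b = z"
  by (subst (2) complex_vec_decomp[of z]) (simp add: of_real_vec_simps vector_ssub_ldistrib)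
 ultimately show ?thesis using r[of \<i>] by simp
qed

section \<open>Holomorphic polynomials and polynomial functions on lines\<close>

lemma holomorphic_polynomial_sum:
 "(!!i. i \<in> I ==> hpoly (f i)) ==> hpoly (%z. \<Sum>i\<in>I. f i z)"
 by (induction I rule: infinite_finite_induct) (auto intro: holomorphic_polynomial.intros)

lemma holomorphic_polynomial_prod:
 "(!!i. i \<in> I ==> hpoly (f i)) ==> hpoly (%z. \<Prod>i\<in>I. f i z)"
 by (induction I rule: infinite_finite_induct) (auto intro: holomorphic_polynomial.intros)

lemma holomorphic_polynomial_poly:
 assumes "hpoly f" shows "hpoly (%z. poly q (f z))"
proof (induction q)
 case 0
 then show ?case by (simp add: holomorphic_polynomial.const)
next
 case (pCons a q)
 show ?case
  using holomorphic_polynomial.add[OF holomorphic_polynomial.const[of a] holomorphic_polynomial.mult[OF assms pCons.IH]]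
  by simp
qed

lemma holomorphic_polynomial_grid_poly: "hpoly (%z. gpoly B D m (snd z))"
 unfolding gpoly_def cdot_def
 by (intro holomorphic_polynomial_prod holomorphic_polynomial_poly holomorphic_polynomial_sum
  holomorphic_polynomial.mult holomorphic_polynomial.coord2 holomorphic_polynomial.const)

text \<open>\<open>D\<close> bounds the degree on all lines at once; in this form the degree enters
  the interpolation identities.\<close>

lemma real_polynomial_function_line:
 fixes p :: "'a::real_normed_vector => real"
 assumes "real_polynomial_function p"
 shows "\<exists>D. \<forall>x y. \<exists>r. degree r \<le> D \<and> (\<forall>t. cplx (p (x + t *\<^sub>R y)) = poly r (of_real t))"
 using assms
proof (induction rule: real_polynomial_function.induct)
 case (linear f)
 interpret bounded_linear f by fact
 show ?case
  by (rule exI[of _ 1], intro allI, rule_tac x = "[:of_real (f x), of_real (f y):]" in exI) (simp add: add scaleR)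
next
 case (const c)
 show ?case by (rule exI[of _ 0], intro allI, rule exI[of _ "[:of_real c:]"]) simp
next
 case (add f g)
 then obtain D D' where D: "!!x y. \<exists>r. degree r \<le> D \<and> (\<forall>t. cplx (f (x + t *\<^sub>R y)) = poly r (of_real t))"
  "!!x y. \<exists>r. degree r \<le> D' \<and> (\<forall>t. cplx (g (x + t *\<^sub>R y)) = poly r (of_real t))" by blast
 have "\<exists>r. degree r \<le> max D D' \<and> (\<forall>t. cplx (f (x + t *\<^sub>R y) + g (x + t *\<^sub>R y)) = poly r (of_real t))" for x y
 proof -
  from D(1)[of x y] D(2)[of x y] obtain r r' where "degree r \<le> D" "\<forall>t. cplx (f (x + t *\<^sub>R y)) = poly r (of_real t)"
   "degree r' \<le> D'" "\<forall>t. cplx (g (x + t *\<^sub>R y)) = poly r' (of_real t)" by blast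
  then show ?thesis by (intro exI[of _ "r + r'"]) (auto intro: degree_add_le)
 qed
 then show ?case by blast
next
 case (mult f g)
 then obtain D D' where D: "!!x y. \<exists>r. degree r \<le> D \<and> (\<forall>t. cplx (f (x + t *\<^sub>R y)) = poly r (of_real t))"
  "!!x y. \<exists>r. degree r \<le> D' \<and> (\<forall>t. cplx (g (x + t *\<^sub>R y)) = poly r (of_real t))" by blast
 have "\<exists>r. degree r \<le> D + D' \<and> (\<forall>t. cplx (f (x + t *\<^sub>R y) * g (x + t *\<^sub>R y)) = poly r (of_real t))" for x y
 proof -
  from D(1)[of x y] D(2)[of x y] obtain r r' where r: "degree r \<le> D" "\<forall>t. cplx (f (x + t *\<^sub>R y)) = poly r (of_real t)"
   "degree r' \<le> D'" "\<forall>t. cplx (g (x + t *\<^sub>R y)) = poly r' (of_real t)" by blast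
  have "degree (r * r') \<le> D + D'" by (rule order_trans[OF degree_mult_le]) (use r in simp)
  then show ?thesis using r by (intro exI[of _ "r * r'"]) auto
 qed
 then show ?case by blast
qed

lemma polynomial_function_line:
 fixes p :: "'a::real_normed_vector => complex"
 assumes "polynomial_function p"
 shows "\<exists>D. \<forall>x y. \<exists>r. degree r \<le> D \<and> (\<forall>t. p (x + t *\<^sub>R y) = poly r (of_real t))"
proof -
 have R: "real_polynomial_function (%x. Re (p x))" "real_polynomial_function (%x. Im (p x))"
  using assms bounded_linear_Re bounded_linear_Im by (auto simp: polynomial_function_def o_def)
 obtain D D' where D: "!!x y. \<exists>r. degree r \<le> D \<and> (\<forall>t. cplx (Re (p (x + t *\<^sub>R y))) = poly r (of_real t))"
  "!!x y. \<exists>r. degree r \<le> D' \<and> (\<forall>t. cplx (Im (p (x + t *\<^sub>R y))) = poly r (of_real t))"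
  using real_polynomial_function_line[OF R(1)] real_polynomial_function_line[OF R(2)] by blast
 have "\<exists>r. degree r \<le> max D D' \<and> (\<forall>t. p (x + t *\<^sub>R y) = poly r (of_real t))" for x y
 proof -
  from D(1)[of x y] D(2)[of x y] obtain r r' where r: "degree r \<le> D" "\<forall>t. cplx (Re (p (x + t *\<^sub>R y))) = poly r (of_real t)"
   "degree r' \<le> D'" "\<forall>t. cplx (Im (p (x + t *\<^sub>R y))) = poly r' (of_real t)" by blast
  have "degree (r + smult \<i> r') \<le> max D D'" using r by (intro degree_add_le) (auto intro: le_trans[OF degree_smult_le])
  moreover have "p (x + t *\<^sub>R y) = poly (r + smult \<i> r') (of_real t)" for t
   using complex_eq[of "p (x + t *\<^sub>R y)"] r by simp
  ultimately show ?thesis by blast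
 qed
 then show ?thesis by blast
qed

section \<open>Growth under a change of the group structure\<close>

lemma left_field_translate:
 assumes Q: "qCR E F \<Phi>" and s: "s \<in> F" and f: "smooth_on (E \<times> F) f"
  and u: "u \<in> E \<times> F" and p: "p \<in> E \<times> F"
 shows "left_field \<Phi> u (%p. f (p + (0, s))) p = left_field \<Phi> u f (p + (0, s))"
 using left_field_pullback[OF Q Q linear_id, of "(0, s)" f u p] s u p f subspace_0[OF CR_subspaces(1)[OF Q]]
 by (auto simp: left_dir_def)

lemma moderate_translate:
 assumes Q: "qCR E F \<Phi>" and s: "s \<in> F" and f: "moderate E F \<Phi> k f"
 shows "moderate E F \<Phi> k (%p. f (p + (0, s)))"
 using moderate_pullback[OF Q Q linear_id, of "(0, s)" k f] s f subspace_0[OF CR_subspaces(1)[OF Q]]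
 by (auto simp: left_dir_def)

text \<open>Degree at most \<open>D\<close> on the lines in direction \<open>v\<close>, as an
  identity between values of \<open>f\<close>: it survives translations, finite combinations and
  operators that commute with translations.\<close>

definition polynomial_along :: "'a::real_vector set => nat => 'a => ('a => complex) => bool" where
 "polynomial_along V D v f \<longleftrightarrow> (\<forall>p\<in>V. \<forall>t::real.
   f (p + t *\<^sub>R v) = (\<Sum>l\<le>D. poly (lag D l) (of_real t) * f (p + real l *\<^sub>R v)))"

text \<open>On functions which are polynomial of degree at most \<open>D\<close> in the direction \<open>v\<close>, the derivative is a
 combination of translations.\<close>

definition line_diff :: "nat => 'a::real_vector => ('a => complex) => 'a => complex" where
 "line_diff D v f p = (\<Sum>l\<le>D. poly (pderiv (lag D l)) 0 * f (p + real l *\<^sub>R v))"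

lemma has_vector_derivative_poly_of_real:
 "((%t. poly r (of_real t)) has_vector_derivative poly (pderiv r) (of_real t :: complex)) (at t)"
 by (rule has_vector_derivative_real_field[of "poly r"]) (rule poly_DERIV)

lemma line_diff_has_dir_deriv:
 assumes "polynomial_along V D v f" "p \<in> V"
 shows "has_dir_deriv v f (line_diff D v f p) p"
proof -
 have "((%t::real. \<Sum>l\<le>D. poly (lag D l) (of_real t) * f (p + real l *\<^sub>R v)) has_vector_derivative
   (\<Sum>l\<le>D. poly (pderiv (lag D l)) (of_real 0) * f (p + real l *\<^sub>R v))) (at 0)"
  by (intro has_vector_derivative_sum has_vector_derivative_mult_left has_vector_derivative_poly_of_real)
 moreover have "(%t::real. \<Sum>l\<le>D. poly (lag D l) (of_real t) * f (p + real l *\<^sub>R v)) = (%t. f (p + t *\<^sub>R v))"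
  using assms by (auto simp: polynomial_along_def)
 ultimately show ?thesis by (simp add: has_dir_deriv_def line_diff_def)
qed

lemma line_diff_commute: "line_diff D v (line_diff D w f) = line_diff D w (line_diff D v f)"
proof
 fix p
 show "line_diff D v (line_diff D w f) p = line_diff D w (line_diff D v f) p"
  unfolding line_diff_def sum_distrib_left
  by (subst sum.swap) (simp add: add_ac mult_ac)
qed

text \<open>The operators commute, so all those in direction \<open>b\<close> may be applied
  last.\<close>

lemma line_diff_foldr_filter:
 "foldr (line_diff D) bs f = foldr (line_diff D) (filter ((=) b) bs) (foldr (line_diff D) (filter (%x. x \<noteq> b) bs) f)"
proof (induction bs)
 case (Cons a bs)
 have c: "line_diff D a (foldr (line_diff D) cs h) = foldr (line_diff D) cs (line_diff D a h)" for cs h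
  by (induction cs) (auto, simp add: line_diff_commute[of D a])
 show ?case using Cons.IH by (auto simp: c)
qed simp

lemma line_diff_zero:
 assumes V: "subspace V" and v: "v \<in> V" and "!!p. p \<in> V ==> f p = 0" "p \<in> V"
 shows "line_diff D v f p = 0"
proof -
 have "f (p + real l *\<^sub>R v) = 0" for l using assms by (simp add: subspace_add subspace_scale)
 then show ?thesis by (simp add: line_diff_def)
qed

lemma polynomial_along_line_diff:
 assumes V: "subspace V" and w: "w \<in> V" and f: "polynomial_along V D v f"
 shows "polynomial_along V D v (line_diff D w f)"
 unfolding polynomial_along_def
proof (intro ballI allI)
 fix p and t :: real assume p: "p \<in> V"
 have "f (p + t *\<^sub>R v + real l *\<^sub>R w) = (\<Sum>k\<le>D. poly (lag D k) (of_real t) * f (p + real l *\<^sub>R w + real k *\<^sub>R v))" for l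
 proof -
  have "f (p + real l *\<^sub>R w + t *\<^sub>R v) = (\<Sum>k\<le>D. poly (lag D k) (of_real t) * f (p + real l *\<^sub>R w + real k *\<^sub>R v))"
   using f p w V unfolding polynomial_along_def by (meson subspace_add subspace_scale)
  then show ?thesis by (simp add: add_ac)
 qed
 then have "line_diff D w f (p + t *\<^sub>R v) = (\<Sum>l\<le>D. \<Sum>k\<le>D. poly (lag D k) (of_real t) *
   (poly (pderiv (lag D l)) 0 * f (p + real k *\<^sub>R v + real l *\<^sub>R w)))"
  by (simp add: line_diff_def sum_distrib_left add_ac mult_ac)
 also have "\<dots> = (\<Sum>k\<le>D. poly (lag D k) (of_real t) * line_diff D w f (p + real k *\<^sub>R v))"
  by (subst sum.swap) (simp add: line_diff_def sum_distrib_left)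
 finally show "line_diff D w f (p + t *\<^sub>R v) = (\<Sum>k\<le>D. poly (lag D k) (of_real t) * line_diff D w f (p + real k *\<^sub>R v))" .
qed

text \<open>Differentiate the interpolation formula at 0: on polynomials of degree at most D the
  finite combination is an exact derivative.\<close>

lemma pderiv_interpolation:
 assumes "degree r \<le> D"
 shows "(\<Sum>l\<le>D. poly (pderiv (lag D l)) 0 * poly r (of_nat l)) = poly (pderiv r) 0"
proof -
 let ?q = "\<Sum>l\<le>D. smult (poly r (of_nat l)) (lag D l)"
 have "poly r = poly ?q"
 proof
  fix t
  show "poly r t = poly ?q t"
   unfolding poly_sum poly_smult by (rule trans[OF lagrange_interpolation[OF assms, of t]]) (simp only: mult.commute)
 qed
 then have "r = ?q" by (simp only: poly_eq_poly_eq_iff)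
 then have "poly (pderiv r) 0 = poly (pderiv ?q) 0" by (rule arg_cong)
 also have "pderiv ?q = (\<Sum>l\<le>D. smult (poly r (of_nat l)) (pderiv (lag D l)))"
  using higher_pderiv_sum[of 1 "%l. smult (poly r (of_nat l)) (lag D l)" "{..D}"] by (simp add: pderiv_smult)
 also have "poly \<dots> 0 = (\<Sum>l\<le>D. poly (pderiv (lag D l)) 0 * poly r (of_nat l))"
  unfolding poly_sum poly_smult by (simp only: mult.commute)
 finally show ?thesis ..
qed

text \<open>On lines in direction \<open>v\<close> the operator is the derivative of polynomials.
  The form \<open>r = 0 \<or> degree r < n\<close> of the bound makes n = 0 mean the zero
  polynomial, so the later induction runs down to 0.\<close>

lemma line_diff_degree:
 assumes V: "subspace V" and v: "v \<in> V" and n: "n \<le> D"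
  and f: "!!p. p \<in> V ==> \<exists>r. (r = 0 \<or> degree r < Suc n) \<and> (\<forall>t. f (p + t *\<^sub>R v) = poly r (of_real t))"
  and p: "p \<in> V"
 shows "\<exists>r. (r = 0 \<or> degree r < n) \<and> (\<forall>t. line_diff D v f (p + t *\<^sub>R v) = poly r (of_real t))"
proof -
 obtain r where r: "r = 0 \<or> degree r < Suc n" "!!t. f (p + t *\<^sub>R v) = poly r (of_real t)" using f[OF p] by blast
 have deg: "degree r \<le> D" using r(1) n by auto
 have "line_diff D v f (p + t *\<^sub>R v) = poly (pderiv r) (of_real t)" for t
 proof -
  let ?s = "r \<circ>\<^sub>p [:of_real t, 1:]"
  have "f (p + t *\<^sub>R v + real l *\<^sub>R v) = poly ?s (of_nat l)" for l
   using r(2)[of "t + real l"] by (simp add: scaleR_add_left add.assoc poly_pcompose)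
  then have "line_diff D v f (p + t *\<^sub>R v) = (\<Sum>l\<le>D. poly (pderiv (lag D l)) 0 * poly ?s (of_nat l))"
   by (simp add: line_diff_def)
  also have "\<dots> = poly (pderiv ?s) 0"
   by (rule pderiv_interpolation) (use degree_pcompose_le[of r "[:of_real t, 1:]"] deg in simp)
  also have "\<dots> = poly (pderiv r) (of_real t)" by (simp add: pderiv_pcompose poly_pcompose pderiv_pCons)
  finally show ?thesis .
 qed
 moreover have "pderiv r = 0 \<or> degree (pderiv r) < n"
  using r(1) by (cases "degree r = 0") (auto simp: degree_pderiv pderiv_eq_0_iff)
 ultimately show ?thesis by blast
qed

lemma line_diff_nilpotent:
 assumes V: "subspace V" and v: "v \<in> V" and f: "polynomial_along V D v f" and n: "n > D"
 shows "p \<in> V ==> (line_diff D v ^^ n) f p = 0"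
proof -
 have start: "\<exists>r. (r = 0 \<or> degree r < Suc D) \<and> (\<forall>t. f (p + t *\<^sub>R v) = poly r (of_real t))" if "p \<in> V" for p
 proof (intro exI conjI allI)
  let ?r = "\<Sum>l\<le>D. smult (f (p + real l *\<^sub>R v)) (lag D l)"
  have "degree ?r \<le> D" by (rule degree_sum_le) (auto simp: degree_lagrange_poly)
  then show "?r = 0 \<or> degree ?r < Suc D" by simp
  show "f (p + t *\<^sub>R v) = poly ?r (of_real t)" for t
   using f that by (simp add: polynomial_along_def poly_sum mult.commute)
 qed
 have "\<exists>r. (r = 0 \<or> degree r < Suc D - k) \<and> (\<forall>t. (line_diff D v ^^ k) f (p + t *\<^sub>R v) = poly r (of_real t))"
  if "k \<le> Suc D" "p \<in> V" for k p
  using that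
 proof (induction k arbitrary: p)
  case (Suc k)
  have "\<exists>r. (r = 0 \<or> degree r < D - k) \<and> (\<forall>t. line_diff D v ((line_diff D v ^^ k) f) (p + t *\<^sub>R v) = poly r (of_real t))"
   by (rule line_diff_degree[OF V v]) (use Suc in \<open>auto simp: Suc_diff_le\<close>)
  then show ?case by simp
 qed (use start in auto)
 from this[of "Suc D"] have zero: "(line_diff D v ^^ Suc D) f p = 0" if "p \<in> V" for p
  using that by (metis add.right_neutral diff_self_eq_0 not_less_zero poly_0 scaleR_zero_left order_refl)
 have "(line_diff D v ^^ (k + Suc D)) f p = 0" if "p \<in> V" for k p
  using that
 proof (induction k arbitrary: p)
  case (Suc k)
  show ?case unfolding add_Suc funpow.simps comp_apply
   by (rule line_diff_zero[OF V v]) (use Suc in auto)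
 qed (use zero in auto)
 from this[of p "n - Suc D"] n show "p \<in> V ==> (line_diff D v ^^ n) f p = 0" by simp
qed

text \<open>Pigeonhole: among more than \<open>D * card B\<close> directions one occurs more than
  \<open>D\<close> times, and that many derivatives kill a polynomial of degree at most
  \<open>D\<close>.\<close>

lemma foldr_line_diff_nilpotent:
 assumes V: "subspace V" and B: "finite B" "B \<subseteq> V" and bs: "set bs \<subseteq> B" and len: "length bs > D * card B"
  and f: "!!b. b \<in> B ==> polynomial_along V D b f" and p: "p \<in> V"
 shows "foldr (line_diff D) bs f p = 0"
proof -
 have "\<exists>b\<in>B. count_list bs b > D"
 proof (rule ccontr)
  assume "\<not> (\<exists>b\<in>B. count_list bs b > D)"
  then have "sum (count_list bs) B \<le> D * card B" using sum_bounded_above[of B "count_list bs" D] by (auto simp: not_less mult.commute)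
  then show False using len sum_count_set[OF bs B(1)] by simp
 qed
 then obtain b where b: "b \<in> B" "count_list bs b > D" by blast
 let ?h = "foldr (line_diff D) (filter (%x. x \<noteq> b) bs) f"
 have "filter ((=) b) bs = replicate (count_list bs b) b"
  by (induction bs) auto
 then have "foldr (line_diff D) bs f = (line_diff D b ^^ count_list bs b) ?h"
  using line_diff_foldr_filter[of D bs f b] by (simp add: foldr_replicate)
 moreover have "polynomial_along V D b ?h"
 proof -
  have "set cs \<subseteq> B ==> polynomial_along V D b (foldr (line_diff D) cs f)" for cs
   by (induction cs) (use f b B in \<open>auto intro: polynomial_along_line_diff[OF V]\<close>)
  then show ?thesis using bs by (metis filter_is_subset subset_trans)
 qed
 ultimately show ?thesis using line_diff_nilpotent[OF V _ _ b(2) p] b(1) B(2) by auto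
qed

text \<open>Polynomials in \<zeta>, written as sums of products of affine factors. The index is the
  growth exponent, and a left-invariant field does not raise it.\<close>

inductive coeff_poly :: "(complex ^ 'n) set => nat => (('n::finite, 'm::finite) point => complex) => bool"
 for E where
 const: "coeff_poly E 0 (%p. k)"
| mult: "linear_on_sub E a ==> coeff_poly E l c ==> coeff_poly E (Suc l) (%p. (a (fst p) + k) * c p)"
| add: "coeff_poly E l c ==> coeff_poly E l c' ==> coeff_poly E l (%p. c p + c' p)"

lemma linear_on_sub_fst:
 "linear_on_sub E a ==> linear_on_sub (E \<times> F) (%p. a (fst p))"
 by (auto simp: linear_on_sub_def)

lemma coeff_poly_props:
 assumes Q: "qCR E F \<Phi>" and c: "coeff_poly E l c"
 shows "smooth_on (E \<times> F) c \<and> grows l (E \<times> F) c \<and>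
  (\<forall>u\<in>E \<times> F. \<exists>c'. coeff_poly E l c' \<and> (\<forall>p\<in>E \<times> F. left_field \<Phi> u c p = c' p))"
 using c
proof induction
 case (const k)
 show ?case
 proof (intro conjI ballI)
  fix u assume u: "u \<in> E \<times> F"
  show "\<exists>c'. coeff_poly E 0 c' \<and> (\<forall>p\<in>E \<times> F. left_field \<Phi> u (%p. k) p = c' p)"
   by (rule exI[of _ "%p. 0"]) (intro conjI coeff_poly.const ballI left_field_const[OF Q u])
 qed (rule smooth_const[OF CR_subspaces(3)[OF Q]], rule grows_const)
next
 case (mult a l c k)
 note S = CR_subspaces[OF Q]
 have la: "linear_on_sub (E \<times> F) (%p. a (fst p))" using mult.hyps by (intro linear_on_sub_fst)
 have sa: "smooth_on (E \<times> F) (%p. a (fst p) + k)"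
  by (intro smooth_add S linear_on_sub_smooth la smooth_const)
 have "grows (1 + l) (E \<times> F) (%p. (a (fst p) + k) * c p)"
  using mult.IH by (intro grows_mult grows_add grows_const grows_linear_on_sub S la) auto
 moreover have "\<exists>c'. coeff_poly E (Suc l) c' \<and> (\<forall>p\<in>E \<times> F. left_field \<Phi> u (%p. (a (fst p) + k) * c p) p = c' p)"
  if u: "u \<in> E \<times> F" for u
 proof -
  obtain c' where c': "coeff_poly E l c'" "!!p. p \<in> E \<times> F ==> left_field \<Phi> u c p = c' p" using mult.IH u by blast
  let ?c = "%p. ((%x. 0) (fst p) + a (fst u)) * c p + (a (fst p) + k) * c' p"
  have "coeff_poly E (Suc l) ?c"
   by (intro coeff_poly.add coeff_poly.mult mult.hyps c') (simp add: linear_on_sub_def)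
  moreover have "left_field \<Phi> u (%p. (a (fst p) + k) * c p) p = ?c p" if p: "p \<in> E \<times> F" for p
  proof -
   have "left_field \<Phi> u (%p. a (fst p) + k) p = a (fst u)"
    using has_dir_deriv_add[OF linear_on_sub_dir_deriv[OF S(3) la left_dir_in[OF Q u p] p] has_dir_deriv_const[of _ k]]
    by (intro left_field_has_dir_deriv[OF Q u p]) (simp add: left_dir_def)
   then show ?thesis using mult.IH c'(2)[OF p] by (simp add: left_field_mult[OF Q u p sa])
  qed
  ultimately show ?thesis by blast
 qed
 ultimately show ?case using mult.IH by (auto intro!: smooth_mult S sa)
next
 case (add l c d)
 note S = CR_subspaces[OF Q]
 have "\<exists>c'. coeff_poly E l c' \<and> (\<forall>p\<in>E \<times> F. left_field \<Phi> u (%p. c p + d p) p = c' p)" if u: "u \<in> E \<times> F" for u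
 proof -
  obtain c' where c': "coeff_poly E l c'" "!!p. p \<in> E \<times> F ==> left_field \<Phi> u c p = c' p" using add.IH u by blast
  obtain d' where d': "coeff_poly E l d'" "!!p. p \<in> E \<times> F ==> left_field \<Phi> u d p = d' p" using add.IH u by blast
  have "left_field \<Phi> u (%p. c p + d p) p = c' p + d' p" if p: "p \<in> E \<times> F" for p
   using add.IH c'(2)[OF p] d'(2)[OF p] by (simp add: left_field_add[OF Q u p])
  then show ?thesis using coeff_poly.add[OF c'(1) d'(1)] by blast
 qed
 then show ?case using add.IH by (auto intro!: smooth_add grows_add S)
qed

text \<open>If \<open>g\<close> is polynomial in the directions \<open>F1\<close> in which the two structures differ, each step that
 replaces a left field of \<open>\<Phi>\<close> by one of \<open>\<Phi>'\<close> produces an affine factor together with a derivative along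
 \<open>F1\<close>; as only boundedly many of the latter are nonzero, the order of growth stays bounded.\<close>

lemma moderate_change_structure:
 fixes \<Phi> :: "('n::finite, 'm::finite) herm"
 assumes Q: "qCR E F \<Phi>" and Q': "qCR E F \<Phi>'"
  and F1: "subspace F1" "F1 \<subseteq> F"
  and diff: "!!\<zeta> \<zeta>'. \<zeta> \<in> E ==> \<zeta>' \<in> E ==> \<Phi> \<zeta> \<zeta>' - \<Phi>' \<zeta> \<zeta>' \<in> complexification F1"
  and g: "moderate E F \<Phi> k g"
  and pol: "!!b. b \<in> onb F1 ==> polynomial_along (E \<times> F) D (0, b) g"
 shows "\<exists>k'. moderate E F \<Phi>' k' g"
proof -
 note S = CR_subspaces[OF Q]
 let ?V = "E \<times> F" and ?B = "Pair (0 :: complex ^ 'n) ` onb F1"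
 have onb: "onb F1 \<subseteq> F1" by (rule onb(1)[OF F1(1)])
 have BV: "?B \<subseteq> ?V" using onb F1 subspace_0[OF S(1)] by auto
 have finB: "finite ?B" using finite_onb[OF F1(1)] by simp
 \<comment> \<open>The class to which \<open>g\<close> belongs before the structure is changed: it
   is stable under the fields of \<open>\<Phi>\<close> and under differences along F1, all with the
   same exponent k.\<close>
 define H where "H = {h. moderate E F \<Phi> k h \<and> (\<forall>b\<in>?B. polynomial_along ?V D b h)}"
 have H_smooth: "smooth_on ?V h" if "h \<in> H" for h using that moderate_smooth by (auto simp: H_def)
 have H_diff: "line_diff D b h \<in> H" if h: "h \<in> H" and b: "b \<in> ?B" for h b
 proof -
  have "moderate E F \<Phi> k (%p. h (p + real l *\<^sub>R b))" for l
  proof -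
   obtain x where x: "x \<in> onb F1" "b = (0, x)" using b by auto
   have "real l *\<^sub>R x \<in> F" using x onb F1 by (intro subspace_scale[OF S(2)]) auto
   then show ?thesis using moderate_translate[OF Q, of "real l *\<^sub>R x" k h] h by (simp add: H_def x)
  qed
  then have "moderate E F \<Phi> k (line_diff D b h)"
   unfolding line_diff_def[abs_def] by (intro moderate_sum moderate_cmult Q)
  then show ?thesis using h b BV polynomial_along_line_diff[OF S(3)] by (auto simp: H_def)
 qed
 have H_foldr: "foldr (line_diff D) bs h \<in> H" if "set bs \<subseteq> ?B" "h \<in> H" for bs h
  using that by (induction bs) (auto intro: H_diff)
 have trans: "left_field \<Phi> u (%p. h (p + t *\<^sub>R b)) p = left_field \<Phi> u h (p + t *\<^sub>R b)"
  if "h \<in> H" "b \<in> ?B" "u \<in> ?V" "p \<in> ?V" for h b u p t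
 proof -
  note h = that
  obtain x where x: "x \<in> onb F1" "b = (0, x)" using h(2) by auto
  have "t *\<^sub>R x \<in> F" using x onb F1 by (intro subspace_scale[OF S(2)]) auto
  then show ?thesis using left_field_translate[OF Q, of "t *\<^sub>R x" h u p] H_smooth[OF h(1)] h(3,4) by (simp add: x)
 qed
 have smooth_trans: "smooth_on ?V (%p. h (p + t *\<^sub>R b))" if "h \<in> H" "b \<in> ?B" for h b t
 proof -
  have "t *\<^sub>R b \<in> ?V" using that BV subspace_scale[OF S(3)] by blast
  then show ?thesis using smooth_compose_affine[OF S(3) S(3) linear_id, of "t *\<^sub>R b" h] H_smooth[OF that(1)] by simp
 qed
 have H_left: "left_field \<Phi> u h \<in> H" if h: "h \<in> H" and u: "u \<in> ?V" for h u
 proof -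
  have "polynomial_along ?V D b (left_field \<Phi> u h)" if b: "b \<in> ?B" for b
   unfolding polynomial_along_def
  proof (intro ballI allI)
   fix p and t :: real assume p: "p \<in> ?V"
   have "left_field \<Phi> u h (p + t *\<^sub>R b) = left_field \<Phi> u (%p. h (p + t *\<^sub>R b)) p" using trans[OF h b u p] by simp
   also have "\<dots> = left_field \<Phi> u (%p. \<Sum>l\<le>D. poly (lag D l) (of_real t) * h (p + real l *\<^sub>R b)) p"
    using h b by (intro left_field_cong[OF Q u p]) (auto simp: H_def polynomial_along_def)
   also have "\<dots> = (\<Sum>l\<le>D. left_field \<Phi> u (%p. poly (lag D l) (of_real t) * h (p + real l *\<^sub>R b)) p)"
    by (intro left_field_sum[OF Q u p] smooth_cmult S smooth_trans h b)
   also have "\<dots> = (\<Sum>l\<le>D. poly (lag D l) (of_real t) * left_field \<Phi> u h (p + real l *\<^sub>R b))"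
    by (intro sum.cong refl) (simp add: left_field_cmult[OF Q u p smooth_trans[OF h b]] trans[OF h b u p])
   finally show "left_field \<Phi> u h (p + t *\<^sub>R b) = (\<Sum>l\<le>D. poly (lag D l) (of_real t) * left_field \<Phi> u h (p + real l *\<^sub>R b))" .
  qed
  then show ?thesis using h moderate_left_field[OF Q _ u] by (auto simp: H_def)
 qed
 have diff_left: "left_field \<Phi> u (line_diff D b h) p = line_diff D b (left_field \<Phi> u h) p"
  if h: "h \<in> H" and b: "b \<in> ?B" and u: "u \<in> ?V" and p: "p \<in> ?V" for h b u p
 proof -
  have "left_field \<Phi> u (line_diff D b h) p = (\<Sum>l\<le>D. left_field \<Phi> u (%p. poly (pderiv (lag D l)) 0 * h (p + real l *\<^sub>R b)) p)"
   unfolding line_diff_def[abs_def] by (intro left_field_sum[OF Q u p] smooth_cmult S smooth_trans h b)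
  then show ?thesis by (simp add: line_diff_def left_field_cmult[OF Q u p smooth_trans[OF h b]] trans[OF h b u p])
 qed
 have line_diff_cong: "line_diff D b f p = line_diff D b f' p" if "b \<in> ?B" "p \<in> ?V" "!!p. p \<in> ?V ==> f p = f' p" for b f f' p
 proof -
  have "p + real l *\<^sub>R b \<in> ?V" for l using that BV by (intro subspace_add subspace_scale S) auto
  then show ?thesis using that(3) by (simp add: line_diff_def)
 qed
 have foldr_left: "left_field \<Phi> u (foldr (line_diff D) bs h) p = foldr (line_diff D) bs (left_field \<Phi> u h) p"
  if "set bs \<subseteq> ?B" "h \<in> H" "u \<in> ?V" "p \<in> ?V" for bs h u p
  using that(1,4)
 proof (induction bs arbitrary: p)
  case (Cons b bs)
  have "left_field \<Phi> u (foldr (line_diff D) (b # bs) h) p = line_diff D b (left_field \<Phi> u (foldr (line_diff D) bs h)) p"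
   using Cons.prems that by (simp add: diff_left H_foldr)
  also have "\<dots> = line_diff D b (foldr (line_diff D) bs (left_field \<Phi> u h)) p"
   by (rule line_diff_cong) (use Cons in auto)
  finally show ?case by simp
 qed simp
 let ?d = "D * card ?B"
 \<comment> \<open>Generators for the new structure. The index of the coefficient equals the number
   of differences, and products with more than \<open>?d\<close> differences are 0, so the growth
   exponent never exceeds \<open>?d + k\<close>.\<close>
 define G where "G = {f. \<exists>c bs h. coeff_poly E (length bs) c \<and> set bs \<subseteq> ?B \<and> h \<in> H \<and> f = (%p. c p * foldr (line_diff D) bs h p)}"
 have "moderate E F \<Phi>' (?d + k) g"
 proof (rule moderate_coinduct[OF Q', where G = G])
  have "g \<in> H" using g pol by (auto simp: H_def)
  then have "(%p. 1 * foldr (line_diff D) [] g p) \<in> G"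
   unfolding G_def using coeff_poly.const[of E 1] by (intro CollectI exI[of _ "%p. 1"] exI[of _ "[]"] exI[of _ g]) auto
  then show "g \<in> fun_span ?V G" using fun_span.gen[of g G ?V] by simp
 next
  fix f assume "f \<in> G"
  then obtain c bs h where f: "coeff_poly E (length bs) c" "set bs \<subseteq> ?B" "h \<in> H" "f = (%p. c p * foldr (line_diff D) bs h p)"
   by (auto simp: G_def)
  note c = coeff_poly_props[OF Q' f(1)]
  have hh: "foldr (line_diff D) bs h \<in> H" by (rule H_foldr[OF f(2,3)])
  have "grows (?d + k) ?V f"
  proof (cases "length bs \<le> ?d")
   case True
   have "grows (length bs + k) ?V f"
    unfolding f(4) using c hh moderate_grows by (intro grows_mult) (auto simp: H_def)
   then show ?thesis by (rule grows_mono) (use True in simp)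
  next
   case False
   have "f p = 0" if "p \<in> ?V" for p
    using foldr_line_diff_nilpotent[OF S(3) finB BV f(2), of D h p] False f(3) that by (auto simp: f(4) H_def)
   then show ?thesis using grows_cong[of ?V f "%p. 0"] grows_const by simp
  qed
  then show "smooth_on ?V f \<and> grows (?d + k) ?V f"
   using c H_smooth[OF hh] by (auto simp: f(4) intro!: smooth_mult S)
  fix u assume u: "u \<in> ?V"
  obtain c' where c': "coeff_poly E (length bs) c'" "!!p. p \<in> ?V ==> left_field \<Phi>' u c p = c' p" using c u by blast
  let ?h = "foldr (line_diff D) bs h" and ?h' = "foldr (line_diff D) bs (left_field \<Phi> u h)"
  \<comment> \<open>A field of \<open>\<Phi>'\<close> is the corresponding field of
    \<open>\<Phi>\<close> plus the sum of \<open>?a b\<close> times the derivative along b; these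
    coefficients are linear in \<zeta>.\<close>
  let ?a = "%b \<zeta>. - cplx (2 * (Im_vec (\<Phi> \<zeta> (fst u) - \<Phi>' \<zeta> (fst u)) \<bullet> b))"
  have a: "linear_on_sub E (?a b)" for b
   using hermD(2,3)[OF Q] hermD(2,3)[OF Q'] u
   by (auto simp: linear_on_sub_def scaleR_eq_vector_scale Re_Im_vec_simps inner_add_left inner_diff_left algebra_simps)
    (auto simp: scaleR_eq_vector_scale[symmetric] algebra_simps scaleR_conv_of_real[where 'a = complex])
  have "(%p. c' p * ?h p + (c p * ?h' p + (\<Sum>b\<in>onb F1. ((?a b (fst p) + 0) * c p) * foldr (line_diff D) ((0, b) # bs) h p))) \<in> fun_span ?V G"
  proof (intro fun_span.add fun_span_sum fun_span.gen)
   show "(%p. c' p * ?h p) \<in> G" unfolding G_def using c'(1) f by blast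
   show "(%p. c p * ?h' p) \<in> G" unfolding G_def using f H_left[OF f(3) u] by blast
   fix b assume "b \<in> onb F1"
   then have "set ((0, b) # bs) \<subseteq> ?B" using f(2) by auto
   moreover have "coeff_poly E (length ((0 :: complex ^ 'n, b) # bs)) (%p. (?a b (fst p) + 0) * c p)"
    using coeff_poly.mult[OF a f(1), of b 0] by (simp only: length_Cons)
   ultimately show "(%p. ((?a b (fst p) + 0) * c p) * foldr (line_diff D) ((0, b) # bs) h p) \<in> G"
    unfolding G_def using f(3) by blast
  qed
  then show "left_field \<Phi>' u f \<in> fun_span ?V G"
  proof (rule fun_span.cong)
   fix p assume p: "p \<in> ?V"
   let ?e = "Im_vec (\<Phi> (fst p) (fst u) - \<Phi>' (fst p) (fst u))"
   have e: "?e \<in> F1" using diff[of "fst p" "fst u"] u p by (auto simp: complexification_parts)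
   have ld: "left_dir \<Phi> u p = left_dir \<Phi>' u p + (0, 2 *\<^sub>R ?e)"
    by (simp add: left_dir_def Re_Im_vec_simps algebra_simps)
   have e0: "(0, 2 *\<^sub>R ?e) \<in> ?V" using e F1 subspace_0[OF S(1)] by (auto intro: subspace_scale[OF S(2)])
   have "dir_deriv (0, 2 *\<^sub>R ?e) ?h p = (\<Sum>b\<in>onb F1. (2 * (?e \<bullet> b)) *\<^sub>R dir_deriv (0, b) ?h p)"
   proof -
    have pr: "fst (\<Sum>b\<in>J. (2 * (?e \<bullet> b)) *\<^sub>R (0 :: complex ^ 'n, b)) = 0 \<and> snd (\<Sum>b\<in>J. (2 * (?e \<bullet> b)) *\<^sub>R (0 :: complex ^ 'n, b)) = (\<Sum>b\<in>J. (2 * (?e \<bullet> b)) *\<^sub>R b)" for J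
     by (induction J rule: infinite_finite_induct) auto
    have "(\<Sum>b\<in>onb F1. (2 * (?e \<bullet> b)) *\<^sub>R b) = 2 *\<^sub>R ?e"
     using onb_expand[OF F1(1) e] by (metis (no_types, lifting) scaleR_right.sum scaleR_scaleR sum.cong)
    then have eq: "(0, 2 *\<^sub>R ?e) = (\<Sum>b\<in>onb F1. (2 * (?e \<bullet> b)) *\<^sub>R (0 :: complex ^ 'n, b))"
     using pr by (simp add: prod_eq_iff)
    show ?thesis unfolding eq
     by (rule dir_deriv_sum_dir[OF S(3) H_smooth[OF hh] p]) (use BV in auto)
   qed
   also have "\<dots> = (\<Sum>b\<in>onb F1. (2 * (?e \<bullet> b)) *\<^sub>R line_diff D (0, b) ?h p)"
    using hh by (intro sum.cong refl arg_cong2[where f = scaleR] has_dir_deriv_eq line_diff_has_dir_deriv[OF _ p]) (auto simp: H_def)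
   finally have de: "dir_deriv (0, 2 *\<^sub>R ?e) ?h p = (\<Sum>b\<in>onb F1. (2 * (?e \<bullet> b)) *\<^sub>R line_diff D (0, b) ?h p)" .
   have "?h' p = left_field \<Phi> u ?h p" using foldr_left[OF f(2,3) u p] by simp
   also have "\<dots> = left_field \<Phi>' u ?h p + dir_deriv (0, 2 *\<^sub>R ?e) ?h p"
    unfolding left_field_eq[OF Q u p] left_field_eq[OF Q' u p] ld
    by (rule dir_deriv_add_dir[OF S(3) H_smooth[OF hh] left_dir_in[OF Q' u p] e0 p])
   finally have "left_field \<Phi>' u ?h p = ?h' p + (\<Sum>b\<in>onb F1. ?a b (fst p) * line_diff D (0, b) ?h p)"
    unfolding de by (simp add: scaleR_conv_of_real sum_negf)
   moreover have "left_field \<Phi>' u f p = left_field \<Phi>' u c p * ?h p + c p * left_field \<Phi>' u ?h p"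
    unfolding f(4) using c by (intro left_field_mult[OF Q' u p _ H_smooth[OF hh]]) auto
   ultimately show "left_field \<Phi>' u f p = c' p * ?h p + (c p * ?h' p + (\<Sum>b\<in>onb F1. ((?a b (fst p) + 0) * c p) * foldr (line_diff D) ((0, b) # bs) h p))"
    using c'(2)[OF p] by (simp add: distrib_left sum_distrib_left mult_ac)
  qed
 qed
 then show ?thesis by blast
qed

section \<open>CR functions of moderate growth\<close>

lemma quadratic_CR_scale: "qCR E F \<Phi> ==> v \<in> E ==> c *s v \<in> E"
 by (auto simp: quadratic_CR_def intro: vec.subspace_scale)

lemma quadratic_CR_Pair0:
 assumes "qCR E F \<Phi>"
 shows "v \<in> E ==> (v, 0) \<in> E \<times> F" "y \<in> F ==> (0, y) \<in> E \<times> F"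
 using CR_subspaces[OF assms] by (auto intro: subspace_0)

lemma CR_on_iff:
 "CR_on E F \<Phi> f \<longleftrightarrow> (\<forall>v\<in>E. \<forall>p\<in>E \<times> F. left_field \<Phi> (v, 0) f p + \<i> * left_field \<Phi> (\<i> *s v, 0) f p = 0)"
 by (simp add: CR_on_def Zbar_def)

section \<open>CR functions of slow growth\<close>

definition slow :: "(complex ^ 'n) set => (real ^ 'm) set => ('n::finite, 'm::finite) herm =>
  (('n, 'm) point => complex) => bool" where
 "slow E F \<Phi> f \<longleftrightarrow> (\<exists>k. moderate E F \<Phi> k f)"

definition tame :: "(complex ^ 'n) set => (real ^ 'm) set => ('n::finite, 'm::finite) herm =>
  (('n, 'm) point => complex) => bool" where
 "tame E F \<Phi> f \<longleftrightarrow> CR_on E F \<Phi> f \<and> slow E F \<Phi> f"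

lemma slow_smooth: "slow E F \<Phi> f ==> smooth_on (E \<times> F) f"
 by (auto simp: slow_def moderate_smooth)

lemma slow_cong:
 "qCR E F \<Phi> ==> (!!p. p \<in> E \<times> F ==> f p = g p) ==> slow E F \<Phi> f \<longleftrightarrow> slow E F \<Phi> g"
 unfolding slow_def using moderate_cong by blast

lemma slow_const: "qCR E F \<Phi> ==> slow E F \<Phi> (%p. c)"
 unfolding slow_def using moderate_const by blast

lemma slow_add:
 assumes Q: "qCR E F \<Phi>" and "slow E F \<Phi> f" "slow E F \<Phi> g"
 shows "slow E F \<Phi> (%p. f p + g p)"
proof -
 obtain k l where "moderate E F \<Phi> k f" "moderate E F \<Phi> l g" using assms by (auto simp: slow_def)
 then have "moderate E F \<Phi> (max k l) (%p. f p + g p)"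
  by (intro moderate_add Q) (auto intro: moderate_mono)
 then show ?thesis by (auto simp: slow_def)
qed

lemma slow_mult:
 assumes "qCR E F \<Phi>" "slow E F \<Phi> f" "slow E F \<Phi> g"
 shows "slow E F \<Phi> (%p. f p * g p)"
 using moderate_mult[OF assms(1)] assms(2,3) by (auto simp: slow_def) blast

lemma slow_sum:
 "qCR E F \<Phi> ==> (!!i. i \<in> I ==> slow E F \<Phi> (f i)) ==> slow E F \<Phi> (%p. \<Sum>i\<in>I. f i p)"
 by (induction I rule: infinite_finite_induct) (auto intro: slow_add slow_const)

lemma slow_prod:
 "qCR E F \<Phi> ==> (!!i. i \<in> I ==> slow E F \<Phi> (f i)) ==> slow E F \<Phi> (%p. \<Prod>i\<in>I. f i p)"
 by (induction I rule: infinite_finite_induct) (auto intro: slow_mult slow_const)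

lemma slow_poly: "qCR E F \<Phi> ==> slow E F \<Phi> f ==> slow E F \<Phi> (%p. poly r (f p))"
 by (induction r) (auto intro: slow_add slow_mult slow_const)

lemma slow_linear: "qCR E F \<Phi> ==> linear_on_sub (E \<times> F) L ==> slow E F \<Phi> L"
 unfolding slow_def using moderate_linear_on_sub by blast

lemma slow_real_polynomial_function:
 fixes r :: "('n::finite, 'm::finite) point => real"
 assumes Q: "qCR E F \<Phi>" and "real_polynomial_function r"
 shows "slow E F \<Phi> (%p. cplx (r p))"
 using assms(2)
proof induction
 case (linear f)
 interpret bounded_linear f by fact
 show ?case
  by (intro slow_linear[OF Q]) (simp add: linear_on_sub_def add scaleR scaleR_conv_of_real)
qed (auto intro: slow_const slow_add slow_mult Q)

lemma slow_polynomial_function: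
 fixes r :: "('n::finite, 'm::finite) point => complex"
 assumes Q: "qCR E F \<Phi>" and "polynomial_function r"
 shows "slow E F \<Phi> r"
proof -
 have R: "real_polynomial_function (%x. Re (r x))" "real_polynomial_function (%x. Im (r x))"
  using assms(2) bounded_linear_Re bounded_linear_Im by (auto simp: polynomial_function_def o_def)
 have "slow E F \<Phi> (%x. cplx (Re (r x)) + \<i> * cplx (Im (r x)))"
  by (intro slow_add slow_mult slow_const Q slow_real_polynomial_function R)
 then show ?thesis by (simp only: complex_eq[symmetric])
qed

lemma CR_on_cong:
 assumes Q: "qCR E F \<Phi>" and "!!p. p \<in> E \<times> F ==> f p = g p"
 shows "CR_on E F \<Phi> f \<longleftrightarrow> CR_on E F \<Phi> g"
proof -
 have "left_field \<Phi> (v, 0) f p = left_field \<Phi> (v, 0) g p" if "v \<in> E" "p \<in> E \<times> F" for v p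
  by (rule left_field_cong[OF Q quadratic_CR_Pair0(1)[OF Q that(1)] that(2) assms(2)])
 then show ?thesis using quadratic_CR_scale[OF Q] by (simp add: CR_on_iff)
qed

lemma CR_on_const: "qCR E F \<Phi> ==> CR_on E F \<Phi> (%p. c)"
 unfolding CR_on_iff
 by (intro ballI) (simp only: left_field_const quadratic_CR_scale quadratic_CR_Pair0(1) mult_zero_right add_0)

lemma CR_on_add:
 assumes Q: "qCR E F \<Phi>" and s: "smooth_on (E \<times> F) f" "smooth_on (E \<times> F) g"
  and "CR_on E F \<Phi> f" "CR_on E F \<Phi> g"
 shows "CR_on E F \<Phi> (%p. f p + g p)"
 unfolding CR_on_iff
proof (intro ballI)
 fix v p assume v: "v \<in> E" and p: "p \<in> E \<times> F"
 note u = quadratic_CR_Pair0(1)[OF Q v] quadratic_CR_Pair0(1)[OF Q quadratic_CR_scale[OF Q v]]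
 have e: "left_field \<Phi> (v, 0) f p + \<i> * left_field \<Phi> (\<i> *s v, 0) f p = 0"
  "left_field \<Phi> (v, 0) g p + \<i> * left_field \<Phi> (\<i> *s v, 0) g p = 0"
  using assms(4,5) v p unfolding CR_on_iff by blast+
 have "(a + b) + \<i> * (c + d) = (a + \<i> * c) + (b + \<i> * d)" for a b c d by (simp add: algebra_simps)
 then show "left_field \<Phi> (v, 0) (%p. f p + g p) p + \<i> * left_field \<Phi> (\<i> *s v, 0) (%p. f p + g p) p = 0"
  by (simp only: left_field_add[OF Q u(1) p s] left_field_add[OF Q u(2) p s] e add_0)
qed

lemma CR_on_mult:
 assumes Q: "qCR E F \<Phi>" and s: "smooth_on (E \<times> F) f" "smooth_on (E \<times> F) g"
  and "CR_on E F \<Phi> f" "CR_on E F \<Phi> g"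
 shows "CR_on E F \<Phi> (%p. f p * g p)"
 unfolding CR_on_iff
proof (intro ballI)
 fix v p assume v: "v \<in> E" and p: "p \<in> E \<times> F"
 note u = quadratic_CR_Pair0(1)[OF Q v] quadratic_CR_Pair0(1)[OF Q quadratic_CR_scale[OF Q v]]
 have e: "left_field \<Phi> (v, 0) f p + \<i> * left_field \<Phi> (\<i> *s v, 0) f p = 0"
  "left_field \<Phi> (v, 0) g p + \<i> * left_field \<Phi> (\<i> *s v, 0) g p = 0"
  using assms(4,5) v p unfolding CR_on_iff by blast+
 have "(a * y + x * b) + \<i> * (c * y + x * d) = (a + \<i> * c) * y + x * (b + \<i> * d)" for a b c d x y
  by (simp add: algebra_simps)
 then show "left_field \<Phi> (v, 0) (%p. f p * g p) p + \<i> * left_field \<Phi> (\<i> *s v, 0) (%p. f p * g p) p = 0"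
  by (simp only: left_field_mult[OF Q u(1) p s] left_field_mult[OF Q u(2) p s] e add_0 mult_zero_left mult_zero_right)
qed

lemma tame_slow: "tame E F \<Phi> f ==> slow E F \<Phi> f"
 by (simp add: tame_def)

lemma tame_smooth: "tame E F \<Phi> f ==> smooth_on (E \<times> F) f"
 unfolding tame_def by (rule slow_smooth[OF conjunct2])

lemma tame_cong:
 "qCR E F \<Phi> ==> (!!p. p \<in> E \<times> F ==> f p = g p) ==> tame E F \<Phi> f \<longleftrightarrow> tame E F \<Phi> g"
 unfolding tame_def using slow_cong CR_on_cong by blast

lemma tame_const: "qCR E F \<Phi> ==> tame E F \<Phi> (%p. c)"
 by (simp add: tame_def slow_const CR_on_const)

lemma tame_add: "qCR E F \<Phi> ==> tame E F \<Phi> f ==> tame E F \<Phi> g ==> tame E F \<Phi> (%p. f p + g p)"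
 unfolding tame_def by (auto intro: slow_add CR_on_add slow_smooth)

lemma tame_mult: "qCR E F \<Phi> ==> tame E F \<Phi> f ==> tame E F \<Phi> g ==> tame E F \<Phi> (%p. f p * g p)"
 unfolding tame_def by (auto intro: slow_mult CR_on_mult slow_smooth)

lemma tame_sum:
 "qCR E F \<Phi> ==> (!!i. i \<in> I ==> tame E F \<Phi> (f i)) ==> tame E F \<Phi> (%p. \<Sum>i\<in>I. f i p)"
 by (induction I rule: infinite_finite_induct) (auto intro: tame_add tame_const)

text \<open>\<open>T\<close> is the part of \<open>J\<close> on E; its compatibility with
  multiplication by i carries the conjugate fields of E to those of E'.\<close>

lemma tame_pullback:
 fixes \<Phi> :: "('n::finite, 'm::finite) herm" and \<Phi>' :: "('k::finite, 'l::finite) herm"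
 assumes Q: "qCR E F \<Phi>" and Q': "qCR E' F' \<Phi>'" and J: "linear J"
  and JV: "!!p. p \<in> E \<times> F ==> J p \<in> E' \<times> F'" and c: "c \<in> E' \<times> F'"
  and hom: "!!u p. u \<in> E \<times> F ==> p \<in> E \<times> F ==> J (left_dir \<Phi> u p) = left_dir \<Phi>' (J u) (J p + c)"
  and T: "!!v. v \<in> E ==> J (v, 0) = (T v, 0)" "!!v. v \<in> E ==> T (\<i> *s v) = \<i> *s T v"
  and f: "tame E' F' \<Phi>' f"
 shows "tame E F \<Phi> (%p. f (J p + c))"
proof -
 have sf: "smooth_on (E' \<times> F') f" by (rule tame_smooth[OF f])
 have "CR_on E F \<Phi> (%p. f (J p + c))"
  unfolding CR_on_iff
 proof (intro ballI)
  fix v p assume v: "v \<in> E" and p: "p \<in> E \<times> F"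
  note u = quadratic_CR_Pair0(1)[OF Q v] quadratic_CR_Pair0(1)[OF Q quadratic_CR_scale[OF Q v]]
  have Tv: "T v \<in> E'" using JV[OF u(1)] T(1)[OF v] by simp
  have q: "J p + c \<in> E' \<times> F'" by (intro subspace_add CR_subspaces(3)[OF Q'] JV p c)
  have "left_field \<Phi>' (T v, 0) f (J p + c) + \<i> * left_field \<Phi>' (\<i> *s T v, 0) f (J p + c) = 0"
   by (rule bspec[OF bspec[OF f[unfolded tame_def CR_on_iff, THEN conjunct1] Tv] q])
  then show "left_field \<Phi> (v, 0) (%p. f (J p + c)) p + \<i> * left_field \<Phi> (\<i> *s v, 0) (%p. f (J p + c)) p = 0"
   by (simp only: left_field_pullback[OF Q Q' J JV c hom sf u(1) p] left_field_pullback[OF Q Q' J JV c hom sf u(2) p]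
    T(1)[OF v] T(1)[OF quadratic_CR_scale[OF Q v]] T(2)[OF v])
 qed
 moreover have "slow E F \<Phi> (%p. f (J p + c))"
  using moderate_pullback[OF Q Q' J JV c hom] tame_slow[OF f] unfolding slow_def by blast
 ultimately show ?thesis by (simp add: tame_def)
qed

lemma tame_linear:
 assumes Q: "qCR E F \<Phi>" and L: "linear_on_sub E L" and i: "!!v. v \<in> E ==> L (\<i> *s v) = \<i> * L v"
 shows "tame E F \<Phi> (%p. L (fst p))"
proof -
 note l = linear_on_sub_fst[OF L, of F]
 have lf: "left_field \<Phi> (v, 0) (%p. L (fst p)) p = L v" if "v \<in> E" "p \<in> E \<times> F" for v p
  using linear_on_sub_dir_deriv[OF CR_subspaces(3)[OF Q] l left_dir_in[OF Q quadratic_CR_Pair0(1)[OF Q that(1)] that(2)] that(2)]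
  by (intro left_field_has_dir_deriv[OF Q quadratic_CR_Pair0(1)[OF Q that(1)] that(2)]) (simp add: left_dir_def)
 have "CR_on E F \<Phi> (%p. L (fst p))"
  unfolding CR_on_iff using lf quadratic_CR_scale[OF Q] i by simp
 then show ?thesis by (simp add: tame_def slow_linear[OF Q l])
qed

section \<open>The quadratic map and the CR coordinates\<close>

lemma linear_on_sub_Re_Phi:
 assumes Q: "qCR E F \<Phi>" and "\<eta> \<in> E"
 shows "linear_on_sub E (%\<zeta>. Re_vec (\<Phi> \<zeta> \<eta>) \<bullet> b)"
 using hermD(2,3)[OF Q] assms(2)
 by (auto simp: linear_on_sub_def Re_Im_vec_simps scaleR_eq_vector_scale inner_add_left)

lemma quad_line:
 assumes Q: "qCR E F \<Phi>" and "\<zeta> \<in> E" "v \<in> E"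
 shows "quad \<Phi> (\<zeta> + t *\<^sub>R v) = quad \<Phi> \<zeta> + (2 * t) *\<^sub>R Re_vec (\<Phi> \<zeta> v) + t\<^sup>2 *\<^sub>R quad \<Phi> v"
proof -
 have tv: "of_real t *s v \<in> E" by (rule quadratic_CR_scale[OF Q assms(3)])
 note S = CR_subspaces[OF Q]
 have add: "\<zeta> + of_real t *s v \<in> E" by (rule subspace_add[OF S(1) assms(2) tv])
 have "Re_vec (\<Phi> v \<zeta>) = Re_vec (\<Phi> \<zeta> v)"
  using hermD(4)[OF Q assms(2,3)] by (simp add: cnj_vec_simps)
 then show ?thesis
  unfolding quad_def scaleR_eq_vector_scale[of t v]
  by (simp add: hermD(2)[OF Q assms(2) tv add] herm_right(1)[OF Q assms(2) tv]
   hermD(3)[OF Q assms(3)] herm_right(2)[OF Q assms(3)] assms tv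
   Re_Im_vec_simps power2_eq_square scaleR_add_right)
   (simp add: mult.commute[of 2 t] scaleR_scaleR[symmetric] scaleR_2 scaleR_add_right del: scaleR_scaleR)
qed

text \<open>Each summand is a real-linear function times a real-linear map on E; growth and
  polynomiality of the quadratic map are read off from this form.\<close>

lemma quad_expand:
 assumes Q: "qCR E F \<Phi>" and z: "\<zeta> \<in> E"
 shows "quad \<Phi> \<zeta> = (\<Sum>a\<in>onb E. (\<zeta> \<bullet> a) *\<^sub>R Re_vec (\<Phi> \<zeta> a))"
proof -
 note S = CR_subspaces[OF Q]
 have s: "Re_vec (\<Phi> \<zeta> (\<Sum>a\<in>A. c a *\<^sub>R a)) = (\<Sum>a\<in>A. c a *\<^sub>R Re_vec (\<Phi> \<zeta> a)) \<and> (\<Sum>a\<in>A. c a *\<^sub>R a) \<in> E"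
  if "finite A" "A \<subseteq> E" for A c
  using that
 proof (induction A rule: finite_induct)
  case empty
  have "\<Phi> \<zeta> 0 = 0" using herm_right(2)[OF Q z z, of 0] by simp
  then show ?case using subspace_0[OF S(1)] by (simp add: Re_vec_def vec_eq_iff)
 next
  case (insert a A)
  then have m: "a \<in> E" "c a *\<^sub>R a \<in> E" "(\<Sum>a\<in>A. c a *\<^sub>R a) \<in> E" by (auto intro: subspace_scale[OF S(1)])
  have "\<Phi> \<zeta> (c a *\<^sub>R a) = of_real (c a) *s \<Phi> \<zeta> a"
   unfolding scaleR_eq_vector_scale using herm_right(2)[OF Q m(1) z, of "of_real (c a)"] by simp
  then show ?case using insert herm_right(1)[OF Q m(2,3) z] subspace_add[OF S(1) m(2,3)]
   by (simp add: Re_Im_vec_simps)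
 qed
 show ?thesis unfolding quad_def
  by (subst (2) onb_expand[OF S(1) z], rule conjunct1[OF s])
   (use finite_onb[OF S(1)] onb(1)[OF S(1)] in auto)
qed

text \<open>The quadratic map belongs to one structure and the growth is measured by the fields of
  the other; the extension \<open>hol_ext\<close> mixes the two in this way.\<close>

lemma slow_quad:
 assumes Q: "qCR E F \<Phi>" and Q': "qCR E F \<Phi>'"
 shows "slow E F \<Phi>' (%p. cplx (quad \<Phi> (fst p) \<bullet> b))"
proof -
 note S = CR_subspaces[OF Q]
 have "linear_on_sub (E \<times> F) (%p. cplx (Re_vec (\<Phi> (fst p) a) \<bullet> b))" if "a \<in> onb E" for a
  using linear_on_sub_Re_Phi[OF Q, of a b] that onb(1)[OF S(1)]
  by (intro linear_on_sub_fst) (auto simp: linear_on_sub_def scaleR_conv_of_real[where 'a = complex])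
 moreover have "linear_on_sub (E \<times> F) (%p. cplx (fst p \<bullet> a))" for a :: "complex ^ 'a"
  by (auto simp: linear_on_sub_def inner_add_left scaleR_conv_of_real[where 'a = complex])
 ultimately have "slow E F \<Phi>' (%p. \<Sum>a\<in>onb E. cplx (fst p \<bullet> a) * cplx (Re_vec (\<Phi> (fst p) a) \<bullet> b))"
  by (intro slow_sum slow_mult slow_linear Q')
 then show ?thesis
  by (rule slow_cong[OF Q', THEN iffD1, rotated]) (auto simp: quad_expand[OF Q] inner_sum_left)
qed

lemma polynomial_quad:
 fixes \<Phi> :: "('n::finite, 'm::finite) herm"
 assumes Q: "qCR E F \<Phi>"
 shows "\<exists>r. real_polynomial_function r \<and> (\<forall>\<zeta>\<in>E. r \<zeta> = quad \<Phi> \<zeta> \<bullet> b)"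
proof -
 note S = CR_subspaces[OF Q]
 have "\<exists>g :: complex ^ 'n => real. linear g \<and> (\<forall>\<zeta>\<in>E. g \<zeta> = Re_vec (\<Phi> \<zeta> a) \<bullet> b)" if "a \<in> onb E" for a
 proof -
  have "a \<in> E" using that onb(1)[OF S(1)] by auto
  from linear_on_sub_extend[OF S(1) linear_on_sub_Re_Phi[OF Q this]] show ?thesis by metis
 qed
 then obtain g :: "complex ^ 'n => complex ^ 'n => real"
  where g: "!!a. a \<in> onb E ==> linear (g a)"
   "!!a \<zeta>. a \<in> onb E ==> \<zeta> \<in> E ==> g a \<zeta> = Re_vec (\<Phi> \<zeta> a) \<bullet> b"
  by metis
 have "real_polynomial_function (%\<zeta>. \<Sum>a\<in>onb E. (\<zeta> \<bullet> a) * g a \<zeta>)"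
  using g(1) by (intro real_polynomial_function_sum real_polynomial_function.intros(4) real_polynomial_function.intros(1)
   bounded_linear_inner_left finite_onb S) (auto simp: linear_conv_bounded_linear)
 moreover have "(\<Sum>a\<in>onb E. (\<zeta> \<bullet> a) * g a \<zeta>) = quad \<Phi> \<zeta> \<bullet> b" if "\<zeta> \<in> E" for \<zeta>
  unfolding quad_expand[OF Q that] inner_sum_left inner_scaleR_left using g(2) that by (intro sum.cong) auto
 ultimately show ?thesis by blast
qed

lemma has_vector_derivative_quad:
 assumes Q: "qCR E F \<Phi>" and "\<zeta> \<in> E" "v \<in> E"
 shows "((%t. cplx (quad \<Phi> (\<zeta> + t *\<^sub>R v) \<bullet> b)) has_vector_derivative
  cplx (2 * (Re_vec (\<Phi> \<zeta> v) \<bullet> b))) (at 0)"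
proof -
 have "((%t. quad \<Phi> \<zeta> \<bullet> b + (2 * t) * (Re_vec (\<Phi> \<zeta> v) \<bullet> b) + t\<^sup>2 * (quad \<Phi> v \<bullet> b)) has_real_derivative
  2 * (Re_vec (\<Phi> \<zeta> v) \<bullet> b)) (at 0)"
  by (auto intro!: derivative_eq_intros)
 then show ?thesis
  by (intro has_vector_derivative_of_real)
   (simp add: quad_line[OF assms] inner_add_left has_real_derivative_iff_has_vector_derivative)
qed

text \<open>The coordinate along \<open>b\<close> of x + i \<Phi>(\<zeta>), which embeds N as a CR
  submanifold of the complex space E x F_C.\<close>

definition hol_coord :: "('n::finite, 'm::finite) herm => real ^ 'm => ('n, 'm) point => complex" where
 "hol_coord \<Phi> b p = of_real (snd p \<bullet> b) + \<i> * of_real (quad \<Phi> (fst p) \<bullet> b)"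

lemma tame_hol_coord:
 assumes Q: "qCR E F \<Phi>"
 shows "tame E F \<Phi> (hol_coord \<Phi> b)"
proof -
 have lf: "left_field \<Phi> (v, 0) (hol_coord \<Phi> b) p =
   of_real (2 * (Im_vec (\<Phi> (fst p) v) \<bullet> b)) + \<i> * of_real (2 * (Re_vec (\<Phi> (fst p) v) \<bullet> b))"
  if v: "v \<in> E" and p: "p \<in> E \<times> F" for v p
 proof (rule left_field_has_dir_deriv[OF Q quadratic_CR_Pair0(1)[OF Q v] p])
  let ?d = "left_dir \<Phi> (v, 0) p"
  have "((%t. cplx ((snd p + t *\<^sub>R snd ?d) \<bullet> b)) has_vector_derivative of_real (snd ?d \<bullet> b)) (at 0)"
   unfolding inner_add_left inner_scaleR_left
   by (intro has_vector_derivative_of_real) (auto intro!: derivative_eq_intros)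
  moreover have "((%t. cplx (quad \<Phi> (fst p + t *\<^sub>R v) \<bullet> b)) has_vector_derivative
    cplx (2 * (Re_vec (\<Phi> (fst p) v) \<bullet> b))) (at 0)"
   using has_vector_derivative_quad[OF Q _ v] p by auto
  ultimately have "((%t. of_real ((snd p + t *\<^sub>R snd ?d) \<bullet> b) + \<i> * of_real (quad \<Phi> (fst p + t *\<^sub>R v) \<bullet> b))
    has_vector_derivative of_real (snd ?d \<bullet> b) + \<i> * of_real (2 * (Re_vec (\<Phi> (fst p) v) \<bullet> b))) (at 0)"
   by (intro has_vector_derivative_add has_vector_derivative_mult_right)
  then show "has_dir_deriv ?d (hol_coord \<Phi> b)
    (of_real (2 * (Im_vec (\<Phi> (fst p) v) \<bullet> b)) + \<i> * of_real (2 * (Re_vec (\<Phi> (fst p) v) \<bullet> b))) p"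
   by (simp add: has_dir_deriv_def hol_coord_def left_dir_def)
 qed
 have "CR_on E F \<Phi> (hol_coord \<Phi> b)"
  unfolding CR_on_iff
 proof (intro ballI)
  fix v p assume v: "v \<in> E" and p: "p \<in> E \<times> F"
  have "\<Phi> (fst p) (\<i> *s v) = cnj \<i> *s \<Phi> (fst p) v"
   by (rule herm_right(2)[OF Q v]) (use p in \<open>simp add: mem_Times_iff\<close>)
  then have "Im_vec (\<Phi> (fst p) (\<i> *s v)) = - Re_vec (\<Phi> (fst p) v)" "Re_vec (\<Phi> (fst p) (\<i> *s v)) = Im_vec (\<Phi> (fst p) v)"
   by (simp_all only: Re_Im_vec_simps) simp_all
  then show "left_field \<Phi> (v, 0) (hol_coord \<Phi> b) p + \<i> * left_field \<Phi> (\<i> *s v, 0) (hol_coord \<Phi> b) p = 0"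
   unfolding lf[OF v p] lf[OF quadratic_CR_scale[OF Q v] p] by (simp add: Re_Im_vec_simps algebra_simps)
 qed
 moreover have "linear_on_sub (E \<times> F) (%p. cplx (snd p \<bullet> b))"
  by (auto simp: linear_on_sub_def inner_add_left scaleR_conv_of_real[where 'a = complex])
 then have "slow E F \<Phi> (hol_coord \<Phi> b)"
  unfolding hol_coord_def[abs_def] by (intro slow_add slow_mult slow_const slow_quad slow_linear Q)
 ultimately show ?thesis by (simp add: tame_def)
qed

lemma tame_holomorphic_polynomial:
 fixes f :: "('n::finite, 'm::finite) point => complex ^ 'k::finite" and g :: "('n, 'm) point => complex ^ 'l::finite"
 assumes Q: "qCR E F \<Phi>" and "!!i. tame E F \<Phi> (%p. f p $ i)" "!!j. tame E F \<Phi> (%p. g p $ j)"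
  and "hpoly h"
 shows "tame E F \<Phi> (%p. h (f p, g p))"
 using assms(4) by induction (use assms in \<open>auto intro: tame_const tame_add tame_mult\<close>)

text \<open>In the null directions of \<open>\<Phi>\<close> a CR function is entire, hence a polynomial if it is of polynomial growth.\<close>

lemma CR_line:
 fixes \<Phi> :: "('n::finite, 'm::finite) herm"
 assumes Q: "qCR E F \<Phi>" and h: "smooth_on (E \<times> F) h" "CR_on E F \<Phi> h" "grows k (E \<times> F) h"
  and v: "v \<in> E" and null: "!!\<zeta>. \<zeta> \<in> E ==> \<Phi> \<zeta> v = 0" and z: "\<zeta> \<in> E" and x: "x \<in> F"
 shows "h (\<zeta> + s *s v, x) = (\<Sum>l\<le>k. poly (lag k l) s * h (\<zeta> + of_nat l *s v, x))"
proof -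
 note S = CR_subspaces[OF Q]
 let ?J = "%s. (s *s v, 0 :: real ^ 'm)"
 have J: "linear ?J" by (rule linearI) (auto simp: distrib_right scaleR_eq_vector_scale vec_eq_iff scaleR_conv_of_real[where 'a = complex])
 have JV: "?J s \<in> E \<times> F" for s using quadratic_CR_Pair0(1)[OF Q quadratic_CR_scale[OF Q v]] by simp
 have zx: "(\<zeta>, x) \<in> E \<times> F" using z x by simp
 have in_EF: "?J s + (\<zeta>, x) \<in> E \<times> F" for s by (rule subspace_add[OF S(3) JV zx])
 define f where "f s = h (?J s + (\<zeta>, x))" for s
 have sm: "smooth_on UNIV f"
  unfolding f_def[abs_def] by (rule smooth_compose_affine[OF subspace_UNIV S(3) J JV zx h(1)])
 have "\<Phi> \<eta> (c *s v) = 0" if "\<eta> \<in> E" for \<eta> c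
  using herm_right(2)[OF Q v that, of c] null[OF that] by simp
 then have ld: "left_dir \<Phi> (c *s v, 0) p = (c *s v, 0)" if "p \<in> E \<times> F" for p c
  using that by (auto simp: left_dir_def Im_vec_def vec_eq_iff)
 have d: "dir_deriv c f s = left_field \<Phi> (c *s v, 0) h (?J s + (\<zeta>, x))" for c s
 proof (rule has_dir_deriv_eq)
  show "has_dir_deriv c f (left_field \<Phi> (c *s v, 0) h (?J s + (\<zeta>, x))) s"
   unfolding f_def[abs_def]
   by (rule has_dir_deriv_compose_affine[OF J], subst (1) ld[OF in_EF[of s], symmetric])
    (rule left_field_smooth_has_dir_deriv[OF Q JV in_EF h(1)])
 qed
 have "dir_deriv \<i> f s = \<i> * dir_deriv 1 f s" for s
 proof -
  have "left_field \<Phi> (v, 0) h (?J s + (\<zeta>, x)) + \<i> * left_field \<Phi> (\<i> *s v, 0) h (?J s + (\<zeta>, x)) = 0"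
   by (rule bspec[OF bspec[OF h(2)[unfolded CR_on_iff] v] in_EF])
  then have "\<i> * (left_field \<Phi> (v, 0) h (?J s + (\<zeta>, x)) + \<i> * left_field \<Phi> (\<i> *s v, 0) h (?J s + (\<zeta>, x))) = 0" by simp
  then show ?thesis unfolding d by (simp add: distrib_left mult.assoc[symmetric])
 qed
 note D = smooth_CR_has_field_derivative[OF sm this]
 have "grows k UNIV f"
  unfolding f_def[abs_def] by (rule grows_compose_affine[OF J in_EF h(3)])
 from entire_polynomial_growth[OF D this]
 have "f s = (\<Sum>l\<le>k. poly (lag k l) s * f (of_nat l))" .
 then show ?thesis by (simp add: f_def add.commute)
qed

section \<open>Holomorphic extension in the polynomial directions\<close>

text \<open>If \<open>f\<close> is polynomial in the directions \<open>F1\<close>, then \<open>f (\<zeta>, x + y)\<close> (for \<open>y\<close> in \<open>F1\<close>) is the value at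
 \<open>z = y + \<i> \<Phi>(\<zeta>)\<close> of the following function, which makes sense for complex \<open>z\<close>.\<close>

definition hol_ext :: "('n::finite, 'm::finite) herm => (real ^ 'm) set => nat => (('n, 'm) point => complex) =>
  complex ^ 'm => ('n, 'm) point => complex" where
 "hol_ext \<Phi> B D f z p = (\<Sum>m\<in>B \<rightarrow>\<^sub>E {..D}.
   gpoly B D m (z - \<i> *s rvec (quad \<Phi> (fst p))) * f (p + (0, grid_point B m)))"

lemma hol_ext_cong:
 assumes "!!b. b \<in> B ==> cdot z b = cdot w b"
 shows "hol_ext \<Phi> B D f z p = hol_ext \<Phi> B D f w p"
proof -
 have "gpoly B D m (z - c) = gpoly B D m (w - c)" for m c
  by (rule grid_poly_cong) (simp add: cdot_simps assms)
 then show ?thesis by (simp add: hol_ext_def)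
qed

lemma hol_ext_sum: "hol_ext \<Phi> B D (%p. \<Sum>i\<in>I. f i p * c i) z p = (\<Sum>i\<in>I. hol_ext \<Phi> B D (f i) z p * c i)"
 unfolding hol_ext_def sum_distrib_left sum_distrib_right mult.assoc by (rule sum.swap)

text \<open>Two instances: \<open>\<Phi>' = Phi_K2\<close> with F1 the space \<open>F_K1\<close>,
  for surjectivity, and the zero map with F1 = F, for the holomorphic extension of CR polynomials.
  In both, \<open>\<Phi>'\<close> is what is left of \<open>\<Phi>\<close> once the directions of F1
  have been absorbed into the complex variable z.\<close>

locale CR_change =
 fixes E :: "(complex ^ 'n::finite) set" and F :: "(real ^ 'm::finite) set"
  and \<Phi> \<Phi>' :: "('n, 'm) herm" and F1 :: "(real ^ 'm) set" and D :: nat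
 assumes Q: "qCR E F \<Phi>" and Q': "qCR E F \<Phi>'"
  and F1: "subspace F1" "F1 \<subseteq> F"
  and diff: "!!\<zeta> \<zeta>'. \<zeta> \<in> E ==> \<zeta>' \<in> E ==> \<Phi> \<zeta> \<zeta>' - \<Phi>' \<zeta> \<zeta>' \<in> complexification F1"
  and perp: "!!\<zeta> \<zeta>' b. \<zeta> \<in> E ==> \<zeta>' \<in> E ==> b \<in> F1 ==> Im_vec (\<Phi>' \<zeta> \<zeta>') \<bullet> b = 0"
begin

abbreviation "B \<equiv> onb F1"
abbreviation "grid \<equiv> B \<rightarrow>\<^sub>E {..D}"
abbreviation "H \<equiv> hol_ext \<Phi> B D"

lemmas S = CR_subspaces[OF Q]

lemma B_in: "b \<in> B ==> b \<in> F1"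
 using onb(1)[OF F1(1)] by auto

lemma finB: "finite B" by (rule finite_onb[OF F1(1)])

lemma grid_point_in: "grid_point B m \<in> F1" "grid_point B m \<in> F" "(0, grid_point B m) \<in> E \<times> F"
proof -
 show 1: "grid_point B m \<in> F1"
  unfolding grid_point_def by (intro subspace_sum[OF F1(1)] subspace_scale[OF F1(1)] B_in)
 then show "grid_point B m \<in> F" using F1 by auto
 then show "(0, grid_point B m) \<in> E \<times> F" by (rule quadratic_CR_Pair0(2)[OF Q])
qed

text \<open>In z, H is a polynomial of degree at most D in each coordinate, hence determined by its
  values on the real grid. It remains to study these finitely many functions of p.\<close>

lemma hol_ext_expand: "H f z p = (\<Sum>m\<in>grid. gpoly B D m z * H f (rvec (grid_point B m)) p)"
proof -
 let ?w = "- (\<i> *s rvec (quad \<Phi> (fst p)))"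
 have "H f z p = (\<Sum>m\<in>grid. (\<Sum>m'\<in>grid. gpoly B D m' z * gpoly B D m (rvec (grid_point B m') + ?w)) * f (p + (0, grid_point B m)))"
  unfolding hol_ext_def using grid_poly_interpolation[OF F1(1), of _ D z ?w] by (intro sum.cong) auto
 also have "\<dots> = (\<Sum>m'\<in>grid. \<Sum>m\<in>grid. gpoly B D m' z * (gpoly B D m (rvec (grid_point B m') + ?w) * f (p + (0, grid_point B m))))"
  unfolding sum_distrib_right mult.assoc by (rule sum.swap)
 finally show ?thesis by (simp add: hol_ext_def sum_distrib_left)
qed

lemma slow_hol_ext:
 assumes "slow E F \<Phi>' f" shows "slow E F \<Phi>' (H f z)"
proof -
 have "slow E F \<Phi>' (%p. cdot (z - \<i> *s rvec (quad \<Phi> (fst p))) b)" for b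
 proof -
  have "slow E F \<Phi>' (%p. cdot z b + (- \<i>) * cplx (quad \<Phi> (fst p) \<bullet> b))"
   by (intro slow_add slow_mult slow_const slow_quad Q Q')
  then show ?thesis by (simp add: cdot_simps)
 qed
 moreover have "slow E F \<Phi>' (%p. f (p + (0, grid_point B m)))" for m
  using assms moderate_translate[OF Q' grid_point_in(2)] unfolding slow_def by blast
 ultimately show ?thesis unfolding hol_ext_def[abs_def] gpoly_def
  by (intro slow_sum slow_mult slow_prod slow_poly Q')
qed

lemma polynomial_F1:
 assumes pol: "!!b. b \<in> B ==> polynomial_along (E \<times> F) D (0, b) f" and p: "p \<in> E \<times> F" and y: "y \<in> F1"
 shows "f (p + (0, y)) = (\<Sum>m\<in>grid. gpoly B D m (rvec y) * f (p + (0, grid_point B m)))"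
proof -
 let ?\<sigma> = "%b t. (0 :: complex ^ 'n, Re t *\<^sub>R b)"
 have bF: "(0, b) \<in> E \<times> F" if "b \<in> B" for b
  using B_in[OF that] F1 by (intro quadratic_CR_Pair0(2)[OF Q]) auto
 have s0: "(0 :: complex ^ 'n, r *\<^sub>R b) = r *\<^sub>R (0, b)" for r and b :: "real ^ 'm" by simp
 have sg: "(\<Sum>b\<in>A. (0 :: complex ^ 'n, g b)) = (0, \<Sum>b\<in>A. g b)" for A and g :: "real ^ 'm => real ^ 'm"
  by (induction A rule: infinite_finite_induct) (auto simp: zero_prod_def)
 have "f (p + (\<Sum>b\<in>B. ?\<sigma> b (cplx (y \<bullet> b)))) =
   (\<Sum>m\<in>grid. (\<Prod>b\<in>B. poly (lag D (m b)) (cplx (y \<bullet> b))) * f (p + (\<Sum>b\<in>B. ?\<sigma> b (of_nat (m b)))))"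
 proof (rule multi_interpolation[OF finB, where T = "range cplx" and C = "E \<times> F"])
  show "of_nat l \<in> range cplx" for l by (rule range_eqI[of _ _ "of_nat l"]) simp
  fix x b and t :: complex assume x: "x \<in> E \<times> F" and b: "b \<in> B" and t: "t \<in> range cplx"
  show "x + ?\<sigma> b t \<in> E \<times> F" unfolding s0 by (intro subspace_add[OF S(3)] subspace_scale[OF S(3)] x bF[OF b])
  obtain t' where t': "t = of_real t'" using t by auto
  show "f (x + ?\<sigma> b t) = (\<Sum>l\<le>D. poly (lag D l) t * f (x + ?\<sigma> b (of_nat l)))"
   unfolding s0 t' Re_complex_of_real complex_Re_of_nat
   by (rule bspec[OF pol[OF b, unfolded polynomial_along_def] x, rule_format])
 qed (use p in auto)
 moreover have "(\<Sum>b\<in>B. ?\<sigma> b (cplx (y \<bullet> b))) = (0, y)"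
  unfolding sg using onb_expand[OF F1(1) y] by simp
 moreover have "(\<Sum>b\<in>B. ?\<sigma> b (of_nat (m b))) = (0, grid_point B m)" for m
  unfolding sg by (simp add: grid_point_def)
 ultimately show ?thesis by (simp only: gpoly_def cdot_simps)
qed

text \<open>The field acts on \<open>g\<close>, where it is exchanged for a field of
  \<open>\<Phi>\<close>, and on the polynomial factor. The direction \<open>c\<close> collects both
  effects on the polynomial: -2i Re \<Phi>(\<zeta>, v) from the derivative of the quadratic map, and
  -2 Im (\<Phi> - \<Phi>')(\<zeta>, v) from the exchange.\<close>

lemma left_field_hol_ext:
 fixes z :: "complex ^ 'm"
 assumes g: "smooth_on (E \<times> F) g" and pol: "!!b. b \<in> B ==> polynomial_along (E \<times> F) D (0, b) g"
  and v: "v \<in> E" and p: "p \<in> E \<times> F"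
 defines "w \<equiv> z - \<i> *s rvec (quad \<Phi> (fst p))"
  and "c \<equiv> (- 2 * \<i>) *s rvec (Re_vec (\<Phi> (fst p) v)) + (- 2) *s rvec (Im_vec (\<Phi> (fst p) v - \<Phi>' (fst p) v))"
 shows "left_field \<Phi>' (v, 0) (H g z) p =
  (\<Sum>m\<in>grid. gpoly B D m w * left_field \<Phi> (v, 0) g (p + (0, grid_point B m))) +
  (\<Sum>m\<in>grid. grid_poly_deriv B D m w c * g (p + (0, grid_point B m)))"
proof -
 let ?q = "%m. p + (0, grid_point B m)" and ?u = "(v, 0 :: real ^ 'm)"
 let ?d = "left_dir \<Phi>' ?u p" and ?e = "Im_vec (\<Phi> (fst p) v - \<Phi>' (fst p) v)"
 let ?c1 = "(- 2 * \<i>) *s rvec (Re_vec (\<Phi> (fst p) v))"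
 note u = quadratic_CR_Pair0(1)[OF Q v]
 have q: "?q m \<in> E \<times> F" for m by (rule subspace_add[OF S(3) p grid_point_in(3)])
 have e: "?e \<in> F1" using diff[of "fst p" v] v p by (auto simp: complexification_parts)
 then have eF: "(0, 2 *\<^sub>R ?e) \<in> E \<times> F" using F1 S(2) by (intro quadratic_CR_Pair0(2)[OF Q] subspace_scale) auto
 have dF: "?d \<in> E \<times> F" by (rule left_dir_in[OF Q' u p])
 \<comment> \<open>As \<open>g\<close> is polynomial along F1, its derivative there is a combination
   of grid values with differentiated Lagrange polynomials.\<close>
 have d0: "dir_deriv (0, 2 *\<^sub>R ?e) g (?q m) = (\<Sum>m'\<in>grid. grid_poly_deriv B D m' (rvec (grid_point B m)) (2 *s rvec ?e) * g (?q m'))" for m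
 proof (rule has_dir_deriv_eq)
  let ?\<gamma> = "%t. rvec (grid_point B m + t *\<^sub>R (2 *\<^sub>R ?e))"
  have "((%t. cdot (?\<gamma> t) b) has_vector_derivative cdot (2 *s rvec ?e) b) (at 0)" for b
   unfolding cdot_simps inner_add_left inner_scaleR_left
   by (auto intro!: derivative_eq_intros has_vector_derivative_of_real simp: has_vector_derivative_def scaleR_conv_of_real)
  from has_vector_derivative_grid_poly[where \<gamma> = ?\<gamma>, OF this]
  have "((%t. \<Sum>m'\<in>grid. gpoly B D m' (?\<gamma> t) * g (?q m')) has_vector_derivative
    (\<Sum>m'\<in>grid. grid_poly_deriv B D m' (?\<gamma> 0) (2 *s rvec ?e) * g (?q m'))) (at 0)"
   by (intro has_vector_derivative_sum has_vector_derivative_mult_left)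
  moreover have "g (?q m + t *\<^sub>R (0, 2 *\<^sub>R ?e)) = (\<Sum>m'\<in>grid. gpoly B D m' (?\<gamma> t) * g (?q m'))" for t
  proof -
   have "grid_point B m + t *\<^sub>R (2 *\<^sub>R ?e) \<in> F1"
    by (intro subspace_add subspace_scale F1 grid_point_in e)
   from polynomial_F1[OF pol p this] show ?thesis by (simp add: add.assoc)
  qed
  ultimately show "has_dir_deriv (0, 2 *\<^sub>R ?e) g (\<Sum>m'\<in>grid. grid_poly_deriv B D m' (rvec (grid_point B m)) (2 *s rvec ?e) * g (?q m')) (?q m)"
   by (simp add: has_dir_deriv_def)
 qed
 have d1: "dir_deriv ?d g (?q m) = left_field \<Phi> ?u g (?q m) - dir_deriv (0, 2 *\<^sub>R ?e) g (?q m)" for m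
 proof -
  have "left_dir \<Phi> ?u (?q m) = ?d + (0, 2 *\<^sub>R ?e)"
   by (simp add: left_dir_def Re_Im_vec_simps algebra_simps)
  then show ?thesis using dir_deriv_add_dir[OF S(3) g dF eF q] by (simp add: left_field_eq[OF Q u q])
 qed
 have tm: "has_dir_deriv ?d (%p. gpoly B D m (z - \<i> *s rvec (quad \<Phi> (fst p))) * g (p + (0, grid_point B m)))
   (grid_poly_deriv B D m w ?c1 * g (?q m) + gpoly B D m w * dir_deriv ?d g (?q m)) p" for m
 proof -
  have 1: "has_dir_deriv ?d (%p. g (p + (0, grid_point B m))) (dir_deriv ?d g (?q m)) p"
   using has_dir_deriv_compose_affine[OF linear_id, of ?d g _ p "(0, grid_point B m)"] smooth_has_dir_deriv[OF g dF q] by simp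
  let ?\<gamma> = "%t. z - \<i> *s rvec (quad \<Phi> (fst p + t *\<^sub>R v))"
  have "((%t. cdot (?\<gamma> t) b) has_vector_derivative cdot ?c1 b) (at 0)" for b
  proof -
   have "fst p \<in> E" using p by auto
   have "((%t. cdot z b + (- \<i>) * cplx (quad \<Phi> (fst p + t *\<^sub>R v) \<bullet> b)) has_vector_derivative
     0 + (- \<i>) * cplx (2 * (Re_vec (\<Phi> (fst p) v) \<bullet> b))) (at 0)"
    by (intro has_vector_derivative_add has_vector_derivative_const has_vector_derivative_mult_right
     has_vector_derivative_quad[OF Q \<open>fst p \<in> E\<close> v])
   then show ?thesis unfolding cdot_simps by (simp add: mult_ac)
  qed
  from has_vector_derivative_grid_poly[where \<gamma> = ?\<gamma>, OF this]
  have "has_dir_deriv ?d (%p. gpoly B D m (z - \<i> *s rvec (quad \<Phi> (fst p)))) (grid_poly_deriv B D m w ?c1) p"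
   by (simp add: has_dir_deriv_def w_def left_dir_def)
  from has_dir_deriv_mult[OF this 1] show ?thesis by (simp only: w_def)
 qed
 have "left_field \<Phi>' ?u (H g z) p = (\<Sum>m\<in>grid. grid_poly_deriv B D m w ?c1 * g (?q m) + gpoly B D m w * dir_deriv ?d g (?q m))"
  unfolding hol_ext_def[abs_def] by (rule left_field_has_dir_deriv[OF Q' u p has_dir_deriv_sum[OF tm]])
 also have "\<dots> = (\<Sum>m\<in>grid. grid_poly_deriv B D m w ?c1 * g (?q m)) + (\<Sum>m\<in>grid. gpoly B D m w * left_field \<Phi> ?u g (?q m))
   - (\<Sum>m\<in>grid. gpoly B D m w * (\<Sum>m'\<in>grid. grid_poly_deriv B D m' (rvec (grid_point B m)) (2 *s rvec ?e) * g (?q m')))"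
  by (simp add: d1 d0 sum.distrib sum_subtractf right_diff_distrib)
 also have "(\<Sum>m\<in>grid. gpoly B D m w * (\<Sum>m'\<in>grid. grid_poly_deriv B D m' (rvec (grid_point B m)) (2 *s rvec ?e) * g (?q m')))
   = (\<Sum>m'\<in>grid. (\<Sum>m\<in>grid. gpoly B D m w * grid_poly_deriv B D m' (rvec (grid_point B m)) (2 *s rvec ?e)) * g (?q m'))"
  unfolding sum_distrib_left sum_distrib_right mult.assoc by (rule sum.swap)
 \<comment> \<open>Interpolating the derivative in z moves it from \<open>g\<close> onto the
   polynomial factor.\<close>
 also have "\<dots> = (\<Sum>m'\<in>grid. grid_poly_deriv B D m' w (2 *s rvec ?e) * g (?q m'))"
  using grid_poly_deriv_interpolation[OF F1(1)] by (intro sum.cong) auto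
 moreover have "grid_poly_deriv B D m w c = grid_poly_deriv B D m w ?c1 - grid_poly_deriv B D m w (2 *s rvec ?e)" for m
  unfolding c_def grid_poly_deriv_linear by simp
 ultimately show ?thesis by (simp only: left_diff_distrib sum_subtractf) simp
qed

lemma CR_on_hol_ext:
 assumes g: "smooth_on (E \<times> F) g" and pol: "!!b. b \<in> B ==> polynomial_along (E \<times> F) D (0, b) g"
  and cr: "CR_on E F \<Phi> g"
 shows "CR_on E F \<Phi>' (H g z)"
 unfolding CR_on_iff
proof (intro ballI)
 fix v p assume v: "v \<in> E" and p: "p \<in> E \<times> F"
 let ?q = "%m. p + (0, grid_point B m)"
 define w where "w = z - \<i> *s rvec (quad \<Phi> (fst p))"
 define c where "c v = (- 2 * \<i>) *s rvec (Re_vec (\<Phi> (fst p) v)) + (- 2) *s rvec (Im_vec (\<Phi> (fst p) v - \<Phi>' (fst p) v))" for v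
 have iv: "\<i> *s v \<in> E" by (rule quadratic_CR_scale[OF Q v])
 have z: "fst p \<in> E" using p by auto
 have q: "?q m \<in> E \<times> F" for m by (rule subspace_add[OF S(3) p grid_point_in(3)])
 have lf: "left_field \<Phi>' (v, 0) (H g z) p =
   (\<Sum>m\<in>grid. gpoly B D m w * left_field \<Phi> (v, 0) g (?q m)) + (\<Sum>m\<in>grid. grid_poly_deriv B D m w (c v) * g (?q m))" if "v \<in> E" for v
  unfolding w_def c_def by (rule left_field_hol_ext[OF g pol that p])
 have e1: "left_field \<Phi> (v, 0) g (?q m) + \<i> * left_field \<Phi> (\<i> *s v, 0) g (?q m) = 0" for m
  by (rule bspec[OF bspec[OF cr[unfolded CR_on_iff] v] q])
 \<comment> \<open>Paired with F1, to which Im \<Phi>' is orthogonal, \<open>c v\<close> is -2i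
   \<Phi>(v, \<zeta>). This is complex linear in v, so c(v) + i c(iv) pairs to 0.\<close>
 have e2: "grid_poly_deriv B D m w (c v) + \<i> * grid_poly_deriv B D m w (c (\<i> *s v)) = 0" for m
 proof -
  have "\<Phi> (fst p) (\<i> *s v) = cnj \<i> *s \<Phi> (fst p) v"
   by (rule herm_right(2)[OF Q v z])
  then have R: "Im_vec (\<Phi> (fst p) (\<i> *s v)) = - Re_vec (\<Phi> (fst p) v)" "Re_vec (\<Phi> (fst p) (\<i> *s v)) = Im_vec (\<Phi> (fst p) v)"
   by (simp_all only: Re_Im_vec_simps) simp_all
  have "grid_poly_deriv B D m w (c v + \<i> *s c (\<i> *s v)) = grid_poly_deriv B D m w (0 *s c v)"
  proof (rule grid_poly_deriv_cong)
   fix b assume "b \<in> B"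
   then have b: "b \<in> F1" by (rule B_in)
   show "cdot (c v + \<i> *s c (\<i> *s v)) b = cdot (0 *s c v) b"
    by (simp add: c_def cdot_simps Re_Im_vec_simps inner_diff_left perp[OF z v b] perp[OF z iv b] R algebra_simps)
  qed
  then show ?thesis by (simp only: grid_poly_deriv_linear mult_zero_left)
 qed
 have "left_field \<Phi>' (v, 0) (H g z) p + \<i> * left_field \<Phi>' (\<i> *s v, 0) (H g z) p =
   (\<Sum>m\<in>grid. gpoly B D m w * (left_field \<Phi> (v, 0) g (?q m) + \<i> * left_field \<Phi> (\<i> *s v, 0) g (?q m))) +
   (\<Sum>m\<in>grid. (grid_poly_deriv B D m w (c v) + \<i> * grid_poly_deriv B D m w (c (\<i> *s v))) * g (?q m))"
  unfolding lf[OF v] lf[OF iv] by (simp add: sum.distrib sum_distrib_left algebra_simps)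
 then show "left_field \<Phi>' (v, 0) (H g z) p + \<i> * left_field \<Phi>' (\<i> *s v, 0) (H g z) p = 0"
  by (simp only: e1 e2) simp
qed

text \<open>For z = y + i \<Phi>(\<zeta>) the argument of the Lagrange polynomials is the real point
  y, where they interpolate \<open>g\<close>; of z only the pairings with F1 enter.\<close>

lemma hol_ext_eq:
 assumes pol: "!!b. b \<in> B ==> polynomial_along (E \<times> F) D (0, b) g"
  and "\<zeta> \<in> E" "x \<in> F" "y \<in> F1"
  and z: "!!b. b \<in> B ==> cdot z b = cdot (rvec y + \<i> *s rvec (quad \<Phi> \<zeta>)) b"
 shows "H g z (\<zeta>, x) = g (\<zeta>, y + x)"
proof -
 have "H g z (\<zeta>, x) = H g (rvec y + \<i> *s rvec (quad \<Phi> \<zeta>)) (\<zeta>, x)"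
  by (rule hol_ext_cong[OF z])
 also have "\<dots> = g ((\<zeta>, x) + (0, y))"
  using polynomial_F1[OF pol, of "(\<zeta>, x)" y] assms(2-4) by (simp add: hol_ext_def)
 finally show ?thesis by (simp add: add.commute)
qed

text \<open>At every grid value of z, H is CR for \<open>\<Phi>'\<close>, and the \<open>a i\<close>
  are null directions of \<open>\<Phi>'\<close>; by \<open>CR_line\<close> it is a polynomial of
  degree at most k in each \<open>s i\<close>. All dependence on z and on the \<open>s i\<close> is
  thus moved into scalar polynomials.\<close>

lemma hol_ext_interpolation:
 fixes a :: "'n => complex ^ 'n"
 assumes g: "smooth_on (E \<times> F) g" and pol: "!!b. b \<in> B ==> polynomial_along (E \<times> F) D (0, b) g"
  and cr: "CR_on E F \<Phi> g" and sm: "!!z. smooth_on (E \<times> F) (H g z)"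
  and gr: "!!m. m \<in> grid ==> grows k (E \<times> F) (H g (rvec (grid_point B m)))"
  and a: "!!i. a i \<in> E" and null: "!!i \<zeta>. \<zeta> \<in> E ==> \<Phi>' \<zeta> (a i) = 0" and z: "\<zeta> \<in> E" and x: "x \<in> F"
 shows "H g z (\<zeta> + (\<Sum>i\<in>UNIV. s i *s a i), x) = (\<Sum>(m, l)\<in>grid \<times> (UNIV \<rightarrow>\<^sub>E {..k}).
  (gpoly B D m z * (\<Prod>i\<in>UNIV. poly (lag k (l i)) (s i))) *
  H g (rvec (grid_point B m)) (\<zeta> + (\<Sum>i\<in>UNIV. of_nat (l i) *s a i), x))"
proof -
 let ?\<sigma> = "%i t. t *s a i"
 have "H g (rvec (grid_point B m)) (\<zeta> + (\<Sum>i\<in>UNIV. s i *s a i), x) = (\<Sum>l\<in>UNIV \<rightarrow>\<^sub>E {..k}.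
  (\<Prod>i\<in>UNIV. poly (lag k (l i)) (s i)) * H g (rvec (grid_point B m)) (\<zeta> + (\<Sum>i\<in>UNIV. of_nat (l i) *s a i), x))"
  if m: "m \<in> grid" for m
 proof (rule multi_interpolation[where f = "%\<zeta>. H g (rvec (grid_point B m)) (\<zeta>, x)" and \<sigma> = ?\<sigma> and C = E and T = UNIV])
  fix \<eta> i t assume "\<eta> \<in> E"
  then show "\<eta> + ?\<sigma> i t \<in> E" by (intro subspace_add S quadratic_CR_scale[OF Q] a)
  show "H g (rvec (grid_point B m)) (\<eta> + ?\<sigma> i t, x) =
   (\<Sum>l\<le>k. poly (lag k l) t * H g (rvec (grid_point B m)) (\<eta> + ?\<sigma> i (of_nat l), x))"
   by (rule CR_line[OF Q' sm CR_on_hol_ext[OF g pol cr] gr[OF m] a null \<open>\<eta> \<in> E\<close> x])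
 qed (use z in auto)
 then show ?thesis
  by (subst hol_ext_expand) (simp add: sum.cartesian_product[symmetric] sum_distrib_left mult.assoc)
qed

end

section \<open>The spaces of CR functions and of CR polynomial mappings\<close>

lemma one_plus_le_square: "1 + r \<le> 2 * (1 + r\<^sup>2)" for r :: real
proof -
 have "0 \<le> (2 * r - 1)\<^sup>2" by simp
 then have "4 * r \<le> 4 * r\<^sup>2 + 1" by (simp add: power2_diff power_mult_distrib)
 moreover have "0 \<le> r\<^sup>2" by simp
 ultimately show ?thesis unfolding distrib_left by linarith
qed

lemma tempered_on_grows:
 assumes "continuous_on V f" "grows k V f"
 shows "tempered_on V f"
proof -
 obtain C where C: "C \<ge> 0" "!!p. p \<in> V ==> norm (f p) \<le> C * (1 + norm p) ^ k" using growsE[OF assms(2)] by blast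
 have "norm (f p) \<le> (C * 2 ^ k) * (jap p) ^ k" if "p \<in> V" for p
 proof -
  have "(1 + norm p) ^ k \<le> (2 * (jap p)) ^ k" by (intro power_mono one_plus_le_square) auto
  then have "C * (1 + norm p) ^ k \<le> C * (2 * (jap p)) ^ k" by (intro mult_left_mono C)
  then show ?thesis using C(2)[OF that] by (simp only: power_mult_distrib mult.assoc)
 qed
 then show ?thesis using assms(1) by (auto simp: tempered_on_def)
qed

lemma slow_grows: "slow E F \<Phi> f ==> \<exists>k. grows k (E \<times> F) f"
 by (auto simp: slow_def intro: moderate_grows)

lemma slow_tempered: "slow E F \<Phi> f ==> tempered_on (E \<times> F) f"
 using slow_grows smooth_continuous[OF slow_smooth] tempered_on_grows by blast

lemma CR_space_iff:
 assumes Q: "qCR E F \<Phi>"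
 shows "g \<in> CR_space E F \<Phi> K \<longleftrightarrow> (\<forall>p. p \<notin> E \<times> F \<longrightarrow> g p = 0) \<and> tame E F \<Phi> g \<and>
  (\<forall>\<zeta>\<in>E. spectrum_in F K (%x. g (\<zeta>, x)))"
proof -
 note S = CR_subspaces[OF Q]
 have "smooth_on (E \<times> F) g \<and> (\<exists>k::nat. \<forall>X\<in>left_invariant_ops E F \<Phi>.
   bounded ((%p. X g p /\<^sub>R (1 + norm p) ^ k) ` (E \<times> F))) \<longleftrightarrow> slow E F \<Phi> g"
  unfolding slow_def moderate_def grows_iff_bounded by blast
 moreover have "slow E F \<Phi> g ==>
  dist_supported_in (E \<times> F) (dist_partial_fourier F (distribution_of (E \<times> F) g)) (E \<times> K) \<longleftrightarrow>
  (\<forall>\<zeta>\<in>E. spectrum_in F K (%x. g (\<zeta>, x)))"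
  by (rule dist_supported_in_iff_fibres[OF S(1,2) slow_tempered])
 ultimately show ?thesis unfolding CR_space_def tame_def mem_Collect_eq by argo
qed

text \<open>The degree bound of \<open>spectrum_in_line\<close> depends only on the growth exponent,
  so it is the same for all fibres although the constant in the estimate varies with
  \<zeta>.\<close>

lemma polynomial_along_spectrum:
 fixes g :: "('n::finite, 'm::finite) point => complex"
 assumes Q: "qCR E F \<Phi>" and g: "slow E F \<Phi> g" "!!\<zeta>. \<zeta> \<in> E ==> spectrum_in F K (%x. g (\<zeta>, x))"
 shows "\<exists>D. \<forall>y\<in>F. (\<forall>l\<in>K. l \<bullet> y = 0) \<longrightarrow> polynomial_along (E \<times> F) D (0, y) g"
proof -
 note S = CR_subspaces[OF Q]
 obtain k where "grows k (E \<times> F) g" using slow_grows[OF g(1)] by blast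
 then obtain C where C: "C \<ge> 0" "!!p. p \<in> E \<times> F ==> norm (g p) \<le> C * (1 + norm p) ^ k" using growsE by blast
 define D where "D = 2 * (k + DIM(real ^ 'm))"
 have "polynomial_along (E \<times> F) D (0, y) g" if y: "y \<in> F" and Ky: "\<forall>l\<in>K. l \<bullet> y = 0" for y
  unfolding polynomial_along_def
 proof (intro ballI allI)
  fix p and t :: real assume p: "p \<in> E \<times> F"
  obtain \<zeta> x where zx: "p = (\<zeta>, x)" "\<zeta> \<in> E" "x \<in> F" using p by auto
  let ?A = "C * (2 * (1 + norm \<zeta>)) ^ k"
  have A: "norm (g (\<zeta>, x)) \<le> ?A * (jap x) ^ k" if "x \<in> F" for x
  proof -
   have "norm (\<zeta>, x) \<le> norm \<zeta> + norm x" by (rule norm_Pair_le)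
   moreover have "1 + norm \<zeta> + norm x \<le> (1 + norm \<zeta>) * (1 + norm x)" by (simp add: algebra_simps)
   moreover have "(1 + norm \<zeta>) * (1 + norm x) \<le> (1 + norm \<zeta>) * (2 * (jap x))"
    by (intro mult_left_mono one_plus_le_square) simp
   moreover have "(1 + norm \<zeta>) * (2 * (jap x)) = 2 * (1 + norm \<zeta>) * (jap x)" by (simp only: mult_ac)
   ultimately have "1 + norm (\<zeta>, x) \<le> 2 * (1 + norm \<zeta>) * (jap x)" by linarith
   then have "(1 + norm (\<zeta>, x)) ^ k \<le> (2 * (1 + norm \<zeta>) * (jap x)) ^ k" by (intro power_mono) auto
   then have "C * (1 + norm (\<zeta>, x)) ^ k \<le> C * (2 * (1 + norm \<zeta>) * (jap x)) ^ k" by (intro mult_left_mono C)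
   then show ?thesis using C(2)[of "(\<zeta>, x)"] zx(2) that by (simp add: power_mult_distrib mult.assoc)
  qed
  \<comment> \<open>There are D + 2 points: the nodes 0, ..., D with their Lagrange values at t, and
    t itself with coefficient -1.\<close>
  define c where "c j = (if j \<le> D then poly (lag D j) (of_real t) else - 1)" for j
  define s where "s j = (if j \<le> D then real j else t)" for j
  have split: "(\<Sum>j\<le>Suc D. c j * h (s j)) = (\<Sum>j\<le>D. poly (lag D j) (of_real t) * h (real j)) - h t" for h
   by (simp add: c_def s_def)
  have "(\<Sum>j\<le>Suc D. c j * g (\<zeta>, x + s j *\<^sub>R y)) = 0"
  proof (rule spectrum_in_line[OF S(2) g(2)[OF zx(2)] y _ _ A _ _ zx(3)])
   show "(\<Sum>j\<le>Suc D. c j * cplx (s j) ^ i) = 0" if "i \<le> 2 * (k + DIM(real ^ 'm))" for i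
    using split[of "%t. cplx t ^ i"] lagrange_moment[of i D "of_real t"] that by (simp add: D_def)
  qed (use Ky C in auto)
  then have "(\<Sum>j\<le>D. poly (lag D j) (of_real t) * g (\<zeta>, x + real j *\<^sub>R y)) - g (\<zeta>, x + t *\<^sub>R y) = 0"
   unfolding split[of "%t. g (\<zeta>, x + t *\<^sub>R y)"] .
  then show "g (p + t *\<^sub>R (0, y)) = (\<Sum>l\<le>D. poly (lag D l) (of_real t) * g (p + real l *\<^sub>R (0, y)))"
   by (simp add: zx)
 qed
 then show ?thesis by blast
qed

section \<open>Polynomial mappings with values in a function space\<close>

definition fun_closed :: "('a => complex) set => bool" where
 "fun_closed W \<longleftrightarrow> (%q. 0) \<in> W \<and> (\<forall>u\<in>W. \<forall>v\<in>W. (%q. u q + v q) \<in> W) \<and> (\<forall>c. \<forall>u\<in>W. (%q. c * u q) \<in> W)"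

lemma fun_closed_cmult: "fun_closed W ==> u \<in> W ==> (%q. c * u q) \<in> W"
 by (simp add: fun_closed_def)

lemma fun_closed_sum: "fun_closed W ==> (!!i. i \<in> I ==> u i \<in> W) ==> (%q. \<Sum>i\<in>I. u i q) \<in> W"
 by (induction I rule: infinite_finite_induct) (auto simp: fun_closed_def)

lemma CR_space_closed:
 assumes Q: "qCR E F \<Phi>" shows "fun_closed (CR_space E F \<Phi> K)"
 unfolding fun_closed_def
 by (auto simp: CR_space_iff[OF Q] intro!: tame_add tame_mult tame_const spectrum_in_zero spectrum_in_add spectrum_in_cmult Q CR_subspaces(2)[OF Q])

text \<open>\<open>poly_map\<close> numbers its summands; the interpolation sums run over arbitrary
  finite sets, which are enumerated here once and for all.\<close>

lemma poly_map_sumI: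
 assumes "!!z. z \<notin> C ==> P z = (%q. 0)" and J: "finite J" and "!!j. j \<in> J ==> R (p j)" "!!j. j \<in> J ==> w j \<in> W"
  and "!!z q. z \<in> C ==> P z q = (\<Sum>j\<in>J. p j z * w j q)"
 shows "poly_map R C W P"
proof -
 obtain h where h: "bij_betw h {0..<card J} J" using ex_bij_betw_nat_finite[OF J] by blast
 have hJ: "h j \<in> J" if "j < card J" for j using h that by (auto simp: bij_betw_def)
 have "P z = (%q. \<Sum>j<card J. p (h j) z * w (h j) q)" if "z \<in> C" for z
 proof
  fix q
  have "P z q = (\<Sum>j\<in>J. p j z * w j q)" by (rule assms(5)[OF that])
  also have "\<dots> = (\<Sum>j\<in>{0..<card J}. p (h j) z * w (h j) q)" by (rule sum.reindex_bij_betw[OF h, symmetric])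
  finally show "P z q = (\<Sum>j<card J. p (h j) z * w (h j) q)" by (simp add: atLeast0LessThan)
 qed
 then show ?thesis unfolding poly_map_def using assms(1,3,4) hJ
  by (intro conjI exI[of _ "card J"] exI[of _ "%j. p (h j)"] exI[of _ "%j. w (h j)"]) auto
qed

lemma poly_mapE:
 assumes "poly_map R C W P"
 obtains N :: nat and p w where "!!j. j < N ==> R (p j)" "!!j. j < N ==> w j \<in> W"
  "!!z. z \<in> C ==> P z = (%q. \<Sum>j<N. p j z * w j q)" "!!z. z \<notin> C ==> P z = (%q. 0)"
 using assms unfolding poly_map_def by blast

lemma poly_map_add:
 assumes "poly_map R C W P" "poly_map R C W P'"
 shows "poly_map R C W (%z q. P z q + P' z q)"
proof -
 obtain N :: nat and p w where P: "!!j. j < N ==> R (p j)" "!!j. j < N ==> w j \<in> W"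
  "!!z. z \<in> C ==> P z = (%q. \<Sum>j<N. p j z * w j q)" "!!z. z \<notin> C ==> P z = (%q. 0)"
  using poly_mapE[OF assms(1)] by blast
 obtain N' :: nat and p' w' where P': "!!j. j < N' ==> R (p' j)" "!!j. j < N' ==> w' j \<in> W"
  "!!z. z \<in> C ==> P' z = (%q. \<Sum>j<N'. p' j z * w' j q)" "!!z. z \<notin> C ==> P' z = (%q. 0)"
  using poly_mapE[OF assms(2)] by blast
 show ?thesis
  by (rule poly_map_sumI[where J = "{..<N} <+> {..<N'}" and p = "case_sum p p'" and w = "case_sum w w'"])
   (auto simp: P P' sum.Plus)
qed

lemma poly_map_cmult:
 assumes W: "fun_closed W" and "poly_map R C W P"
 shows "poly_map R C W (%z q. c * P z q)"
proof -
 obtain N :: nat and p w where P: "!!j. j < N ==> R (p j)" "!!j. j < N ==> w j \<in> W"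
  "!!z. z \<in> C ==> P z = (%q. \<Sum>j<N. p j z * w j q)" "!!z. z \<notin> C ==> P z = (%q. 0)"
  using poly_mapE[OF assms(2)] by blast
 show ?thesis
  by (rule poly_map_sumI[where J = "{..<N}" and p = p and w = "%j q. c * w j q"])
   (auto simp: P sum_distrib_left mult_ac intro: fun_closed_cmult[OF W])
qed

lemma poly_map_value:
 assumes W: "fun_closed W" and "poly_map R C W P" shows "P z \<in> W"
proof -
 obtain N :: nat and p w where "!!j. j < N ==> R (p j)" and P: "!!j. j < N ==> w j \<in> W"
  "!!z. z \<in> C ==> P z = (%q. \<Sum>j<N. p j z * w j q)" "!!z. z \<notin> C ==> P z = (%q. 0)"
  using poly_mapE[OF assms(2)] by blast
 show ?thesis
 proof (cases "z \<in> C")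
  case True
  show ?thesis unfolding P(2)[OF True] by (intro fun_closed_sum[OF W] fun_closed_cmult[OF W] P(1)) auto
 next
  case False
  then show ?thesis using W by (simp add: P(3) fun_closed_def)
 qed
qed

text \<open>The level \<open>h\<close> may vary with \<zeta> and q. It is \<Phi>(\<zeta>) where
  extensions of one CR polynomial are compared; for injectivity of \<open>iota\<close> it also
  involves the E2 component of q.\<close>

lemma poly_map_holomorphic_unique:
 fixes Q Q' :: "(complex ^ 'n::finite) \<times> (complex ^ 'm::finite) => 'b => complex"
 assumes W: "fun_closed W" "!!w q. w \<in> W ==> q \<notin> N ==> w q = 0" and F: "subspace F"
  and Q: "poly_map hpoly (E \<times> complexification F) W Q"
   "poly_map hpoly (E \<times> complexification F) W Q'"
  and eq: "!!\<zeta> q. \<zeta> \<in> E ==> q \<in> N ==> \<exists>h\<in>F. \<forall>x\<in>F. Q (\<zeta>, rvec x + \<i> *s rvec h) q = Q' (\<zeta>, rvec x + \<i> *s rvec h) q"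
 shows "Q = Q'"
proof (intro ext)
 fix pt :: "(complex ^ 'n) \<times> (complex ^ 'm)" and q
 let ?C = "E \<times> complexification F"
 obtain \<zeta> z where pt: "pt = (\<zeta>, z)" by (cases pt)
 have neg: "poly_map hpoly ?C W (%z q. Q z q + (- 1) * Q' z q)"
  by (intro poly_map_add Q poly_map_cmult[OF W(1)])
 obtain n :: nat and p w where P: "!!j. j < n ==> hpoly (p j)"
  "!!z. z \<in> ?C ==> (%q. Q z q + (- 1) * Q' z q) = (%q. \<Sum>j<n. p j z * w j q)"
  by (rule poly_mapE[OF neg]) (rule that)
 have d: "Q pt q + (- 1) * Q' pt q = 0"
 proof (cases "pt \<in> ?C \<and> q \<in> N")
  case True
  obtain h where h: "h \<in> F" "!!x. x \<in> F ==> Q (\<zeta>, rvec x + \<i> *s rvec h) q = Q' (\<zeta>, rvec x + \<i> *s rvec h) q"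
   using eq[of \<zeta> q] True pt by auto
  let ?f = "%pt. \<Sum>j<n. p j pt * w j q"
  have f: "Q z q + (- 1) * Q' z q = ?f z" if "z \<in> ?C" for z using fun_cong[OF P(2)[OF that]] .
  have "?f (\<zeta>, z) = 0"
  proof (rule holomorphic_polynomial_unique[OF _ F h(1)])
   show "hpoly ?f"
    by (intro holomorphic_polynomial_sum holomorphic_polynomial.mult holomorphic_polynomial.const P(1)) auto
   fix x assume x: "x \<in> F"
   have "(\<zeta>, rvec x + \<i> *s rvec h) \<in> ?C" using True x h(1) pt by (simp add: complexification_parts Re_Im_vec_simps)
   from f[OF this] h(2)[OF x] show "?f (\<zeta>, rvec x + \<i> *s rvec h) = 0" by simp
  qed (use True pt in auto)
  then show ?thesis using f True pt by simp
 next
  case False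
  then consider "pt \<notin> ?C" | "q \<notin> N" by blast
  then show ?thesis
  proof cases
   case 1
   have "Q pt = (%q. 0)" "Q' pt = (%q. 0)"
    by (rule Q(1)[unfolded poly_map_def, THEN conjunct1, rule_format, OF 1] Q(2)[unfolded poly_map_def, THEN conjunct1, rule_format, OF 1])+
   then show ?thesis by simp
  next
   case 2
   show ?thesis using W(2)[OF poly_map_value[OF W(1) neg] 2] .
  qed
 qed
 then show "Q pt q = Q' pt q" by simp
qed

text \<open>The \<open>a i\<close> are the images of the standard basis under a projection onto E.
  They generate E and need not be independent, but the coefficients are the ambient coordinates of
  \<zeta>, hence holomorphic polynomials.\<close>

lemma complex_subspace_generators:
 fixes E :: "(complex ^ 'n::finite) set"
 assumes "vec.subspace E"
 obtains a :: "'n => complex ^ 'n" where "!!i. a i \<in> E" "!!\<zeta>. \<zeta> \<in> E ==> (\<Sum>i\<in>UNIV. \<zeta> $ i *s a i) = \<zeta>"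
proof -
 have "Vector_Spaces.linear (*s) (*s) (%x :: complex ^ 'n. x)" by (rule vec.linear_ident)
 from vec.linear_exists_left_inverse_on[OF this assms]
 obtain g :: "complex ^ 'n => complex ^ 'n" where g: "range g \<subseteq> E" "Vector_Spaces.linear (*s) (*s) g" "\<forall>v\<in>E. g v = v"
  by (auto simp: inj_on_def)
 interpret g: Vector_Spaces.linear "(*s)" "(*s)" g by (rule g(2))
 have "(\<Sum>i\<in>UNIV. \<zeta> $ i *s g (axis i 1)) = \<zeta>" if "\<zeta> \<in> E" for \<zeta>
 proof -
  have "(\<Sum>i\<in>UNIV. \<zeta> $ i *s g (axis i 1)) = g (\<Sum>i\<in>UNIV. \<zeta> $ i *s axis i 1)" by (simp add: g.sum g.scale)
  then show ?thesis using g(3) that by (simp add: basis_expansion)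
 qed
 then show thesis using that[of "%i. g (axis i 1)"] g(1) by auto
qed

lemma grows_uniform:
 assumes "finite A" "!!a. a \<in> A ==> \<exists>k. grows k V (f a)"
 shows "\<exists>k. \<forall>a\<in>A. grows k V (f a)"
proof -
 obtain k where k: "!!a. a \<in> A ==> grows (k a) V (f a)" using assms(2) by metis
 have "grows (Max (k ` A)) V (f a)" if "a \<in> A" for a
  by (rule grows_mono[OF k[OF that]]) (use assms(1) that in auto)
 then show ?thesis by blast
qed

lemma grows_sum: "(!!i. i \<in> I ==> grows k V (f i)) ==> grows k V (%p. \<Sum>i\<in>I. f i p)"
 by (induction I rule: infinite_finite_induct) (auto intro: grows_add grows_const)

text \<open>With F1 = F and the zero map as second structure, every direction of E is null, so H is
  polynomial along all of E as well as in z. Its coefficients are combinations of the vectors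
  \<open>w j\<close>, which keeps them in W.\<close>

lemma holomorphic_extension_exists:
 fixes \<Phi> :: "('n::finite, 'm::finite) herm"
 assumes Q: "qCR E F \<Phi>" and W: "fun_closed W" and P: "P \<in> Pol_CR E F \<Phi> W"
 shows "\<exists>Q. poly_map hpoly (E \<times> complexification F) W Q \<and>
  (\<forall>\<zeta>\<in>E. \<forall>x\<in>F. Q (\<zeta>, rvec x + \<i> *s rvec (quad \<Phi> \<zeta>)) = P (\<zeta>, x))"
proof -
 note S = CR_subspaces[OF Q]
 obtain N :: nat and p w where p: "!!j. j < N ==> polynomial_function (p j)" and w: "!!j. j < N ==> w j \<in> W"
  and Pz: "!!z. z \<in> E \<times> F ==> P z = (%q. \<Sum>j<N. p j z * w j q)"
  using P unfolding Pol_CR_def by (elim CollectE conjE poly_mapE) blast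
 have "\<exists>D. \<forall>x y. \<exists>r. degree r \<le> D \<and> (\<forall>t. p j (x + t *\<^sub>R y) = poly r (of_real t))" if "j < N" for j
  by (rule polynomial_function_line[OF p[OF that]])
 then obtain d where d: "!!j x y. j < N ==> \<exists>r. degree r \<le> d j \<and> (\<forall>t. p j (x + t *\<^sub>R y) = poly r (of_real t))" by metis
 define D where "D = Max (d ` {..<N})"
 have pj: "p j (x + t *\<^sub>R y) = (\<Sum>l\<le>D. poly (lag D l) (of_real t) * p j (x + real l *\<^sub>R y))" if j: "j < N" for j x y t
 proof -
  obtain r where r: "degree r \<le> d j" "!!t. p j (x + t *\<^sub>R y) = poly r (of_real t)" using d[OF j] by blast
  have "degree r \<le> D" using r(1) j unfolding D_def by (meson Max_ge finite_imageI finite_lessThan imageI lessThan_iff order_trans)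
  from lagrange_interpolation[OF this, of "of_real t"] show ?thesis by (simp add: r(2))
 qed
 have Q0: "qCR E F (%_ _. 0)"
  using Q S(2) by (auto simp: quadratic_CR_def hermitian_map_def complexification_parts Re_vec_def Im_vec_def cnj_vec_def vec_eq_iff zero_vec_def[symmetric] subspace_0)
 interpret CR_change E F \<Phi> "%_ _. 0" F D
  by unfold_locales (use Q Q0 S hermD(1)[OF Q] in \<open>auto simp: Im_vec_def zero_vec_def[symmetric]\<close>)
 define f where "f q z = (\<Sum>j<N. p j z * w j q)" for q z
 have pol: "polynomial_along (E \<times> F) D (0, b) (f q)" for b q
  unfolding polynomial_along_def f_def
 proof (intro ballI allI)
  fix x and t :: real
  have "(\<Sum>j<N. p j (x + t *\<^sub>R (0, b)) * w j q) = (\<Sum>j<N. \<Sum>l\<le>D. poly (lag D l) (of_real t) * (p j (x + real l *\<^sub>R (0, b)) * w j q))"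
   by (intro sum.cong refl, subst pj) (auto simp: sum_distrib_right mult.assoc)
  also have "\<dots> = (\<Sum>l\<le>D. poly (lag D l) (of_real t) * (\<Sum>j<N. p j (x + real l *\<^sub>R (0, b)) * w j q))"
   by (subst sum.swap) (simp add: sum_distrib_left)
  finally show "(\<Sum>j<N. p j (x + t *\<^sub>R (0, b)) * w j q) = (\<Sum>l\<le>D. poly (lag D l) (of_real t) * (\<Sum>j<N. p j (x + real l *\<^sub>R (0, b)) * w j q))" .
 qed
 have sp: "slow E F \<Psi> (p j)" if "qCR E F \<Psi>" "j < N" for \<Psi> j
  by (rule slow_polynomial_function[OF that(1) p[OF that(2)]])
 have sf: "slow E F \<Psi> (f q)" if "qCR E F \<Psi>" for \<Psi> q
  unfolding f_def[abs_def] by (intro slow_sum slow_mult slow_const sp that) auto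
 have cr: "CR_on E F \<Phi> (f q)" for q
  using P CR_on_cong[OF Q, of "%z. P z q" "f q"] by (simp add: Pol_CR_def Pz f_def)
 \<comment> \<open>The exponent must not depend on q; it is therefore taken from the scalar
   polynomials \<open>p j\<close>.\<close>
 have "\<exists>k. \<forall>(j, m)\<in>{..<N} \<times> grid. grows k (E \<times> F) (H (p j) (rvec (grid_point B m)))"
  unfolding case_prod_unfold
  by (rule grows_uniform) (auto intro!: finite_PiE finB slow_grows[OF slow_hol_ext[OF sp[OF Q0]]])
 then obtain k where k: "!!j m. j < N ==> m \<in> grid ==> grows k (E \<times> F) (H (p j) (rvec (grid_point B m)))" by auto
 have Hf: "H (f q) z = (%x. \<Sum>j<N. H (p j) z x * w j q)" for q z
  unfolding f_def[abs_def] by (rule ext) (rule hol_ext_sum)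
 have gr: "grows k (E \<times> F) (H (f q) (rvec (grid_point B m)))" if "m \<in> grid" for q m
  unfolding Hf by (intro grows_sum) (use grows_mult[OF k[OF _ that] grows_const[of 0]] in auto)
 have "vec.subspace E" using Q by (simp add: quadratic_CR_def)
 then obtain a :: "'n => complex ^ 'n" where a: "!!i. a i \<in> E" "!!\<zeta>. \<zeta> \<in> E ==> (\<Sum>i\<in>UNIV. \<zeta> $ i *s a i) = \<zeta>"
  using complex_subspace_generators by blast
 let ?I = "grid \<times> ((UNIV :: 'n set) \<rightarrow>\<^sub>E {..k})"
 let ?p = "%(m, l) (z :: (complex ^ 'n) \<times> (complex ^ 'm)). gpoly B D m (snd z) * (\<Prod>i\<in>UNIV. poly (lag k (l i)) (fst z $ i))"
 let ?w = "%(m, l) q. H (f q) (rvec (grid_point B m)) (0 + (\<Sum>i\<in>UNIV. of_nat (l i) *s a i), 0)"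
 have z0: "0 \<in> E" "0 \<in> F" using S by (auto intro: subspace_0)
 have key: "H (f q) z (\<zeta>, 0) = (\<Sum>j\<in>?I. ?p j (\<zeta>, z) * ?w j q)" if "\<zeta> \<in> E" for \<zeta> z q
  using hol_ext_interpolation[OF slow_smooth[OF sf[OF Q]] pol cr slow_smooth[OF slow_hol_ext[OF sf[OF Q0]]] gr a(1) refl z0, of q z "%i. \<zeta> $ i" "%i. i"] a(2)[OF that]
  by (simp add: case_prod_unfold)
 \<comment> \<open>All of F has been absorbed into z, so the remaining real variable is fixed at
   0.\<close>
 define Qx where "Qx z q = (if z \<in> E \<times> complexification F then H (f q) (snd z) (fst z, 0) else 0)" for z q
 have wW: "?w j \<in> W" if "j \<in> ?I" for j
  unfolding case_prod_unfold hol_ext_def f_def by (intro fun_closed_sum[OF W] fun_closed_cmult[OF W] w) auto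
 have hp: "hpoly (?p j)" for j
  unfolding case_prod_unfold
  by (intro holomorphic_polynomial.mult holomorphic_polynomial_grid_poly holomorphic_polynomial_prod
   holomorphic_polynomial_poly holomorphic_polynomial.coord1)
 have "poly_map hpoly (E \<times> complexification F) W Qx"
 proof (rule poly_map_sumI[where J = ?I and p = ?p and w = ?w])
  show "finite ?I" by (intro finite_cartesian_product finite_PiE finB) auto
  show "Qx z q = (\<Sum>j\<in>?I. ?p j z * ?w j q)" if "z \<in> E \<times> complexification F" for z q
   using key[of "fst z" q "snd z"] that by (auto simp: Qx_def)
 qed (use wW hp in \<open>auto simp: Qx_def fun_eq_iff\<close>)
 moreover have "Qx (\<zeta>, rvec x + \<i> *s rvec (quad \<Phi> \<zeta>)) = P (\<zeta>, x)" if "\<zeta> \<in> E" "x \<in> F" for \<zeta> x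
 proof
  fix q
  have "quad \<Phi> \<zeta> \<in> F" using hermD(1)[OF Q that(1) that(1)] by (simp add: quad_def complexification_parts)
  then have "(\<zeta>, rvec x + \<i> *s rvec (quad \<Phi> \<zeta>)) \<in> E \<times> complexification F"
   using that by (simp add: complexification_parts Re_Im_vec_simps)
  then show "Qx (\<zeta>, rvec x + \<i> *s rvec (quad \<Phi> \<zeta>)) q = P (\<zeta>, x) q"
   using hol_ext_eq[OF pol that(1) z0(2) that(2) refl, of q] that by (simp add: Qx_def Pz f_def)
 qed
 ultimately show ?thesis by blast
qed

text \<open>Existence together with uniqueness at the level \<Phi>(\<zeta>) justifies the definite
  description; the third part serves to compute the extension of a given P.\<close>

lemma holomorphic_extension:
 fixes \<Phi> :: "('n::finite, 'm::finite) herm" and P :: "('n, 'm) point => 'b => complex"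
 assumes Q: "qCR E F \<Phi>" and W: "fun_closed W" and P: "P \<in> Pol_CR E F \<Phi> W"
 defines "Q \<equiv> holomorphic_extension E F \<Phi> W P"
 shows "poly_map hpoly (E \<times> complexification F) W Q"
  "!!\<zeta> x. \<zeta> \<in> E ==> x \<in> F ==> Q (\<zeta>, rvec x + \<i> *s rvec (quad \<Phi> \<zeta>)) = P (\<zeta>, x)"
  "!!Q'. poly_map hpoly (E \<times> complexification F) W Q' ==>
   (!!\<zeta> x. \<zeta> \<in> E ==> x \<in> F ==> Q' (\<zeta>, rvec x + \<i> *s rvec (quad \<Phi> \<zeta>)) = P (\<zeta>, x)) ==> Q = Q'"
proof -
 let ?P = "%Q. poly_map hpoly (E \<times> complexification F) W Q \<and>
    (\<forall>\<zeta>\<in>E. \<forall>x\<in>F. Q (\<zeta>, rvec x + \<i> *s rvec (quad \<Phi> \<zeta>)) = P (\<zeta>, x))"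
 have quad: "quad \<Phi> \<zeta> \<in> F" if "\<zeta> \<in> E" for \<zeta>
  using hermD(1)[OF Q that that] by (simp add: quad_def complexification_parts)
 have uniq: "Q1 = Q2" if "?P Q1" "?P Q2" for Q1 Q2
  by (rule poly_map_holomorphic_unique[OF W, where N = UNIV and F = F and E = E])
   (use that quad CR_subspaces(2)[OF Q] in \<open>auto intro!: bexI[of _ "quad \<Phi> _"]\<close>)
 obtain Q0 where Q0: "?P Q0" using holomorphic_extension_exists[OF Q W P] by blast
 have "?P Q" unfolding Q_def holomorphic_extension_def
  by (rule theI[of ?P, OF Q0]) (rule uniq[OF _ Q0])
 then show "poly_map hpoly (E \<times> complexification F) W Q"
  "!!\<zeta> x. \<zeta> \<in> E ==> x \<in> F ==> Q (\<zeta>, rvec x + \<i> *s rvec (quad \<Phi> \<zeta>)) = P (\<zeta>, x)" by auto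
 show "Q = Q'" if "poly_map hpoly (E \<times> complexification F) W Q'"
   "!!\<zeta> x. \<zeta> \<in> E ==> x \<in> F ==> Q' (\<zeta>, rvec x + \<i> *s rvec (quad \<Phi> \<zeta>)) = P (\<zeta>, x)" for Q'
  by (rule uniq[OF \<open>?P Q\<close>]) (use that in auto)
qed

section \<open>The isomorphism\<close>

lemma complexification_closed:
 assumes "subspace F"
 shows "0 \<in> complexification F" "z \<in> complexification F ==> w \<in> complexification F ==> z + w \<in> complexification F"
  "z \<in> complexification F ==> w \<in> complexification F ==> z - w \<in> complexification F"
  "z \<in> complexification F ==> c *s z \<in> complexification F" "z \<in> complexification F ==> cnj_vec z \<in> complexification F"
proof -
 have z: "Re_vec 0 = 0" "Im_vec 0 = 0" by (simp_all add: Re_vec_def Im_vec_def vec_eq_iff)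
 note s = subspace_0[OF assms] subspace_add[OF assms] subspace_diff[OF assms] subspace_scale[OF assms] subspace_neg[OF assms]
 show "0 \<in> complexification F" by (simp add: complexification_parts z s)
 show "z + w \<in> complexification F" "z - w \<in> complexification F" if "z \<in> complexification F" "w \<in> complexification F"
  using that by (simp_all add: complexification_parts Re_Im_vec_simps s)
 show "c *s z \<in> complexification F" "cnj_vec z \<in> complexification F" if "z \<in> complexification F"
  using that by (simp_all add: complexification_parts Re_Im_vec_simps cnj_vec_simps s)
qed

lemma inner_complex_sum: "u \<bullet> a = Re (\<Sum>i\<in>UNIV. u $ i * cnj (a $ i))" for u a :: "complex ^ 'n::finite"
 by (simp add: inner_vec_def inner_complex_def)

lemma polynomial_function_complex_mult:
 fixes f g :: "'a::real_normed_vector => complex"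
 assumes "polynomial_function f" "polynomial_function g"
 shows "polynomial_function (%x. f x * g x)"
proof -
 have "real_polynomial_function (%x. Re (f x))" "real_polynomial_function (%x. Im (f x))"
  "real_polynomial_function (%x. Re (g x))" "real_polynomial_function (%x. Im (g x))"
  using assms bounded_linear_Re bounded_linear_Im by (auto simp: polynomial_function_def o_def)
 then show ?thesis unfolding polynomial_function_iff_Basis_inner
  by (auto simp: Basis_complex_def intro!: real_polynomial_function_diff real_polynomial_function.intros(3,4))
qed

text \<open>The quadratic map agrees on E with a polynomial on the ambient space, so the
  substitution yields polynomial functions.\<close>

lemma polynomial_of_holomorphic:
 fixes \<Phi> :: "('n::finite, 'm::finite) herm"
 assumes Q: "qCR E F \<Phi>" and "hpoly h"
 shows "\<exists>r. polynomial_function r \<and> (\<forall>\<zeta>\<in>E. \<forall>x. r (\<zeta>, x) = h (\<zeta>, rvec x + \<i> *s rvec (quad \<Phi> \<zeta>)))"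
 using assms(2)
proof induction
 case (const c)
 show ?case by (rule exI[of _ "%_. c"]) (simp add: polynomial_function_const)
next
 case (coord1 i)
 have "bounded_linear (%p :: ('n, 'm) point. fst p $ i)"
  by (rule bounded_linear_compose[OF bounded_linear_vec_nth bounded_linear_fst])
 then show ?case by (intro exI[of _ "%p. fst p $ i"]) (simp add: polynomial_function_bounded_linear)
next
 case (coord2 j)
 obtain r where r: "real_polynomial_function r" "!!\<zeta>. \<zeta> \<in> E ==> r \<zeta> = quad \<Phi> \<zeta> \<bullet> axis j 1"
  using polynomial_quad[OF Q, of "axis j 1"] by blast
 have "polynomial_function (%p :: ('n, 'm) point. cplx (snd p $ j))"
  by (rule polynomial_function_bounded_linear[OF bounded_linear_compose[OF bounded_linear_of_real
   bounded_linear_compose[OF bounded_linear_vec_nth bounded_linear_snd]]])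
 moreover have "polynomial_function (%p :: ('n, 'm) point. \<i> * cplx (r (fst p)))"
 proof -
  have "polynomial_function (r \<circ> (fst :: ('n, 'm) point => _))"
   using r(1) by (intro polynomial_function_compose[OF polynomial_function_bounded_linear[OF bounded_linear_fst]])
    (simp add: real_polynomial_function_eq)
  then have "polynomial_function ((%t. \<i> * cplx t) \<circ> (r \<circ> (fst :: ('n, 'm) point => _)))"
   by (rule polynomial_function_compose[OF _ polynomial_function_bounded_linear[OF bounded_linear_const_mult[OF bounded_linear_of_real]]])
  then show ?thesis by (simp add: o_def)
 qed
 ultimately have "polynomial_function (%p :: ('n, 'm) point. cplx (snd p $ j) + \<i> * cplx (r (fst p)))"
  by (rule polynomial_function_add)
 then show ?case
  by (intro exI[of _ "%p. cplx (snd p $ j) + \<i> * cplx (r (fst p))"])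
   (simp add: r(2) inner_axis of_real_vec_def)
next
 case (add p q)
 then obtain r r' where "polynomial_function r" "\<forall>\<zeta>\<in>E. \<forall>x. r (\<zeta>, x) = p (\<zeta>, rvec x + \<i> *s rvec (quad \<Phi> \<zeta>))"
  "polynomial_function r'" "\<forall>\<zeta>\<in>E. \<forall>x. r' (\<zeta>, x) = q (\<zeta>, rvec x + \<i> *s rvec (quad \<Phi> \<zeta>))" by blast
 then show ?case by (intro exI[of _ "%p. r p + r' p"]) (simp add: polynomial_function_add)
next
 case (mult p q)
 then obtain r r' where "polynomial_function r" "\<forall>\<zeta>\<in>E. \<forall>x. r (\<zeta>, x) = p (\<zeta>, rvec x + \<i> *s rvec (quad \<Phi> \<zeta>))"
  "polynomial_function r'" "\<forall>\<zeta>\<in>E. \<forall>x. r' (\<zeta>, x) = q (\<zeta>, rvec x + \<i> *s rvec (quad \<Phi> \<zeta>))" by blast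
 then show ?case by (intro exI[of _ "%p. r p * r' p"]) (simp add: polynomial_function_complex_mult)
qed

lemma Pol_CR_slow:
 assumes Q: "qCR E F \<Phi>" and P: "P \<in> Pol_CR E F \<Phi> W"
 shows "slow E F \<Phi> (%z. P z q)"
proof -
 have "poly_map polynomial_function (E \<times> F) W P" using P by (simp add: Pol_CR_def)
 then obtain N :: nat and p w where p: "!!j. j < N ==> polynomial_function (p j)" "!!j. j < N ==> w j \<in> W"
  "!!z. z \<in> E \<times> F ==> P z = (%q. \<Sum>j<N. p j z * w j q)" "!!z. z \<notin> E \<times> F ==> P z = (%q. 0)"
  using poly_mapE by blast
 have "slow E F \<Phi> (%z. \<Sum>j<N. p j z * w j q)"
  by (intro slow_sum slow_mult slow_const slow_polynomial_function p Q) auto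
 then show ?thesis by (rule slow_cong[OF Q, THEN iffD1, rotated]) (simp add: p(3))
qed

lemma Pol_CR_closed:
 assumes Q: "qCR E F \<Phi>" and W: "fun_closed W"
 shows "(%z q. 0) \<in> Pol_CR E F \<Phi> W"
  "P \<in> Pol_CR E F \<Phi> W ==> P' \<in> Pol_CR E F \<Phi> W ==> (%z q. P z q + P' z q) \<in> Pol_CR E F \<Phi> W"
  "P \<in> Pol_CR E F \<Phi> W ==> (%z q. c * P z q) \<in> Pol_CR E F \<Phi> W"
proof -
 have "poly_map polynomial_function (E \<times> F) W (%z q. 0)" by (rule poly_map_sumI[where J = "{}"]) auto
 then show "(%z q. 0) \<in> Pol_CR E F \<Phi> W" by (simp add: Pol_CR_def CR_on_const[OF Q])
next
 assume P: "P \<in> Pol_CR E F \<Phi> W"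
 then show "(%z q. c * P z q) \<in> Pol_CR E F \<Phi> W"
  using CR_on_mult[OF Q smooth_const[OF CR_subspaces(3)[OF Q]] slow_smooth[OF Pol_CR_slow[OF Q P]] CR_on_const[OF Q]]
  by (simp add: Pol_CR_def poly_map_cmult[OF W])
 assume P': "P' \<in> Pol_CR E F \<Phi> W"
 show "(%z q. P z q + P' z q) \<in> Pol_CR E F \<Phi> W"
  using P P' CR_on_add[OF Q slow_smooth[OF Pol_CR_slow[OF Q P]] slow_smooth[OF Pol_CR_slow[OF Q P']]]
  by (simp add: Pol_CR_def poly_map_add)
qed

lemma module_functions: "module (%c (g :: 'a => complex) p. c * g p)" "module (%c (P :: 'a => 'b => complex) z q. c * P z q)"
 by unfold_locales (auto simp: fun_eq_iff algebra_simps)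

lemma (in orthogonal_sum) proj1_inner: "proj1 x \<bullet> y = x \<bullet> proj1 y"
 by (simp add: proj1_def inner_sum_left inner_sum_right inner_commute mult.commute)

section \<open>The splitting determined by \<open>K\<close>\<close>

locale CR_split =
 fixes E :: "(complex ^ 'n::finite) set" and F :: "(real ^ 'm::finite) set" and \<Phi> :: "('n, 'm) herm" and K :: "(real ^ 'm) set"
 assumes Q: "qCR E F \<Phi>" and K: "K \<subseteq> F"
begin

abbreviation "E1 \<equiv> E_K1 E F \<Phi> K"
abbreviation "E2 \<equiv> E_K2 E F \<Phi> K"
abbreviation "F1 \<equiv> F_K1 F K"
abbreviation "F2 \<equiv> F_K2 F K"
abbreviation "\<Phi>2 \<equiv> Phi_K2 F \<Phi> K"
abbreviation "W \<equiv> CR_space_K2 E F \<Phi> K"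
abbreviation "Pol \<equiv> Pol_CR_K E F \<Phi> K"

lemmas S = CR_subspaces[OF Q]
lemmas F1 = subspace_F_K1[OF S(2), of K]
lemmas F2 = subspace_F_K2[OF S(2), of K]
lemmas c1 = complexification_closed[OF F1]
lemmas c2 = complexification_closed[OF F2]

lemma sub: "F1 \<subseteq> F" "F2 \<subseteq> F" "E1 \<subseteq> E" "E2 \<subseteq> E" "K \<subseteq> F2"
 using K by (auto simp: F_K1_def F_K2_def E_K1_def E_K2_def)

lemma E: "vec.subspace E" using Q by (simp add: quadratic_CR_def)

lemma sE1: "vec.subspace E1"
 unfolding vec.subspace_def
proof (intro conjI ballI allI)
 have "\<Phi> 0 \<zeta> = 0" if "\<zeta> \<in> E" for \<zeta> using hermD(3)[OF Q that that, of 0] by simp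
 then show "0 \<in> E1" using vec.subspace_0[OF E] c1(1) by (simp add: E_K1_def)
 show "x + y \<in> E1" if "x \<in> E1" "y \<in> E1" for x y
  using that by (auto simp: E_K1_def hermD(2)[OF Q] intro: vec.subspace_add[OF E] c1(2))
 show "c *s x \<in> E1" if "x \<in> E1" for c x
  using that by (auto simp: E_K1_def hermD(3)[OF Q] intro: vec.subspace_scale[OF E] c1(4))
qed

lemma sE2: "vec.subspace E2"
 unfolding vec.subspace_def
 by (auto simp: E_K2_def vec.subspace_0[OF E] distrib_right sum.distrib mult.assoc sum_distrib_left[symmetric]
  intro: vec.subspace_add[OF E] vec.subspace_scale[OF E])

lemma Q1: "qCR E1 F1 \<Phi>"
proof -
 have in1: "\<Phi> \<zeta> \<zeta>' \<in> complexification F1" if "\<zeta> \<in> E1" "\<zeta>' \<in> E1" for \<zeta> \<zeta>' using that by (auto simp: E_K1_def)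
 have inE: "\<zeta> \<in> E" if "\<zeta> \<in> E1" for \<zeta> using that sub by auto
 show ?thesis unfolding quadratic_CR_def hermitian_map_def
  by (intro conjI ballI allI sE1 F1 in1 hermD(2-4)[OF Q] inE)
qed

text \<open>F1 and F2 meet only in 0, so the F2 part is determined. The algebraic properties of
  \<open>Phi_K2\<close> follow by exhibiting a candidate.\<close>

lemma Phi2_eqI:
 assumes "\<zeta> \<in> E" "\<zeta>' \<in> E" "w \<in> complexification F2" "w - \<Phi> \<zeta> \<zeta>' \<in> complexification F1"
 shows "\<Phi>2 \<zeta> \<zeta>' = w"
proof -
 note P = Phi_K2[OF Q assms(1,2), of K]
 have d1: "(w - \<Phi> \<zeta> \<zeta>') - (\<Phi>2 \<zeta> \<zeta>' - \<Phi> \<zeta> \<zeta>') \<in> complexification F1" by (rule c1(3)[OF assms(4) P(2)])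
 have "w - \<Phi>2 \<zeta> \<zeta>' \<in> complexification F1" using d1 by (simp only: diff_diff_eq2 diff_add_cancel)
 moreover have "w - \<Phi>2 \<zeta> \<zeta>' \<in> complexification F2" by (rule c2(3)[OF assms(3) P(1)])
 ultimately have "Re_vec (w - \<Phi>2 \<zeta> \<zeta>') = 0" "Im_vec (w - \<Phi>2 \<zeta> \<zeta>') = 0"
  by (auto simp: complexification_parts intro: F_K1_Int_F_K2)
 then show ?thesis by (intro complex_vec_eqI) (simp_all add: Re_Im_vec_simps)
qed

lemma Phi2_diff: "\<zeta> \<in> E ==> \<zeta>' \<in> E ==> \<Phi> \<zeta> \<zeta>' - \<Phi>2 \<zeta> \<zeta>' \<in> complexification F1"
 using c1(3)[OF c1(1) Phi_K2(2)[OF Q, of \<zeta> \<zeta>' K]] by simp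

text \<open>\<open>Phi_K2\<close> is used on all of E, not only on E2: this is the structure for
  which the extension H of \<open>g\<close> is CR before the variables of E1 are split off.\<close>

lemma Q2: "qCR E F \<Phi>2"
proof -
 note h = hermD[OF Q]
 have in2: "\<Phi>2 \<zeta> \<zeta>' \<in> complexification F2" if "\<zeta> \<in> E" "\<zeta>' \<in> E" for \<zeta> \<zeta>' by (rule Phi_K2(1)[OF Q that])
 have m1: "\<Phi>2 \<zeta> \<zeta>' \<in> complexification F" if "\<zeta> \<in> E" "\<zeta>' \<in> E" for \<zeta> \<zeta>'
  using in2[OF that] sub(2) by (auto simp: complexification_parts)
 have m2: "\<Phi>2 (\<zeta> + \<eta>) \<zeta>' = \<Phi>2 \<zeta> \<zeta>' + \<Phi>2 \<eta> \<zeta>'" if z: "\<zeta> \<in> E" "\<eta> \<in> E" "\<zeta>' \<in> E" for \<zeta> \<eta> \<zeta>'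
 proof (rule Phi2_eqI[OF vec.subspace_add[OF E z(1,2)] z(3) c2(2)[OF in2[OF z(1,3)] in2[OF z(2,3)]]])
  show "\<Phi>2 \<zeta> \<zeta>' + \<Phi>2 \<eta> \<zeta>' - \<Phi> (\<zeta> + \<eta>) \<zeta>' \<in> complexification F1"
   using c1(2)[OF Phi_K2(2)[OF Q z(1,3), of K] Phi_K2(2)[OF Q z(2,3), of K]] unfolding h(2)[OF z] by (simp only: add_diff_add)
 qed
 have m3: "\<Phi>2 (c *s \<zeta>) \<zeta>' = c *s \<Phi>2 \<zeta> \<zeta>'" if z: "\<zeta> \<in> E" "\<zeta>' \<in> E" for c \<zeta> \<zeta>'
 proof (rule Phi2_eqI[OF vec.subspace_scale[OF E z(1)] z(2) c2(4)[OF in2[OF z]]])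
  show "c *s \<Phi>2 \<zeta> \<zeta>' - \<Phi> (c *s \<zeta>) \<zeta>' \<in> complexification F1"
   using c1(4)[OF Phi_K2(2)[OF Q z, of K], of c] by (simp add: h(3)[OF z] vector_ssub_ldistrib)
 qed
 have m4: "\<Phi>2 \<zeta>' \<zeta> = cnj_vec (\<Phi>2 \<zeta> \<zeta>')" if z: "\<zeta> \<in> E" "\<zeta>' \<in> E" for \<zeta> \<zeta>'
 proof (rule Phi2_eqI[OF z(2,1) c2(5)[OF in2[OF z]]])
  have "cnj_vec (\<Phi>2 \<zeta> \<zeta>' - \<Phi> \<zeta> \<zeta>') = cnj_vec (\<Phi>2 \<zeta> \<zeta>') - cnj_vec (\<Phi> \<zeta> \<zeta>')"
   by (simp add: cnj_vec_def vec_eq_iff)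
  then show "cnj_vec (\<Phi>2 \<zeta> \<zeta>') - \<Phi> \<zeta>' \<zeta> \<in> complexification F1"
   using c1(5)[OF Phi_K2(2)[OF Q z, of K]] by (simp add: h(4)[OF z])
 qed
 show ?thesis unfolding quadratic_CR_def hermitian_map_def by (intro conjI ballI allI E S(2) m1 m2 m3 m4)
qed

lemma Q22: "qCR E2 F2 \<Phi>2"
proof -
 have inE: "\<zeta> \<in> E" if "\<zeta> \<in> E2" for \<zeta> using that sub by auto
 show ?thesis unfolding quadratic_CR_def hermitian_map_def
  by (intro conjI ballI allI sE2 F2 Phi_K2(1)[OF Q] hermD(2-4)[OF Q2] inE)
qed

text \<open>When one argument is in E1, the values of \<open>\<Phi>\<close> lie in the
  complexification of F1, whose F2 part is 0.\<close>

lemma Phi2_null: "\<zeta> \<in> E ==> v \<in> E1 ==> \<Phi>2 \<zeta> v = 0" "\<zeta> \<in> E ==> v \<in> E1 ==> \<Phi>2 v \<zeta> = 0"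
proof -
 assume z: "\<zeta> \<in> E" and v: "v \<in> E1"
 have vE: "v \<in> E" and p: "\<Phi> v \<zeta> \<in> complexification F1" using z v by (auto simp: E_K1_def)
 show "\<Phi>2 v \<zeta> = 0" by (rule Phi2_eqI[OF vE z c2(1) c1(3)[OF c1(1) p]])
 have "\<Phi> \<zeta> v \<in> complexification F1" using c1(5)[OF p] hermD(4)[OF Q vE z] by simp
 then show "\<Phi>2 \<zeta> v = 0" by (rule Phi2_eqI[OF z vE c2(1) c1(3)[OF c1(1)]])
qed

lemma F1_F2: "x \<in> F2 ==> b \<in> F1 ==> x \<bullet> b = 0"
 by (auto simp: F_K2_def)

sublocale SF: orthogonal_sum F F1 F2
proof
 show "F = {a + b |a b. a \<in> F1 \<and> b \<in> F2}"
 proof safe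
  show "\<exists>a b. x = a + b \<and> a \<in> F1 \<and> b \<in> F2" if "x \<in> F" for x
   by (rule F_K_decomp[OF S(2) that, of K]) blast
  show "a + b \<in> F" if "a \<in> F1" "b \<in> F2" for a b
   using that sub by (intro subspace_add[OF S(2)]) auto
 qed
 show "a \<bullet> b = 0" if "a \<in> F1" "b \<in> F2" for a b using F1_F2[OF that(2,1)] by (simp add: inner_commute)
qed (use F1 F2 in auto)

sublocale SE: orthogonal_sum E E1 E2
proof
 show "subspace E1" "subspace E2" using CR_subspaces(1)[OF Q1] CR_subspaces(1)[OF Q22] .
 show "a \<bullet> b = 0" if "a \<in> E1" "b \<in> E2" for a b
 proof -
  have "(\<Sum>i\<in>UNIV. b $ i * cnj (a $ i)) = 0" using that by (simp add: E_K2_def)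
  then have "b \<bullet> a = 0" by (simp only: inner_complex_sum zero_complex.sel)
  then show ?thesis by (simp only: inner_commute)
 qed
 have "\<exists>a b. \<zeta> = a + b \<and> a \<in> E1 \<and> b \<in> E2" if z: "\<zeta> \<in> E" for \<zeta>
 proof -
  have sp: "span E1 = E1" using CR_subspaces(1)[OF Q1] by simp
  obtain y b where y: "y \<in> span E1" and b: "!!\<eta>. \<eta> \<in> span E1 ==> orthogonal b \<eta>" and e: "\<zeta> = y + b"
   using orthogonal_subspace_decomp_exists[of E1 \<zeta>] by blast
  have yE: "y \<in> E1" using y sp by simp
  have "b = \<zeta> - y" using e by simp
  then have "b \<in> E" using z yE sub(3) by (auto intro: vec.subspace_diff[OF E])
  \<comment> \<open>E1 is a complex subspace, so b is orthogonal in the real sense to \<eta> and to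
    i \<eta>; together this is hermitian orthogonality.\<close>
  moreover have "(\<Sum>i\<in>UNIV. b $ i * cnj (\<eta> $ i)) = 0" if h: "\<eta> \<in> E1" for \<eta>
  proof -
   have r: "Re (\<Sum>i\<in>UNIV. b $ i * cnj (\<eta> $ i)) = 0" if "\<eta> \<in> E1" for \<eta>
    using b[of \<eta>] that sp by (simp add: orthogonal_def inner_complex_sum)
   have "(\<Sum>i\<in>UNIV. b $ i * cnj ((\<i> *s \<eta>) $ i)) = - \<i> * (\<Sum>i\<in>UNIV. b $ i * cnj (\<eta> $ i))"
    by (simp add: sum_distrib_left sum_negf[symmetric] mult_ac)
   then show ?thesis using r[OF h] r[OF vec.subspace_scale[OF sE1 h, of \<i>]] by (simp add: complex_eq_iff)
  qed
  ultimately have "b \<in> E2" by (simp add: E_K2_def)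
  then show ?thesis using e yE by blast
 qed
 then show "E = {a + b |a b. a \<in> E1 \<and> b \<in> E2}" using sub vec.subspace_add[OF E] by (auto 4 4)
qed

lemma proj_i: "v \<in> E ==> SE.proj1 (\<i> *s v) = \<i> *s SE.proj1 v" "v \<in> E ==> SE.proj2 (\<i> *s v) = \<i> *s SE.proj2 v"
proof -
 assume "v \<in> E"
 then have "\<i> *s v = \<i> *s SE.proj1 v + \<i> *s SE.proj2 v"
  using SE.proj_sum[of v] by (metis vector_add_ldistrib)
 then show "SE.proj1 (\<i> *s v) = \<i> *s SE.proj1 v" "SE.proj2 (\<i> *s v) = \<i> *s SE.proj2 v"
  using SE.proj_add[OF vec.subspace_scale[OF sE1 SE.proj_in(1)[of v]] vec.subspace_scale[OF sE2 SE.proj_in(2)[of v]], of \<i> \<i>]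
  by simp_all
qed

lemma Phi2_proj: "\<zeta> \<in> E ==> \<eta> \<in> E ==> \<Phi>2 \<zeta> \<eta> = \<Phi>2 (SE.proj2 \<zeta>) (SE.proj2 \<eta>)"
proof -
 assume z: "\<zeta> \<in> E" "\<eta> \<in> E"
 have p: "SE.proj1 \<xi> \<in> E" "SE.proj2 \<xi> \<in> E" for \<xi> using SE.proj_in sub by auto
 have "\<Phi>2 \<zeta> \<eta> = \<Phi>2 (SE.proj1 \<zeta> + SE.proj2 \<zeta>) \<eta>" by (simp add: SE.proj_sum z)
 also have "\<dots> = \<Phi>2 (SE.proj2 \<zeta>) \<eta>"
  using hermD(2)[OF Q2 p z(2)] Phi2_null(2)[OF z(2) SE.proj_in(1)] by simp
 also have "\<dots> = \<Phi>2 (SE.proj2 \<zeta>) (SE.proj1 \<eta> + SE.proj2 \<eta>)" by (simp add: SE.proj_sum z)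
 also have "\<dots> = \<Phi>2 (SE.proj2 \<zeta>) (SE.proj2 \<eta>)"
  using herm_right(1)[OF Q2 p p(2)] Phi2_null(1)[OF p(2) SE.proj_in(1)] by simp
 finally show ?thesis .
qed

lemma quad2: "\<zeta> \<in> E ==> quad \<Phi>2 (SE.proj2 \<zeta>) \<in> F2" "\<zeta> \<in> E ==> quad \<Phi> \<zeta> - quad \<Phi>2 (SE.proj2 \<zeta>) \<in> F1"
proof -
 assume z: "\<zeta> \<in> E"
 show "quad \<Phi>2 (SE.proj2 \<zeta>) \<in> F2"
  using hermD(1)[OF Q22 SE.proj_in(2) SE.proj_in(2)] by (simp add: quad_def complexification_parts)
 show "quad \<Phi> \<zeta> - quad \<Phi>2 (SE.proj2 \<zeta>) \<in> F1"
  using Phi2_diff[OF z z] Phi2_proj[OF z z] by (simp add: quad_def complexification_parts Re_Im_vec_simps)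
qed

section \<open>Holomorphic coordinates for \<open>iota\<close>\<close>

definition Z :: "('n, 'm) point => complex ^ 'm" where
 "Z p = rvec (SF.proj1 (snd p)) + \<i> *s rvec (quad \<Phi> (fst p) - quad \<Phi>2 (SE.proj2 (fst p)))"

definition \<pi> :: "('n, 'm) point => ('n, 'm) point" where "\<pi> p = (SE.proj2 (fst p), SF.proj2 (snd p))"

lemma \<pi>_in: "\<pi> p \<in> E2 \<times> F2" using SE.proj_in SF.proj_in by (simp add: \<pi>_def)

lemma Z_in: "p \<in> E \<times> F ==> (SE.proj1 (fst p), Z p) \<in> E1 \<times> complexification F1"
 using quad2(2)[of "fst p"] SE.proj_in SF.proj_in by (auto simp: Z_def complexification_parts Re_Im_vec_simps)

text \<open>\<open>Z p\<close> is the F1 part of x + i \<Phi>(\<zeta>), since the subtracted term is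
  the F2 part of \<Phi>(\<zeta>). Its components are therefore CR functions on N.\<close>

lemma Z_coord: "p \<in> E \<times> F ==> Z p $ j = hol_coord \<Phi> (SF.proj1 (axis j 1)) p"
proof -
 assume p: "p \<in> E \<times> F"
 let ?b = "SF.proj1 (axis j 1)" and ?h = "quad \<Phi> (fst p) - quad \<Phi>2 (SE.proj2 (fst p))"
 have z: "fst p \<in> E" using p by auto
 have nth: "x $ j = x \<bullet> axis j 1" for x :: "real ^ 'm" by (simp add: inner_axis)
 have "SF.proj1 (snd p) $ j = snd p \<bullet> ?b" unfolding nth by (rule SF.proj1_inner)
 moreover have "?h $ j = ?h \<bullet> ?b"
  unfolding nth SF.proj1_inner[symmetric] using quad2(2)[OF z] by (simp only: SF.proj_simps(1))
 moreover have "?h \<bullet> ?b = quad \<Phi> (fst p) \<bullet> ?b"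
  using F1_F2[OF quad2(1)[OF z] SF.proj_in(1)] by (simp add: inner_diff_left)
 ultimately show ?thesis unfolding Z_def hol_coord_def of_real_vec_def by (simp del: vector_minus_component)
qed

lemmas W_closed = CR_space_closed[OF Q22, of K, folded CR_space_K2_def]
lemmas W_iff = CR_space_iff[OF Q22, of _ K, folded CR_space_K2_def]

abbreviation "hol P \<equiv> holomorphic_extension E1 F1 \<Phi> W P"

lemmas Pol_def = Pol_CR_K_def[of E F \<Phi> K]

lemma hol:
 assumes "P \<in> Pol"
 shows "poly_map hpoly (E1 \<times> complexification F1) W (hol P)"
  "!!\<zeta> x. \<zeta> \<in> E1 ==> x \<in> F1 ==> hol P (\<zeta>, rvec x + \<i> *s rvec (quad \<Phi> \<zeta>)) = P (\<zeta>, x)"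
  "!!Q'. poly_map hpoly (E1 \<times> complexification F1) W Q' ==>
   (!!\<zeta> x. \<zeta> \<in> E1 ==> x \<in> F1 ==> Q' (\<zeta>, rvec x + \<i> *s rvec (quad \<Phi> \<zeta>)) = P (\<zeta>, x)) ==> hol P = Q'"
 by (fact holomorphic_extension[OF Q1 W_closed assms[unfolded Pol_def]])+

text \<open>The term \<Phi>(\<zeta>1) subtracted in the shift cancels the one added in the
  definition of P_h.\<close>

lemma iota_eq:
 assumes p: "p \<in> E \<times> F"
 shows "iota E F \<Phi> K P p = hol P (SE.proj1 (fst p), Z p) (\<pi> p)"
proof -
 have s: "fst p = SE.proj1 (fst p) + SE.proj2 (fst p)" "snd p = SF.proj1 (snd p) + SF.proj2 (snd p)"
  using p SE.proj_sum SF.proj_sum by auto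
 have "iota E F \<Phi> K P p = iota E F \<Phi> K P (SE.proj1 (fst p) + SE.proj2 (fst p), SF.proj1 (snd p) + SF.proj2 (snd p))"
  by (simp only: s[symmetric] prod.collapse)
 also have "\<dots> = shift_K E F \<Phi> K P (quad \<Phi> (fst p) - quad \<Phi> (SE.proj1 (fst p)) - quad \<Phi>2 (SE.proj2 (fst p)))
   (SE.proj1 (fst p), SF.proj1 (snd p)) (\<pi> p)"
  unfolding iota_apply[OF Q SE.proj_in SF.proj_in] by (simp only: s[symmetric] \<pi>_def)
 also have "\<dots> = hol P (SE.proj1 (fst p), Z p) (\<pi> p)"
  by (simp add: shift_K_def poly_shift_def Z_def of_real_vec_simps vector_add_ldistrib vector_ssub_ldistrib algebra_simps)
 finally show ?thesis .
qed

lemma iota_off: "p \<notin> E \<times> F ==> iota E F \<Phi> K P p = 0"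
 by (cases p) (auto simp: iota_def)

text \<open>\<open>\<pi>\<close> respects the group structures of N and N_2, because
  \<open>Phi_K2\<close> is the F2 part of \<open>\<Phi>\<close> and depends only on the E2
  components.\<close>

lemma tame_\<pi>: "w \<in> W ==> tame E F \<Phi> (%p. w (\<pi> p))"
proof -
 assume "w \<in> W"
 then have w: "tame E2 F2 \<Phi>2 w" by (simp add: W_iff)
 have lin: "linear \<pi>"
  unfolding \<pi>_def by (rule linearI) (simp_all add: linear_add[OF SE.linear_proj(2)] linear_add[OF SF.linear_proj(2)]
   linear_scale[OF SE.linear_proj(2)] linear_scale[OF SF.linear_proj(2)])
 have "tame E F \<Phi> (%p. w (\<pi> p + 0))"
 proof (rule tame_pullback[OF Q Q22 lin \<pi>_in _ _ _ _ w, where T = SE.proj2])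
  show "0 \<in> E2 \<times> F2" by (rule subspace_0[OF CR_subspaces(3)[OF Q22]])
  show "\<pi> (v, 0) = (SE.proj2 v, 0)" for v by (simp add: \<pi>_def linear_0[OF SF.linear_proj(2)])
  fix u p assume u: "u \<in> E \<times> F" and p: "p \<in> E \<times> F"
  then have z: "fst p \<in> E" "fst u \<in> E" by auto
  have "Im_vec (\<Phi> (fst p) (fst u)) - Im_vec (\<Phi>2 (fst p) (fst u)) \<in> F1" "Im_vec (\<Phi>2 (fst p) (fst u)) \<in> F2"
   using Phi2_diff[OF z] Phi_K2(1)[OF Q z, of K] by (auto simp: complexification_parts Re_Im_vec_simps)
  from SF.proj_add(2)[OF this]
  have "SF.proj2 (Im_vec (\<Phi> (fst p) (fst u))) = Im_vec (\<Phi>2 (SE.proj2 (fst p)) (SE.proj2 (fst u)))"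
   by (simp add: Phi2_proj[OF z])
  then show "\<pi> (left_dir \<Phi> u p) = left_dir \<Phi>2 (\<pi> u) (\<pi> p + 0)"
   by (simp add: \<pi>_def left_dir_def linear_add[OF SF.linear_proj(2)] linear_scale[OF SF.linear_proj(2)])
 qed (rule proj_i(2))
 then show ?thesis by simp
qed

text \<open>Built from multiplications by coordinates, each of which preserves the spectrum;
  \<open>u\<close> is generalised in the induction because a product applies its two factors in
  turn.\<close>

lemma spectrum_holomorphic:
 assumes "hpoly h"
 shows "spectrum_in F K u ==> spectrum_in F K (%x. h (a, rvec (SF.proj1 x) + c) * u x)"
 using assms
proof (induction arbitrary: u)
 case (coord2 j)
 have nth: "x $ j = x \<bullet> axis j 1" for x :: "real ^ 'm" by (simp add: inner_axis)
 have "spectrum_in F K (%x. of_real (x \<bullet> SF.proj1 (axis j 1)) * u x + c $ j * u x)"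
  using SF.proj_in(1) sub(1) by (intro spectrum_in_add spectrum_in_cmult spectrum_in_mult_inner coord2 S) auto
 then show ?case by (simp add: of_real_vec_def nth SF.proj1_inner distrib_right)
next
 case (add p q)
 then have "spectrum_in F K (%x. p (a, rvec (SF.proj1 x) + c) * u x + q (a, rvec (SF.proj1 x) + c) * u x)"
  by (intro spectrum_in_add S) auto
 then show ?case by (simp add: distrib_right)
next
 case (mult p q)
 from mult.IH(1)[OF mult.IH(2)[OF mult.prems]] show ?case by (simp add: mult.assoc)
qed (auto intro: spectrum_in_cmult)

section \<open>\<open>iota\<close> as a linear bijection\<close>

lemma iota_in: "P \<in> Pol ==> iota E F \<Phi> K P \<in> CR_space E F \<Phi> K"
proof -
 assume P: "P \<in> Pol"
 obtain N :: nat and p w where p: "!!j. j < N ==> hpoly (p j)" and w: "!!j. j < N ==> w j \<in> W"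
  and h: "!!z. z \<in> E1 \<times> complexification F1 ==> hol P z = (%q. \<Sum>j<N. p j z * w j q)"
  by (rule poly_mapE[OF hol(1)[OF P]]) (rule that)
 have eq: "iota E F \<Phi> K P x = (\<Sum>j<N. p j (SE.proj1 (fst x), Z x) * w j (\<pi> x))" if "x \<in> E \<times> F" for x
  using iota_eq[OF that, of P] fun_cong[OF h[OF Z_in[OF that]], of "\<pi> x"] by (rule trans)
 have "linear_on_sub E (%\<zeta>. SE.proj1 \<zeta> $ i)" for i
  by (simp add: linear_on_sub_def linear_add[OF SE.linear_proj(1)] linear_scale[OF SE.linear_proj(1)])
 then have 1: "tame E F \<Phi> (%x. SE.proj1 (fst x) $ i)" for i
  by (rule tame_linear[OF Q]) (simp add: proj_i)
 have 2: "tame E F \<Phi> (%x. Z x $ j)" for j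
  using tame_hol_coord[OF Q] by (rule tame_cong[OF Q, THEN iffD1, rotated]) (rule Z_coord[symmetric])
 have "tame E F \<Phi> (%x. \<Sum>j<N. p j (SE.proj1 (fst x), Z x) * w j (\<pi> x))"
  by (intro tame_sum tame_mult tame_\<pi> w Q tame_holomorphic_polynomial[OF Q 1 2] p) auto
 then have "tame E F \<Phi> (iota E F \<Phi> K P)" by (rule tame_cong[OF Q, THEN iffD1, rotated]) (simp only: eq)
 moreover have "spectrum_in F K (%x. iota E F \<Phi> K P (\<zeta>, x))" if z: "\<zeta> \<in> E" for \<zeta>
 proof -
  have "spectrum_in F K (%x. \<Sum>j<N. p j (SE.proj1 \<zeta>, rvec (SF.proj1 x) + \<i> *s rvec (quad \<Phi> \<zeta> - quad \<Phi>2 (SE.proj2 \<zeta>))) *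
    w j (SE.proj2 \<zeta>, SF.proj2 x))"
  proof (intro spectrum_in_sum S spectrum_holomorphic p)
   fix j assume "j \<in> {..<N}"
   then have "spectrum_in F2 K (%x. w j (SE.proj2 \<zeta>, x))" using w[of j] SE.proj_in(2) by (simp add: W_iff)
   from SF.spectrum_in_proj2[OF this sub(5)] show "spectrum_in F K (%x. w j (SE.proj2 \<zeta>, SF.proj2 x))" .
  qed auto
  then show ?thesis by (rule spectrum_in_cong[THEN iffD1, rotated]) (simp add: eq z Z_def \<pi>_def)
 qed
 ultimately show ?thesis by (simp add: CR_space_iff[OF Q] iota_off)
qed

text \<open>For fixed \<zeta>1 and \<zeta>2 the image under \<open>iota\<close> displays the
  extensions on a real translate F1 + i h, with h the difference of \<Phi>(\<zeta>1 + \<zeta>2) and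
  the second quadratic map at \<zeta>2. Such a set determines a holomorphic polynomial.\<close>

lemma iota_inj: "inj_on (iota E F \<Phi> K) Pol"
proof (rule inj_onI)
 fix P P' assume P: "P \<in> Pol" "P' \<in> Pol" and eq: "iota E F \<Phi> K P = iota E F \<Phi> K P'"
 have "hol P = hol P'"
 proof (rule poly_map_holomorphic_unique[OF W_closed _ F1 hol(1)[OF P(1)] hol(1)[OF P(2)], where N = "E2 \<times> F2"])
  show "w q = 0" if "w \<in> W" "q \<notin> E2 \<times> F2" for w q using that by (cases q) (simp add: W_iff)
  fix \<zeta>1 q assume z1: "\<zeta>1 \<in> E1" and q: "q \<in> E2 \<times> F2"
  obtain \<zeta>2 x2 where q2: "q = (\<zeta>2, x2)" "\<zeta>2 \<in> E2" "x2 \<in> F2" using q by auto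
  let ?h = "quad \<Phi> (\<zeta>1 + \<zeta>2) - quad \<Phi>2 \<zeta>2"
  note pz = SE.proj_add[OF z1 q2(2)]
  have zE: "\<zeta>1 + \<zeta>2 \<in> E" by (rule SE.add_in[OF z1 q2(2)])
  show "\<exists>h\<in>F1. \<forall>x\<in>F1. hol P (\<zeta>1, rvec x + \<i> *s rvec h) q = hol P' (\<zeta>1, rvec x + \<i> *s rvec h) q"
  proof (intro bexI[of _ ?h] ballI)
   show "?h \<in> F1" using quad2(2)[OF zE] by (simp add: pz)
   fix x assume x: "x \<in> F1"
   have m: "(\<zeta>1 + \<zeta>2, x + x2) \<in> E \<times> F" using zE SF.add_in[OF x q2(3)] by simp
   show "hol P (\<zeta>1, rvec x + \<i> *s rvec ?h) q = hol P' (\<zeta>1, rvec x + \<i> *s rvec ?h) q"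
    using iota_eq[OF m, of P] iota_eq[OF m, of P'] eq by (simp add: Z_def \<pi>_def pz SF.proj_add[OF x q2(3)] q2(1))
  qed
 qed
 then have on: "P (\<zeta>, x) = P' (\<zeta>, x)" if "\<zeta> \<in> E1" "x \<in> F1" for \<zeta> x
  using hol(2)[OF P(1) that] hol(2)[OF P(2) that] by simp
 have off: "P z = (%q. 0)" "P' z = (%q. 0)" if "z \<notin> E1 \<times> F1" for z
  using P that unfolding Pol_def Pol_CR_def poly_map_def by blast+
 show "P = P'"
 proof
  fix z show "P z = P' z" using on off[of z] by (cases "z \<in> E1 \<times> F1") auto
 qed
qed

lemma iota_add: "P \<in> Pol ==> P' \<in> Pol ==> iota E F \<Phi> K (%z q. P z q + P' z q) p = iota E F \<Phi> K P p + iota E F \<Phi> K P' p"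
proof (cases "p \<in> E \<times> F")
 case True
 assume P: "P \<in> Pol" "P' \<in> Pol"
 then have m: "(%z q. P z q + P' z q) \<in> Pol" unfolding Pol_def by (rule Pol_CR_closed(2)[OF Q1 W_closed])
 have "hol (%z q. P z q + P' z q) = (%z q. hol P z q + hol P' z q)"
  by (rule hol(3)[OF m poly_map_add[OF hol(1)[OF P(1)] hol(1)[OF P(2)]]]) (simp only: hol(2)[OF P(1)] hol(2)[OF P(2)])
 then show ?thesis by (simp add: iota_eq[OF True])
qed (simp add: iota_off)

lemma iota_cmult: "P \<in> Pol ==> iota E F \<Phi> K (%z q. c * P z q) p = c * iota E F \<Phi> K P p"
proof (cases "p \<in> E \<times> F")
 case True
 assume P: "P \<in> Pol"
 then have m: "(%z q. c * P z q) \<in> Pol" unfolding Pol_def by (rule Pol_CR_closed(3)[OF Q1 W_closed])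
 have "hol (%z q. c * P z q) = (%z q. c * hol P z q)"
  by (rule hol(3)[OF m poly_map_cmult[OF W_closed hol(1)[OF P]]]) (simp only: hol(2)[OF P])
 then show ?thesis by (simp add: iota_eq[OF True])
qed (simp add: iota_off)

text \<open>P is found through its holomorphic extension \<open>R\<close>, which is H with z and
  \<zeta>1 as polynomial variables and (\<zeta>2, x2) as the argument of its values. Evaluating H at
  \<open>Z x\<close> gives back \<open>g\<close>, because H sees z only through its pairings with
  F1.\<close>

lemma iota_surj:
 assumes g: "g \<in> CR_space E F \<Phi> K"
 shows "\<exists>P\<in>Pol. iota E F \<Phi> K P = g"
proof -
 have gt: "tame E F \<Phi> g" and gs: "!!\<zeta>. \<zeta> \<in> E ==> spectrum_in F K (%x. g (\<zeta>, x))" and goff: "!!p. p \<notin> E \<times> F ==> g p = 0"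
  using g unfolding CR_space_iff[OF Q] by blast+
 obtain D where D: "!!y. y \<in> F ==> (\<forall>l\<in>K. l \<bullet> y = 0) ==> polynomial_along (E \<times> F) D (0, y) g"
  using polynomial_along_spectrum[OF Q tame_slow[OF gt] gs] by blast
 interpret C: CR_change E F \<Phi> \<Phi>2 F1 D
 proof
  show "Im_vec (\<Phi>2 \<zeta> \<zeta>') \<bullet> b = 0" if "\<zeta> \<in> E" "\<zeta>' \<in> E" "b \<in> F1" for \<zeta> \<zeta>' b
   using Phi_K2(1)[OF Q that(1,2), of K] that(3) by (auto simp: complexification_parts intro: F1_F2)
 qed (use Q Q2 F1 sub Phi2_diff in auto)
 have pol: "polynomial_along (E \<times> F) D (0, b) g" if "b \<in> C.B" for b
  by (rule D) (use C.B_in[OF that] in \<open>auto simp: F_K1_def\<close>)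
 obtain k0 where k0: "moderate E F \<Phi> k0 g" using tame_slow[OF gt] unfolding slow_def ..
 \<comment> \<open>H has to be of slow growth for the fields of \<open>Phi_K2\<close>, so the growth
   of \<open>g\<close> is transferred to these first.\<close>
 have "slow E F \<Phi>2 g"
  unfolding slow_def by (rule moderate_change_structure[OF Q Q2 F1 sub(1) Phi2_diff k0 pol])
 then have Hslow: "slow E F \<Phi>2 (C.H g z)" for z by (rule C.slow_hol_ext)
 note gsm = tame_smooth[OF gt] and gcr = gt[unfolded tame_def, THEN conjunct1]
 have Htame: "tame E F \<Phi>2 (C.H g z)" for z
  unfolding tame_def by (intro conjI Hslow C.CR_on_hol_ext[OF gsm pol gcr])
 obtain k where k: "!!m. m \<in> C.grid ==> grows k (E \<times> F) (C.H g (rvec (grid_point C.B m)))"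
 proof -
  have "\<exists>k. \<forall>m\<in>C.grid. grows k (E \<times> F) (C.H g (rvec (grid_point C.B m)))"
   by (rule grows_uniform[OF finite_PiE[OF C.finB] slow_grows[OF Hslow]]) simp
  then show thesis using that by blast
 qed
 obtain a :: "'n => complex ^ 'n" where a: "!!i. a i \<in> E1" "!!\<zeta>. \<zeta> \<in> E1 ==> (\<Sum>i\<in>UNIV. \<zeta> $ i *s a i) = \<zeta>"
  using complex_subspace_generators[OF sE1] by blast
 have aE: "a i \<in> E" for i using a(1) sub(3) by auto
 let ?I = "C.grid \<times> ((UNIV :: 'n set) \<rightarrow>\<^sub>E {..k})"
 \<comment> \<open>The points of E1 at which the interpolation in \<zeta>1 samples H.\<close>
 define c where "c l = (\<Sum>i\<in>UNIV. of_nat (l i) *s a i)" for l :: "'n => nat"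
 define p where "p = (%(m, l) (z :: (complex ^ 'n) \<times> (complex ^ 'm)). gpoly C.B D m (snd z) * (\<Prod>i\<in>UNIV. poly (lag k (l i)) (fst z $ i)))"
 \<comment> \<open>The coefficient vectors: H at a grid value of z, translated by a sample point of
   E1. They are set to 0 off E2 x F2, as members of \<open>CR_space\<close> must be.\<close>
 define w where "w = (%(m, l) q. if q \<in> E2 \<times> F2 then C.H g (rvec (grid_point C.B m)) (fst q + c l, snd q) else 0)"
 define R where "R z q = (if z \<in> E1 \<times> complexification F1 \<and> q \<in> E2 \<times> F2 then C.H g (snd z) (fst q + fst z, snd q) else 0)"
  for z :: "(complex ^ 'n) \<times> (complex ^ 'm)" and q
 have cE1: "c l \<in> E1" for l unfolding c_def by (intro vec.subspace_sum sE1 vec.subspace_scale a)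
 have finI: "finite ?I" by (intro finite_cartesian_product finite_PiE C.finB) auto
 have hp: "hpoly (p j)" for j
  unfolding p_def case_prod_unfold
  by (intro holomorphic_polynomial.mult holomorphic_polynomial_grid_poly holomorphic_polynomial_prod
   holomorphic_polynomial_poly holomorphic_polynomial.coord1)
 have R: "R z q = (\<Sum>j\<in>?I. p j z * w j q)" if z: "z \<in> E1 \<times> complexification F1" for z q
 proof (cases "q \<in> E2 \<times> F2")
  case True
  then have q: "fst q \<in> E" "snd q \<in> F" using sub by auto
  have "(\<Sum>i\<in>UNIV. fst z $ i *s a i) = fst z" using z by (intro a) auto
  then show ?thesis
   using C.hol_ext_interpolation[OF gsm pol gcr slow_smooth[OF Hslow] k aE Phi2_null(1)[OF _ a(1)] q, of "snd z" "%i. fst z $ i" "%i. i"] True z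
   by (simp add: R_def p_def w_def c_def case_prod_unfold)
 qed (simp add: R_def w_def case_prod_unfold)
 have wW: "w j \<in> W" for j
 proof -
  obtain m l where j: "j = (m, l)" by (cases j)
  let ?H = "C.H g (rvec (grid_point C.B m))"
  have cc: "(c l, 0) \<in> E \<times> F" using cE1 sub(3) subspace_0[OF S(2)] by auto
  have "tame E2 F2 \<Phi>2 (%q. ?H (q + (c l, 0)))"
  \<comment> \<open>Translation by a null vector of \<open>Phi_K2\<close> does not change the
    fields.\<close>
  proof (rule tame_pullback[OF Q22 Q2 linear_ident _ cc _ _ _ Htame, where T = "%v. v"])
   fix u q assume u: "u \<in> E2 \<times> F2" and q: "q \<in> E2 \<times> F2"
   have "\<Phi>2 (fst q + c l) (fst u) = \<Phi>2 (fst q) (fst u)"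
   proof -
    have "fst q \<in> E" "c l \<in> E" "fst u \<in> E" using u q cE1 sub by auto
    then show ?thesis using hermD(2)[OF Q2] Phi2_null(2)[OF _ cE1] by simp
   qed
   then show "left_dir \<Phi>2 u q = left_dir \<Phi>2 u (q + (c l, 0))" by (simp add: left_dir_def)
  qed (use sub in auto)
  then have "tame E2 F2 \<Phi>2 (w j)"
   by (rule tame_cong[OF Q22, THEN iffD1, rotated]) (auto simp: w_def j)
  moreover have "spectrum_in F2 K (%x. w j (\<zeta>, x))" if z: "\<zeta> \<in> E2" for \<zeta>
  proof -
   have zc: "\<zeta> + c l \<in> E" by (rule vec.subspace_add[OF E]) (use z cE1[of l] sub in auto)
   \<comment> \<open>Unfolded, H is a combination of sections of \<open>g\<close> along F2 through
     the grid points of F1, with coefficients constant in x.\<close>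
   have "spectrum_in F2 K (%x. \<Sum>m'\<in>C.grid. gpoly C.B D m' (rvec (grid_point C.B m) - \<i> *s rvec (quad \<Phi> (\<zeta> + c l))) *
     g (\<zeta> + c l, grid_point C.B m' + x))"
    by (intro spectrum_in_sum F2 spectrum_in_cmult SF.spectrum_in_section[OF gs[OF zc] sub(5)] C.grid_point_in(1))
   then show ?thesis
    by (rule spectrum_in_cong[THEN iffD1, rotated]) (simp add: w_def j z hol_ext_def add.commute)
  qed
  ultimately show ?thesis by (simp add: W_iff w_def case_prod_unfold)
 qed
 have Rp: "poly_map hpoly (E1 \<times> complexification F1) W R"
 proof (rule poly_map_sumI[where J = ?I and p = p and w = w])
  show "R z = (%q. 0)" if "z \<notin> E1 \<times> complexification F1" for z
   unfolding R_def using that by (simp only: simp_thms if_False)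
 qed (rule finI hp wW R, assumption?)+
 \<comment> \<open>The CR embedding of N_1; \<open>P\<close> will be the restriction of
   \<open>R\<close> to its image.\<close>
 define z0 where "z0 z = (fst z, rvec (snd z) + \<i> *s rvec (quad \<Phi> (fst z)))" for z :: "('n, 'm) point"
 have z0: "z0 z \<in> E1 \<times> complexification F1" if "z \<in> E1 \<times> F1" for z
  using that hermD(1)[OF Q1, of "fst z" "fst z"] by (auto simp: z0_def quad_def complexification_parts Re_Im_vec_simps)
 define P where "P z = (if z \<in> E1 \<times> F1 then R (z0 z) else (%q. 0))" for z
 have "\<exists>r. polynomial_function r \<and> (\<forall>\<zeta>\<in>E1. \<forall>x. r (\<zeta>, x) = p j (z0 (\<zeta>, x)))" for j
  using polynomial_of_holomorphic[OF Q1 hp[of j]] by (simp add: z0_def)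
 then obtain r where r: "!!j. polynomial_function (r j)" "!!j \<zeta> x. \<zeta> \<in> E1 ==> r j (\<zeta>, x) = p j (z0 (\<zeta>, x))" by metis
 have Pz: "P z q = (\<Sum>j\<in>?I. p j (z0 z) * w j q)" if "z \<in> E1 \<times> F1" for z q
  using R[OF z0[OF that]] that by (simp add: P_def)
 have "poly_map polynomial_function (E1 \<times> F1) W P"
 proof (rule poly_map_sumI[where J = ?I and p = r and w = w])
  show "P z q = (\<Sum>j\<in>?I. r j z * w j q)" if z: "z \<in> E1 \<times> F1" for z q
  proof -
   obtain \<zeta> x where zx: "z = (\<zeta>, x)" "\<zeta> \<in> E1" using z by auto
   show ?thesis unfolding Pz[OF z] unfolding zx(1) by (simp only: r(2)[OF zx(2)])
  qed
 qed (rule finI r(1) wW | simp add: P_def)+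
 moreover have "CR_on E1 F1 \<Phi> (%z. P z q)" for q
 proof -
  have 1: "tame E1 F1 \<Phi> (%z. fst z $ i)" for i
   by (rule tame_linear[OF Q1]) (auto simp: linear_on_sub_def)
  have 2: "tame E1 F1 \<Phi> (%z. snd (z0 z) $ j)" for j
   using tame_hol_coord[OF Q1, of "axis j 1"] by (rule tame_cong[OF Q1, THEN iffD1, rotated])
    (simp add: z0_def hol_coord_def inner_axis of_real_vec_def)
  have "tame E1 F1 \<Phi> (%z. \<Sum>j\<in>?I. p j (fst z, snd (z0 z)) * w j q)"
   by (intro tame_sum tame_mult tame_const Q1 tame_holomorphic_polynomial[OF Q1 1 2] hp)
  then have "CR_on E1 F1 \<Phi> (%z. \<Sum>j\<in>?I. p j (z0 z) * w j q)" by (simp add: tame_def z0_def)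
  then show ?thesis by (rule CR_on_cong[OF Q1, THEN iffD1, rotated]) (rule Pz[symmetric])
 qed
 ultimately have P: "P \<in> Pol" by (simp add: Pol_def Pol_CR_def)
 have holP: "hol P = R"
  by (rule hol(3)[OF P Rp]) (simp add: P_def z0_def)
 have "iota E F \<Phi> K P x = g x" for x
 proof (cases "x \<in> E \<times> F")
  case True
  then have zx: "fst x \<in> E" "snd x \<in> F" by auto
  have "iota E F \<Phi> K P x = C.H g (Z x) (SE.proj2 (fst x) + SE.proj1 (fst x), SF.proj2 (snd x))"
   using Z_in[OF True] \<pi>_in[of x] by (simp add: iota_eq[OF True] holP R_def \<pi>_def)
  also have "SE.proj2 (fst x) + SE.proj1 (fst x) = fst x" using SE.proj_sum[OF zx(1)] by (simp add: add.commute)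
  also have "C.H g (Z x) (fst x, SF.proj2 (snd x)) = g (fst x, SF.proj1 (snd x) + SF.proj2 (snd x))"
  proof (rule C.hol_ext_eq[OF pol zx(1) _ SF.proj_in(1)])
   show "SF.proj2 (snd x) \<in> F" using SF.proj_in(2) sub by auto
   fix b assume b: "b \<in> C.B"
   show "cdot (Z x) b = cdot (rvec (SF.proj1 (snd x)) + \<i> *s rvec (quad \<Phi> (fst x))) b"
    using F1_F2[OF quad2(1)[OF zx(1)] C.B_in[OF b]] by (simp add: Z_def cdot_simps inner_diff_left)
  qed
  also have "\<dots> = g x" by (simp add: SF.proj_sum[OF zx(2)])
  finally show ?thesis .
 qed (simp add: iota_off goff)
 then show ?thesis using P by blast
qed

end

theorem proposition5p8:
  fixes E :: "(complex ^ 'n::finite) set"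
    and F :: "(real ^ 'm::finite) set"
    and \<Phi> :: "complex ^ 'n \<Rightarrow> complex ^ 'n \<Rightarrow> complex ^ 'm"
    and K :: "(real ^ 'm) set"
  assumes "quadratic_CR E F \<Phi>"
    and "compact K" and "convex K" and "K \<subseteq> pos_cone E F \<Phi>"
  shows "complex_linear_iso (\<lambda>c P z q. c * P z q) (\<lambda>c g p. c * g p)
           (Pol_CR_K E F \<Phi> K) (CR_space E F \<Phi> K) (iota E F \<Phi> K)"
proof -
 interpret CR_split E F \<Phi> K
  by unfold_locales (use assms in \<open>auto simp: pos_cone_def\<close>)
 note p = Pol_CR_closed[OF Q1 W_closed, folded Pol_def] and c = CR_space_closed[OF Q, of K, unfolded fun_closed_def]
 have "module.subspace (%c P z q. c * P z q) Pol"
  unfolding module.subspace_def[OF module_functions(2)] using p by (auto simp: plus_fun_def zero_fun_def)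
 moreover have "module.subspace (%c g p. c * g p) (CR_space E F \<Phi> K)"
  unfolding module.subspace_def[OF module_functions(1)] using c by (auto simp: plus_fun_def zero_fun_def)
 moreover have "bij_betw (iota E F \<Phi> K) Pol (CR_space E F \<Phi> K)"
  unfolding bij_betw_def using iota_inj iota_in iota_surj by blast
 ultimately show ?thesis
  unfolding complex_linear_iso_def using iota_add iota_cmult by (auto simp: plus_fun_def fun_eq_iff)
qed

end
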